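(* For all $0<\gamma<1/10$ there exist $T_\gamma>0$, a $2T_\gamma$-periodic function $K_\gamma:\mathbb{R}\to(0,1)$ satisfying $K_\gamma(0)=\gamma$ and $K_\gamma(T_\gamma)\ge 1/10$, and $\nu_0>0$ such that the following holds. Let $\mathcal{A}=\{a_2,a_1,b_2,b_1\}$ be a resonant set and let $0<\nu<\nu_0$. Then there exists a solution $u$ of $$ i\partial_t u+\partial_x^2 u=\pm\nu|u|^4u,\qquad (t,x)\in\mathbb{R}\times\mathbb{S}^1, $$ satisfying, for all $0\le t\le\nu^{-3/2}$, $$ u(t,x)=\sum_{j\in\mathcal{A}}u_j(t)e^{ijx}+\nu^{1/4}q_1(t,x)+\nu^{3/2}\,t\,q_2(t,x), $$ with $$ |u_{a_1}(t)|^2=K_\gamma(\nu t),\quad 2|u_{a_2}(t)|^2=7+K_\gamma(\nu t),\quad |u_{b_1}(t)|^2=1-K_\gamma(\nu t),\quad 2|u_{b_2}(t)|^2=1-K_\gamma(\nu t), $$ and where, for all $s\in\mathbb{R}$, there is a constant $C_s$ (independent of $t$ and $\nu$) with $\|q_1(t,\cdot)\|_{H^s(\mathbb{S}^1)}\le C_s$ for all $t\ge 0$, and $\|q_2(t,\cdot)\|_{H^s(\mathbb{S}^1)}\le C_s$ for all $0\le t\le\nu^{-3/2}$.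
   Context: $\mathbb{S}^1=\mathbb{R}/2\pi\mathbb{Z}$. The sign $\pm$ in the equation is either of the two signs. A resonant set is a set of the form $\mathcal{A}=\{n,n+3k,n+4k,n+k\}$ with $n\in\mathbb{Z}$ and $k\in\mathbb{Z}\setminus\{0\}$; its elements are denoted $a_2=n$, $a_1=n+3k$, $b_2=n+4k$, $b_1=n+k$. The functions $u_j$ ($j\in\mathcal{A}$) are complex-valued functions of time. *)

theory Defs
  imports "HOL-Analysis.Analysis"
begin

text \<open>
  Functions on the circle \<open>\<real>/2\<pi>\<int>\<close> are represented by \<open>2\<pi>\<close>-periodic functions on the real line.
\<close>

definition circle_periodic :: "(real \<Rightarrow> complex) \<Rightarrow> bool" where
  "circle_periodic f \<longleftrightarrow> (\<forall>x. f (x + 2 * pi) = f x)"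

definition fourier_coeff :: "(real \<Rightarrow> complex) \<Rightarrow> int \<Rightarrow> complex" where
  "fourier_coeff f n =
     1 / (2 * pi) * integral {0..2 * pi} (\<lambda>x. f x * exp (- (\<i> * of_int n * complex_of_real x)))"

text \<open>
  The Sobolev space \<open>H\<^sup>s\<close> of the circle, as a set of functions. Integrability ensures that the Fourier
  coefficients are genuine integrals. For \<open>s \<ge> 0\<close> this is all of \<open>H\<^sup>s\<close> (up to null sets). For \<open>s < 0\<close> it
  contains only those elements that are integrable functions; nothing is lost when
  membership is required for every real \<open>s\<close>.
\<close>

definition sobolev_space :: "real \<Rightarrow> (real \<Rightarrow> complex) set" where
  "sobolev_space s =
     {f. circle_periodic f \<and> f absolutely_integrable_on {0..2 * pi} \<and>
         (\<lambda>n::int. (1 + (real_of_int n)\<^sup>2) powr s * (cmod (fourier_coeff f n))\<^sup>2) summable_on UNIV}"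

definition sobolev_norm :: "real \<Rightarrow> (real \<Rightarrow> complex) \<Rightarrow> real" where
  "sobolev_norm s f =
     sqrt (\<Sum>\<^sub>\<infinity>n::int. (1 + (real_of_int n)\<^sup>2) powr s * (cmod (fourier_coeff f n))\<^sup>2)"

text \<open>
  Global classical solutions of \<open>\<i> \<partial>\<^sub>t u + \<partial>\<^sub>x\<^sup>2 u = \<sigma> \<nu> |u|\<^sup>4 u\<close> on the circle, with \<open>u\<close> of class \<open>C\<^sup>1\<close> in
  time and \<open>C\<^sup>2\<close> in space; \<open>\<sigma>\<close> is the sign of the nonlinearity.
\<close>

definition quintic_NLS_solution :: "real \<Rightarrow> real \<Rightarrow> (real \<Rightarrow> real \<Rightarrow> complex) \<Rightarrow> bool" where
  "quintic_NLS_solution \<sigma> \<nu> u \<longleftrightarrow>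
     (\<forall>t. circle_periodic (u t)) \<and>
     (\<exists>ut ux uxx :: real \<Rightarrow> real \<Rightarrow> complex.
        continuous_on UNIV (\<lambda>(t, x). ut t x) \<and>
        continuous_on UNIV (\<lambda>(t, x). ux t x) \<and>
        continuous_on UNIV (\<lambda>(t, x). uxx t x) \<and>
        (\<forall>t x. ((\<lambda>r. u r x) has_vector_derivative ut t x) (at t) \<and>
               (u t has_vector_derivative ux t x) (at x) \<and>
               (ux t has_vector_derivative uxx t x) (at x) \<and>
               \<i> * ut t x + uxx t x =
                 complex_of_real (\<sigma> * \<nu> * cmod (u t x) ^ 4) * u t x))"

text \<open>
  A resonant set together with the labelling of its elements. The set alone does not determine the
  labelling: replacing \<open>(n, k)\<close> by \<open>(n + 4k, -k)\<close> exchanges the roles of the \<open>a\<close>'s and the \<open>b\<close>'s.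
\<close>

definition resonant_set :: "int set \<Rightarrow> int \<Rightarrow> int \<Rightarrow> int \<Rightarrow> int \<Rightarrow> bool" where
  "resonant_set A a2 a1 b2 b1 \<longleftrightarrow>
     (\<exists>n k. k \<noteq> 0 \<and> A = {n, n + 3 * k, n + 4 * k, n + k} \<and>
            a2 = n \<and> a1 = n + 3 * k \<and> b2 = n + 4 * k \<and> b1 = n + k)"

end

theory Submission
  imports Defs "HOL-Library.Multiset" "HOL-Computational_Algebra.Polynomial" "HOL-Analysis.Analysis"
begin

text \<open>
  By a Galilean boost and a rescaling the resonant set becomes \<open>{-2, -1, 1, 2}\<close>. In the interaction picture the
  Fourier modes of the solution are limits of Galerkin approximations, all estimated uniformly in the truncation.
  One step of normal form removes the non-resonant interactions up to \<open>O(\<nu>\<^sup>2)\<close>; the resonant sextic form preserves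
  every weight that is additive along resonances, in particular a weight vanishing exactly on the resonant set and
  positive on all other modes except the zero mode. The zero mode is controlled separately: resonances preserve the mass
  on the multiples of 3 up to higher order, and the remaining forcing of these modes averages out over a third of the
  period. A bootstrap over times \<open>\<nu> powr (-3/2)\<close>, with exponential weights, then keeps all other modes of size \<open>O(\<nu> powr (1/4))\<close>.
  The four remaining modes obey an integrable system, which reduces to \<open>x' = y\<close>, \<open>y\<^sup>2 = P x\<close> with a sextic polynomial
  \<open>P\<close>; between two simple zeros of \<open>P\<close> the orbit is periodic and stable in the angle variable.
\<close>

section \<open>Differential inequalities\<close>

text \<open>All scales are powers of \<open>mu\<close>, with mu^4 the size of the coupling, so the
  time span is mu^-6 and the remainder of the normal form is of order mu^8. Modes off the resonant
  set are held at two levels at once: a weighted bound eta * mu for each mode and an H^1 bound B *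
  mu^2 for their sum. The first is exactly critical: three small factors at rate mu^4 over time
  mu^-6 reproduce the order mu, so it is closed by a small \<open>eta\<close>, not by a small
  \<open>mu\<close>. The second is critical too, but its square is bounded linearly in
  \<open>B\<close>, so a large \<open>B\<close> closes it. The obstacle is the zero mode, where the
  additional weight is negative. Gronwall on the multiples of 3 costs a factor exponential in
  \<open>B\<close>; forcing of order mu^8 during mu^-6 would give mu^2 times that factor, and the
  choice of \<open>B\<close> could not absorb it. Averaging lowers the accumulated forcing to order
  mu^6 and leaves a zero mode of order mu^4, where a small \<open>mu\<close> pays for the
  exponential. Working with finite truncations makes the family of bootstrapped bounds finite, so a
  first bad time exists.\<close>

abbreviation (input) cpx :: "real => complex" where "cpx == complex_of_real"
abbreviation (input) rl :: "int => real" where "rl == real_of_int"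

abbreviation (input) hvd :: "(real => 'a::real_normed_vector) => 'a => real filter => bool" (infix "hvd" 50)
 where "f hvd d == (f has_vector_derivative d)"
abbreviation (input) hrd :: "(real => real) => real => real filter => bool" (infix "hrd" 50)
 where "f hrd d == (f has_real_derivative d)"

text \<open>At the earliest time where some bound is attained, all bounds hold weakly up to then,
  and \<open>step\<close> makes them strict there. Finiteness of \<open>I\<close> makes the set of
  bad times compact, so that earliest time exists. Several bounds can thus be used to improve one
  another.\<close>

lemma continuity_bootstrap:
 fixes phi :: "'i => real => real" and b :: "'i => real"
 assumes fin: "finite I" and cont: "!!i. i : I ==> continuous_on {0..S} (phi i)"
 and base: "!!i. i : I ==> phi i 0 <= b i"
 and step: "!!t i. t : {0..S} ==> (!!s k. s : {0..t} ==> k : I ==> phi k s <= b k) ==> i : I ==> phi i t < b i"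
 and "t : {0..S}" "i : I"
 shows "phi i t < b i"
proof (rule ccontr)
 assume neg: "\<not> phi i t < b i"
 define E where "E = (\<Union>k\<in>I. {s : {0..S}. b k <= phi k s})"
 have "compact E" unfolding E_def
 proof (rule compact_UN[OF fin])
 fix k assume "k : I"
 have "closed {s : {0..S}. b k <= phi k s}"
 by (intro continuous_on_closed_Collect_le continuous_intros cont \<open>k : I\<close> closed_atLeastAtMost)
 then show "compact {s : {0..S}. b k <= phi k s}"
 by (intro compact_Int_closed[of "{0..S}", simplified Int_def, simplified] |
 metis (no_types, lifting) compact_Icc compact_Int_closed Int_absorb1 mem_Collect_eq subsetI)+
 qed
 moreover have "E ~= {}" using neg assms(5,6) by (force simp: E_def)
 ultimately obtain t0 where t0: "t0 : E" "!!s. s : E ==> t0 <= s"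
 by (meson compact_attains_inf)
 obtain k where k: "k : I" "b k <= phi k t0" and t0S: "t0 : {0..S}" using t0(1) by (auto simp: E_def)
 have before: "phi l s < b l" if "s : {0..<t0}" "l : I" for s l
 proof (rule ccontr)
 assume "\<not> phi l s < b l"
 then have "b l <= phi l s" by simp
 then have "s : E" unfolding E_def using that t0S by auto
 then show False using t0(2)[of s] that by auto
 qed
 have at0: "phi l t0 <= b l" if "l : I" for l
 proof (cases "t0 = 0")
 case True then show ?thesis using base that by simp
 next
 case False
 then have "t0 > 0" using t0S by auto
 have "continuous_on {0..t0} (phi l)"
 using cont[OF that] t0S by (meson atLeastatMost_subset_iff continuous_on_subset order_refl atLeastAtMost_iff)
 moreover have "closure {0..<t0} = {0..t0}" using \<open>t0 > 0\<close> by simp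
 ultimately show ?thesis
 using continuous_le_on_closure[of "{0..<t0}" "phi l" t0 "b l"] before[OF _ that] \<open>t0 > 0\<close>
 by (smt (verit) atLeastAtMost_iff t0S)
 qed
 have "phi k t0 < b k"
 using step[OF t0S _ k(1)] before at0 by (metis atLeastAtMost_iff atLeastLessThan_iff less_eq_real_def)
 then show False using k by simp
qed

text \<open>After division by the exponential, \<open>N\<close> grows at rate at most
  \<open>d\<close>. With \<open>c = 0\<close> this is plain integration of a drift, and it serves in
  that form as well.\<close>

lemma gronwall:
 fixes N :: "real => real"
 assumes der: "!!t. t : {0..S} ==> (N hrd N' t) (at t)"
 and le: "!!t. t : {0..S} ==> N' t <= c * N t + d" and "0 <= c" "0 <= d" "t : {0..S}"
 shows "N t <= (N 0 + d * t) * exp (c * t)"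
proof -
 define g where "g s = d * s - exp (- (c * s)) * N s" for s
 have "g 0 <= g t"
 proof (rule DERIV_nonneg_imp_nondecreasing[where f = g])
 show "0 <= t" using assms by auto
 fix s assume s: "0 <= s" "s <= t"
 have sS: "s : {0..S}" using s assms by auto
 have "(g hrd d - (exp (- (c * s)) * N' s - c * exp (- (c * s)) * N s)) (at s)"
 unfolding g_def by (auto intro!: derivative_eq_intros der[OF sS])
 moreover have "d - (exp (- (c * s)) * N' s - c * exp (- (c * s)) * N s) \<ge> 0"
 proof -
 have "exp (- (c * s)) * (N' s - c * N s) <= exp (- (c * s)) * d"
 using le[OF sS] by (intro mult_left_mono) auto
 also have "\<dots> <= 1 * d" using assms s by (intro mult_right_mono) auto
 finally show ?thesis by (simp add: algebra_simps)
 qed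
 ultimately show "\<exists>y. (g hrd y) (at s) & 0 <= y" by blast
 qed
 then have "exp (- (c * t)) * N t <= N 0 + d * t" by (simp add: g_def)
 then have "exp (c * t) * (exp (- (c * t)) * N t) <= exp (c * t) * (N 0 + d * t)"
 by (intro mult_left_mono) auto
 then show ?thesis by (simp add: exp_minus field_simps)
qed

lemma has_real_derivative_cmod_sq:
 assumes "(z hvd z') (at t)"
 shows "((%s. (cmod (z s))\<^sup>2) hrd 2 * Re (cnj (z t) * z')) (at t)"
proof -
 have "((%s. z s \<bullet> z s) has_derivative (%h. z t \<bullet> (h *\<^sub>R z') + (h *\<^sub>R z') \<bullet> z t)) (at t)"
 using assms unfolding has_vector_derivative_def by (auto intro!: derivative_eq_intros)
 moreover have "z s \<bullet> z s = (cmod (z s))\<^sup>2" for s by (simp add: power2_norm_eq_inner)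
 moreover have "z t \<bullet> (h *\<^sub>R z') + (h *\<^sub>R z') \<bullet> z t = h * (2 * Re (cnj (z t) * z'))" for h
 by (simp add: inner_complex_def algebra_simps)
 ultimately show ?thesis unfolding has_field_derivative_def
 by (intro has_derivative_eq_rhs[OF _ ext[OF mult.commute[of _ "2 * Re (cnj (z t) * z')"]]])
 (simp add: fun_eq_iff)
qed

text \<open>The modulus is not differentiable at zeros of \<open>z\<close>, but the square root of
  |z|^2 + e^2 is, with slope at most \<open>m\<close>; then \<open>e\<close> tends to 0. The
  hypothesis sees only the radial part of the derivative, so terms that merely rotate
  \<open>z\<close> cost nothing.\<close>

lemma cmod_growth:
 fixes z :: "real => complex"
 assumes der: "!!t. t : {0..S} ==> (z hvd z' t) (at t)"
 and le: "!!t. t : {0..S} ==> Re (cnj (z t) * z' t) <= m * cmod (z t)" and "0 <= m" "t : {0..S}"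
 shows "cmod (z t) <= cmod (z 0) + m * t"
proof (rule field_le_epsilon)
 fix e :: real assume e: "e > 0"
 define g where "g s = sqrt ((cmod (z s))\<^sup>2 + e\<^sup>2)" for s
 have pos: "(cmod (z s))\<^sup>2 + e\<^sup>2 > 0" for s using e by (simp add: add_nonneg_pos)
 have "m * 0 - g 0 <= m * t - g t"
 proof (rule DERIV_nonneg_imp_nondecreasing[where f = "%s. m * s - g s"])
 show "0 <= t" using assms by auto
 fix s assume s: "0 <= s" "s <= t"
 have sS: "s : {0..S}" using s assms by auto
 define D where "D = (2 * Re (cnj (z s) * z' s)) / (2 * g s)"
 have "((%s. (cmod (z s))\<^sup>2 + e\<^sup>2) hrd 2 * Re (cnj (z s) * z' s)) (at s)"
 using DERIV_add[OF has_real_derivative_cmod_sq[OF der[OF sS]] DERIV_const[of "e\<^sup>2"]] by simp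
 from DERIV_chain2[OF DERIV_real_sqrt[OF pos[of s]] this]
 have "(g hrd D) (at s)"
 unfolding g_def D_def by (simp add: field_simps)
 then have "((%s. m * s - g s) hrd m - D) (at s)"
 by (auto intro!: derivative_eq_intros)
 moreover have "D <= m"
 proof -
 have gp: "g s > 0" using pos by (simp add: g_def)
 have "cmod (z s) <= g s" unfolding g_def by (rule real_le_rsqrt) simp
 then have "Re (cnj (z s) * z' s) <= m * g s" using le[OF sS] assms(3)
 by (meson dual_order.trans mult_left_mono)
 then show ?thesis unfolding D_def using gp by (simp add: field_simps)
 qed
 ultimately show "\<exists>y. ((%s. m * s - g s) hrd y) (at s) & 0 <= y" by force
 qed
 then have "g t <= g 0 + m * t" by simp
 moreover have "cmod (z t) <= g t" unfolding g_def by (rule real_le_rsqrt) simp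
 moreover have "g 0 <= cmod (z 0) + e"
 unfolding g_def using e by (intro real_le_lsqrt) (auto simp: power2_sum)
 ultimately show "cmod (z t) <= cmod (z 0) + m * t + e" by simp
qed

text \<open>Picard iteration on the whole half-line at once: the unknown is the solution divided by
  \<open>exp (2 * L * t)\<close>, a weight that turns the integral operator into a contraction with
  factor 1/2 in the sup norm.\<close>

lemma lipschitz_ode_half:
 fixes F :: "'a::banach => 'a"
 assumes lip: "!!x y. norm (F x - F y) <= L * norm (x - y)" and L: "L > 0"
 shows "\<exists>x. x 0 = x0 & (\<forall>t\<ge>0. (x hvd F (x t)) (at t within {0..}))"
proof -
 have contF: "continuous_on UNIV F"
 by (rule lipschitz_on_continuous_on[where L = L])
 (use lip L in \<open>auto simp: lipschitz_on_def dist_norm\<close>)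
 have Fb: "norm (F x) <= norm (F 0) + L * norm x" for x
 using lip[of x 0] norm_triangle_ineq2[of "F x" "F 0"] by auto
 define H where "H q r = F (exp (2 * L * r) *\<^sub>R apply_bcontfun q r)" for q :: "real \<Rightarrow>\<^sub>C 'a" and r
 define I where "I q s = x0 + integral {0..s} (H q)" for q s
 \<comment> \<open>Times below 0 are frozen by \<open>max 0\<close>, which makes the iterates
   bounded continuous functions on the full line.\<close>
 define G where "G q t = exp (- 2 * L * max 0 t) *\<^sub>R I q (max 0 t)" for q t
 have contH: "continuous_on X (H q)" for q X
 unfolding H_def
 by (intro continuous_on_compose2[OF contF] continuous_intros subset_UNIV)
 auto
 have Hint: "H q integrable_on {0..s}" for q s
 by (rule integrable_continuous_interval[OF contH])
 have Ider: "(I q hvd H q s) (at s within {0..T})" if "s : {0..T}" for q s T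
 unfolding I_def using integral_has_vector_derivative[OF contH that, of q]
 by (auto intro!: derivative_eq_intros)
 have contI: "continuous_on {0..} (I q)" for q
 proof -
 have "continuous (at s within {0..}) (I q)" if "s \<ge> 0" for s
 proof -
 have "continuous (at s within {0..s+1}) (I q)"
 using Ider[of s "s+1" q] that by (auto dest: has_vector_derivative_continuous)
 moreover have "at s within {0..s+1} = at s within {0..}"
 by (rule at_within_nhd[of s "{..<s+1}"]) auto
 ultimately show ?thesis by simp
 qed
 then show ?thesis by (simp add: continuous_on_eq_continuous_within)
 qed
 have Hb: "norm (H q r) <= norm (F 0) + L * (exp (2 * L * r) * norm q)" for q r
 proof -
 have "norm (exp (2 * L * r) *\<^sub>R apply_bcontfun q r) <= exp (2 * L * r) * norm q"
 by (simp add: norm_bounded)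
 then show ?thesis unfolding H_def using Fb[of "exp (2 * L * r) *\<^sub>R apply_bcontfun q r"] L
 by (smt (verit) mult_left_mono)
 qed
 have expint: "((%r. L * (exp (2 * L * r) * c)) has_integral (exp (2 * L * s) - 1) / 2 * c) {0..s}" if "s \<ge> 0" for s c
 proof -
 have "((%r. L * (exp (2 * L * r) * c)) has_integral exp (2 * L * s) / 2 * c - exp (2 * L * 0) / 2 * c) {0..s}"
 using that by (intro fundamental_theorem_of_calculus)
 (auto simp flip: has_real_derivative_iff_has_vector_derivative intro!: derivative_eq_intros)
 then show ?thesis by (simp add: algebra_simps diff_divide_distrib)
 qed
 have Gb: "G q : bcontfun" for q
 proof (rule bcontfun_normI)
 show "continuous_on UNIV (G q)" unfolding G_def
 by (intro continuous_intros continuous_on_compose2[OF contI]) auto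
 fix t :: real
 define s where "s = max 0 t"
 have s: "s \<ge> 0" by (simp add: s_def)
 have "norm (integral {0..s} (H q)) <= integral {0..s} (%r. norm (F 0) + L * (exp (2 * L * r) * norm q))"
 using Hb expint[OF s, of "norm q"]
 by (intro integral_norm_bound_integral Hint integrable_add) (auto simp: integrable_on_def)
 also have "\<dots> = norm (F 0) * s + (exp (2 * L * s) - 1) / 2 * norm q"
 using has_integral_add[OF has_integral_const_real[of "norm (F 0)" "0" "s"] expint[OF s, of "norm q"]] s
 by (intro integral_unique) (simp add: mult.commute)
 also have "\<dots> <= norm (F 0) * s + exp (2 * L * s) * norm q"
 proof -
 have "(exp (2 * L * s) - 1) / 2 <= exp (2 * L * s)" using order_trans[of "- 1" 0 "exp (2 * L * s)"] by simp
 then show ?thesis by (intro add_left_mono mult_right_mono) auto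
 qed
 finally have *: "norm (I q s) <= norm x0 + norm (F 0) * s + exp (2 * L * s) * norm q"
 unfolding I_def by (smt (verit) norm_triangle_ineq)
 \<comment> \<open>The value \<open>F 0\<close> makes the integral grow linearly in time; the
   exponential weight still bounds that.\<close>
 have es: "s * exp (- 2 * L * s) <= 1 / (2 * L)"
 proof -
 have "2 * L * s <= exp (2 * L * s)" using exp_ge_add_one_self[of "2 * L * s"] by linarith
 then show ?thesis using L by (simp add: exp_minus field_simps)
 qed
 have "norm (G q t) = exp (- 2 * L * s) * norm (I q s)" by (simp add: G_def s_def)
 also have "\<dots> <= exp (- 2 * L * s) * (norm x0 + norm (F 0) * s + exp (2 * L * s) * norm q)"
 using * by (intro mult_left_mono) auto
 also have "\<dots> = exp (- 2 * L * s) * norm x0 + norm (F 0) * (s * exp (- 2 * L * s)) + norm q"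
 by (simp add: algebra_simps exp_minus)
 also have "\<dots> <= 1 * norm x0 + norm (F 0) * (1 / (2 * L)) + norm q"
 using es L s by (intro add_mono mult_right_mono mult_left_mono) auto
 finally show "norm (G q t) <= 1 * norm x0 + norm (F 0) * (1 / (2 * L)) + norm q" .
 qed
 define \<Gamma> where "\<Gamma> q = Bcontfun (G q)" for q
 have \<Gamma>: "apply_bcontfun (\<Gamma> q) = G q" for q using Gb by (simp add: \<Gamma>_def Bcontfun_inverse)
 have "dist (\<Gamma> p) (\<Gamma> q) <= 1/2 * dist p q" for p q
 proof (rule dist_bound)
 fix t :: real
 define s where "s = max 0 t"
 have s: "s \<ge> 0" by (simp add: s_def)
 have pt: "norm (H p r - H q r) <= L * (exp (2 * L * r) * dist p q)" for r
 proof -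
 have "norm (H p r - H q r) <= L * norm (exp (2 * L * r) *\<^sub>R apply_bcontfun p r - exp (2 * L * r) *\<^sub>R apply_bcontfun q r)"
 unfolding H_def by (rule lip)
 also have "\<dots> = L * (exp (2 * L * r) * dist (apply_bcontfun p r) (apply_bcontfun q r))"
 by (simp add: dist_norm flip: scaleR_diff_right)
 also have "\<dots> <= L * (exp (2 * L * r) * dist p q)"
 using L by (intro mult_left_mono dist_bounded) auto
 finally show ?thesis .
 qed
 have "norm (I p s - I q s) = norm (integral {0..s} (%r. H p r - H q r))"
 unfolding I_def by (subst integral_diff[OF Hint Hint]) simp
 also have "\<dots> <= integral {0..s} (%r. L * (exp (2 * L * r) * dist p q))"
 using pt expint[OF s, of "dist p q"]
 by (intro integral_norm_bound_integral integrable_diff Hint) (auto simp: integrable_on_def)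
 also have "\<dots> = (exp (2 * L * s) - 1) / 2 * dist p q" using expint[OF s] by (rule integral_unique)
 also have "\<dots> <= exp (2 * L * s) * (1/2 * dist p q)" by (simp add: algebra_simps divide_right_mono)
 finally have *: "norm (I p s - I q s) <= exp (2 * L * s) * (1/2 * dist p q)" .
 have "dist (G p t) (G q t) = exp (- 2 * L * s) * norm (I p s - I q s)"
 by (simp add: G_def s_def dist_norm flip: scaleR_diff_right)
 also have "\<dots> <= exp (- 2 * L * s) * (exp (2 * L * s) * (1/2 * dist p q))"
 using * by (intro mult_left_mono) auto
 also have "\<dots> = 1/2 * dist p q" by (simp add: exp_minus)
 finally show "dist (apply_bcontfun (\<Gamma> p) t) (apply_bcontfun (\<Gamma> q) t) <= 1/2 * dist p q" by (simp add: \<Gamma>)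
 qed
 then obtain q where q: "\<Gamma> q = q" using banach_fix_type[of "1/2" \<Gamma>] by auto
 have xe: "exp (2 * L * t) *\<^sub>R apply_bcontfun q t = I q t" if "t \<ge> 0" for t
 proof -
 have "apply_bcontfun q t = exp (- 2 * L * t) *\<^sub>R I q t"
 using \<Gamma>[of q] q that by (metis G_def max_absorb2)
 then show ?thesis by (simp add: exp_minus)
 qed
 define x where "x = I q"
 have "(x hvd F (x t)) (at t within {0..})" if "t \<ge> 0" for t
 proof -
 have "(x hvd H q t) (at t within {0..t+1})" unfolding x_def using that by (intro Ider) auto
 moreover have "at t within {0..t+1} = at t within {0..}"
 by (rule at_within_nhd[of t "{..<t+1}"]) auto
 moreover have "H q t = F (x t)" unfolding H_def x_def using xe[OF that] by simp
 ultimately show ?thesis by simp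
 qed
 moreover have "x 0 = x0" by (simp add: x_def I_def)
 ultimately show ?thesis by blast
qed

text \<open>Backward time is forward time for the negated field; the two halves meet at 0 with the
  same one-sided derivative \<open>F x0\<close>.\<close>

theorem lipschitz_ode:
 fixes F :: "'a::banach => 'a"
 assumes lip: "!!x y. norm (F x - F y) <= L * norm (x - y)"
 shows "\<exists>x. x 0 = x0 & (\<forall>t. (x hvd F (x t)) (at t))"
proof -
 define L' where "L' = max L 1"
 have L': "L' > 0" by (simp add: L'_def)
 have lip': "norm (F x - F y) <= L' * norm (x - y)" for x y
 using lip[of x y] by (smt (verit) L'_def mult_right_mono norm_ge_zero)
 obtain x where x: "x 0 = x0" "!!t. t \<ge> 0 ==> (x hvd F (x t)) (at t within {0..})"
 using lipschitz_ode_half[OF lip' L'] by blast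
 have lip2: "norm (- F x - - F y) <= L' * norm (x - y)" for x y
 using lip'[of x y] by (simp add: norm_minus_commute)
 obtain y where y: "y 0 = x0" "!!t. t \<ge> 0 ==> (y hvd - F (y t)) (at t within {0..})"
 using lipschitz_ode_half[of "%x. - F x", OF lip2 L'] by blast
 define z where "z t = (if t : {0..} then x t else y (- t))" for t
 have yneg: "((%t. y (- t)) hvd F (y (- t))) (at t within {..0})" if "t <= 0" for t
 proof -
 have "((y \<circ> uminus) hvd (- 1) *\<^sub>R (- F (y (- t)))) (at t within {..0})"
 proof (rule vector_diff_chain_within)
 show "(uminus hvd - 1) (at t within {..0})"
 by (auto intro!: derivative_eq_intros)
 have "uminus ` {..(0::real)} = {0..}" by auto
 then show "(y hvd - F (y (- t))) (at (- t) within uminus ` {..0})"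
 using y(2)[of "- t"] that by simp
 qed
 then show ?thesis by (simp add: o_def)
 qed
 have "(z hvd F (z t)) (at t)" for t
 proof -
 consider "t > 0" | "t < 0" | "t = 0" by linarith
 then show ?thesis
 proof cases
 case 1
 have "(x hvd F (x t)) (at t)"
 using x(2)[of t] 1 at_within_interior[of t "{0..}"] by (simp add: interior_real_atLeast)
 then have "(z hvd F (x t)) (at t)"
 by (rule has_vector_derivative_transform_within_open[of _ _ _ "{0<..}"]) (use 1 in \<open>auto simp: z_def\<close>)
 then show ?thesis using 1 by (simp add: z_def)
 next
 case 2
 have "((%t. y (- t)) hvd F (y (- t))) (at t)"
 using yneg[of t] 2 at_within_interior[of t "{..0}"] by (simp add: interior_real_atMost)
 then have "(z hvd F (y (- t))) (at t)"
 by (rule has_vector_derivative_transform_within_open[of _ _ _ "{..<0}"]) (use 2 in \<open>auto simp: z_def\<close>)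
 then show ?thesis using 2 by (simp add: z_def)
 next
 case 3
 have a: "(z hvd F x0) (at 0 within {0..})"
 by (rule has_vector_derivative_transform[OF _ _ x(2)[of 0, unfolded x(1)]]) (auto simp: z_def)
 have b: "(z hvd F x0) (at 0 within {..0})"
 using yneg[of 0] y(1) x(1)
 by (intro has_vector_derivative_transform[of 0 "{..0}" z "%t. y (- t)"]) (auto simp: z_def)
 have U: "at (0::real) = at 0 within ({0..} \<union> {..0})" by (rule arg_cong[of _ _ "%S. at 0 within S"]) auto
 have "(z has_derivative (%h. h *\<^sub>R F x0)) (at 0)"
 using a b unfolding has_vector_derivative_def has_derivative_within U Lim_within_Un by simp
 then show ?thesis using 3 x(1) by (simp add: has_vector_derivative_def z_def)
 qed
 qed
 moreover have "z 0 = x0" using x(1) by (simp add: z_def)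
 ultimately show ?thesis by blast
qed

section \<open>Resonant sums\<close>

text \<open>The argument of \<open>kap\<close> is the defect of the squares along a sextet, so a
  single definition covers the full nonlinearity in the interaction picture, its resonant part and
  the normal form correction. The five slots are separate for the sake of multilinear
  expansions.\<close>

definition qsum :: "int set => (int => complex) => (int => complex) => (int => complex) => (int => complex) =>
 (int => complex) => (int => complex) => int => complex" where
 "qsum J kap p q r s t j = (\<Sum>(a, b, c, d, e)\<in>J \<times> J \<times> J \<times> J \<times> J.
 if a + b + c = d + e + j
 then kap (j\<^sup>2 + d\<^sup>2 + e\<^sup>2 - a\<^sup>2 - b\<^sup>2 - c\<^sup>2) * (p a * q b * r c * cnj (s d) * cnj (t e)) else 0)"

definition qmaj :: "int set => (int => real) => (int => real) => (int => real) => (int => real) => (int => real) => int => real" where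
 "qmaj J p q r s t j = (\<Sum>(a, b, c, d, e)\<in>J \<times> J \<times> J \<times> J \<times> J.
 if a + b + c = d + e + j then p a * q b * r c * s d * t e else 0)"

lemma qsum_norm_le:
 assumes "!!x. cmod (kap x) <= k"
 shows "cmod (qsum J kap p q r s t j) <=
 k * qmaj J (%i. cmod (p i)) (%i. cmod (q i)) (%i. cmod (r i)) (%i. cmod (s i)) (%i. cmod (t i)) j"
 unfolding qsum_def qmaj_def sum_distrib_left
 by (rule sum_norm_le) (auto simp: norm_mult intro!: mult_right_mono assms split: prod.splits)

lemma qmaj_mono:
 assumes "!!i. i : J ==> 0 <= p i & p i <= p' i" "!!i. i : J ==> 0 <= q i & q i <= q' i"
 "!!i. i : J ==> 0 <= r i & r i <= r' i" "!!i. i : J ==> 0 <= s i & s i <= s' i"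
 "!!i. i : J ==> 0 <= t i & t i <= t' i"
 shows "qmaj J p q r s t j <= qmaj J p' q' r' s' t' j"
proof -
 have "p a * q b * r c * s d * t e <= p' a * q' b * r' c * s' d * t' e"
 if "a : J" "b : J" "c : J" "d : J" "e : J" for a b c d e
 proof -
 have "0 <= p' a" "0 <= q' b" "0 <= r' c" "0 <= s' d" "0 <= t' e" using assms that by (meson order_trans)+
 then show ?thesis using assms that by (intro mult_mono) (auto intro!: mult_nonneg_nonneg)
 qed
 then show ?thesis unfolding qmaj_def by (intro sum_mono) auto
qed

lemma sum_delta_le:
 fixes g :: "int => real"
 assumes "finite X" "!!i. 0 <= g i"
 shows "(\<Sum>j\<in>X. if j = y then g j else 0) <= g y"
 using assms by (simp add: sum.delta)

lemma sum5_nested: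
 "(\<Sum>(a, b, c, d, e)\<in>J \<times> J \<times> J \<times> J \<times> J. f a b c d e) = (\<Sum>a\<in>J. \<Sum>b\<in>J. \<Sum>c\<in>J. \<Sum>d\<in>J. \<Sum>e\<in>J. f a b c d e)"
 by (simp add: sum.cartesian_product')

lemma sum5_product:
 fixes p q r s t :: "int => real"
 shows "(\<Sum>(a, b, c, d, e)\<in>J \<times> J \<times> J \<times> J \<times> J. p a * q b * r c * s d * t e) = sum p J * sum q J * sum r J * sum s J * sum t J"
 by (simp only: sum5_nested mult.assoc sum_distrib_left[symmetric] sum_distrib_right[symmetric])

lemma qmaj_l1:
 assumes "finite X" "!!i. 0 <= p i" "!!i. 0 <= q i" "!!i. 0 <= r i" "!!i. 0 <= s i" "!!i. 0 <= t i"
 shows "(\<Sum>j\<in>X. qmaj J p q r s t j) <= sum p J * sum q J * sum r J * sum s J * sum t J"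
proof -
 have "(\<Sum>j\<in>X. qmaj J p q r s t j) = (\<Sum>x\<in>J \<times> J \<times> J \<times> J \<times> J. \<Sum>j\<in>X.
 (case x of (a, b, c, d, e) => if a + b + c = d + e + j then p a * q b * r c * s d * t e else 0))"
 unfolding qmaj_def by (rule sum.swap)
 also have "\<dots> <= (\<Sum>(a, b, c, d, e)\<in>J \<times> J \<times> J \<times> J \<times> J. p a * q b * r c * s d * t e)"
 proof (intro sum_mono, clarsimp)
 fix a b c d e
 have "(\<Sum>j\<in>X. if a + b + c = d + e + j then p a * q b * r c * s d * t e else 0) =
 (\<Sum>j\<in>X. if j = a + b + c - d - e then p a * q b * r c * s d * t e else 0)"
 by (intro sum.cong) auto
 also have "\<dots> <= p a * q b * r c * s d * t e"
 using assms by (intro sum_delta_le) auto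
 finally show "(\<Sum>j\<in>X. if a + b + c = d + e + j then p a * q b * r c * s d * t e else 0) <= p a * q b * r c * s d * t e" .
 qed
 finally show ?thesis by (simp only: sum5_product)
qed

text \<open>Momentum conservation fixes \<open>e\<close>; the other sums collapse one at a time,
  each being a convolution that \<open>conv\<close> absorbs at the price of a factor
  \<open>K\<close>. Evenness turns the conjugated slots into ordinary ones.\<close>

lemma qmaj_weight:
 fixes w :: "int => real"
 assumes fin: "finite J" and nn: "!!i. 0 <= w i" and even: "!!i. w (- i) = w i" and K: "0 <= K"
 and conv: "!!j. (\<Sum>k\<in>J. w k * w (j - k)) <= K * w j"
 shows "qmaj J w w w w w j <= K ^ 4 * w j"
proof -
 have sym: "w (x - y) = w (y - x)" for x y using even[of "x - y"] by simp
 have "qmaj J w w w w w j = (\<Sum>a\<in>J. \<Sum>b\<in>J. \<Sum>c\<in>J. \<Sum>d\<in>J. \<Sum>e\<in>J.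
 if a + b + c = d + e + j then w a * w b * w c * w d * w e else 0)"
 unfolding qmaj_def by (rule sum5_nested)
 also have "\<dots> <= (\<Sum>a\<in>J. \<Sum>b\<in>J. \<Sum>c\<in>J. \<Sum>d\<in>J. w a * w b * w c * (w d * w (a + b + c - j - d)))"
 proof (intro sum_mono)
 fix a b c d
 have "(\<Sum>e\<in>J. if a + b + c = d + e + j then w a * w b * w c * w d * w e else 0) =
 (\<Sum>e\<in>J. if e = a + b + c - j - d then w a * w b * w c * w d * w e else 0)"
 by (intro sum.cong) auto
 also have "\<dots> <= w a * w b * w c * w d * w (a + b + c - j - d)"
 by (rule sum_delta_le[OF fin]) (simp add: nn)
 finally show "(\<Sum>e\<in>J. if a + b + c = d + e + j then w a * w b * w c * w d * w e else 0) <=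
 w a * w b * w c * (w d * w (a + b + c - j - d))" by (simp add: mult_ac)
 qed
 also have "\<dots> <= (\<Sum>a\<in>J. \<Sum>b\<in>J. \<Sum>c\<in>J. w a * w b * (K * (w c * w (j - a - b - c))))"
 proof (intro sum_mono)
 fix a b c
 have "(\<Sum>d\<in>J. w a * w b * w c * (w d * w (a + b + c - j - d))) <= w a * w b * w c * (K * w (a + b + c - j))"
 unfolding sum_distrib_left[symmetric] by (intro mult_left_mono conv) (simp add: nn)
 also have "w (a + b + c - j) = w (j - a - b - c)"
 using even[of "a + b + c - j"] by (simp add: algebra_simps)
 finally show "(\<Sum>d\<in>J. w a * w b * w c * (w d * w (a + b + c - j - d))) <= w a * w b * (K * (w c * w (j - a - b - c)))"
 by (simp add: mult_ac)
 qed
 also have "\<dots> <= (\<Sum>a\<in>J. \<Sum>b\<in>J. w a * (K\<^sup>2 * (w b * w (j - a - b))))"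
 proof (intro sum_mono)
 fix a b
 have "(\<Sum>c\<in>J. w a * w b * (K * (w c * w (j - a - b - c)))) <= w a * w b * (K * (K * w (j - a - b)))"
 unfolding sum_distrib_left[symmetric] by (intro mult_left_mono conv) (simp_all add: nn K)
 then show "(\<Sum>c\<in>J. w a * w b * (K * (w c * w (j - a - b - c)))) <= w a * (K\<^sup>2 * (w b * w (j - a - b)))"
 by (simp add: mult_ac power2_eq_square)
 qed
 also have "\<dots> <= (\<Sum>a\<in>J. K ^ 3 * (w a * w (j - a)))"
 proof (intro sum_mono)
 fix a
 have "(\<Sum>b\<in>J. w a * (K\<^sup>2 * (w b * w (j - a - b)))) <= w a * (K\<^sup>2 * (K * w (j - a)))"
 unfolding sum_distrib_left[symmetric] by (intro mult_left_mono conv) (simp_all add: nn)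
 then show "(\<Sum>b\<in>J. w a * (K\<^sup>2 * (w b * w (j - a - b)))) <= K ^ 3 * (w a * w (j - a))"
 by (simp add: mult_ac power2_eq_square power3_eq_cube)
 qed
 also have "\<dots> <= K ^ 3 * (K * w j)"
 unfolding sum_distrib_left[symmetric] by (intro mult_left_mono conv) (simp add: K)
 finally show ?thesis by (simp add: eval_nat_numeral mult_ac)
qed

lemma sum_inverse_one_plus_sq_le:
 assumes "finite (J :: int set)"
 shows "(\<Sum>k\<in>J. 1 / (1 + (rl k)\<^sup>2)) <= 5"
proof -
 \<comment> \<open>Telescoping against 4 / (n + 1); at n = 0 both sides equal 1.\<close>
 have interval: "(\<Sum>k\<in>{- int n..int n}. 1 / (1 + (rl k)\<^sup>2)) <= 5 - 4 / (real n + 1)" for n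
 proof (induction n)
 case 0 then show ?case by simp
 next
 case (Suc n)
 have "{- int (Suc n)..int (Suc n)} = insert (int (Suc n)) (insert (- int (Suc n)) {- int n..int n})" by auto
 then have "(\<Sum>k\<in>{- int (Suc n)..int (Suc n)}. 1 / (1 + (rl k)\<^sup>2)) =
 2 / (1 + (real n + 1)\<^sup>2) + (\<Sum>k\<in>{- int n..int n}. 1 / (1 + (rl k)\<^sup>2))"
 by (simp add: add.commute power2_eq_square algebra_simps)
 moreover have "2 / (1 + (real n + 1)\<^sup>2) <= 4 / (real n + 1) - 4 / (real (Suc n) + 1)"
 by (simp add: field_simps add_pos_nonneg power2_eq_square)
 ultimately show ?case using Suc by linarith
 qed
 obtain n where n: "J \<subseteq> {- int n..int n}"
 proof -
 obtain m where "\<forall>k\<in>J. \<bar>k\<bar> <= m" using assms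
 by (metis finite_imageI Max_ge image_eqI)
 then have "J \<subseteq> {- int (nat m)..int (nat m)}" by force
 then show ?thesis using that by blast
 qed
 have "(\<Sum>k\<in>J. 1 / (1 + (rl k)\<^sup>2)) <= (\<Sum>k\<in>{- int n..int n}. 1 / (1 + (rl k)\<^sup>2))"
 using n by (intro sum_mono2) auto
 also have "\<dots> <= 5 - 4 / (real n + 1)" by (rule interval)
 also have "\<dots> <= 5" by simp
 finally show ?thesis .
qed

text \<open>The exponential controls every Sobolev norm. The rational factor makes the weight stable
  under convolution, which the exponential alone is not.\<close>

definition wt :: "int => real" where
 "wt j = exp (- \<bar>rl j\<bar>) / (1 + (rl j)\<^sup>2)"

lemma wt_pos: "0 < wt j" by (simp add: wt_def add_pos_nonneg)
lemma wt_nonneg: "0 <= wt j" using wt_pos[of j] by simp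
lemma wt_minus [simp]: "wt (- j) = wt j" by (simp add: wt_def)
lemma wt_le: "wt j <= 1 / (1 + (rl j)\<^sup>2)" by (simp add: wt_def divide_right_mono)
lemma wt_le_1: "wt j <= 1"
 using wt_le[of j] by (smt (verit) divide_le_eq_1 zero_le_power2)

text \<open>Since 1 + (x + y)^2 is at most 2 (1 + x^2 + 1 + y^2), one of the two denominators can be
  traded for that of the sum. Two series bounded by 5 remain, whence 20 = 2 * (5 + 5).\<close>

lemma wt_conv:
 assumes fin: "finite J"
 shows "(\<Sum>k\<in>J. wt k * wt (j - k)) <= 20 * wt j"
proof -
 have "wt k * wt (j - k) <= 2 * wt j * (1 / (1 + (rl k)\<^sup>2) + 1 / (1 + (rl (j - k))\<^sup>2))" for k
 proof -
 define x y where "x = rl k" and "y = rl (j - k)"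
 have j: "rl j = x + y" by (simp add: x_def y_def)
 have e: "exp (- \<bar>x\<bar>) * exp (- \<bar>y\<bar>) <= exp (- \<bar>x + y\<bar>)" by (simp flip: exp_add)
 have p: "1 + x\<^sup>2 > 0" "1 + y\<^sup>2 > 0" "1 + (x + y)\<^sup>2 > 0" by (simp_all add: add_pos_nonneg)
 have "1 + (x + y)\<^sup>2 <= 2 * (1 + x\<^sup>2 + (1 + y\<^sup>2))"
 using zero_le_power2[of "x - y"] by (simp add: power2_eq_square algebra_simps)
 then have "1 / ((1 + x\<^sup>2) * (1 + y\<^sup>2)) <= 2 / (1 + (x + y)\<^sup>2) * (1 / (1 + x\<^sup>2) + 1 / (1 + y\<^sup>2))"
 using p by (simp add: divide_simps)
 then have "(exp (- \<bar>x\<bar>) * exp (- \<bar>y\<bar>)) * (1 / ((1 + x\<^sup>2) * (1 + y\<^sup>2))) <=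
 exp (- \<bar>x + y\<bar>) * (2 / (1 + (x + y)\<^sup>2) * (1 / (1 + x\<^sup>2) + 1 / (1 + y\<^sup>2)))"
 using e p by (intro mult_mono) auto
 moreover have "exp (- \<bar>x\<bar>) / (1 + x\<^sup>2) * (exp (- \<bar>y\<bar>) / (1 + y\<^sup>2)) = (exp (- \<bar>x\<bar>) * exp (- \<bar>y\<bar>)) * (1 / ((1 + x\<^sup>2) * (1 + y\<^sup>2)))" by simp
 moreover have "2 * (exp (- \<bar>x + y\<bar>) / (1 + (x + y)\<^sup>2)) * S = exp (- \<bar>x + y\<bar>) * (2 / (1 + (x + y)\<^sup>2) * S)" for S by simp
 ultimately show ?thesis unfolding wt_def j x_def[symmetric] y_def[symmetric] by presburger
 qed
 then have "(\<Sum>k\<in>J. wt k * wt (j - k)) <=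
 (\<Sum>k\<in>J. 2 * wt j * (1 / (1 + (rl k)\<^sup>2) + 1 / (1 + (rl (j - k))\<^sup>2)))"
 by (rule sum_mono)
 also have "\<dots> = 2 * wt j * ((\<Sum>k\<in>J. 1 / (1 + (rl k)\<^sup>2)) + (\<Sum>k\<in>J. 1 / (1 + (rl (j - k))\<^sup>2)))"
 by (simp only: sum.distrib[symmetric] sum_distrib_left[symmetric])
 also have "(\<Sum>k\<in>J. 1 / (1 + (rl (j - k))\<^sup>2)) = (\<Sum>k\<in>(%k. j - k) ` J. 1 / (1 + (rl k)\<^sup>2))"
 by (subst sum.reindex) (auto simp: inj_on_def)
 also have "2 * wt j * ((\<Sum>k\<in>J. 1 / (1 + (rl k)\<^sup>2)) + (\<Sum>k\<in>(%k. j - k) ` J. 1 / (1 + (rl k)\<^sup>2))) <= 2 * wt j * (5 + 5)"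
 by (intro mult_left_mono add_mono sum_inverse_one_plus_sq_le finite_imageI fin) (simp add: wt_nonneg)
 finally show ?thesis by simp
qed

lemma qmaj_wt:
 assumes "finite J"
 shows "qmaj J wt wt wt wt wt j <= 160000 * wt j"
 using qmaj_weight[of J wt 20 j] assms wt_conv[OF assms] by (simp add: wt_nonneg)

lemma qmaj_scale:
 "qmaj J (%i. a1 * p i) (%i. a2 * q i) (%i. a3 * r i) (%i. a4 * s i) (%i. a5 * t i) j =
 a1 * a2 * a3 * a4 * a5 * qmaj J p q r s t j"
 unfolding qmaj_def sum_distrib_left by (rule sum.cong) (auto simp: mult_ac)

lemma qsum_wt_bound:
 assumes fin: "finite J" and k: "!!x. cmod (kap x) <= 1"
 and b: "!!i. i : J ==> cmod (p i) <= b1 * wt i" "!!i. i : J ==> cmod (q i) <= b2 * wt i"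
 "!!i. i : J ==> cmod (r i) <= b3 * wt i" "!!i. i : J ==> cmod (s i) <= b4 * wt i" "!!i. i : J ==> cmod (t i) <= b5 * wt i"
 and nn: "0 <= b1" "0 <= b2" "0 <= b3" "0 <= b4" "0 <= b5"
 shows "cmod (qsum J kap p q r s t j) <= 160000 * (b1 * b2 * b3 * b4 * b5) * wt j"
proof -
 have "cmod (qsum J kap p q r s t j) <=
 1 * qmaj J (%i. cmod (p i)) (%i. cmod (q i)) (%i. cmod (r i)) (%i. cmod (s i)) (%i. cmod (t i)) j"
 by (rule qsum_norm_le[OF k])
 also have "\<dots> <= 1 * qmaj J (%i. b1 * wt i) (%i. b2 * wt i) (%i. b3 * wt i) (%i. b4 * wt i) (%i. b5 * wt i) j"
 using b by (intro mult_left_mono qmaj_mono) auto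
 also have "\<dots> <= b1 * b2 * b3 * b4 * b5 * (160000 * wt j)"
 unfolding qmaj_scale mult_1 using nn by (intro mult_left_mono qmaj_wt fin) auto
 finally show ?thesis by (simp add: mult_ac)
qed

section \<open>Estimates of quintic sums in l^1 and l^2\<close>

definition n1 :: "int set => (int => complex) => real" where "n1 J p = (\<Sum>j\<in>J. cmod (p j))"
definition n2 :: "int set => (int => complex) => real" where "n2 J p = L2_set (%j. cmod (p j)) J"

lemma n1_nonneg [simp]: "0 <= n1 J p" by (simp add: n1_def sum_nonneg)
lemma n2_nonneg [simp]: "0 <= n2 J p" by (simp add: n2_def)
lemma n2_sq: "(n2 J p)\<^sup>2 = (\<Sum>j\<in>J. (cmod (p j))\<^sup>2)" by (simp add: n2_def L2_set_def sum_nonneg)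
lemma n2_le_n1: "n2 J p <= n1 J p" unfolding n1_def n2_def by (rule L2_set_le_sum) auto

lemma qsum_n1:
 assumes "finite X" "!!x. cmod (kap x) <= 1"
 shows "n1 X (qsum J kap p q r s t) <= n1 J p * n1 J q * n1 J r * n1 J s * n1 J t"
proof -
 have "n1 X (qsum J kap p q r s t) <=
 (\<Sum>j\<in>X. qmaj J (%i. cmod (p i)) (%i. cmod (q i)) (%i. cmod (r i)) (%i. cmod (s i)) (%i. cmod (t i)) j)"
 unfolding n1_def using qsum_norm_le[OF assms(2)] by (intro sum_mono) (simp add: mult_1)
 also have "\<dots> <= n1 J p * n1 J q * n1 J r * n1 J s * n1 J t"
 unfolding n1_def using assms(1) by (intro qmaj_l1) auto
 finally show ?thesis .
qed

text \<open>Cauchy-Schwarz along the graph of \<open>phi\<close>: injectivity keeps the square sum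
  of \<open>x\<close> under reindexing, and values of \<open>phi\<close> outside \<open>J\<close>
  are dropped.\<close>

lemma inj_sum_cs:
 fixes x p :: "int => real"
 assumes fin: "finite J" and inj: "inj phi" and "!!i. 0 <= x i" "!!i. 0 <= p i"
 shows "(\<Sum>a\<in>J. \<Sum>j\<in>J. if j = phi a then x j * p a else 0) <= L2_set x J * L2_set p J"
proof -
 define y where "y a = (if phi a : J then x (phi a) else 0)" for a
 have "(\<Sum>a\<in>J. \<Sum>j\<in>J. if j = phi a then x j * p a else 0) = (\<Sum>a\<in>J. y a * p a)"
 by (intro sum.cong) (auto simp: y_def sum.delta fin)
 also have "\<dots> <= (\<Sum>a\<in>J. \<bar>y a\<bar> * \<bar>p a\<bar>)" by (intro sum_mono) (simp flip: abs_mult)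
 also have "\<dots> <= L2_set y J * L2_set p J" by (rule L2_set_mult_ineq)
 also have "L2_set y J <= L2_set x J"
 proof -
 have "(\<Sum>a\<in>J. (y a)\<^sup>2) = (\<Sum>a\<in>{a\<in>J. phi a : J}. (x (phi a))\<^sup>2)"
 by (rule sum.mono_neutral_cong_right) (auto simp: y_def fin)
 also have "\<dots> = (\<Sum>j\<in>phi ` {a\<in>J. phi a : J}. (x j)\<^sup>2)"
 by (subst sum.reindex) (use inj in \<open>auto simp: inj_on_def inj_def\<close>)
 also have "\<dots> <= (\<Sum>j\<in>J. (x j)\<^sup>2)" by (intro sum_mono2 fin) auto
 finally show ?thesis unfolding L2_set_def by simp
 qed
 finally show ?thesis by (simp add: mult_right_mono)
qed

lemma sum_swap3:
 "(\<Sum>j\<in>J. \<Sum>a\<in>K. \<Sum>b\<in>L. f j a b) = (\<Sum>b\<in>L. \<Sum>j\<in>J. \<Sum>a\<in>K. f j a b)"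
proof -
 have "(\<Sum>j\<in>J. \<Sum>a\<in>K. \<Sum>b\<in>L. f j a b) = (\<Sum>j\<in>J. \<Sum>b\<in>L. \<Sum>a\<in>K. f j a b)"
 by (intro sum.cong refl sum.swap)
 also have "\<dots> = (\<Sum>b\<in>L. \<Sum>j\<in>J. \<Sum>a\<in>K. f j a b)" by (rule sum.swap)
 finally show ?thesis .
qed

text \<open>With four indices frozen, \<open>j\<close> is a translate of \<open>a\<close>, so these
  two slots can be measured in l^2 and the other four in l^1.\<close>

lemma qmaj_six1:
 assumes fin: "finite J" and nn: "!!i. 0 <= x i" "!!i. 0 <= p i" "!!i. 0 <= q i" "!!i. 0 <= r i" "!!i. 0 <= s i" "!!i. 0 <= t i"
 shows "(\<Sum>j\<in>J. x j * qmaj J p q r s t j) <= L2_set x J * L2_set p J * sum q J * sum r J * sum s J * sum t J"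
proof -
 define F where "F j a b c d e = x j * (if a + b + c = d + e + j then p a * q b * r c * s d * t e else 0)" for j a b c d e
 have "(\<Sum>j\<in>J. x j * qmaj J p q r s t j) = (\<Sum>j\<in>J. \<Sum>a\<in>J. \<Sum>b\<in>J. \<Sum>c\<in>J. \<Sum>d\<in>J. \<Sum>e\<in>J. F j a b c d e)"
 unfolding qmaj_def F_def by (simp only: sum5_nested sum_distrib_left)
 also have "\<dots> = (\<Sum>b\<in>J. \<Sum>j\<in>J. \<Sum>a\<in>J. \<Sum>c\<in>J. \<Sum>d\<in>J. \<Sum>e\<in>J. F j a b c d e)" by (rule sum_swap3)
 also have "\<dots> = (\<Sum>b\<in>J. \<Sum>c\<in>J. \<Sum>j\<in>J. \<Sum>a\<in>J. \<Sum>d\<in>J. \<Sum>e\<in>J. F j a b c d e)" by (intro sum.cong refl sum_swap3)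
 also have "\<dots> = (\<Sum>b\<in>J. \<Sum>c\<in>J. \<Sum>d\<in>J. \<Sum>j\<in>J. \<Sum>a\<in>J. \<Sum>e\<in>J. F j a b c d e)" by (intro sum.cong refl sum_swap3)
 also have "\<dots> = (\<Sum>b\<in>J. \<Sum>c\<in>J. \<Sum>d\<in>J. \<Sum>e\<in>J. \<Sum>j\<in>J. \<Sum>a\<in>J. F j a b c d e)" by (intro sum.cong refl sum_swap3)
 also have "\<dots> = (\<Sum>b\<in>J. \<Sum>c\<in>J. \<Sum>d\<in>J. \<Sum>e\<in>J. \<Sum>a\<in>J. \<Sum>j\<in>J. F j a b c d e)" by (intro sum.cong refl sum.swap)
 also have "\<dots> = (\<Sum>b\<in>J. \<Sum>c\<in>J. \<Sum>d\<in>J. \<Sum>e\<in>J. (\<Sum>a\<in>J. \<Sum>j\<in>J.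
 if j = a + (b + c - d - e) then x j * p a else 0) * (q b * r c * s d * t e))"
 unfolding sum_distrib_right F_def by (intro sum.cong refl) (auto simp: mult_ac)
 also have "\<dots> <= (\<Sum>b\<in>J. \<Sum>c\<in>J. \<Sum>d\<in>J. \<Sum>e\<in>J. (L2_set x J * L2_set p J) * (q b * r c * s d * t e))"
 by (intro sum_mono mult_right_mono inj_sum_cs fin nn) (auto simp: inj_def nn)
 also have "\<dots> = L2_set x J * L2_set p J * sum q J * sum r J * sum s J * sum t J"
 by (simp only: mult.assoc sum_distrib_left[symmetric] sum_distrib_right[symmetric])
 finally show ?thesis .
qed


lemma qmaj_swap12: "qmaj J p q r s t j = qmaj J q p r s t j"
 unfolding qmaj_def sum5_nested by (subst sum.swap) (intro sum.cong refl if_cong, auto)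

lemma qmaj_swap23: "qmaj J p q r s t j = qmaj J p r q s t j"
 unfolding qmaj_def sum5_nested
 by (rule sum.cong[OF refl], subst sum.swap) (intro sum.cong refl if_cong, auto)

lemma qmaj_swap45: "qmaj J p q r s t j = qmaj J p q r t s j"
 unfolding qmaj_def sum5_nested
 by (rule sum.cong[OF refl], rule sum.cong[OF refl], rule sum.cong[OF refl], subst sum.swap) (intro sum.cong refl if_cong, auto)

text \<open>The counterpart for a conjugated slot: with the others frozen, \<open>j\<close> is a
  reflection of \<open>d\<close> rather than a translate, which is again injective.\<close>

lemma qmaj_six4:
 assumes fin: "finite J" and nn: "!!i. 0 <= x i" "!!i. 0 <= p i" "!!i. 0 <= q i" "!!i. 0 <= r i" "!!i. 0 <= s i" "!!i. 0 <= t i"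
 shows "(\<Sum>j\<in>J. x j * qmaj J p q r s t j) <= L2_set x J * L2_set s J * sum p J * sum q J * sum r J * sum t J"
proof -
 define F where "F j a b c d e = x j * (if a + b + c = d + e + j then p a * q b * r c * s d * t e else 0)" for j a b c d e
 have "(\<Sum>j\<in>J. x j * qmaj J p q r s t j) = (\<Sum>j\<in>J. \<Sum>a\<in>J. \<Sum>b\<in>J. \<Sum>c\<in>J. \<Sum>d\<in>J. \<Sum>e\<in>J. F j a b c d e)"
 unfolding qmaj_def F_def by (simp only: sum5_nested sum_distrib_left)
 also have "\<dots> = (\<Sum>a\<in>J. \<Sum>j\<in>J. \<Sum>b\<in>J. \<Sum>c\<in>J. \<Sum>d\<in>J. \<Sum>e\<in>J. F j a b c d e)" by (rule sum.swap)
 also have "\<dots> = (\<Sum>a\<in>J. \<Sum>b\<in>J. \<Sum>j\<in>J. \<Sum>c\<in>J. \<Sum>d\<in>J. \<Sum>e\<in>J. F j a b c d e)" by (intro sum.cong refl sum.swap)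
 also have "\<dots> = (\<Sum>a\<in>J. \<Sum>b\<in>J. \<Sum>c\<in>J. \<Sum>j\<in>J. \<Sum>d\<in>J. \<Sum>e\<in>J. F j a b c d e)" by (intro sum.cong refl sum.swap)
 also have "\<dots> = (\<Sum>a\<in>J. \<Sum>b\<in>J. \<Sum>c\<in>J. \<Sum>e\<in>J. \<Sum>j\<in>J. \<Sum>d\<in>J. F j a b c d e)" by (intro sum.cong refl sum_swap3)
 also have "\<dots> = (\<Sum>a\<in>J. \<Sum>b\<in>J. \<Sum>c\<in>J. \<Sum>e\<in>J. \<Sum>d\<in>J. \<Sum>j\<in>J. F j a b c d e)" by (intro sum.cong refl sum.swap)
 also have "\<dots> = (\<Sum>a\<in>J. \<Sum>b\<in>J. \<Sum>c\<in>J. \<Sum>e\<in>J. (\<Sum>d\<in>J. \<Sum>j\<in>J.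
 if j = (a + b + c - e) - d then x j * s d else 0) * (p a * q b * r c * t e))"
 unfolding sum_distrib_right F_def by (intro sum.cong refl) (auto simp: mult_ac)
 also have "\<dots> <= (\<Sum>a\<in>J. \<Sum>b\<in>J. \<Sum>c\<in>J. \<Sum>e\<in>J. (L2_set x J * L2_set s J) * (p a * q b * r c * t e))"
 by (intro sum_mono mult_right_mono inj_sum_cs fin nn) (auto simp: inj_def nn)
 also have "\<dots> = L2_set x J * L2_set s J * sum p J * sum q J * sum r J * sum t J"
 by (simp only: mult.assoc sum_distrib_left[symmetric] sum_distrib_right[symmetric])
 finally show ?thesis .
qed

lemma qsum_diff:
 "qsum J kap p q r s t j - qsum J kap p' q' r' s' t' j =
 qsum J kap (%i. p i - p' i) q r s t j + qsum J kap p' (%i. q i - q' i) r s t j + qsum J kap p' q' (%i. r i - r' i) s t j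
 + qsum J kap p' q' r' (%i. s i - s' i) t j + qsum J kap p' q' r' s' (%i. t i - t' i) j"
 unfolding qsum_def sum.distrib[symmetric] sum_subtractf[symmetric]
 by (rule sum.cong) (auto simp: algebra_simps)

lemma qsum_support:
 assumes "finite J" "A \<subseteq> J" "!!i. i \<notin> A ==> p i = 0" "!!i. i \<notin> A ==> q i = 0" "!!i. i \<notin> A ==> r i = 0"
 "!!i. i \<notin> A ==> s i = 0" "!!i. i \<notin> A ==> t i = 0"
 shows "qsum J kap p q r s t j = qsum A kap p q r s t j"
 unfolding qsum_def using assms by (intro sum.mono_neutral_right) (auto split: prod.splits, blast+)

lemma qsum_add_kernel: "qsum J (%x. kap x + kap' x) p q r s t j = qsum J kap p q r s t j + qsum J kap' p q r s t j"
 unfolding qsum_def sum.distrib[symmetric] by (rule sum.cong) (auto simp: algebra_simps)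

lemma qsum_scale_kernel: "qsum J (%x. c * kap x) p q r s t j = c * qsum J kap p q r s t j"
 unfolding qsum_def sum_distrib_left by (rule sum.cong) (auto simp: algebra_simps)

text \<open>Linear in the first three slots, conjugate linear in the last two.\<close>
lemma qsum_scale:
 "qsum J kap (%i. c1 * p i) (%i. c2 * q i) (%i. c3 * r i) (%i. c4 * s i) (%i. c5 * t i) j =
 c1 * c2 * c3 * cnj c4 * cnj c5 * qsum J kap p q r s t j"
 unfolding qsum_def sum_distrib_left by (rule sum.cong) (auto simp: algebra_simps)

text \<open>A phase linear in the defect of squares factors into one phase per index. This converts
  between the interaction picture and the original variables, and it expresses a time translation of
  the oscillating kernels.\<close>

lemma qsum_shift:
 "qsum J (%x. cis (tht * rl x) * kap x) p q r s t j = cis (tht * (rl j)\<^sup>2) *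
 qsum J kap (%i. cis (- tht * (rl i)\<^sup>2) * p i) (%i. cis (- tht * (rl i)\<^sup>2) * q i)
 (%i. cis (- tht * (rl i)\<^sup>2) * r i) (%i. cis (- tht * (rl i)\<^sup>2) * s i) (%i. cis (- tht * (rl i)\<^sup>2) * t i) j"
proof -
 have *: "cis (tht * rl (j\<^sup>2 + d\<^sup>2 + e\<^sup>2 - a\<^sup>2 - b\<^sup>2 - c\<^sup>2)) = cis (tht * (rl j)\<^sup>2) *
 (cis (- tht * (rl a)\<^sup>2) * cis (- tht * (rl b)\<^sup>2) * cis (- tht * (rl c)\<^sup>2) *
 cnj (cis (- tht * (rl d)\<^sup>2)) * cnj (cis (- tht * (rl e)\<^sup>2)))" for a b c d e
 by (simp add: cis_mult cis_cnj algebra_simps)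
 have pt: "(if a + b + c = d + e + j
 then cis (tht * rl (j\<^sup>2 + d\<^sup>2 + e\<^sup>2 - a\<^sup>2 - b\<^sup>2 - c\<^sup>2)) * kap (j\<^sup>2 + d\<^sup>2 + e\<^sup>2 - a\<^sup>2 - b\<^sup>2 - c\<^sup>2) * (p a * q b * r c * cnj (s d) * cnj (t e)) else 0) =
 cis (tht * (rl j)\<^sup>2) * (if a + b + c = d + e + j then kap (j\<^sup>2 + d\<^sup>2 + e\<^sup>2 - a\<^sup>2 - b\<^sup>2 - c\<^sup>2) *
 (cis (- tht * (rl a)\<^sup>2) * p a * (cis (- tht * (rl b)\<^sup>2) * q b) * (cis (- tht * (rl c)\<^sup>2) * r c) *
 cnj (cis (- tht * (rl d)\<^sup>2) * s d) * cnj (cis (- tht * (rl e)\<^sup>2) * t e)) else 0)" for a b c d e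
 unfolding * by (simp add: mult_ac)
 show ?thesis
 unfolding qsum_def sum_distrib_left by (rule sum.cong[OF refl]) (simp only: case_prod_unfold pt)
qed

lemma qsum_has_vector_derivative:
 fixes p q r s t :: "real => int => complex"
 assumes k: "!!x. ((%u. kap u x) hvd kap' x) (at tau)"
 and d: "!!i. i : J ==> ((%u. p u i) hvd p' i) (at tau)"
 "!!i. i : J ==> ((%u. q u i) hvd q' i) (at tau)"
 "!!i. i : J ==> ((%u. r u i) hvd r' i) (at tau)"
 "!!i. i : J ==> ((%u. s u i) hvd s' i) (at tau)"
 "!!i. i : J ==> ((%u. t u i) hvd t' i) (at tau)"
 shows "((%u. qsum J (kap u) (p u) (q u) (r u) (s u) (t u) j) has_vector_derivative
 (qsum J kap' (p tau) (q tau) (r tau) (s tau) (t tau) j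
 + (qsum J (kap tau) p' (q tau) (r tau) (s tau) (t tau) j + qsum J (kap tau) (p tau) q' (r tau) (s tau) (t tau) j
 + qsum J (kap tau) (p tau) (q tau) r' (s tau) (t tau) j + qsum J (kap tau) (p tau) (q tau) (r tau) s' (t tau) j
 + qsum J (kap tau) (p tau) (q tau) (r tau) (s tau) t' j))) (at tau)"
proof -
 have tm: "((%u. if a + b + c = d + e + j
 then kap u (j\<^sup>2 + d\<^sup>2 + e\<^sup>2 - a\<^sup>2 - b\<^sup>2 - c\<^sup>2) * (p u a * q u b * r u c * cnj (s u d) * cnj (t u e)) else 0) has_vector_derivative
 (if a + b + c = d + e + j then kap' (j\<^sup>2 + d\<^sup>2 + e\<^sup>2 - a\<^sup>2 - b\<^sup>2 - c\<^sup>2) * (p tau a * q tau b * r tau c * cnj (s tau d) * cnj (t tau e)) else 0)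
 + ((if a + b + c = d + e + j then kap tau (j\<^sup>2 + d\<^sup>2 + e\<^sup>2 - a\<^sup>2 - b\<^sup>2 - c\<^sup>2) * (p' a * q tau b * r tau c * cnj (s tau d) * cnj (t tau e)) else 0)
 + (if a + b + c = d + e + j then kap tau (j\<^sup>2 + d\<^sup>2 + e\<^sup>2 - a\<^sup>2 - b\<^sup>2 - c\<^sup>2) * (p tau a * q' b * r tau c * cnj (s tau d) * cnj (t tau e)) else 0)
 + (if a + b + c = d + e + j then kap tau (j\<^sup>2 + d\<^sup>2 + e\<^sup>2 - a\<^sup>2 - b\<^sup>2 - c\<^sup>2) * (p tau a * q tau b * r' c * cnj (s tau d) * cnj (t tau e)) else 0)
 + (if a + b + c = d + e + j then kap tau (j\<^sup>2 + d\<^sup>2 + e\<^sup>2 - a\<^sup>2 - b\<^sup>2 - c\<^sup>2) * (p tau a * q tau b * r tau c * cnj (s' d) * cnj (t tau e)) else 0)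
 + (if a + b + c = d + e + j then kap tau (j\<^sup>2 + d\<^sup>2 + e\<^sup>2 - a\<^sup>2 - b\<^sup>2 - c\<^sup>2) * (p tau a * q tau b * r tau c * cnj (s tau d) * cnj (t' e)) else 0))) (at tau)"
 if J: "a : J" "b : J" "c : J" "d : J" "e : J" for a b c d e
 proof (cases "a + b + c = d + e + j")
 case True
 have cn: "((%u. cnj (s u d)) hvd cnj (s' d)) (at tau)" "((%u. cnj (t u e)) hvd cnj (t' e)) (at tau)"
 using d(4)[OF J(4)] d(5)[OF J(5)] by (auto intro: bounded_linear.has_vector_derivative[OF bounded_linear_cnj])
 show ?thesis
 using has_vector_derivative_mult[OF k has_vector_derivative_mult[OF has_vector_derivative_mult[OF
 has_vector_derivative_mult[OF has_vector_derivative_mult[OF d(1)[OF J(1)] d(2)[OF J(2)]] d(3)[OF J(3)]] cn(1)] cn(2)],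
 of "j\<^sup>2 + d\<^sup>2 + e\<^sup>2 - a\<^sup>2 - b\<^sup>2 - c\<^sup>2"] True
 by (simp add: algebra_simps)
 next
 case False then show ?thesis by simp
 qed
 show ?thesis
 unfolding qsum_def sum.distrib[symmetric]
 by (rule has_vector_derivative_sum, elim SigmaE, simp only: prod.case, rule tm)
qed

section \<open>Sextic forms and their symmetrization\<close>

definition six :: "int set => (int => int => int => int => int => int => 'a::comm_monoid_add) => 'a" where
 "six J f = (\<Sum>(a, b, c)\<in>J \<times> J \<times> J. \<Sum>(d, e, j)\<in>J \<times> J \<times> J. f a b c d e j)"

lemma six_nested: "six J f = (\<Sum>a\<in>J. \<Sum>b\<in>J. \<Sum>c\<in>J. \<Sum>d\<in>J. \<Sum>e\<in>J. \<Sum>j\<in>J. f a b c d e j)"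
 unfolding six_def by (simp add: sum.cartesian_product')

text \<open>The indices are grouped into two triples in \<open>six\<close> so that exchanging the
  two sides of a sextet is a single swap of sums.\<close>

lemma six_flip: "six J f = six J (%a b c d e j. f d e j a b c)"
 unfolding six_def case_prod_unfold by (rule sum.swap)

lemma six_swap_ej: "six J f = six J (%a b c d e j. f a b c d j e)"
 unfolding six_nested by (intro sum.cong refl sum.swap)

lemma six_swap_dj: "six J f = six J (%a b c d e j. f a b c j e d)"
proof -
 have sw: "(\<Sum>d\<in>J. \<Sum>e\<in>J. \<Sum>j\<in>J. g d e j) = (\<Sum>d\<in>J. \<Sum>e\<in>J. \<Sum>j\<in>J. g j e d)" for g :: "int => int => int => 'a"
 proof -
 have "(\<Sum>d\<in>J. \<Sum>e\<in>J. \<Sum>j\<in>J. g d e j) = (\<Sum>d\<in>J. \<Sum>j\<in>J. \<Sum>e\<in>J. g j e d)" by (rule sum_swap3)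
 also have "\<dots> = (\<Sum>d\<in>J. \<Sum>e\<in>J. \<Sum>j\<in>J. g j e d)" by (intro sum.cong refl sum.swap)
 finally show ?thesis .
 qed
 show ?thesis unfolding six_nested
 by (rule sum.cong[OF refl], rule sum.cong[OF refl], rule sum.cong[OF refl], rule sw)
qed

lemma six_cong: "(!!a b c d e j. a : J ==> b : J ==> c : J ==> d : J ==> e : J ==> j : J ==> f a b c d e j = g a b c d e j) ==> six J f = six J g"
 unfolding six_nested by (intro sum.cong refl) auto

lemma six_add: "six J (%a b c d e j. f a b c d e j + g a b c d e j) = six J f + six J g"
 unfolding six_nested by (simp only: sum.distrib)

lemma six_diff: "six J (%a b c d e j. f a b c d e j - g a b c d e j) = six J f - (six J g :: 'a::ab_group_add)"
 unfolding six_nested by (simp only: sum_subtractf)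

lemma six_mono:
 fixes f g :: "int => int => int => int => int => int => real"
 shows "(!!a b c d e j. a : J ==> b : J ==> c : J ==> d : J ==> e : J ==> j : J ==> f a b c d e j <= g a b c d e j) ==> six J f <= six J g"
 unfolding six_nested by (intro sum_mono) auto

lemma six_norm:
 fixes f :: "int => int => int => int => int => int => complex"
 shows "cmod (six J f) <= six J (%a b c d e j. cmod (f a b c d e j))"
 unfolding six_nested by (intro order_trans[OF norm_sum] sum_mono order_refl)

lemma six_scale: "six J (%a b c d e j. k * f a b c d e j) = (k :: 'a::comm_ring) * six J f"
 unfolding six_nested by (simp only: sum_distrib_left)

lemma six_cnj: "cnj (six J f) = six J (%a b c d e j. cnj (f a b c d e j))"
 unfolding six_nested by (simp only: cnj_sum)

lemma six_qmaj: "(\<Sum>j\<in>J. x j * qmaj J p q r s t j) =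
 six J (%a b c d e j. if a + b + c = d + e + j then p a * q b * r c * s d * t e * x j else 0)"
proof -
 have "(\<Sum>j\<in>J. x j * qmaj J p q r s t j) = (\<Sum>y\<in>J \<times> J \<times> J \<times> J \<times> J. \<Sum>j\<in>J. x j *
 (case y of (a, b, c, d, e) => if a + b + c = d + e + j then p a * q b * r c * s d * t e else 0))"
 unfolding qmaj_def sum_distrib_left by (rule sum.swap)
 also have "\<dots> = (\<Sum>(a, b, c, d, e)\<in>J \<times> J \<times> J \<times> J \<times> J. \<Sum>j\<in>J. if a + b + c = d + e + j then p a * q b * r c * s d * t e * x j else 0)"
 by (intro sum.cong refl) (auto intro!: sum.cong)
 finally show ?thesis unfolding six_nested by (simp only: sum5_nested)
qed

definition mono6 :: "(int => complex) => (int => complex) => int => int => int => int => int => int => complex" where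
 "mono6 kap v a b c d e j = (if a + b + c = d + e + j
 then kap (j\<^sup>2 + d\<^sup>2 + e\<^sup>2 - a\<^sup>2 - b\<^sup>2 - c\<^sup>2) * (v a * v b * v c * cnj (v d) * cnj (v e) * cnj (v j)) else 0)"

lemma six_qsum: "(\<Sum>j\<in>J. g j * cnj (v j) * qsum J kap v v v v v j) = six J (%a b c d e j. g j * mono6 kap v a b c d e j)"
proof -
 have "(\<Sum>j\<in>J. g j * cnj (v j) * qsum J kap v v v v v j) = (\<Sum>y\<in>J \<times> J \<times> J \<times> J \<times> J. \<Sum>j\<in>J. g j * cnj (v j) *
 (case y of (a, b, c, d, e) => if a + b + c = d + e + j
 then kap (j\<^sup>2 + d\<^sup>2 + e\<^sup>2 - a\<^sup>2 - b\<^sup>2 - c\<^sup>2) * (v a * v b * v c * cnj (v d) * cnj (v e)) else 0))"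
 unfolding qsum_def sum_distrib_left by (rule sum.swap)
 also have "\<dots> = (\<Sum>(a, b, c, d, e)\<in>J \<times> J \<times> J \<times> J \<times> J. \<Sum>j\<in>J. g j * mono6 kap v a b c d e j)"
 by (intro sum.cong refl) (auto intro!: sum.cong simp: mono6_def)
 finally show ?thesis unfolding six_nested by (simp only: sum5_nested)
qed

text \<open>Relabelling the six indices replaces the weight \<open>g\<close> by its defect along a sextet.\<close>
lemma qsum_symmetrized:
 fixes g :: "int => real"
 assumes herm: "!!x. kap (- x) = cnj (kap x)"
 shows "6 * \<i> * cpx (Im (\<Sum>j\<in>J. cpx (g j) * cnj (v j) * qsum J kap v v v v v j)) =
 six J (%a b c d e j. cpx (g d + g e + g j - g a - g b - g c) * mono6 kap v a b c d e j)"
proof -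
 define K where "K = mono6 kap v"
 define G where "G i = cpx (g i)" for i
 define T where "T = (\<Sum>j\<in>J. cpx (g j) * cnj (v j) * qsum J kap v v v v v j)"
 have Tj: "T = six J (%a b c d e j. G j * K a b c d e j)" unfolding T_def G_def K_def by (rule six_qsum)
 have sym1: "K a b c d j e = K a b c d e j" and sym2: "K a b c j e d = K a b c d e j" for a b c d e j
 unfolding K_def mono6_def by (auto simp: algebra_simps)
 have Te: "T = six J (%a b c d e j. G e * K a b c d e j)"
 unfolding Tj by (subst six_swap_ej) (simp only: sym1)
 have Td: "T = six J (%a b c d e j. G d * K a b c d e j)"
 unfolding Tj by (subst six_swap_dj) (simp only: sym2)
 \<comment> \<open>Because the kernel is Hermitian, exchanging the two triples conjugates the
   monomial.\<close>
 have cK: "cnj (K a b c d e j) = K d e j a b c" for a b c d e j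
 proof -
 have "kap (c\<^sup>2 + a\<^sup>2 + b\<^sup>2 - d\<^sup>2 - e\<^sup>2 - j\<^sup>2) = cnj (kap (j\<^sup>2 + d\<^sup>2 + e\<^sup>2 - a\<^sup>2 - b\<^sup>2 - c\<^sup>2))"
 using herm[of "j\<^sup>2 + d\<^sup>2 + e\<^sup>2 - a\<^sup>2 - b\<^sup>2 - c\<^sup>2"] by (simp add: algebra_simps)
 then show ?thesis unfolding K_def mono6_def by (auto simp: algebra_simps)
 qed
 have cG: "cnj (G i) = G i" for i by (simp add: G_def)
 have T1: "cnj T = six J (%a b c d e j. G c * K a b c d e j)"
 by (subst Tj, subst six_flip) (simp only: six_cnj complex_cnj_mult cK cG)
 have T2: "cnj T = six J (%a b c d e j. G b * K a b c d e j)"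
 by (subst Te, subst six_flip) (simp only: six_cnj complex_cnj_mult cK cG)
 have T3: "cnj T = six J (%a b c d e j. G a * K a b c d e j)"
 by (subst Td, subst six_flip) (simp only: six_cnj complex_cnj_mult cK cG)
 \<comment> \<open>The weight sits on \<open>d\<close>, \<open>e\<close> or \<open>j\<close> in a
   copy of \<open>T\<close> and on \<open>a\<close>, \<open>b\<close> or \<open>c\<close> in a copy
   of \<open>cnj T\<close>; three copies of each assemble the defect.\<close>
 have "6 * \<i> * cpx (Im T) = 3 * (T - cnj T)" by (simp add: complex_eq_iff)
 also have "\<dots> = (T + T + T) - (cnj T + cnj T + cnj T)" by simp
 also have "\<dots> = six J (%a b c d e j. G d * K a b c d e j + G e * K a b c d e j + G j * K a b c d e j
 - (G a * K a b c d e j + G b * K a b c d e j + G c * K a b c d e j))"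
 unfolding six_diff six_add by (simp only: Td[symmetric] Te[symmetric] Tj[symmetric] T1[symmetric] T2[symmetric] T3[symmetric])
 also have "\<dots> = six J (%a b c d e j. cpx (g d + g e + g j - g a - g b - g c) * K a b c d e j)"
 by (rule six_cong) (simp add: G_def algebra_simps)
 finally show ?thesis unfolding T_def K_def .
qed

section \<open>Arithmetic of resonant sextets\<close>

definition A4 :: "int set" where "A4 = {-2, -1, 1, 2}"

lemma finite_A4 [simp]: "finite A4" by (simp add: A4_def)

definition res :: "int => int => int => int => int => int => bool" where
 "res a b c d e j \<longleftrightarrow> a + b + c = d + e + j & a\<^sup>2 + b\<^sup>2 + c\<^sup>2 = d\<^sup>2 + e\<^sup>2 + j\<^sup>2"

lemma square_mod4: obtains k :: int where "x\<^sup>2 = 4 * k + x mod 2"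
proof (cases "even x")
 case True
 then obtain m where "x = 2 * m" by (elim evenE)
 then have "x\<^sup>2 = 4 * m\<^sup>2 + x mod 2" by (simp add: power2_eq_square)
 then show ?thesis using that by blast
next
 case False
 then obtain m where "x = 2 * m + 1" by (elim oddE)
 then have "x\<^sup>2 = 4 * (m\<^sup>2 + m) + x mod 2" by (simp add: power2_eq_square algebra_simps)
 then show ?thesis using that by blast
qed

text \<open>Squares are congruent to parities modulo 4, so the two sums of parities agree modulo 4.
  Both lie between 0 and 3, hence they are equal.\<close>

lemma res_odd:
 assumes "res a b c d e j"
 shows "a mod 2 + b mod 2 + c mod 2 = d mod 2 + e mod 2 + j mod 2"
proof -
 obtain ka where ka: "a\<^sup>2 = 4 * ka + a mod 2" by (rule square_mod4)
 obtain kb where kb: "b\<^sup>2 = 4 * kb + b mod 2" by (rule square_mod4)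
 obtain kc where kc: "c\<^sup>2 = 4 * kc + c mod 2" by (rule square_mod4)
 obtain kd where kd: "d\<^sup>2 = 4 * kd + d mod 2" by (rule square_mod4)
 obtain ke where ke: "e\<^sup>2 = 4 * ke + e mod 2" by (rule square_mod4)
 obtain kj where kj: "j\<^sup>2 = 4 * kj + j mod 2" by (rule square_mod4)
 have m: "0 <= x mod 2 & x mod 2 <= 1" for x :: int by presburger
 have key: "p + q + r = s + t + u" if "4 * ia + p + (4 * ib + q) + (4 * ic + r) = 4 * id + s + (4 * ie + t) + (4 * ij + u)"
 "0 <= p & p <= 1" "0 <= q & q <= 1" "0 <= r & r <= 1" "0 <= s & s <= 1" "0 <= t & t <= 1" "0 <= u & u <= 1"
 for p q r s t u ia ib ic id ie ij :: int
 proof -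
 have "y = 0" if "4 * x = y" "\<bar>y\<bar> <= 3" for x y :: int using that by arith
 moreover have "4 * (ia + ib + ic - id - ie - ij) = (s + t + u) - (p + q + r)" using that(1) by simp
 moreover have "\<bar>(s + t + u) - (p + q + r)\<bar> <= 3" using that by linarith
 ultimately have "(s + t + u) - (p + q + r) = 0" by blast
 then show ?thesis by simp
 qed
 have "4 * ka + a mod 2 + (4 * kb + b mod 2) + (4 * kc + c mod 2) = 4 * kd + d mod 2 + (4 * ke + e mod 2) + (4 * kj + j mod 2)"
 using assms unfolding res_def by (simp only: ka kb kc kd ke kj)
 from key[OF this m m m m m m] show ?thesis .
qed

text \<open>The extra conservation law of resonant sextets: both the squares and the parities are
 conserved, and this combination of them vanishes exactly on the resonant set.\<close>
definition fw :: "int => int" where "fw j = j\<^sup>2 - 4 + 3 * (j mod 2)"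

lemma res_fw: "res a b c d e j ==> fw a + fw b + fw c = fw d + fw e + fw j"
 using res_odd[of a b c d e j] by (simp add: res_def fw_def)

lemma fw_A4 [simp]: "j : A4 ==> fw j = 0" by (auto simp: A4_def fw_def)

lemma fw_ge: "3 <= \<bar>j\<bar> ==> 1 + j\<^sup>2 <= 2 * fw j"
proof -
 assume "3 <= \<bar>j\<bar>"
 then have "9 <= j\<^sup>2" using abs_le_square_iff[of 3 j] by simp
 moreover have "0 <= j mod 2" by simp
 ultimately show ?thesis unfolding fw_def by (simp add: algebra_simps)
qed

lemma A4_or: "j : A4 \<or> j = 0 \<or> 3 <= \<bar>j\<bar>" by (auto simp: A4_def)

lemma fw_0 [simp]: "fw 0 = -4" by (simp add: fw_def)

lemma fw_eq_0: "fw j = 0 \<longleftrightarrow> j : A4"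
 using A4_or[of j] fw_ge[of j] fw_A4[of j] by (smt (verit) fw_0 zero_le_power2)

lemma square_mod3: "(x :: int)\<^sup>2 mod 3 = (if 3 dvd x then 0 else 1)"
proof -
 have sq: "x\<^sup>2 mod 3 = (x mod 3)\<^sup>2 mod 3" by (simp add: power_mod)
 have "x mod 3 = 0 \<or> x mod 3 = 1 \<or> x mod 3 = 2" by presburger
 then show ?thesis unfolding sq dvd_eq_mod_eq_0 by (elim disjE) (simp_all only:, simp_all)
qed

text \<open>The number of multiples of 3 on the two sides of a resonant sextet agrees modulo 3.\<close>
lemma res_mod3:
 assumes "res a b c d e j"
 shows "of_bool (3 dvd d) + of_bool (3 dvd e) + of_bool (3 dvd j) = of_bool (3 dvd a) + of_bool (3 dvd b) + (of_bool (3 dvd c) :: int)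
 \<or> (3 dvd a & 3 dvd b & 3 dvd c) \<or> (3 dvd d & 3 dvd e & 3 dvd j)"
proof -
 have "(a\<^sup>2 mod 3 + b\<^sup>2 mod 3 + c\<^sup>2 mod 3) mod 3 = (d\<^sup>2 mod 3 + e\<^sup>2 mod 3 + j\<^sup>2 mod 3) mod 3"
 proof -
 have "(x mod 3 + y mod 3 + z mod 3) mod 3 = (x + y + z) mod 3" for x y z :: int by presburger
 then show ?thesis using assms by (simp only: res_def)
 qed
 then show ?thesis unfolding square_mod3
 by (cases "3 dvd a"; cases "3 dvd b"; cases "3 dvd c"; cases "3 dvd d"; cases "3 dvd e"; cases "3 dvd j"; simp)
qed

lemma int_factor_le:
 assumes "x * y = (m :: int)" "m ~= 0" "\<bar>m\<bar> <= 16"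
 shows "\<bar>x\<bar> <= 16 & \<bar>y\<bar> <= 16"
proof -
 have "x dvd m" "y dvd m" using assms(1) by auto
 then have "\<bar>x\<bar> <= \<bar>m\<bar>" "\<bar>y\<bar> <= \<bar>m\<bar>" using assms(2) by (auto intro: dvd_imp_le_int)
 then show ?thesis using assms(3) by simp
qed

lemma A4_abs: "x : A4 ==> \<bar>x\<bar> <= 2" by (auto simp: A4_def)

lemma A4_diff_prod: "x : A4 ==> y : A4 ==> z : A4 ==> \<bar>(x - z) * (y - z)\<bar> <= 16"
 by (auto simp: A4_def)

text \<open>Eliminating \<open>p\<close> turns resonance into the factorization
  \<open>(q - dlt) * (l - dlt) = (x - z) * (y - z)\<close>. The right side is at most 16 in modulus
  on \<open>A4\<close>: if it is nonzero, its divisors bound \<open>l\<close>; if it is zero, the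
  sextet is a trivial pairing.\<close>

lemma res_two_left:
 assumes r: "res p x y z q l" and A: "x : A4" "y : A4" "z : A4" and l: "\<bar>l\<bar> > 38"
 shows "(x = z & q = y & p = l) \<or> (y = z & q = x & p = l)"
proof -
 define dlt where "dlt = x + y - z"
 have p: "p = z + q + l - x - y" using r by (simp add: res_def)
 have id: "(q - dlt) * (l - dlt) = (x - z) * (y - z)"
 proof -
 have "p\<^sup>2 + x\<^sup>2 + y\<^sup>2 = z\<^sup>2 + q\<^sup>2 + l\<^sup>2" using r by (simp add: res_def)
 then have "2 * ((q - dlt) * (l - dlt)) = 2 * ((x - z) * (y - z))"
 unfolding p dlt_def by (simp add: power2_eq_square algebra_simps)
 then show ?thesis by simp
 qed
 have d: "\<bar>dlt\<bar> <= 6" using A4_abs[OF A(1)] A4_abs[OF A(2)] A4_abs[OF A(3)] by (simp add: dlt_def)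
 show ?thesis
 proof (cases "(x - z) * (y - z) = 0")
 case True
 then have "q = dlt" using id l d by auto
 then show ?thesis using True p by (auto simp: dlt_def)
 next
 case False
 then have "\<bar>l - dlt\<bar> <= 16" using int_factor_le[OF id False] A4_diff_prod[OF A] by blast
 then show ?thesis using l d by linarith
 qed
qed

text \<open>The same factorization with both free indices on one side. Here \<open>l\<close> is the
  sum of two divisors of modulus at most 16 and of \<open>dlt\<close>, of modulus at most 6; this is
  the origin of the threshold 38.\<close>

lemma res_one_left:
 assumes r: "res p q x y z l" and A: "x : A4" "y : A4" "z : A4" and l: "\<bar>l\<bar> > 38"
 shows "{#p, q, x#} = {#y, z, l#}"
proof -
 define dlt where "dlt = y + z - x"
 have p: "l = p + q - dlt" using r by (simp add: res_def dlt_def)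
 have id: "(p - dlt) * (q - dlt) = (y - x) * (z - x)"
 proof -
 have "p\<^sup>2 + q\<^sup>2 + x\<^sup>2 = y\<^sup>2 + z\<^sup>2 + l\<^sup>2" using r by (simp add: res_def)
 then have "2 * ((p - dlt) * (q - dlt)) = 2 * ((y - x) * (z - x))"
 unfolding p dlt_def by (simp add: power2_eq_square algebra_simps)
 then show ?thesis by simp
 qed
 have d: "\<bar>dlt\<bar> <= 6" using A4_abs[OF A(1)] A4_abs[OF A(2)] A4_abs[OF A(3)] by (simp add: dlt_def)
 show ?thesis
 proof (cases "(y - x) * (z - x) = 0")
 case True
 then have "p = dlt \<or> q = dlt" using id by auto
 moreover have "(y = x & dlt = z) \<or> (z = x & dlt = y)" using True by (auto simp: dlt_def)
 ultimately show ?thesis using p by (auto simp: add_mset_commute)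
 next
 case False
 then have "\<bar>p - dlt\<bar> <= 16 & \<bar>q - dlt\<bar> <= 16" using int_factor_le[OF id False] A4_diff_prod[of y z x] A by blast
 then show ?thesis using l d p by linarith
 qed
qed

lemma res_three_left:
 assumes r: "res x y z p q l" and A: "x : A4" "y : A4" "z : A4" and l: "\<bar>l\<bar> > 38"
 shows False
proof -
 have "x\<^sup>2 <= 4" "y\<^sup>2 <= 4" "z\<^sup>2 <= 4" using A by (auto simp: A4_def)
 moreover have "16 <= l\<^sup>2" using l abs_le_square_iff[of 4 l] by simp
 moreover have "0 <= p\<^sup>2" "0 <= q\<^sup>2" by simp_all
 ultimately show False using r unfolding res_def by linarith
qed

lemma res_perm:
 "res a b c d e j ==> res b a c d e j" "res a b c d e j ==> res a c b d e j" "res a b c d e j ==> res a b c e d j"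
 by (auto simp: res_def)

text \<open>Three of the five indices other than \<open>j\<close> lie in \<open>A4\<close>. Up to
  permutations within each side they can be placed in three ways, each covered by one of the three
  preceding cases.\<close>

lemma res_high:
 assumes r: "res a b c d e j" and j: "\<bar>j\<bar> > 38"
 and few: "of_bool (a \<notin> A4) + of_bool (b \<notin> A4) + of_bool (c \<notin> A4) + of_bool (d \<notin> A4) + of_bool (e \<notin> A4) <= (2 :: nat)"
 shows "{#a, b, c#} = {#d, e, j#}"
proof -
 have two: "{#p, x, y#} = {#z, q, j#}" if "res p x y z q j" "x : A4" "y : A4" "z : A4" for p x y z q
 using res_two_left[OF that j] by (auto simp: add_mset_commute)
 note one = res_one_left[OF _ _ _ _ j] and three = res_three_left[OF _ _ _ _ j]
 consider "a : A4" "b : A4" "c : A4" | "b : A4" "c : A4" "d : A4" | "b : A4" "c : A4" "e : A4"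
 | "a : A4" "c : A4" "d : A4" | "a : A4" "c : A4" "e : A4" | "a : A4" "b : A4" "d : A4" | "a : A4" "b : A4" "e : A4"
 | "a : A4" "d : A4" "e : A4" | "b : A4" "d : A4" "e : A4" | "c : A4" "d : A4" "e : A4"
 using few by (cases "a : A4"; cases "b : A4"; cases "c : A4"; cases "d : A4"; cases "e : A4"; simp)
 then show ?thesis
 proof cases
 case 1 then show ?thesis using three r by blast
 next
 case 2 then show ?thesis using two[OF r] by blast
 next
 case 3 then show ?thesis using two[OF res_perm(3)[OF r]] by (metis add_mset_commute)
 next
 case 4 then show ?thesis using two[OF res_perm(1)[OF r]] by (metis add_mset_commute)
 next
 case 5 then show ?thesis using two[OF res_perm(3)[OF res_perm(1)[OF r]]] by (metis add_mset_commute)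
 next
 case 6 then show ?thesis using two[OF res_perm(1)[OF res_perm(2)[OF r]]] by (metis add_mset_commute)
 next
 case 7 then show ?thesis using two[OF res_perm(3)[OF res_perm(1)[OF res_perm(2)[OF r]]]] by (metis add_mset_commute)
 next
 case 8 then show ?thesis using one[OF res_perm(2)[OF res_perm(1)[OF r]]] by (metis add_mset_commute)
 next
 case 9 then show ?thesis using one[OF res_perm(2)[OF r]] by (metis add_mset_commute)
 next
 case 10 then show ?thesis using one[OF r] by blast
 qed
qed

section \<open>Conservation laws and reality properties of the resonant sum\<close>

definition kR :: "int => complex" where "kR x = (if x = 0 then 1 else 0)"

lemma kR_norm [simp]: "cmod (kR x) <= 1" by (simp add: kR_def)
lemma kR_herm: "kR (- x) = cnj (kR x)" by (simp add: kR_def)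

lemma kR_res: "a + b + c = d + e + j ==> kR (j\<^sup>2 + d\<^sup>2 + e\<^sup>2 - a\<^sup>2 - b\<^sup>2 - c\<^sup>2) = (if res a b c d e j then 1 else 0)"
 by (auto simp: kR_def res_def)

text \<open>Symmetrization replaces the weight by its defect along sextets, which vanishes on the
  resonant ones; the kernel removes the others.\<close>

lemma qsum_kR_conserved:
 fixes g :: "int => int"
 assumes "!!a b c d e j. res a b c d e j ==> g a + g b + g c = g d + g e + g j"
 shows "(\<Sum>j\<in>J. of_int (g j) * Im (cnj (v j) * qsum J kR v v v v v j)) = 0"
proof -
 define S where "S = Im (\<Sum>j\<in>J. cpx (of_int (g j)) * cnj (v j) * qsum J kR v v v v v j)"
 have "6 * \<i> * cpx S =
 six J (%a b c d e j. cpx (of_int (g d) + of_int (g e) + of_int (g j) - of_int (g a) - of_int (g b) - of_int (g c)) * mono6 kR v a b c d e j)"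
 unfolding S_def by (rule qsum_symmetrized) (rule kR_herm)
 also have "\<dots> = six J (%a b c d e j. 0)"
 proof (rule six_cong)
 fix a b c d e j
 show "cpx (of_int (g d) + of_int (g e) + of_int (g j) - of_int (g a) - of_int (g b) - of_int (g c)) * mono6 kR v a b c d e j = 0"
 proof (cases "res a b c d e j")
 case True
 have "rl (g d) + of_int (g e) + of_int (g j) - of_int (g a) - of_int (g b) - of_int (g c) = 0"
 using assms[OF True] by linarith
 then show ?thesis by (simp only: of_real_0 mult_zero_left)
 next
 case False
 then show ?thesis unfolding mono6_def by (auto simp: kR_res)
 qed
 qed
 also have "\<dots> = 0" unfolding six_nested by simp
 finally have "S = 0" by simp
 moreover have "S = (\<Sum>j\<in>J. of_int (g j) * Im (cnj (v j) * qsum J kR v v v v v j))"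
 unfolding S_def Im_sum by (rule sum.cong) (auto simp: algebra_simps)
 ultimately show ?thesis by simp
qed

text \<open>By \<open>res_mod3\<close>, a sextet that transfers mass to or from the multiples of 3
  has a whole side of such multiples. The transfer is therefore at least cubic in \<open>y\<close>,
  with two factors measured in l^2 and one in l^1. A defect of at most 3 and two possible sides
  match the factor 6 of the symmetrized identity.\<close>

lemma qsum_kR_multiples_of_3:
 fixes v :: "int => complex"
 assumes fin: "finite J"
 defines "y \<equiv> %i. if 3 dvd i then v i else 0"
 shows "\<bar>\<Sum>j\<in>J. of_bool (3 dvd j) * Im (cnj (v j) * qsum J kR v v v v v j)\<bar> <= (n2 J y)\<^sup>2 * n1 J y * (n1 J v) ^ 3"
proof -
 define g :: "int => real" where "g j = of_bool (3 dvd j)" for j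
 define V Y where "V i = cmod (v i)" and "Y i = cmod (y i)" for i
 define F where "F a b c d e j = (if a + b + c = d + e + j then V a * V b * V c * Y d * Y e * Y j else 0)" for a b c d e j
 have nn: "0 <= V i" "0 <= Y i" for i by (simp_all add: V_def Y_def)
 have Y: "3 dvd i ==> Y i = V i" for i by (simp add: Y_def V_def y_def)
 define S where "S = Im (\<Sum>j\<in>J. cpx (g j) * cnj (v j) * qsum J kR v v v v v j)"
 have "6 * \<bar>S\<bar> = cmod (6 * \<i> * cpx S)" by (simp add: norm_mult)
 also have "6 * \<i> * cpx S = six J (%a b c d e j. cpx (g d + g e + g j - g a - g b - g c) * mono6 kR v a b c d e j)"
 unfolding S_def by (rule qsum_symmetrized) (rule kR_herm)
 also have "cmod \<dots> <= six J (%a b c d e j. cmod (cpx (g d + g e + g j - g a - g b - g c) * mono6 kR v a b c d e j))"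
 by (rule six_norm)
 also have "\<dots> <= six J (%a b c d e j. 3 * (F a b c d e j + F d e j a b c))"
 proof (rule six_mono)
 fix a b c d e j
 have F0: "0 <= F a b c d e j" "0 <= F d e j a b c" using nn by (simp_all add: F_def)
 have g01: "0 <= g i" "g i <= 1" for i by (simp_all add: g_def)
 show "cmod (cpx (g d + g e + g j - g a - g b - g c) * mono6 kR v a b c d e j) <= 3 * (F a b c d e j + F d e j a b c)"
 proof (cases "res a b c d e j")
 case True
 then have sm: "a + b + c = d + e + j" by (simp add: res_def)
 have m: "cmod (mono6 kR v a b c d e j) = V a * V b * V c * V d * V e * V j"
 using True sm kR_res[OF sm] by (simp add: mono6_def norm_mult V_def)
 have l: "\<bar>g d + g e + g j - g a - g b - g c\<bar> <= 3" using g01[of a] g01[of b] g01[of c] g01[of d] g01[of e] g01[of j] by linarith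
 show ?thesis
 proof (cases "g d + g e + g j = g a + g b + g c")
 case True then show ?thesis using F0 by simp
 next
 case False
 have "(3 dvd a & 3 dvd b & 3 dvd c) \<or> (3 dvd d & 3 dvd e & 3 dvd j)"
 proof (rule ccontr)
 assume n: "\<not> ?thesis"
 have "rl (of_bool (3 dvd d) + of_bool (3 dvd e) + of_bool (3 dvd j)) = rl (of_bool (3 dvd a) + of_bool (3 dvd b) + of_bool (3 dvd c))"
 using res_mod3[OF \<open>res a b c d e j\<close>] n by (simp only: simp_thms)
 then show False using False by (simp add: g_def)
 qed
 then have "V a * V b * V c * V d * V e * V j <= F a b c d e j + F d e j a b c"
 proof
 assume "3 dvd a & 3 dvd b & 3 dvd c"
 then have "F d e j a b c = V a * V b * V c * V d * V e * V j" using sm by (simp add: F_def Y mult_ac)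
 then show ?thesis using F0 by simp
 next
 assume "3 dvd d & 3 dvd e & 3 dvd j"
 then have "F a b c d e j = V a * V b * V c * V d * V e * V j" using sm by (simp add: F_def Y mult_ac)
 then show ?thesis using F0 by simp
 qed
 then show ?thesis unfolding norm_mult m norm_of_real using l nn
 by (intro mult_mono) (auto intro!: mult_nonneg_nonneg)
 qed
 next
 case False
 then have "mono6 kR v a b c d e j = 0" unfolding mono6_def by (auto simp: kR_res)
 then show ?thesis using F0 by simp
 qed
 qed
 also have "\<dots> = 3 * (six J F + six J (%a b c d e j. F d e j a b c))" by (simp only: six_scale six_add)
 also have "six J (%a b c d e j. F d e j a b c) = six J F" by (rule six_flip[symmetric])
 also have "six J F = (\<Sum>j\<in>J. Y j * qmaj J V V V Y Y j)" unfolding six_qmaj F_def by (intro six_cong) simp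
 also have "3 * ((\<Sum>j\<in>J. Y j * qmaj J V V V Y Y j) + (\<Sum>j\<in>J. Y j * qmaj J V V V Y Y j)) <=
 3 * (L2_set Y J * L2_set Y J * sum V J * sum V J * sum V J * sum Y J + L2_set Y J * L2_set Y J * sum V J * sum V J * sum V J * sum Y J)"
 by (intro mult_left_mono add_mono qmaj_six4 fin nn) auto
 also have "\<dots> = 6 * ((n2 J y)\<^sup>2 * n1 J y * (n1 J v) ^ 3)"
 unfolding n2_def n1_def V_def Y_def by (simp add: power2_eq_square power3_eq_cube mult_ac)
 finally have "\<bar>S\<bar> <= (n2 J y)\<^sup>2 * n1 J y * (n1 J v) ^ 3" by simp
 moreover have "S = (\<Sum>j\<in>J. of_bool (3 dvd j) * Im (cnj (v j) * qsum J kR v v v v v j))"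
 unfolding S_def g_def by (simp add: mult.assoc)
 ultimately show ?thesis by simp
qed

text \<open>Sextets with at most two off-resonant indices besides \<open>j\<close> are trivial
  pairings; their contribution is a number times its own conjugate, hence real. Every other sextet
  carries at least three factors \<open>alp\<close>.\<close>

lemma qsum_kR_high:
 assumes fin: "finite J" and j: "\<bar>j\<bar> > 38" and C: "0 <= C" "0 <= alp" "alp <= 1"
 and b: "!!i. i : J ==> cmod (w i) <= C * wt i" and o: "!!i. i : J ==> i \<notin> A4 ==> cmod (w i) <= C * alp * wt i"
 shows "\<bar>Im (cnj (w j) * qsum J kR w w w w w j)\<bar> <= cmod (w j) * (160000 * C ^ 5 * alp ^ 3 * wt j)"
proof -
 define o' :: "int => nat" where "o' i = of_bool (i \<notin> A4)" for i
 have bi: "cmod (w i) <= C * alp ^ o' i * wt i" if "i : J" for i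
 using b[OF that] o[OF that] by (auto simp: o'_def)
 have "\<bar>Im (cnj (w j) * qsum J kR w w w w w j)\<bar> = \<bar>\<Sum>(a, b, c, d, e)\<in>J \<times> J \<times> J \<times> J \<times> J. Im (cnj (w j) * (if a + b + c = d + e + j
 then kR (j\<^sup>2 + d\<^sup>2 + e\<^sup>2 - a\<^sup>2 - b\<^sup>2 - c\<^sup>2) * (w a * w b * w c * cnj (w d) * cnj (w e)) else 0))\<bar>"
 unfolding qsum_def sum_distrib_left Im_sum by (simp only: case_prod_unfold)
 also have "\<dots> <= (\<Sum>(a, b, c, d, e)\<in>J \<times> J \<times> J \<times> J \<times> J. cmod (w j) * (C ^ 5 * alp ^ 3 * (if a + b + c = d + e + j then wt a * wt b * wt c * wt d * wt e else 0)))"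
 proof (rule order_trans[OF sum_abs], rule sum_mono, elim SigmaE, simp only: prod.case)
 fix a b c d e :: int
 assume J: "a : J" "b : J" "c : J" "d : J" "e : J"
 define m where "m = w a * w b * w c * cnj (w d) * cnj (w e)"
 have R0: "0 <= cmod (w j) * (C ^ 5 * alp ^ 3 * (if a + b + c = d + e + j then wt a * wt b * wt c * wt d * wt e else 0))"
 using C wt_nonneg by auto
 show "\<bar>Im (cnj (w j) * (if a + b + c = d + e + j
 then kR (j\<^sup>2 + d\<^sup>2 + e\<^sup>2 - a\<^sup>2 - b\<^sup>2 - c\<^sup>2) * (w a * w b * w c * cnj (w d) * cnj (w e)) else 0))\<bar>
 <= cmod (w j) * (C ^ 5 * alp ^ 3 * (if a + b + c = d + e + j then wt a * wt b * wt c * wt d * wt e else 0))"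
 proof (cases "res a b c d e j")
 case True
 then have sm: "a + b + c = d + e + j" by (simp add: res_def)
 show ?thesis
 proof (cases "o' a + o' b + o' c + o' d + o' e <= 2")
 case few: True
 have ms: "{#a, b, c#} = {#d, e, j#}" using res_high[OF True j] few by (simp add: o'_def)
 then have "prod_mset (image_mset w {#a, b, c#}) = prod_mset (image_mset w {#d, e, j#})" by simp
 then have "w a * w b * w c = w d * w e * w j" by (simp add: mult_ac)
 then have "cnj (w j) * m = (w d * w e * w j) * cnj (w d * w e * w j)" by (simp add: m_def mult_ac)
 moreover have "Im (X * cnj X) = 0" for X by simp
 ultimately have "Im (cnj (w j) * m) = 0" by metis
 then show ?thesis using R0 sm True kR_res[OF sm] by (simp add: m_def)
 next
 case many: False
 have "cmod m <= (C * alp ^ o' a * wt a) * (C * alp ^ o' b * wt b) * (C * alp ^ o' c * wt c) * (C * alp ^ o' d * wt d) * (C * alp ^ o' e * wt e)"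
 unfolding m_def norm_mult complex_mod_cnj using C wt_nonneg by (intro mult_mono bi J) auto
 also have "\<dots> = C ^ 5 * alp ^ (o' a + o' b + o' c + o' d + o' e) * (wt a * wt b * wt c * wt d * wt e)"
 by (simp add: power_add eval_nat_numeral mult_ac)
 also have "\<dots> <= C ^ 5 * alp ^ 3 * (wt a * wt b * wt c * wt d * wt e)"
 using C wt_nonneg many by (intro mult_right_mono mult_left_mono power_decreasing) auto
 finally have "cmod (w j) * cmod m <= cmod (w j) * (C ^ 5 * alp ^ 3 * (wt a * wt b * wt c * wt d * wt e))"
 by (intro mult_left_mono) auto
 moreover have "\<bar>Im (cnj (w j) * m)\<bar> <= cmod (w j) * cmod m" using abs_Im_le_cmod[of "cnj (w j) * m"] by (simp add: norm_mult)
 ultimately show ?thesis using sm True kR_res[OF sm] by (simp add: m_def)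
 qed
 next
 case False
 then show ?thesis using R0 by (auto simp: kR_res)
 qed
 qed
 also have "\<dots> = cmod (w j) * (C ^ 5 * alp ^ 3 * qmaj J wt wt wt wt wt j)"
 unfolding qmaj_def sum_distrib_left by (intro sum.cong refl) auto
 also have "\<dots> <= cmod (w j) * (C ^ 5 * alp ^ 3 * (160000 * wt j))"
 using C by (intro mult_left_mono qmaj_wt fin) auto
 finally show ?thesis by (simp add: mult_ac)
qed

text \<open>With \<open>j\<close> in \<open>A4\<close>, conservation of \<open>fw\<close> rules out
  exactly one index outside \<open>A4\<close>, so the error is quadratic in the off-resonant part.
  The ten summands of \<open>T\<close> are the ten pairs of slots.\<close>

lemma qsum_kR_A4:
 fixes w :: "int => complex"
 assumes fin: "finite J" and j: "j : A4"
 defines "a \<equiv> %i. if i : A4 then w i else 0" and "z \<equiv> %i. if i : A4 then 0 else w i"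
 shows "cmod (qsum J kR w w w w w j - qsum J kR a a a a a j) <= 10 * (n1 J z)\<^sup>2 * (n1 J w) ^ 3"
proof -
 define V Z where "V i = cmod (w i)" and "Z i = cmod (z i)" for i
 have nn: "0 <= V i" "0 <= Z i" for i by (simp_all add: V_def Z_def)
 have Zo: "i \<notin> A4 ==> Z i = V i" for i by (simp add: Z_def V_def z_def)
 define T where "T = (%(a, b, c, d, e).
 Z a * Z b * V c * V d * V e + Z a * V b * Z c * V d * V e + Z a * V b * V c * Z d * V e + Z a * V b * V c * V d * Z e
 + V a * Z b * Z c * V d * V e + V a * Z b * V c * Z d * V e + V a * Z b * V c * V d * Z e
 + V a * V b * Z c * Z d * V e + V a * V b * Z c * V d * Z e + V a * V b * V c * Z d * Z e)"
 have "cmod (qsum J kR w w w w w j - qsum J kR a a a a a j) <= (\<Sum>x\<in>J \<times> J \<times> J \<times> J \<times> J. T x)"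
 unfolding qsum_def sum_subtractf[symmetric]
 proof (rule sum_norm_le, elim SigmaE, simp only: prod.case)
 fix i b c d e :: int
 assume J: "i : J" "b : J" "c : J" "d : J" "e : J"
 have T0: "0 <= T (i, b, c, d, e)" unfolding T_def using nn by auto
 define D where "D = (if i + b + c = d + e + j then kR (j\<^sup>2 + d\<^sup>2 + e\<^sup>2 - i\<^sup>2 - b\<^sup>2 - c\<^sup>2) * (w i * w b * w c * cnj (w d) * cnj (w e)) else 0) -
 (if i + b + c = d + e + j then kR (j\<^sup>2 + d\<^sup>2 + e\<^sup>2 - i\<^sup>2 - b\<^sup>2 - c\<^sup>2) * (a i * a b * a c * cnj (a d) * cnj (a e)) else 0)"
 have "cmod D <= T (i, b, c, d, e)"
 proof (cases "res i b c d e j")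
 case True
 then have sm: "i + b + c = d + e + j" by (simp add: res_def)
 have D: "D = w i * w b * w c * cnj (w d) * cnj (w e) - a i * a b * a c * cnj (a d) * cnj (a e)"
 using True sm kR_res[OF sm] by (simp add: D_def)
 have f: "fw i + fw b + fw c = fw d + fw e" using res_fw[OF True] j by simp
 show ?thesis
 proof (cases "i : A4 & b : A4 & c : A4 & d : A4 & e : A4")
 case True then show ?thesis using T0 by (simp add: D a_def)
 next
 case False
 then have "D = w i * w b * w c * cnj (w d) * cnj (w e)" by (auto simp: D a_def)
 then have D': "cmod D = V i * V b * V c * V d * V e" by (simp add: norm_mult V_def)
 have pos: "0 <= Z i * Z b * V c * V d * V e" "0 <= Z i * V b * Z c * V d * V e" "0 <= Z i * V b * V c * Z d * V e" "0 <= Z i * V b * V c * V d * Z e"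
 "0 <= V i * Z b * Z c * V d * V e" "0 <= V i * Z b * V c * Z d * V e" "0 <= V i * Z b * V c * V d * Z e"
 "0 <= V i * V b * Z c * Z d * V e" "0 <= V i * V b * Z c * V d * Z e" "0 <= V i * V b * V c * Z d * Z e" using nn by auto
 consider "i \<notin> A4" "b \<notin> A4" | "i \<notin> A4" "c \<notin> A4" | "i \<notin> A4" "d \<notin> A4" | "i \<notin> A4" "e \<notin> A4"
 | "b \<notin> A4" "c \<notin> A4" | "b \<notin> A4" "d \<notin> A4" | "b \<notin> A4" "e \<notin> A4" | "c \<notin> A4" "d \<notin> A4" | "c \<notin> A4" "e \<notin> A4" | "d \<notin> A4" "e \<notin> A4"
 using False f fw_eq_0 fw_A4
 by (cases "i : A4"; cases "b : A4"; cases "c : A4"; cases "d : A4"; cases "e : A4"; simp)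
 then show ?thesis unfolding D' T_def prod.case
 by cases (simp_all add: Zo nn)
 qed
 next
 case False
 then have "D = 0" unfolding D_def by (auto simp: kR_res)
 then show ?thesis using T0 by simp
 qed
 then show "cmod ((if i + b + c = d + e + j then kR (j\<^sup>2 + d\<^sup>2 + e\<^sup>2 - i\<^sup>2 - b\<^sup>2 - c\<^sup>2) * (w i * w b * w c * cnj (w d) * cnj (w e)) else 0) -
 (if i + b + c = d + e + j then kR (j\<^sup>2 + d\<^sup>2 + e\<^sup>2 - i\<^sup>2 - b\<^sup>2 - c\<^sup>2) * (a i * a b * a c * cnj (a d) * cnj (a e)) else 0)) <= T (i, b, c, d, e)"
 unfolding D_def .
 qed
 also have "\<dots> = 10 * (sum Z J)\<^sup>2 * (sum V J) ^ 3"
 unfolding T_def case_prod_unfold sum.distrib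
 by (simp only: sum5_product[unfolded case_prod_unfold]) (simp add: power2_eq_square power3_eq_cube)
 finally show ?thesis unfolding n1_def V_def Z_def .
qed

section \<open>Galerkin approximations\<close>

definition kF :: "real => int => complex" where "kF t x = cis (t * rl x)"

lemma kF_norm [simp]: "cmod (kF t x) <= 1" by (simp add: kF_def)
lemma kF_herm: "kF t (- x) = cnj (kF t x)" by (simp add: kF_def cis_cnj)

lemma kF_has_vector_derivative: "((%t. kF t x) hvd \<i> * of_int x * kF t x) (at t)"
proof -
 have "((%z. exp (\<i> * z * of_int x)) has_field_derivative \<i> * of_int x * exp (\<i> * of_real t * of_int x)) (at (cpx t))"
 by (auto intro!: derivative_eq_intros)
 from has_vector_derivative_real_field[OF this, of UNIV] show ?thesis
 by (simp add: kF_def cis_conv_exp mult.assoc)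
qed

text \<open>The Galerkin truncation of the equation \<open>\<i> \<partial>\<^sub>t u + \<partial>\<^sub>x\<^sup>2 u = l |u|\<^sup>4 u\<close> to the modes in \<open>J\<close>, written for
 \<open>v\<^sub>j(t) = exp(\<i> j\<^sup>2 t) u\<^sub>j(t)\<close>.\<close>
definition galerkin :: "real => int set => (real => int => complex) => bool" where
 "galerkin l J v \<longleftrightarrow> (\<forall>t j. (j \<notin> J --> v t j = 0) &
 (j : J --> ((%t. v t j) hvd - \<i> * l * qsum J (kF t) (v t) (v t) (v t) (v t) (v t) j) (at t)))"

text \<open>Turns the polynomial vector field into a globally Lipschitz one; mass conservation later
  shows that the cut never acts.\<close>

definition radial_cut :: "real => 'a::real_normed_vector => 'a" where
 "radial_cut R x = (if norm x <= R then x else (R / norm x) *\<^sub>R x)"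

lemma norm_radial_cut_le: "0 <= R ==> norm (radial_cut R x) <= R"
 by (auto simp: radial_cut_def)

lemma radial_cut_lipschitz:
 assumes R: "0 <= R"
 shows "norm (radial_cut R x - radial_cut R y) <= 2 * norm (x - y)"
proof -
 have one: "norm (x - (R / norm y) *\<^sub>R y) <= 2 * norm (x - y)" if "norm x <= R" "R < norm y" for x y :: 'a
 proof -
 have y0: "norm y > 0" using that R by linarith
 have "y - (R / norm y) *\<^sub>R y = (1 - R / norm y) *\<^sub>R y" by (simp add: scaleR_diff_left)
 then have "norm (y - (R / norm y) *\<^sub>R y) = \<bar>1 - R / norm y\<bar> * norm y" by simp
 also have "\<dots> = norm y - R" using that y0 by (simp add: field_simps)
 also have "\<dots> <= norm (x - y)" using that norm_triangle_ineq2[of y x] by (simp add: norm_minus_commute)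
 finally show ?thesis using norm_triangle_ineq[of "x - y" "y - (R / norm y) *\<^sub>R y"] by simp
 qed
 have two: "norm ((R / norm x) *\<^sub>R x - (R / norm y) *\<^sub>R y) <= 2 * norm (x - y)" if "R < norm x" "R < norm y"
 proof -
 have p: "norm x > 0" "norm y > 0" using that R by linarith+
 have "(R / norm x) *\<^sub>R x - (R / norm y) *\<^sub>R y = (R / norm x) *\<^sub>R (x - y) + (R / norm x - R / norm y) *\<^sub>R y"
 by (simp add: algebra_simps)
 then have "norm ((R / norm x) *\<^sub>R x - (R / norm y) *\<^sub>R y) <= \<bar>R / norm x\<bar> * norm (x - y) + \<bar>R / norm x - R / norm y\<bar> * norm y"
 by (metis norm_scaleR norm_triangle_ineq)
 also have "\<bar>R / norm x - R / norm y\<bar> * norm y = (R / norm x) * \<bar>norm y - norm x\<bar>"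
 proof -
 have "R / norm x - R / norm y = (R / norm x) * ((norm y - norm x) / norm y)" using p by (simp add: field_simps)
 then show ?thesis using p R by (simp add: abs_mult)
 qed
 finally have A: "norm ((R / norm x) *\<^sub>R x - (R / norm y) *\<^sub>R y) <= \<bar>R / norm x\<bar> * norm (x - y) + (R / norm x) * \<bar>norm y - norm x\<bar>" .
 have a: "0 <= R / norm x" "R / norm x <= 1" using that p R by (auto simp: field_simps)
 have "\<bar>norm y - norm x\<bar> <= norm (x - y)" by (metis norm_minus_commute norm_triangle_ineq3)
 then have "(R / norm x) * \<bar>norm y - norm x\<bar> <= (R / norm x) * norm (x - y)" using a by (intro mult_left_mono) auto
 moreover have "(R / norm x) * norm (x - y) <= 1 * norm (x - y)" using a by (intro mult_right_mono) auto
 ultimately show ?thesis using A a(1) unfolding abs_of_nonneg[OF a(1)] by linarith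
 qed
 show ?thesis
 using one[of x y] one[of y x] two norm_ge_zero[of "x - y"] by (auto simp: radial_cut_def norm_minus_commute)
qed

lemma qsum_crude_bound:
 assumes fin: "finite J" and k: "!!x. cmod (kap x) <= 1"
 and b: "!!i. i : J ==> cmod (p i) <= b1" "!!i. i : J ==> cmod (q i) <= b2" "!!i. i : J ==> cmod (r i) <= b3"
 "!!i. i : J ==> cmod (s i) <= b4" "!!i. i : J ==> cmod (t i) <= b5"
 and nn: "0 <= b1" "0 <= b2" "0 <= b3" "0 <= b4" "0 <= b5"
 shows "cmod (qsum J kap p q r s t j) <= real (card J) ^ 5 * (b1 * b2 * b3 * b4 * b5)"
proof -
 have n: "n1 J p <= real (card J) * b1" "n1 J q <= real (card J) * b2" "n1 J r <= real (card J) * b3"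
 "n1 J s <= real (card J) * b4" "n1 J t <= real (card J) * b5"
 unfolding n1_def using b by (auto intro!: sum_bounded_above)
 have "cmod (qsum J kap p q r s t j) = n1 {j} (qsum J kap p q r s t)" by (simp add: n1_def)
 also have "\<dots> <= n1 J p * n1 J q * n1 J r * n1 J s * n1 J t" by (rule qsum_n1[OF _ k]) simp
 also have "\<dots> <= (real (card J) * b1) * (real (card J) * b2) * (real (card J) * b3) * (real (card J) * b4) * (real (card J) * b5)"
 using n nn by (intro mult_mono) auto
 finally show ?thesis by (simp add: eval_nat_numeral mult_ac)
qed

lemma six_kone_mass:
 assumes "!!x. kap (- x) = cnj (kap x)"
 shows "(\<Sum>j\<in>J. Im (cnj (v j) * qsum J kap v v v v v j)) = 0"
proof -
 have "6 * \<i> * cpx (Im (\<Sum>j\<in>J. cpx 1 * cnj (v j) * qsum J kap v v v v v j)) = six J (%a b c d e j. cpx (1 + 1 + 1 - 1 - 1 - 1) * mono6 kap v a b c d e j)"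
 by (rule qsum_symmetrized[where g = "%_. 1"]) (rule assms)
 also have "\<dots> = 0" unfolding six_nested by simp
 finally have "cpx (Im (\<Sum>j\<in>J. cpx 1 * cnj (v j) * qsum J kap v v v v v j)) = 0" by (simp only: mult_eq_0_iff) simp
 then show ?thesis by (simp only: of_real_eq_0_iff Im_sum of_real_1 mult_1)
qed

text \<open>With this discrete metric, bounded functions on the integers form a Banach space of
  bounded continuous functions, in which the Galerkin system is an ordinary differential
  equation.\<close>

instantiation int :: metric_space
begin

definition dist_int :: "int => int => real" where "dist_int x y = \<bar>rl x - rl y\<bar>"

definition uniformity_int :: "(int \<times> int) filter" where
 "uniformity_int = (INF e\<in>{0 <..}. principal {(x, y). dist x y < e})"

instance
proof
 show "(uniformity :: (int \<times> int) filter) = (INF e\<in>{0 <..}. principal {(x, y). dist x y < e})"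
 by (rule uniformity_int_def)
 have "x = y" if "\<bar>rl x - rl y\<bar> < 1" for x y :: int using that by linarith
 then have "\<forall>\<^sub>F (x, y) in (uniformity :: (int \<times> int) filter). x = y"
 unfolding uniformity_int_def by (intro eventually_INF1[of 1]) (auto simp: eventually_principal dist_int_def)
 then show "open U \<longleftrightarrow> (\<forall>x\<in>U. \<forall>\<^sub>F (x', y) in uniformity. x' = x --> y : U)" for U :: "int set"
 by (auto simp: open_discrete elim: eventually_mono)
 show "dist x y = 0 \<longleftrightarrow> x = y" for x y :: int by (simp add: dist_int_def)
 show "dist x y <= dist x z + dist y z" for x y z :: int by (simp add: dist_int_def)
qed

end

instance bcontfun :: (metric_space, banach) banach ..

lemma apply_bcontfun_derivative:
 assumes "(x hvd d) (at t)"
 shows "((%t. apply_bcontfun (x t) (i :: int)) hvd apply_bcontfun d i) (at t)"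
proof -
 have "bounded_linear (%x. apply_bcontfun x i :: 'a)"
 by (rule bounded_linear_intro[of _ 1]) (auto simp: plus_bcontfun.rep_eq scaleR_bcontfun.rep_eq norm_bounded)
 then show ?thesis using assms by (rule bounded_linear.has_vector_derivative)
qed

text \<open>The system is solved in the original variables, where it is autonomous, with the quintic
  term evaluated at the cut vector; \<open>qsum_shift\<close> restores the phases at the end. The
  radius is the l^2 norm of the data, which by mass conservation bounds the sup norm for all
  times.\<close>

lemma galerkin_exists:
 assumes fin: "finite J"
 shows "\<exists>v. galerkin l J v & (\<forall>j\<in>J. v 0 j = c j)"
proof -
 define R where "R = sqrt (\<Sum>j\<in>J. (cmod (c j))\<^sup>2)"
 have R: "0 <= R" by (simp add: R_def sum_nonneg)
 define Q where "Q x = qsum J (%_. 1) x x x x x" for x :: "int => complex"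
 define f where "f x j = (if j : J then - \<i> * (of_int (j\<^sup>2) * x j + of_real l * Q (apply_bcontfun (radial_cut R x)) j) else 0)"
 for x :: "int \<Rightarrow>\<^sub>C complex" and j
 have fb: "g : bcontfun" if "!!j. j \<notin> J ==> g j = 0" for g :: "int => complex"
 proof (rule bcontfun_normI)
 show "continuous_on UNIV g" by (simp add: continuous_on_discrete)
 show "norm (g j) <= (\<Sum>j\<in>J. norm (g j))" for j
 proof (cases "j : J")
 case True
 then show ?thesis using fin by (auto intro: member_le_sum)
 qed (use that in \<open>simp add: sum_nonneg\<close>)
 qed
 define F where "F x = Bcontfun (f x)" for x
 have Fx: "apply_bcontfun (F x) = f x" for x unfolding F_def by (rule Bcontfun_inverse) (simp add: fb f_def)
 define m where "m = (\<Sum>j\<in>J. rl (j\<^sup>2))"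
 define L where "L = m + \<bar>l\<bar> * (5 * (real (card J) ^ 5 * (2 * R ^ 4)))"
 have lip: "norm (F x - F y) <= L * norm (x - y)" for x y
 proof (rule norm_bound)
 fix j
 define X Y where "X = apply_bcontfun (radial_cut R x)" and "Y = apply_bcontfun (radial_cut R y)"
 have XR: "cmod (X i) <= R" "cmod (Y i) <= R" for i
 unfolding X_def Y_def by (meson R norm_bounded norm_radial_cut_le order_trans)+
 have XY: "cmod (X i - Y i) <= 2 * norm (x - y)" for i
 unfolding X_def Y_def using radial_cut_lipschitz[OF R, of x y] norm_bounded[of "radial_cut R x - radial_cut R y" i]
 by (simp add: minus_bcontfun.rep_eq)
 have xy: "cmod (x i - y i) <= norm (x - y)" for i
 using norm_bounded[of "x - y" i] by (simp add: minus_bcontfun.rep_eq)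
 show "norm (apply_bcontfun (F x - F y) j) <= L * norm (x - y)"
 proof (cases "j : J")
 case True
 have k1: "cmod ((%_. 1) z) <= 1" for z :: int by simp
 have q: "cmod (qsum J (%_. 1) p q r s t j) <= real (card J) ^ 5 * (b1 * b2 * b3 * b4 * b5)"
 if "!!i. cmod (p i) <= b1" "!!i. cmod (q i) <= b2" "!!i. cmod (r i) <= b3" "!!i. cmod (s i) <= b4" "!!i. cmod (t i) <= b5"
 for p q r s t b1 b2 b3 b4 b5
 proof -
 have "0 <= b1" "0 <= b2" "0 <= b3" "0 <= b4" "0 <= b5" using that norm_ge_zero order_trans by meson+
 then show ?thesis using that by (intro qsum_crude_bound fin) auto
 qed
 define B where "B = real (card J) ^ 5 * (2 * R ^ 4 * norm (x - y))"
 have tri: "cmod (z1 + z2 + z3 + z4 + z5) <= 5 * B" if "cmod z1 <= B" "cmod z2 <= B" "cmod z3 <= B" "cmod z4 <= B" "cmod z5 <= B" for z1 z2 z3 z4 z5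
 using that norm_triangle_ineq[of "z1 + z2 + z3 + z4" z5] norm_triangle_ineq[of "z1 + z2 + z3" z4]
 norm_triangle_ineq[of "z1 + z2" z3] norm_triangle_ineq[of z1 z2] by linarith
 have B: "real (card J) ^ 5 * (2 * norm (x - y) * R * R * R * R) = B" "real (card J) ^ 5 * (R * (2 * norm (x - y)) * R * R * R) = B"
 "real (card J) ^ 5 * (R * R * (2 * norm (x - y)) * R * R) = B" "real (card J) ^ 5 * (R * R * R * (2 * norm (x - y)) * R) = B"
 "real (card J) ^ 5 * (R * R * R * R * (2 * norm (x - y))) = B"
 by (simp_all add: B_def eval_nat_numeral mult_ac)
 have "cmod (Q X j - Q Y j) <= 5 * B"
 unfolding Q_def qsum_diff
 by (rule tri; (rule q[OF XY XR(1) XR(1) XR(1) XR(1), unfolded B] q[OF XR(2) XY XR(1) XR(1) XR(1), unfolded B] q[OF XR(2) XR(2) XY XR(1) XR(1), unfolded B]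
 q[OF XR(2) XR(2) XR(2) XY XR(1), unfolded B] q[OF XR(2) XR(2) XR(2) XR(2) XY, unfolded B]))
 then have qq: "cmod (Q X j - Q Y j) <= (5 * (real (card J) ^ 5 * (2 * R ^ 4))) * norm (x - y)" by (simp add: B_def mult_ac)
 have "j\<^sup>2 <= (\<Sum>j\<in>J. j\<^sup>2)" using True fin by (intro member_le_sum) auto
 then have jm: "rl (j\<^sup>2) <= m" unfolding m_def by (metis of_int_le_iff of_int_sum)
 have "apply_bcontfun (F x - F y) j = - \<i> * (of_int (j\<^sup>2) * (x j - y j) + of_real l * (Q X j - Q Y j))"
 using True by (simp add: minus_bcontfun.rep_eq Fx f_def X_def Y_def algebra_simps)
 then have "norm (apply_bcontfun (F x - F y) j) = cmod (of_int (j\<^sup>2) * (x j - y j) + of_real l * (Q X j - Q Y j))"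
 by (simp add: norm_mult)
 also have "\<dots> <= rl (j\<^sup>2) * cmod (x j - y j) + \<bar>l\<bar> * cmod (Q X j - Q Y j)"
 by (rule order_trans[OF norm_triangle_ineq]) (simp add: norm_mult norm_power)
 also have "\<dots> <= m * norm (x - y) + \<bar>l\<bar> * ((5 * (real (card J) ^ 5 * (2 * R ^ 4))) * norm (x - y))"
 using jm xy qq by (intro add_mono mult_mono mult_left_mono) (auto simp: m_def intro!: sum_nonneg)
 finally show ?thesis by (simp add: L_def algebra_simps)
 next
 case False
 then show ?thesis using R unfolding L_def m_def
 by (simp add: minus_bcontfun.rep_eq Fx f_def) (intro mult_nonneg_nonneg add_nonneg_nonneg sum_nonneg, auto)
 qed
 qed
 define x0 where "x0 = Bcontfun (%j. if j : J then c j else 0)"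
 have x0: "apply_bcontfun x0 = (%j. if j : J then c j else 0)" unfolding x0_def by (rule Bcontfun_inverse) (simp add: fb)
 obtain x where x: "x 0 = x0" "!!t. (x hvd F (x t)) (at t)" using lipschitz_ode[OF lip, of x0] by blast
 define y where "y t j = apply_bcontfun (x t) j" for t j
 have yd: "((%t. y t j) hvd f (x t) j) (at t)" for t j
 using apply_bcontfun_derivative[OF x(2), of j t] by (simp add: y_def Fx)
 have y0: "y t j = 0" if "j \<notin> J" for t j
 proof -
 have "((%t. y t j) hvd 0) (at t within UNIV)" for t using yd[of j t] that by (simp add: f_def)
 then obtain k where k: "!!t. t : UNIV ==> y t j = k" using has_vector_derivative_zero_constant[OF convex_UNIV] by blast
 have "y 0 j = 0" using that by (simp add: y_def x x0)
 then show ?thesis using k[of 0] k[of t] by simp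
 qed
 have mass: "(\<Sum>j\<in>J. (cmod (y t j))\<^sup>2) = R\<^sup>2" for t
 proof -
 have "((%t. \<Sum>j\<in>J. (cmod (y t j))\<^sup>2) hrd 0) (at t)" for t
 proof -
 \<comment> \<open>The cut multiplies by a real number, so the quintic sum only gains the factor
   \<open>k ^ 5\<close> and mass conservation is available before the cut is known to be
   inactive.\<close>
 define k where "k = (if norm (x t) <= R then 1 else R / norm (x t))"
 have kx: "apply_bcontfun (radial_cut R (x t)) = (%j. cpx k * y t j)"
 by (auto simp: radial_cut_def k_def y_def scaleR_bcontfun.rep_eq scaleR_conv_of_real fun_eq_iff)
 have Qk: "Q (apply_bcontfun (radial_cut R (x t))) j = of_real (k ^ 5) * Q (y t) j" for j
 unfolding Q_def kx qsum_scale by (simp add: eval_nat_numeral mult_ac)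
 have "((%t. \<Sum>j\<in>J. (cmod (y t j))\<^sup>2) hrd (\<Sum>j\<in>J. 2 * Re (cnj (y t j) * f (x t) j))) (at t)"
 by (intro DERIV_sum has_real_derivative_cmod_sq yd)
 also have "(\<Sum>j\<in>J. 2 * Re (cnj (y t j) * f (x t) j)) = (\<Sum>j\<in>J. 2 * (l * k ^ 5) * Im (cnj (y t j) * Q (y t) j))"
 proof (intro sum.cong refl)
 fix j assume j: "j : J"
 have "cnj (y t j) * f (x t) j = - \<i> * cpx (rl (j\<^sup>2) * (cmod (y t j))\<^sup>2) + cpx (l * k ^ 5) * (- \<i> * (cnj (y t j) * Q (y t) j))"
 using j unfolding f_def Qk of_real_mult complex_norm_square by (simp add: y_def algebra_simps)
 moreover have "Re (- \<i> * cpx a + cpx b * (- \<i> * X)) = b * Im X" for a b X by simp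
 ultimately have "Re (cnj (y t j) * f (x t) j) = (l * k ^ 5) * Im (cnj (y t j) * Q (y t) j)" by (simp only:)
 then show "2 * Re (cnj (y t j) * f (x t) j) = 2 * (l * k ^ 5) * Im (cnj (y t j) * Q (y t) j)" by (simp only: mult.assoc)
 qed
 also have "\<dots> = 0" unfolding sum_distrib_left[symmetric] Q_def
 by (subst six_kone_mass[of "%_. 1"]) simp_all
 finally show ?thesis .
 qed
 then have "(\<Sum>j\<in>J. (cmod (y t j))\<^sup>2) = (\<Sum>j\<in>J. (cmod (y 0 j))\<^sup>2)" using DERIV_isconst_all by blast
 also have "\<dots> = R\<^sup>2" by (simp add: R_def sum_nonneg y_def x x0)
 finally show ?thesis .
 qed
 have "norm (x t) <= R" for t
 proof (rule norm_bound)
 fix j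
 show "norm (apply_bcontfun (x t) j) <= R"
 proof (cases "j : J")
 case True
 have "(cmod (y t j))\<^sup>2 <= R\<^sup>2" unfolding mass[of t, symmetric] using fin True by (intro member_le_sum) auto
 then show ?thesis using R by (simp add: y_def power2_le_iff_abs_le)
 next
 case False
 then show ?thesis using y0[of j t] R by (simp add: y_def)
 qed
 qed
 then have fy: "f (x t) j = - \<i> * (of_int (j\<^sup>2) * y t j + of_real l * Q (y t) j)" if "j : J" for t j
 using that by (simp add: f_def radial_cut_def y_def[abs_def])
 define v where "v t j = cis (t * (rl j)\<^sup>2) * y t j" for t j
 have "((%t. v t j) hvd - \<i> * l * qsum J (kF t) (v t) (v t) (v t) (v t) (v t) j) (at t)" if j: "j : J" for t j
 proof -
 have c: "((%t. cis (t * (rl j)\<^sup>2)) hvd \<i> * of_int (j\<^sup>2) * cis (t * (rl j)\<^sup>2)) (at t)"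
 using kF_has_vector_derivative[of "j\<^sup>2" t] by (simp add: kF_def)
 have "qsum J (kF t) (v t) (v t) (v t) (v t) (v t) j = cis (t * (rl j)\<^sup>2) * Q (y t) j"
 proof -
 have "kF t = (%x. cis (t * x) * 1)" by (simp add: kF_def fun_eq_iff)
 moreover have "(%i. cis (- t * (rl i)\<^sup>2) * v t i) = y t" by (simp add: v_def fun_eq_iff mult.assoc[symmetric] cis_mult)
 ultimately show ?thesis unfolding Q_def using qsum_shift[of J t "%_. 1" "v t" "v t" "v t" "v t" "v t" j] by simp
 qed
 then show ?thesis unfolding v_def
 using has_vector_derivative_mult[OF c yd[of j t]] by (simp add: fy[OF j] v_def algebra_simps)
 qed
 moreover have "v t j = 0" if "j \<notin> J" for t j using y0[OF that] by (simp add: v_def)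
 moreover have "v 0 j = c j" if "j : J" for j using that by (simp add: v_def y_def x x0)
 ultimately have "galerkin l J v & (\<forall>j\<in>J. v 0 j = c j)" unfolding galerkin_def by blast
 then show ?thesis by blast
qed

lemma qsum_cnj:
 "qsum J kap (%i. cnj (p i)) (%i. cnj (q i)) (%i. cnj (r i)) (%i. cnj (s i)) (%i. cnj (t i)) j = cnj (qsum J (%x. cnj (kap x)) p q r s t j)"
 unfolding qsum_def cnj_sum by (intro sum.cong refl) auto

text \<open>Complex conjugation reverses time. Forward estimates thereby extend to negative times,
  which the global classical solution requires.\<close>

lemma galerkin_reverse:
 assumes g: "galerkin l J v"
 shows "galerkin l J (%t j. cnj (v (- t) j))"
 unfolding galerkin_def
proof (intro allI conjI impI)
 fix t j
 show "cnj (v (- t) j) = 0" if "j \<notin> J" using g that by (simp add: galerkin_def)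
 assume j: "j : J"
 define d where "d = - \<i> * l * qsum J (kF (- t)) (v (- t)) (v (- t)) (v (- t)) (v (- t)) (v (- t)) j"
 have "((%t. v t j) hvd d) (at (- t))" using g j by (simp add: galerkin_def d_def)
 moreover have u: "(uminus hvd - 1) (at t)" by (auto intro!: derivative_eq_intros)
 ultimately have "((%t. v (- t) j) hvd - d) (at t)"
 using vector_diff_chain_at[OF u, of "%t. v t j" d] by (simp add: o_def)
 then have "((%t. cnj (v (- t) j)) hvd cnj (- d)) (at t)"
 by (rule bounded_linear.has_vector_derivative[OF bounded_linear_cnj])
 moreover have "(%x. cnj (kF t x)) = kF (- t)" by (auto simp: kF_def cis_cnj)
 ultimately show "((%t. cnj (v (- t) j)) hvd - \<i> * l *
 qsum J (kF t) (%j. cnj (v (- t) j)) (%j. cnj (v (- t) j)) (%j. cnj (v (- t) j)) (%j. cnj (v (- t) j)) (%j. cnj (v (- t) j)) j) (at t)"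
 unfolding qsum_cnj by (simp add: d_def)
qed

context
 fixes l :: real and J :: "int set" and v :: "real => int => complex"
 assumes fin: "finite J" and g: "galerkin l J v"
begin

lemma galerkin_vd: "j : J ==> ((%t. v t j) hvd - \<i> * l * qsum J (kF t) (v t) (v t) (v t) (v t) (v t) j) (at t)"
 using g by (simp add: galerkin_def)

lemma galerkin_weighted_derivative:
 "((%t. \<Sum>j\<in>J. f j * (cmod (v t j))\<^sup>2) has_real_derivative
 2 * l * (\<Sum>j\<in>J. f j * Im (cnj (v t j) * qsum J (kF t) (v t) (v t) (v t) (v t) (v t) j))) (at t)"
proof -
 have "((%t. \<Sum>j\<in>J. f j * (cmod (v t j))\<^sup>2) has_real_derivative
 (\<Sum>j\<in>J. f j * (2 * Re (cnj (v t j) * (- \<i> * l * qsum J (kF t) (v t) (v t) (v t) (v t) (v t) j))))) (at t)"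
 by (intro DERIV_sum DERIV_cmult has_real_derivative_cmod_sq galerkin_vd)
 moreover have "f j * (2 * Re (cnj (v t j) * (- \<i> * l * X))) = 2 * l * (f j * Im (cnj (v t j) * X))" for X j
 proof -
 have "cnj (v t j) * (- \<i> * l * X) = - \<i> * (cpx l * (cnj (v t j) * X))" by (simp add: mult_ac)
 then show ?thesis by (simp add: algebra_simps)
 qed
 ultimately show ?thesis by (simp only: sum_distrib_left)
qed

lemma galerkin_mass: "(\<Sum>j\<in>J. (cmod (v t j))\<^sup>2) = (\<Sum>j\<in>J. (cmod (v 0 j))\<^sup>2)"
proof -
 have "((%t. \<Sum>j\<in>J. (cmod (v t j))\<^sup>2) hrd 0) (at t)" for t
 using galerkin_weighted_derivative[of "%_. 1" t] six_kone_mass[of "kF t" "v t" J, OF kF_herm] by simp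
 then show ?thesis using DERIV_isconst_all by blast
qed

definition H6 :: "real => complex" where
 "H6 t = (\<Sum>j\<in>J. cnj (v t j) * qsum J (kF t) (v t) (v t) (v t) (v t) (v t) j)"

definition six_form :: "(int => complex) => (int => complex) => (int => complex) => (int => complex) => (int => complex) => (int => complex) => (int => complex) => complex" where
 "six_form kap p q r s t x = six J (%a b c d e j. if a + b + c = d + e + j
 then kap (j\<^sup>2 + d\<^sup>2 + e\<^sup>2 - a\<^sup>2 - b\<^sup>2 - c\<^sup>2) * (p a * q b * r c * cnj (s d) * cnj (t e) * cnj (x j)) else 0)"

lemma six_form_qsum: "(\<Sum>j\<in>J. cnj (x j) * qsum J kap p q r s t j) = six_form kap p q r s t x"
proof -
 have "(\<Sum>j\<in>J. cnj (x j) * qsum J kap p q r s t j) = (\<Sum>y\<in>J \<times> J \<times> J \<times> J \<times> J. \<Sum>j\<in>J. cnj (x j) *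
 (case y of (a, b, c, d, e) => if a + b + c = d + e + j
 then kap (j\<^sup>2 + d\<^sup>2 + e\<^sup>2 - a\<^sup>2 - b\<^sup>2 - c\<^sup>2) * (p a * q b * r c * cnj (s d) * cnj (t e)) else 0))"
 unfolding qsum_def sum_distrib_left by (rule sum.swap)
 also have "\<dots> = (\<Sum>(a, b, c, d, e)\<in>J \<times> J \<times> J \<times> J \<times> J. \<Sum>j\<in>J. if a + b + c = d + e + j
 then kap (j\<^sup>2 + d\<^sup>2 + e\<^sup>2 - a\<^sup>2 - b\<^sup>2 - c\<^sup>2) * (p a * q b * r c * cnj (s d) * cnj (t e) * cnj (x j)) else 0)"
 by (intro sum.cong refl) (auto intro!: sum.cong)
 finally show ?thesis unfolding six_form_def six_nested by (simp only: sum5_nested)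
qed

lemma six_form_swap:
 "six_form kap p q r s t x = six_form kap p q r x t s" "six_form kap p q r s t x = six_form kap p q r s x t"
 unfolding six_form_def
 apply (subst six_swap_dj, intro six_cong if_cong, simp_all add: algebra_simps)
 apply (subst six_swap_ej, intro six_cong if_cong, simp_all add: algebra_simps)
 done

lemma six_form_flip:
 assumes "!!x. kap (- x) = cnj (kap x)"
 shows "six_form kap p q r s t x = cnj (six_form kap s t x p q r)"
proof -
 have *: "kap (c\<^sup>2 + a\<^sup>2 + b\<^sup>2 - d\<^sup>2 - e\<^sup>2 - j\<^sup>2) = cnj (kap (j\<^sup>2 + d\<^sup>2 + e\<^sup>2 - a\<^sup>2 - b\<^sup>2 - c\<^sup>2))" for a b c d e j
 using assms[of "j\<^sup>2 + d\<^sup>2 + e\<^sup>2 - a\<^sup>2 - b\<^sup>2 - c\<^sup>2"] by (simp add: algebra_simps)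
 have "six_form kap p q r s t x = six J (%a b c d e j. if d + e + j = a + b + c
 then kap (c\<^sup>2 + a\<^sup>2 + b\<^sup>2 - d\<^sup>2 - e\<^sup>2 - j\<^sup>2) * (p d * q e * r j * cnj (s a) * cnj (t b) * cnj (x c)) else 0)"
 unfolding six_form_def by (rule six_flip)
 also have "\<dots> = cnj (six_form kap s t x p q r)"
 unfolding six_form_def six_cnj
 proof (intro six_cong)
 fix a b c d e j
 show "(if d + e + j = a + b + c
 then kap (c\<^sup>2 + a\<^sup>2 + b\<^sup>2 - d\<^sup>2 - e\<^sup>2 - j\<^sup>2) * (p d * q e * r j * cnj (s a) * cnj (t b) * cnj (x c)) else 0) =
 cnj (if a + b + c = d + e + j
 then kap (j\<^sup>2 + d\<^sup>2 + e\<^sup>2 - a\<^sup>2 - b\<^sup>2 - c\<^sup>2) * (s a * t b * x c * cnj (p d) * cnj (q e) * cnj (r j)) else 0)"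
 unfolding *[of c a b d e j] by (simp add: mult_ac eq_commute)
 qed
 finally show ?thesis .
qed

text \<open>Only the explicit time dependence of the kernel survives: differentiating the six
  factors gives three times \<open>Z + cnj Z\<close>, and \<open>Z\<close> is purely imaginary
  because the velocity is \<open>- \<i> * l\<close> times the quintic sum itself.\<close>

lemma H6_derivative:
 "(H6 hvd six J (%a b c d e j. \<i> * of_int (j\<^sup>2 + d\<^sup>2 + e\<^sup>2 - a\<^sup>2 - b\<^sup>2 - c\<^sup>2) * mono6 (kF t) (v t) a b c d e j)) (at t)"
proof -
 define Q where "Q = qsum J (kF t) (v t) (v t) (v t) (v t) (v t)"
 define d where "d j = - \<i> * l * Q j" for j
 define k' where "k' x = \<i> * of_int x * kF t x" for x :: int
 define V where "V = v t"
 have vd: "((%t. v t j) hvd d j) (at t)" if "j : J" for j using galerkin_vd[OF that] by (simp add: d_def Q_def)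
 have cvd: "((%t. cnj (v t j)) hvd cnj (d j)) (at t)" if "j : J" for j
 using vd[OF that] by (rule bounded_linear.has_vector_derivative[OF bounded_linear_cnj])
 define Z where "Z = (\<Sum>j\<in>J. cnj (d j) * Q j)"
 have Z: "six_form (kF t) V V V V V d = Z" unfolding Z_def Q_def V_def six_form_qsum ..
 have Z4: "six_form (kF t) V V V d V V = Z" using six_form_swap(1) Z by metis
 have Z5: "six_form (kF t) V V V V d V = Z" using six_form_swap(2) Z by metis
 have Z1: "six_form (kF t) d V V V V V = cnj Z" using six_form_flip[where kap = "kF t", OF kF_herm] Z4 by metis
 have Z2: "six_form (kF t) V d V V V V = cnj Z" using six_form_flip[where kap = "kF t", OF kF_herm] Z5 by metis
 have Z3: "six_form (kF t) V V d V V V = cnj Z" using six_form_flip[where kap = "kF t", OF kF_herm] Z by metis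
 have "Z + cnj Z = 0"
 proof -
 have "Z = \<i> * l * (\<Sum>j\<in>J. cnj (Q j) * Q j)" unfolding Z_def d_def sum_distrib_left by (intro sum.cong refl) simp
 also have "(\<Sum>j\<in>J. cnj (Q j) * Q j) = cpx (\<Sum>j\<in>J. (cmod (Q j))\<^sup>2)"
 by (simp only: of_real_sum complex_norm_square mult.commute)
 finally show ?thesis by (simp add: complex_eq_iff)
 qed
 then have Z0: "Z + (cnj Z + cnj Z + cnj Z + Z + Z) = 0" by (simp add: complex_eq_iff)
 have "(H6 hvd (\<Sum>j\<in>J. cnj (V j) * (qsum J k' V V V V V j + (qsum J (kF t) d V V V V j + qsum J (kF t) V d V V V j
 + qsum J (kF t) V V d V V j + qsum J (kF t) V V V d V j + qsum J (kF t) V V V V d j)) + cnj (d j) * Q j)) (at t)"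
 unfolding H6_def[abs_def] V_def Q_def k'_def
 by (rule has_vector_derivative_sum, rule has_vector_derivative_mult, erule cvd,
 rule qsum_has_vector_derivative[OF kF_has_vector_derivative], (erule vd)+)
 also have "(\<Sum>j\<in>J. cnj (V j) * (qsum J k' V V V V V j + (qsum J (kF t) d V V V V j + qsum J (kF t) V d V V V j
 + qsum J (kF t) V V d V V j + qsum J (kF t) V V V d V j + qsum J (kF t) V V V V d j)) + cnj (d j) * Q j) =
 six_form k' V V V V V V + (cnj Z + cnj Z + cnj Z + Z + Z) + Z"
 unfolding distrib_left sum.distrib six_form_qsum Z1 Z2 Z3 Z4 Z5 by (simp add: Z_def)
 also have "\<dots> = six_form k' V V V V V V" using Z0 by (simp add: algebra_simps)
 also have "\<dots> = six J (%a b c d e j. \<i> * of_int (j\<^sup>2 + d\<^sup>2 + e\<^sup>2 - a\<^sup>2 - b\<^sup>2 - c\<^sup>2) * mono6 (kF t) (v t) a b c d e j)"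
 unfolding six_form_def mono6_def V_def k'_def by (intro six_cong) (simp add: mult_ac)
 finally show ?thesis .
qed

text \<open>The factor 1/3 comes from the symmetrized identity: the quadratic part changes at rate
  \<open>2 * l * T\<close>, the real part of \<open>H6\<close> at rate
  \<open>- 6 * T\<close>.\<close>

lemma galerkin_energy:
 "(\<Sum>j\<in>J. (rl j)\<^sup>2 * (cmod (v t j))\<^sup>2) + l / 3 * Re (H6 t) = (\<Sum>j\<in>J. (rl j)\<^sup>2 * (cmod (v 0 j))\<^sup>2) + l / 3 * Re (H6 0)"
proof -
 have "((%t. (\<Sum>j\<in>J. (rl j)\<^sup>2 * (cmod (v t j))\<^sup>2) + l / 3 * Re (H6 t)) hrd 0) (at t)" for t
 proof -
 define T where "T = Im (\<Sum>j\<in>J. cpx ((rl j)\<^sup>2) * cnj (v t j) * qsum J (kF t) (v t) (v t) (v t) (v t) (v t) j)"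
 have T1: "(\<Sum>j\<in>J. (rl j)\<^sup>2 * Im (cnj (v t j) * qsum J (kF t) (v t) (v t) (v t) (v t) (v t) j)) = T"
 unfolding T_def Im_sum by (intro sum.cong refl) (auto simp: algebra_simps)
 have "6 * \<i> * cpx T = six J (%a b c d e j. cpx ((rl d)\<^sup>2 + (rl e)\<^sup>2 + (rl j)\<^sup>2 - (rl a)\<^sup>2 - (rl b)\<^sup>2 - (rl c)\<^sup>2) * mono6 (kF t) (v t) a b c d e j)"
 unfolding T_def by (rule qsum_symmetrized[where kap = "kF t", OF kF_herm])
 then have X: "\<i> * (6 * \<i> * cpx T) = six J (%a b c d e j. \<i> * of_int (j\<^sup>2 + d\<^sup>2 + e\<^sup>2 - a\<^sup>2 - b\<^sup>2 - c\<^sup>2) * mono6 (kF t) (v t) a b c d e j)"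
 by (simp add: six_scale[symmetric]) (intro six_cong, simp add: algebra_simps)
 have "\<i> * (6 * \<i> * cpx T) = - 6 * cpx T" by (simp add: algebra_simps)
 then have "(H6 hvd - 6 * cpx T) (at t)" using H6_derivative[of t] unfolding X[symmetric] by (simp only:)
 then have "((%t. Re (H6 t)) hrd - 6 * T) (at t)"
 using bounded_linear.has_vector_derivative[OF bounded_linear_Re, of H6 "- 6 * cpx T" "at t"]
 by (simp add: has_real_derivative_iff_has_vector_derivative)
 then have "((%t. (\<Sum>j\<in>J. (rl j)\<^sup>2 * (cmod (v t j))\<^sup>2) + l / 3 * Re (H6 t)) hrd 2 * l * T + l / 3 * (- 6 * T)) (at t)"
 using galerkin_weighted_derivative[of "%j. (rl j)\<^sup>2" t] unfolding T1 by (intro DERIV_add DERIV_cmult)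
 then show ?thesis by simp
 qed
 then show ?thesis using DERIV_isconst_all by blast
qed

lemma H6_bound: "\<bar>Re (H6 t)\<bar> <= (n2 J (v t))\<^sup>2 * n1 J (v t) ^ 4"
proof -
 define V where "V i = cmod (v t i)" for i
 have "\<bar>Re (H6 t)\<bar> <= cmod (H6 t)" by (rule abs_Re_le_cmod)
 also have "\<dots> <= (\<Sum>j\<in>J. V j * qmaj J V V V V V j)"
 unfolding H6_def
 proof (rule sum_norm_le)
 fix j
 show "cmod (cnj (v t j) * qsum J (kF t) (v t) (v t) (v t) (v t) (v t) j) <= V j * qmaj J V V V V V j"
 using qsum_norm_le[of "kF t" 1 J "v t" "v t" "v t" "v t" "v t" j] by (simp add: norm_mult V_def[abs_def] mult_left_mono)
 qed
 also have "\<dots> <= L2_set V J * L2_set V J * sum V J * sum V J * sum V J * sum V J"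
 by (intro qmaj_six1 fin) (auto simp: V_def)
 finally show ?thesis by (simp add: n1_def n2_def V_def[abs_def] power2_eq_square eval_nat_numeral mult_ac)
qed

end

section \<open>A priori bounds uniform in the truncation\<close>

lemma n1_le_h1:
 assumes fin: "finite J"
 shows "(n1 J v)\<^sup>2 <= 5 * (\<Sum>j\<in>J. (1 + (rl j)\<^sup>2) * (cmod (v j))\<^sup>2)"
proof -
 define a where "a j = 1 / sqrt (1 + (rl j)\<^sup>2)" for j
 define b where "b j = sqrt (1 + (rl j)\<^sup>2) * cmod (v j)" for j
 have p: "0 < 1 + (rl j)\<^sup>2" for j by (simp add: add_pos_nonneg)
 have "\<bar>a j\<bar> * \<bar>b j\<bar> = cmod (v j)" for j
 proof -
 define s where "s = sqrt (1 + (rl j)\<^sup>2)"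
 have "0 < s" using p[of j] by (simp add: s_def)
 then show ?thesis by (simp add: a_def b_def s_def[symmetric] abs_mult)
 qed
 then have "n1 J v = (\<Sum>j\<in>J. \<bar>a j\<bar> * \<bar>b j\<bar>)" by (simp add: n1_def)
 also have "\<dots> <= L2_set a J * L2_set b J" by (rule L2_set_mult_ineq)
 finally have "(n1 J v)\<^sup>2 <= (L2_set a J * L2_set b J)\<^sup>2" by (rule power_mono) simp
 also have "\<dots> = (\<Sum>j\<in>J. (a j)\<^sup>2) * (\<Sum>j\<in>J. (b j)\<^sup>2)"
 by (simp add: L2_set_def power_mult_distrib sum_nonneg)
 also have "(\<Sum>j\<in>J. (a j)\<^sup>2) = (\<Sum>j\<in>J. 1 / (1 + (rl j)\<^sup>2))" using p by (simp add: a_def power_divide less_imp_le)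
 also have "(\<Sum>j\<in>J. (b j)\<^sup>2) = (\<Sum>j\<in>J. (1 + (rl j)\<^sup>2) * (cmod (v j))\<^sup>2)"
 using p by (simp add: b_def power_mult_distrib less_imp_le)
 also have "(\<Sum>j\<in>J. 1 / (1 + (rl j)\<^sup>2)) * (\<Sum>j\<in>J. (1 + (rl j)\<^sup>2) * (cmod (v j))\<^sup>2) <=
 5 * (\<Sum>j\<in>J. (1 + (rl j)\<^sup>2) * (cmod (v j))\<^sup>2)"
 using p by (intro mult_right_mono sum_inverse_one_plus_sq_le fin sum_nonneg) (auto simp: less_imp_le)
 finally show ?thesis .
qed

text \<open>For such small \<open>l\<close> the conserved energy controls the kinetic part despite
  the indefinite sextic term. The numbers 5 and 17 are mass and kinetic energy of the intended data,
  and 23 satisfies 5 * (5 + 100) < 23^2.\<close>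

lemma galerkin_h1_bound:
 assumes fin: "finite J" and g: "galerkin l J v" and l: "\<bar>l\<bar> <= 1 / 100000"
 and m0: "(\<Sum>j\<in>J. (cmod (v 0 j))\<^sup>2) <= 5" and d0: "(\<Sum>j\<in>J. (rl j)\<^sup>2 * (cmod (v 0 j))\<^sup>2) <= 17" and t: "0 <= t"
 shows "(\<Sum>j\<in>J. (rl j)\<^sup>2 * (cmod (v t j))\<^sup>2) < 100" "n1 J (v t) <= 23"
proof -
 define D where "D s = (\<Sum>j\<in>J. (rl j)\<^sup>2 * (cmod (v s j))\<^sup>2)" for s
 have m: "(\<Sum>j\<in>J. (cmod (v s j))\<^sup>2) <= 5" for s using galerkin_mass[OF fin g, of s] m0 by simp
 have n: "(n1 J (v s))\<^sup>2 <= 5 * (5 + D s)" for s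
 using n1_le_h1[OF fin, of "v s"] m[of s] by (simp add: D_def algebra_simps sum.distrib)
 have H: "\<bar>Re (H6 J v s)\<bar> <= 125 * (5 + X)\<^sup>2" if "D s <= X" for s X
 proof -
 have D0: "0 <= D s" by (simp add: D_def sum_nonneg)
 have "(n1 J (v s))\<^sup>2 <= 5 * (5 + X)" by (rule order_trans[OF n]) (use that in simp)
 then have "((n1 J (v s))\<^sup>2)\<^sup>2 <= (5 * (5 + X))\<^sup>2" by (intro power_mono) auto
 then have "n1 J (v s) ^ 4 <= 25 * (5 + X)\<^sup>2" by (simp only: power_mult_distrib power_mult[symmetric]) simp
 then have "(n2 J (v s))\<^sup>2 * n1 J (v s) ^ 4 <= 5 * (25 * (5 + X)\<^sup>2)"
 using m[of s] by (intro mult_mono) (auto simp: n2_sq sum_nonneg)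
 then show ?thesis using H6_bound[OF fin g, of s] by simp
 qed
 have E: "D s + l / 3 * Re (H6 J v s) = D 0 + l / 3 * Re (H6 J v 0)" for s
 using galerkin_energy[OF fin g, of s] by (simp add: D_def)
 have contD: "continuous_on X D" for X
 unfolding D_def by (rule DERIV_continuous_on, rule has_field_derivative_at_within, rule galerkin_weighted_derivative[OF fin g])
 have "D t < 100"
 proof (rule continuity_bootstrap[of "{()}" t "%_. D" "%_. 100"])
 fix s i assume s: "s : {0..t}" "!!r k. r : {0..s} ==> k : {()} ==> D r <= 100"
 have "D s <= 100" using s by auto
 \<comment> \<open>1378125 = 125 * 105^2, and 60500 = 125 * 22^2 for the data. The exchange with the
   sextic term stays below 5, so \<open>D\<close> cannot climb from 17 to 100.\<close>
 from H[OF this] have h1: "\<bar>Re (H6 J v s)\<bar> <= 1378125" by (simp add: power2_eq_square)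
 have "D 0 <= 17" using d0 by (simp add: D_def)
 from H[OF this] have h2: "\<bar>Re (H6 J v 0)\<bar> <= 60500" by (simp add: power2_eq_square)
 have "\<bar>l / 3 * (Re (H6 J v 0) - Re (H6 J v s))\<bar> <= (1 / 300000) * 1438625"
 unfolding abs_mult using h1 h2 l by (intro mult_mono) auto
 from abs_le_D1[OF this] have h: "l / 3 * (Re (H6 J v 0) - Re (H6 J v s)) <= 5" by simp
 have "D s = D 0 + l / 3 * (Re (H6 J v 0) - Re (H6 J v s))" using E[of s] unfolding right_diff_distrib by linarith
 then show "D s < 100" using h \<open>D 0 <= 17\<close> by linarith
 next
 show "D 0 <= 100" using d0 by (simp add: D_def)
 qed (use contD t in auto)
 then show "(\<Sum>j\<in>J. (rl j)\<^sup>2 * (cmod (v t j))\<^sup>2) < 100" by (simp add: D_def)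
 have "(n1 J (v t))\<^sup>2 <= 23\<^sup>2" using n[of t] \<open>D t < 100\<close> by simp
 then show "n1 J (v t) <= 23" by (rule power2_le_imp_le) simp
qed

text \<open>A polynomial weight that serves only the limit of the truncations. Its fourth power
  leaves two powers of 1 + j^2 after the interpolation in \<open>weighted_diff_V\<close>.\<close>

definition hw :: "int => real" where "hw j = (1 + (rl j)\<^sup>2) ^ 4"

lemma hw_pos: "0 < hw j" unfolding hw_def by (rule zero_less_power) (simp add: add_pos_nonneg)
lemma hw_nonneg [simp]: "0 <= hw j" by (simp add: hw_def)

text \<open>The largest of the five indices is at least a fifth of \<open>j\<close> in modulus;
  390625 is 25^4.\<close>

lemma hw_sum:
 assumes "a + b + c = d + e + (j :: int)"
 shows "hw j <= 390625 * (hw a + hw b + hw c + hw d + hw e)"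
proof -
 define m where "m = Max {\<bar>a\<bar>, \<bar>b\<bar>, \<bar>c\<bar>, \<bar>d\<bar>, \<bar>e\<bar>}"
 have le: "\<bar>a\<bar> <= m" "\<bar>b\<bar> <= m" "\<bar>c\<bar> <= m" "\<bar>d\<bar> <= m" "\<bar>e\<bar> <= m" unfolding m_def by (intro Max_ge; simp)+
 have "m : {\<bar>a\<bar>, \<bar>b\<bar>, \<bar>c\<bar>, \<bar>d\<bar>, \<bar>e\<bar>}" unfolding m_def by (rule Max_in) auto
 moreover have "hw \<bar>x\<bar> = hw x" for x by (simp add: hw_def)
 ultimately have m: "hw m <= hw a + hw b + hw c + hw d + hw e" by auto
 have m0: "0 <= m" using le by linarith
 have "\<bar>j\<bar> <= 5 * m" using assms le by linarith
 then have "\<bar>rl j\<bar> <= 5 * rl m" by linarith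
 then have "(rl j)\<^sup>2 <= (5 * rl m)\<^sup>2" by (rule abs_le_square_iff[THEN iffD1, OF order_trans]) (use m0 in simp)
 then have "1 + (rl j)\<^sup>2 <= 25 * (1 + (rl m)\<^sup>2)" by (simp add: power_mult_distrib)
 then have "hw j <= (25 * (1 + (rl m)\<^sup>2)) ^ 4" unfolding hw_def by (intro power_mono) auto
 also have "\<dots> = 390625 * hw m" by (simp only: hw_def power_mult_distrib) simp
 finally show ?thesis using m by simp
qed

lemma qmaj_six_slots:
 assumes fin: "finite J" and nn: "!!i. 0 <= x i" "!!i. 0 <= p i" "!!i. 0 <= V i"
 and V: "sum V J <= B"
 shows "(\<Sum>j\<in>J. x j * qmaj J p V V V V j) <= L2_set x J * L2_set p J * B ^ 4"
 "(\<Sum>j\<in>J. x j * qmaj J V p V V V j) <= L2_set x J * L2_set p J * B ^ 4"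
 "(\<Sum>j\<in>J. x j * qmaj J V V p V V j) <= L2_set x J * L2_set p J * B ^ 4"
 "(\<Sum>j\<in>J. x j * qmaj J V V V p V j) <= L2_set x J * L2_set p J * B ^ 4"
 "(\<Sum>j\<in>J. x j * qmaj J V V V V p j) <= L2_set x J * L2_set p J * B ^ 4"
proof -
 have "sum V J ^ 4 <= B ^ 4" using V nn by (intro power_mono) (auto simp: sum_nonneg)
 then have B: "L2_set x J * L2_set p J * sum V J ^ 4 <= L2_set x J * L2_set p J * B ^ 4"
 by (intro mult_left_mono) auto
 have e: "c * sum V J * sum V J * sum V J * sum V J = c * sum V J ^ 4" for c by (simp add: eval_nat_numeral)
 show 1: "(\<Sum>j\<in>J. x j * qmaj J p V V V V j) <= L2_set x J * L2_set p J * B ^ 4"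
 proof -
 have "(\<Sum>j\<in>J. x j * qmaj J p V V V V j) <= L2_set x J * L2_set p J * sum V J * sum V J * sum V J * sum V J"
 by (intro qmaj_six1 fin nn)
 then show ?thesis using B unfolding e by (rule order_trans)
 qed
 show 2: "(\<Sum>j\<in>J. x j * qmaj J V p V V V j) <= L2_set x J * L2_set p J * B ^ 4"
 using 1 by (subst qmaj_swap12)
 show "(\<Sum>j\<in>J. x j * qmaj J V V p V V j) <= L2_set x J * L2_set p J * B ^ 4"
 using 2 by (subst qmaj_swap23)
 show 4: "(\<Sum>j\<in>J. x j * qmaj J V V V p V j) <= L2_set x J * L2_set p J * B ^ 4"
 proof -
 have "(\<Sum>j\<in>J. x j * qmaj J V V V p V j) <= L2_set x J * L2_set p J * sum V J * sum V J * sum V J * sum V J"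
 by (intro qmaj_six4 fin nn)
 then show ?thesis using B unfolding e by (rule order_trans)
 qed
 show "(\<Sum>j\<in>J. x j * qmaj J V V V V p j) <= L2_set x J * L2_set p J * B ^ 4"
 using 4 by (subst qmaj_swap45)
qed

lemma qmaj_hw:
 assumes "!!i. 0 <= V i"
 shows "hw j * qmaj J V V V V V j <= 390625 * (qmaj J (%i. hw i * V i) V V V V j + qmaj J V (%i. hw i * V i) V V V j
 + qmaj J V V (%i. hw i * V i) V V j + qmaj J V V V (%i. hw i * V i) V j + qmaj J V V V V (%i. hw i * V i) j)"
 unfolding qmaj_def sum.distrib[symmetric] sum_distrib_left
proof (rule sum_mono, elim SigmaE, simp only: prod.case)
 fix a b c d e :: int
 show "hw j * (if a + b + c = d + e + j then V a * V b * V c * V d * V e else 0) <= 390625 *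
 ((if a + b + c = d + e + j then hw a * V a * V b * V c * V d * V e else 0) + (if a + b + c = d + e + j then V a * (hw b * V b) * V c * V d * V e else 0)
 + (if a + b + c = d + e + j then V a * V b * (hw c * V c) * V d * V e else 0) + (if a + b + c = d + e + j then V a * V b * V c * (hw d * V d) * V e else 0)
 + (if a + b + c = d + e + j then V a * V b * V c * V d * (hw e * V e) else 0))"
 proof (cases "a + b + c = d + e + j")
 case True
 have "hw j * (V a * V b * V c * V d * V e) <= (390625 * (hw a + hw b + hw c + hw d + hw e)) * (V a * V b * V c * V d * V e)"
 using assms by (intro mult_right_mono hw_sum True) auto
 then show ?thesis using True by (simp add: algebra_simps)
 qed simp
qed

text \<open>The weight is distributed over the five factors and the weighted factor is measured in
  l^2, the others in l^1, where 23 bounds them independently of \<open>J\<close>. The rate rounds up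
  2 * 390625 * 5 * 23^4 / 100000.\<close>

lemma galerkin_growth:
 assumes fin: "finite J" and g: "galerkin l J v" and l: "\<bar>l\<bar> <= 1 / 100000"
 and n: "!!s. 0 <= s ==> n1 J (v s) <= 23" and t: "0 <= t"
 shows "(\<Sum>j\<in>J. (hw j * cmod (v t j))\<^sup>2) <= (\<Sum>j\<in>J. (hw j * cmod (v 0 j))\<^sup>2) * exp (11000000 * t)"
proof -
 define S where "S s = (\<Sum>j\<in>J. (hw j)\<^sup>2 * (cmod (v s j))\<^sup>2)" for s
 define S' where "S' s = 2 * l * (\<Sum>j\<in>J. (hw j)\<^sup>2 * Im (cnj (v s j) * qsum J (kF s) (v s) (v s) (v s) (v s) (v s) j))" for s
 have "S t <= (S 0 + 0 * t) * exp (11000000 * t)"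
 proof (rule gronwall[of t S S'])
 fix s assume "s : {0..t}"
 then have s: "0 <= s" by simp
 show "(S hrd S' s) (at s)" unfolding S_def S'_def by (rule galerkin_weighted_derivative[OF fin g])
 define V where "V i = cmod (v s i)" for i
 define X where "X i = hw i * V i" for i
 have V0: "0 <= V i" and X0: "0 <= X i" for i by (simp_all add: V_def X_def)
 have VB: "sum V J <= 23" using n[OF s] by (simp add: n1_def V_def)
 have "\<bar>\<Sum>j\<in>J. (hw j)\<^sup>2 * Im (cnj (v s j) * qsum J (kF s) (v s) (v s) (v s) (v s) (v s) j)\<bar> <= (\<Sum>j\<in>J. X j * (hw j * qmaj J V V V V V j))"
 proof (rule order_trans[OF sum_abs], rule sum_mono)
 fix j
 have "\<bar>Im (cnj (v s j) * qsum J (kF s) (v s) (v s) (v s) (v s) (v s) j)\<bar> <= V j * cmod (qsum J (kF s) (v s) (v s) (v s) (v s) (v s) j)"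
 using abs_Im_le_cmod[of "cnj (v s j) * qsum J (kF s) (v s) (v s) (v s) (v s) (v s) j"] by (simp add: norm_mult V_def)
 also have "\<dots> <= V j * qmaj J V V V V V j"
 using qsum_norm_le[of "kF s" 1 J "v s" "v s" "v s" "v s" "v s" j] V0 by (intro mult_left_mono) (simp_all add: V_def[abs_def])
 finally have "(hw j)\<^sup>2 * \<bar>Im (cnj (v s j) * qsum J (kF s) (v s) (v s) (v s) (v s) (v s) j)\<bar> <= (hw j)\<^sup>2 * (V j * qmaj J V V V V V j)"
 by (rule mult_left_mono) simp
 then show "\<bar>(hw j)\<^sup>2 * Im (cnj (v s j) * qsum J (kF s) (v s) (v s) (v s) (v s) (v s) j)\<bar> <= X j * (hw j * qmaj J V V V V V j)"
 by (simp add: abs_mult X_def power2_eq_square mult_ac)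
 qed
 also have "\<dots> <= (\<Sum>j\<in>J. X j * (390625 * (qmaj J X V V V V j + qmaj J V X V V V j + qmaj J V V X V V j + qmaj J V V V X V j + qmaj J V V V V X j)))"
 using qmaj_hw[of V] V0 X0 unfolding X_def[abs_def] by (intro sum_mono mult_left_mono) auto
 also have "\<dots> = 390625 * ((\<Sum>j\<in>J. X j * qmaj J X V V V V j) + (\<Sum>j\<in>J. X j * qmaj J V X V V V j) + (\<Sum>j\<in>J. X j * qmaj J V V X V V j)
 + (\<Sum>j\<in>J. X j * qmaj J V V V X V j) + (\<Sum>j\<in>J. X j * qmaj J V V V V X j))"
 by (simp only: sum.distrib[symmetric] sum_distrib_left) (simp add: algebra_simps)
 also have "\<dots> <= 390625 * (5 * (L2_set X J * L2_set X J * 23 ^ 4))"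
 using qmaj_six_slots[where x = X and p = X and V = V, OF fin X0 X0 V0 VB] by simp
 also have "L2_set X J * L2_set X J = S s"
 by (simp add: L2_set_def S_def X_def V_def power_mult_distrib sum_nonneg)
 finally have b: "\<bar>\<Sum>j\<in>J. (hw j)\<^sup>2 * Im (cnj (v s j) * qsum J (kF s) (v s) (v s) (v s) (v s) (v s) j)\<bar> <= 390625 * (5 * (S s * 23 ^ 4))" .
 have S0: "0 <= S s" by (simp add: S_def sum_nonneg)
 have "S' s <= \<bar>S' s\<bar>" by simp
 also have "\<dots> <= (2 * (1 / 100000)) * (390625 * (5 * (S s * 23 ^ 4)))"
 unfolding S'_def abs_mult using l b by (intro mult_mono) auto
 also have "\<dots> <= 11000000 * S s + 0" using S0 by simp
 finally show "S' s <= 11000000 * S s + 0" .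
 qed (use t in auto)
 then show ?thesis by (simp add: S_def power_mult_distrib)
qed

text \<open>On \<open>J' - J\<close> the quintic sum of \<open>v\<close> has no counterpart in the
  smaller system. There \<open>v\<close> vanishes, so the difference is \<open>v'\<close> itself, at
  most \<open>dlt\<close>, paired with an l^1 bound. Everything else is a Lipschitz term in
  l^2.\<close>

lemma galerkin_difference:
 assumes fin: "finite J'" and J: "J \<subseteq> J'" and g: "galerkin l J v" and g': "galerkin l J' v'" and l: "\<bar>l\<bar> <= 1 / 100000"
 and init: "!!j. v 0 j = v' 0 j"
 and n: "!!s. 0 <= s ==> n1 J (v s) <= 23" and n': "!!s. 0 <= s ==> n1 J' (v' s) <= 23"
 and dlt: "!!s j. s : {0..t} ==> j : J' - J ==> cmod (v' s j) <= dlt" "0 <= dlt" and t: "0 <= t"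
 shows "(\<Sum>j\<in>J'. (cmod (v' t j - v t j))\<^sup>2) <= 200 * dlt * t * exp (30 * t)"
proof -
 have finJ: "finite J" using fin J by (rule finite_subset[rotated])
 have vz: "v s j = 0" if "j \<notin> J" for s j using g that by (simp add: galerkin_def)
 define Q where "Q s w = qsum J' (kF s) w w w w w" for s w
 define d where "d s j = v' s j - v s j" for s j
 define d' where "d' s j = - \<i> * l * (Q s (v' s) j - (if j : J then Q s (v s) j else 0))" for s j
 have QJ: "qsum J (kF s) (v s) (v s) (v s) (v s) (v s) j = Q s (v s) j" for s j
 unfolding Q_def by (rule qsum_support[symmetric]) (use fin J vz in auto)
 have dd: "((%s. d s j) hvd d' s j) (at s)" if "j : J'" for s j
 proof (cases "j : J")
 case True
 have "((%s. d s j) hvd (- \<i> * l * Q s (v' s) j) - (- \<i> * l * Q s (v s) j)) (at s)"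
 unfolding d_def Q_def by (rule has_vector_derivative_diff)
 (use g g' True that QJ in \<open>auto simp: galerkin_def Q_def\<close>)
 then show ?thesis using True by (simp add: d'_def algebra_simps)
 next
 case False
 then have "(%s. d s j) = (%s. v' s j)" by (simp add: d_def vz)
 then show ?thesis using g' that False by (simp add: galerkin_def d'_def Q_def)
 qed
 define S where "S s = (\<Sum>j\<in>J'. (cmod (d s j))\<^sup>2)" for s
 define S' where "S' s = (\<Sum>j\<in>J'. 2 * Re (cnj (d s j) * d' s j))" for s
 have "S t <= (S 0 + 200 * dlt * t) * exp (30 * t)"
 proof (rule gronwall[of t S S'])
 fix s assume s: "s : {0..t}"
 then have s0: "0 <= s" by simp
 show "(S hrd S' s) (at s)" unfolding S_def S'_def
 by (intro DERIV_sum has_real_derivative_cmod_sq dd)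
 define V W D where "V i = cmod (v' s i)" and "W i = cmod (v s i)" and "D i = cmod (d s i)" for i
 have nn: "0 <= V i" "0 <= W i" "0 <= D i" for i by (simp_all add: V_def W_def D_def)
 have VB: "sum V J' <= 23" using n'[OF s0] by (simp add: n1_def V_def)
 have "sum W J' = sum W J" using J fin vz by (intro sum.mono_neutral_right) (auto simp: W_def)
 then have WB: "sum W J' <= 23" using n[OF s0] by (simp add: n1_def W_def)
 have Q_diff: "cmod (Q s (v' s) j - Q s (v s) j) <= qmaj J' D V V V V j + qmaj J' W D V V V j + qmaj J' W W D V V j + qmaj J' W W W D V j + qmaj J' W W W W D j" for j
 unfolding Q_def qsum_diff
 by (intro order_trans[OF norm_triangle_ineq] add_mono order_trans[OF qsum_norm_le[where k = 1]])
 (simp_all add: V_def[abs_def] W_def[abs_def] D_def[abs_def] d_def[abs_def])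
 have e1: "L2_set D J' * L2_set D J' = S s" by (simp add: L2_set_def S_def D_def sum_nonneg)
 have prod4: "S s * a * b * c * e <= S s * 279841" if "0 <= a" "0 <= b" "0 <= c" "0 <= e" "a <= 23" "b <= 23" "c <= 23" "e <= 23" for a b c e
 proof -
 have "a * b * c * e <= 23 * 23 * 23 * 23" using that by (intro mult_mono) auto
 then have "S s * (a * b * c * e) <= S s * 279841" by (intro mult_left_mono) (auto simp: S_def sum_nonneg)
 then show ?thesis by (simp add: mult_ac)
 qed
 have sm: "0 <= sum V J'" "0 <= sum W J'" using nn by (simp_all add: sum_nonneg)
 have s1: "(\<Sum>j\<in>J'. D j * qmaj J' D V V V V j) <= S s * 279841"
 using qmaj_six1[where x = D and p = D and q = V and r = V and s = V and t = V, OF fin nn(3) nn(3) nn(1) nn(1) nn(1) nn(1)] prod4[OF sm(1) sm(1) sm(1) sm(1) VB VB VB VB] unfolding e1 by (rule order_trans)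
 have s2: "(\<Sum>j\<in>J'. D j * qmaj J' W D V V V j) <= S s * 279841"
 using qmaj_six1[where x = D and p = D and q = W and r = V and s = V and t = V, OF fin nn(3) nn(3) nn(2) nn(1) nn(1) nn(1)] prod4[OF sm(2) sm(1) sm(1) sm(1) WB VB VB VB] unfolding e1
 by (subst qmaj_swap12) (rule order_trans)
 have s3: "(\<Sum>j\<in>J'. D j * qmaj J' W W D V V j) <= S s * 279841"
 using qmaj_six1[where x = D and p = D and q = W and r = W and s = V and t = V, OF fin nn(3) nn(3) nn(2) nn(2) nn(1) nn(1)] prod4[OF sm(2) sm(2) sm(1) sm(1) WB WB VB VB] unfolding e1
 by (subst qmaj_swap23, subst qmaj_swap12) (rule order_trans)
 have s4: "(\<Sum>j\<in>J'. D j * qmaj J' W W W D V j) <= S s * 279841"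
 using qmaj_six4[where x = D and p = W and q = W and r = W and s = D and t = V, OF fin nn(3) nn(2) nn(2) nn(2) nn(3) nn(1)] prod4[OF sm(2) sm(2) sm(2) sm(1) WB WB WB VB] unfolding e1 by (rule order_trans)
 have s5: "(\<Sum>j\<in>J'. D j * qmaj J' W W W W D j) <= S s * 279841"
 using qmaj_six4[where x = D and p = W and q = W and r = W and s = D and t = W, OF fin nn(3) nn(2) nn(2) nn(2) nn(3) nn(2)] prod4[OF sm(2) sm(2) sm(2) sm(2) WB WB WB WB] unfolding e1
 by (subst qmaj_swap45) (rule order_trans)
 have Q1: "n1 (J' - J) (Q s (v s)) <= 23 ^ 5"
 proof -
 have "n1 (J' - J) (Q s (v s)) <= sum W J' * sum W J' * sum W J' * sum W J' * sum W J'"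
 unfolding Q_def W_def using fin qsum_n1[of "J' - J" "kF s" J' "v s" "v s" "v s" "v s" "v s"] by (simp add: n1_def)
 also have "\<dots> <= 23 * 23 * 23 * 23 * 23" using sm WB by (intro mult_mono) auto
 finally show ?thesis by simp
 qed
 have "S' s <= (\<Sum>j\<in>J'. 2 * \<bar>l\<bar> * (D j * cmod (Q s (v' s) j - Q s (v s) j)) + 2 * \<bar>l\<bar> * (if j : J then 0 else dlt * cmod (Q s (v s) j)))"
 unfolding S'_def
 proof (rule sum_mono)
 fix j assume j: "j : J'"
 have "2 * Re (cnj (d s j) * d' s j) <= 2 * cmod (cnj (d s j) * d' s j)" by (intro mult_left_mono complex_Re_le_cmod) simp
 also have "\<dots> = 2 * \<bar>l\<bar> * (D j * cmod (Q s (v' s) j - (if j : J then Q s (v s) j else 0)))"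
 by (simp add: norm_mult d'_def D_def)
 also have "\<dots> <= 2 * \<bar>l\<bar> * (D j * cmod (Q s (v' s) j - Q s (v s) j) + (if j : J then 0 else dlt * cmod (Q s (v s) j)))"
 proof (rule mult_left_mono)
 show "D j * cmod (Q s (v' s) j - (if j : J then Q s (v s) j else 0)) <= D j * cmod (Q s (v' s) j - Q s (v s) j) + (if j : J then 0 else dlt * cmod (Q s (v s) j))"
 proof (cases "j : J")
 case False
 have "D j <= dlt" using dlt(1)[OF s, of j] False j by (simp add: D_def d_def vz)
 then have "D j * cmod (Q s (v s) j) <= dlt * cmod (Q s (v s) j)" by (rule mult_right_mono) simp
 moreover have "cmod (Q s (v' s) j) <= cmod (Q s (v' s) j - Q s (v s) j) + cmod (Q s (v s) j)"
 by (metis diff_add_cancel norm_triangle_ineq)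
 then have "D j * cmod (Q s (v' s) j) <= D j * (cmod (Q s (v' s) j - Q s (v s) j) + cmod (Q s (v s) j))" using nn by (intro mult_left_mono) auto
 ultimately show ?thesis using False by (simp add: algebra_simps)
 qed simp
 qed simp
 finally show "2 * Re (cnj (d s j) * d' s j) <= 2 * \<bar>l\<bar> * (D j * cmod (Q s (v' s) j - Q s (v s) j)) + 2 * \<bar>l\<bar> * (if j : J then 0 else dlt * cmod (Q s (v s) j))"
 by (simp add: distrib_left)
 qed
 also have "\<dots> = 2 * \<bar>l\<bar> * ((\<Sum>j\<in>J'. D j * cmod (Q s (v' s) j - Q s (v s) j)) + dlt * n1 (J' - J) (Q s (v s)))"
 proof -
 have "(\<Sum>j\<in>J'. if j : J then 0 else dlt * cmod (Q s (v s) j)) = (\<Sum>j\<in>J' - J. dlt * cmod (Q s (v s) j))"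
 by (rule sum.mono_neutral_cong_right) (use fin in auto)
 then show ?thesis by (simp only: sum.distrib sum_distrib_left[symmetric] n1_def distrib_left)
 qed
 also have "\<dots> <= 2 * \<bar>l\<bar> * (5 * (S s * 279841) + dlt * 23 ^ 5)"
 proof (intro mult_left_mono add_mono Q1)
 have "(\<Sum>j\<in>J'. D j * cmod (Q s (v' s) j - Q s (v s) j)) <= (\<Sum>j\<in>J'. D j * (qmaj J' D V V V V j + qmaj J' W D V V V j + qmaj J' W W D V V j + qmaj J' W W W D V j + qmaj J' W W W W D j))"
 using nn by (intro sum_mono mult_left_mono Q_diff) auto
 also have "\<dots> <= 5 * (S s * 279841)" unfolding distrib_left sum.distrib using s1 s2 s3 s4 s5 by linarith
 finally show "(\<Sum>j\<in>J'. D j * cmod (Q s (v' s) j - Q s (v s) j)) <= 5 * (S s * 279841)" .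
 qed (use dlt in auto)
 also have "\<dots> <= 2 * (1 / 100000) * (5 * (S s * 279841) + dlt * 23 ^ 5)"
 using l dlt(2) by (intro mult_right_mono) (auto simp: S_def sum_nonneg)
 also have "\<dots> <= 30 * S s + 200 * dlt"
 proof -
 have "0 <= S s" by (simp add: S_def sum_nonneg)
 then show ?thesis using dlt(2) by simp
 qed
 finally show "S' s <= 30 * S s + 200 * dlt" .
 qed (use t dlt(2) in auto)
 moreover have "S 0 = 0" by (simp add: S_def d_def init)
 ultimately show ?thesis by (simp add: S_def d_def)
qed

section \<open>Classical solutions\<close>

lemma has_vector_derivative_uniform_limit:
 fixes f :: "nat => real => complex"
 assumes S: "convex S" "open S" and d: "!!n x. x : S ==> (f n hvd f' n x) (at x)"
 and le: "!!n x. m <= n ==> x : S ==> cmod (f' n x - g' x) <= e n" and e: "e \<longlonglongrightarrow> 0"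
 and lim: "!!x. x : S ==> (%n. f n x) \<longlonglongrightarrow> g x" and x: "x : S"
 shows "(g hvd g' x) (at x)"
proof -
 have "\<exists>h. \<forall>y\<in>S. (%n. f n y) \<longlonglongrightarrow> h y & (h has_derivative (%z. z *\<^sub>R g' y)) (at y within S)"
 proof (rule has_derivative_sequence[where f = f and f' = "%n y z. z *\<^sub>R f' n y" and g' = "%y z. z *\<^sub>R g' y", OF S(1) _ _ x lim[OF x]])
 show "(f n has_derivative (%z. z *\<^sub>R f' n y)) (at y within S)" if "y : S" for n y
 using d[OF that, of n] unfolding has_vector_derivative_def by (rule has_derivative_at_withinI)
 fix eps :: real assume "0 < eps"
 then have "\<forall>\<^sub>F n in sequentially. e n < eps" by (rule order_tendstoD(2)[OF e])
 then show "\<forall>\<^sub>F n in sequentially. \<forall>y\<in>S. \<forall>h. cmod (h *\<^sub>R f' n y - h *\<^sub>R g' y) <= eps * norm h"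
 using eventually_ge_at_top[of m]
 proof eventually_elim
 case (elim n)
 show ?case
 proof (intro ballI allI)
 fix y h assume "y : S"
 have "cmod (h *\<^sub>R f' n y - h *\<^sub>R g' y) = \<bar>h\<bar> * cmod (f' n y - g' y)" by (simp flip: scaleR_diff_right)
 also have "\<dots> <= \<bar>h\<bar> * eps" using le[OF elim(2) \<open>y : S\<close>] elim(1) by (intro mult_left_mono) auto
 finally show "cmod (h *\<^sub>R f' n y - h *\<^sub>R g' y) <= eps * norm h" by (simp add: mult.commute)
 qed
 qed
 qed
 then obtain h where h: "!!y. y : S ==> (%n. f n y) \<longlonglongrightarrow> h y" "!!y. y : S ==> (h has_derivative (%z. z *\<^sub>R g' y)) (at y within S)" by blast
 have hg: "h y = g y" if "y : S" for y using LIMSEQ_unique[OF h(1)[OF that] lim[OF that]] .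
 have "(h hvd g' x) (at x)"
 using h(2)[OF x] unfolding at_within_open[OF x S(2)] has_vector_derivative_def .
 then show ?thesis by (rule has_vector_derivative_transform_within_open[OF _ S(2) x]) (rule hg)
qed

lemma cmod_pow4_eq: "cpx (cmod z ^ 4) * z = z * z * z * cnj z * cnj z"
proof -
 have "cpx (cmod z ^ 4) = (cpx ((cmod z)\<^sup>2))\<^sup>2" by (simp flip: power_mult)
 also have "\<dots> = (z * cnj z)\<^sup>2" by (simp only: complex_norm_square)
 finally show ?thesis by (simp add: power2_eq_square mult_ac)
qed

lemma quintic_lipschitz:
 assumes z: "cmod z <= B" and w: "cmod w <= B"
 shows "cmod (cpx (cmod z ^ 4) * z - cpx (cmod w ^ 4) * w) <= 5 * B ^ 4 * cmod (z - w)"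
proof -
 define d where "d = z - w"
 have B: "0 <= B" using z norm_ge_zero order_trans by blast
 have e: "cpx (cmod z ^ 4) * z - cpx (cmod w ^ 4) * w =
 d * z * z * cnj z * cnj z + w * d * z * cnj z * cnj z + w * w * d * cnj z * cnj z + w * w * w * cnj d * cnj z + w * w * w * cnj w * cnj d"
 unfolding cmod_pow4_eq d_def by (simp add: algebra_simps)
 have p: "x * y * u * v * cmod d <= B ^ 4 * cmod d" if "0 <= x" "0 <= y" "0 <= u" "0 <= v" "x <= B" "y <= B" "u <= B" "v <= B" for x y u v
 proof -
 have "x * y * u * v <= B * B * B * B" using that by (intro mult_mono) auto
 then show ?thesis by (intro mult_right_mono) (auto simp: eval_nat_numeral mult_ac)
 qed
 note P = p[OF norm_ge_zero norm_ge_zero norm_ge_zero norm_ge_zero]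
 have "cmod (d * z * z * cnj z * cnj z) <= B ^ 4 * cmod d" "cmod (w * d * z * cnj z * cnj z) <= B ^ 4 * cmod d"
 "cmod (w * w * d * cnj z * cnj z) <= B ^ 4 * cmod d" "cmod (w * w * w * cnj d * cnj z) <= B ^ 4 * cmod d" "cmod (w * w * w * cnj w * cnj d) <= B ^ 4 * cmod d"
 using P[OF z z z z] P[OF w z z z] P[OF w w z z] P[OF w w w z] P[OF w w w w] by (simp_all add: norm_mult mult_ac)
 then show ?thesis unfolding e
 using norm_triangle_ineq[of "d * z * z * cnj z * cnj z + w * d * z * cnj z * cnj z + w * w * d * cnj z * cnj z + w * w * w * cnj d * cnj z" "w * w * w * cnj w * cnj d"]
 norm_triangle_ineq[of "d * z * z * cnj z * cnj z + w * d * z * cnj z * cnj z + w * w * d * cnj z * cnj z" "w * w * w * cnj d * cnj z"]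
 norm_triangle_ineq[of "d * z * z * cnj z * cnj z + w * d * z * cnj z * cnj z" "w * w * d * cnj z * cnj z"]
 norm_triangle_ineq[of "d * z * z * cnj z * cnj z" "w * d * z * cnj z * cnj z"]
 by (simp add: d_def)
qed

definition JN :: "nat => int set" where "JN N = {- int N..int N}"

lemma finite_JN [simp]: "finite (JN N)" by (simp add: JN_def)

text \<open>Truncations with \<open>N\<close> below 2 cut off part of the initial data, so all
  estimates start at 2.\<close>

locale galerkin_family =
 fixes l :: real and c :: "int => complex" and V :: "nat => real => int => complex"
 assumes l: "\<bar>l\<bar> <= 1 / 100000"
 and supp: "!!j. 2 < \<bar>j\<bar> ==> c j = 0"
 and mass: "(\<Sum>j\<in>JN 2. (cmod (c j))\<^sup>2) <= 5" and kin: "(\<Sum>j\<in>JN 2. (rl j)\<^sup>2 * (cmod (c j))\<^sup>2) <= 17"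
 and gal: "!!N. galerkin l (JN N) (V N)" and init: "!!N j. j : JN N ==> V N 0 j = c j"
begin

lemma V_0: "j \<notin> JN N ==> V N t j = 0" using gal[of N] by (simp add: galerkin_def)

lemma init': "2 <= N ==> V N 0 j = c j"
 using init[of j N] V_0[of j N 0] supp[of j] by (cases "j : JN N") (auto simp: JN_def)

lemma sum_init:
 fixes f :: "int => real"
 assumes "2 <= N" "!!j. c j = 0 ==> f j = 0"
 shows "sum f (JN N) = sum f (JN 2)"
proof (rule sum.mono_neutral_right)
 show "JN 2 \<subseteq> JN N" using assms by (auto simp: JN_def)
 show "\<forall>i\<in>JN N - JN 2. f i = 0" using assms supp by (auto simp: JN_def)
qed simp

definition S0 :: real where "S0 = (\<Sum>j\<in>JN 2. (hw j * cmod (c j))\<^sup>2)"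
definition Ab :: "real => real" where "Ab T = sqrt (S0 * exp (11000000 * T))"

lemma S0_nonneg [simp]: "0 <= S0" by (simp add: S0_def sum_nonneg)
lemma Ab_nonneg [simp]: "0 <= Ab T" by (simp add: Ab_def)

lemma bounds_forward:
 assumes N: "2 <= N" and g: "galerkin l (JN N) v" and i: "!!j. cmod (v 0 j) = cmod (c j)" and t: "0 <= t"
 shows "n1 (JN N) (v t) <= 23" "hw j * cmod (v t j) <= Ab t"
proof -
 have m: "(\<Sum>j\<in>JN N. (cmod (v 0 j))\<^sup>2) <= 5"
 unfolding i using sum_init[OF N, of "%j. (cmod (c j))\<^sup>2"] mass by simp
 have k: "(\<Sum>j\<in>JN N. (rl j)\<^sup>2 * (cmod (v 0 j))\<^sup>2) <= 17"
 unfolding i using sum_init[OF N, of "%j. (rl j)\<^sup>2 * (cmod (c j))\<^sup>2"] kin by simp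
 have n: "n1 (JN N) (v s) <= 23" if "0 <= s" for s
 by (rule galerkin_h1_bound(2)[OF finite_JN g l m k that])
 then show "n1 (JN N) (v t) <= 23" using t by blast
 have "(\<Sum>j\<in>JN N. (hw j * cmod (v 0 j))\<^sup>2) = S0"
 unfolding i S0_def by (rule sum_init[OF N]) simp
 then have S: "(\<Sum>j\<in>JN N. (hw j * cmod (v t j))\<^sup>2) <= S0 * exp (11000000 * t)"
 using galerkin_growth[OF finite_JN g l n t] by simp
 show "hw j * cmod (v t j) <= Ab t"
 proof (cases "j : JN N")
 case True
 have "(hw j * cmod (v t j))\<^sup>2 <= (\<Sum>j\<in>JN N. (hw j * cmod (v t j))\<^sup>2)" using True by (intro member_le_sum) auto
 then show ?thesis using S unfolding Ab_def by (intro real_le_rsqrt) simp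
 next
 case False
 then show ?thesis using g by (simp add: galerkin_def)
 qed
qed

lemma reversed: "galerkin l (JN N) (%t j. cnj (V N (- t) j))" by (rule galerkin_reverse[OF gal])

lemma n1_V: assumes N: "2 <= N" shows "n1 (JN N) (V N t) <= 23"
proof (cases "0 <= t")
 case True then show ?thesis using bounds_forward(1)[OF N gal] init'[OF N] by simp
next
 case False
 then show ?thesis using bounds_forward(1)[OF N reversed, of "- t"] init'[OF N] by (simp add: n1_def)
qed

lemma Ab_mono: "S <= T ==> Ab S <= Ab T" unfolding Ab_def by (simp add: mult_left_mono)

lemma hw_V: assumes N: "2 <= N" and t: "\<bar>t\<bar> <= T" shows "cmod (V N t j) <= Ab T / hw j"
proof -
 have "hw j * cmod (V N t j) <= Ab \<bar>t\<bar>"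
 proof (cases "0 <= t")
 case True then show ?thesis using bounds_forward(2)[OF N gal] init'[OF N] by simp
 next
 case False
 then show ?thesis using bounds_forward(2)[OF N reversed, of "- t" j] init'[OF N] by simp
 qed
 also have "\<dots> <= Ab T" by (rule Ab_mono[OF t])
 finally show ?thesis using hw_pos[of j] by (simp add: field_simps)
qed

text \<open>\<open>Eb\<close> bounds the distance of each mode between two truncations through the
  tail beyond \<open>N\<close>; \<open>Gb\<close> does so in a norm strong enough for two space
  derivatives and, through the equation, one time derivative.\<close>

definition Eb :: "real => nat => real" where "Eb T N = sqrt (200 * (Ab T / (1 + real N)) * T * exp (30 * T))"
definition Gb :: "real => nat => real" where "Gb T N = 5 * sqrt (2 * Ab T * Eb T N)"

lemma Eb_lim: "Eb T \<longlonglongrightarrow> 0"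
proof -
 have "(%N. sqrt (200 * (Ab T / (1 + real N)) * T * exp (30 * T))) \<longlonglongrightarrow> sqrt (200 * 0 * T * exp (30 * T))"
 by (intro tendsto_intros tendsto_divide_0[OF tendsto_const] filterlim_at_top_imp_at_infinity
 filterlim_tendsto_add_at_top[OF tendsto_const] filterlim_real_sequentially)
 then show ?thesis by (simp add: Eb_def[abs_def])
qed

lemma Gb_lim: "Gb T \<longlonglongrightarrow> 0"
proof -
 have "(%N. 5 * sqrt (2 * Ab T * Eb T N)) \<longlonglongrightarrow> 5 * sqrt (2 * Ab T * 0)"
 by (intro tendsto_intros Eb_lim)
 then show ?thesis by (simp add: Gb_def[abs_def])
qed

lemma hw_outside: "j \<notin> JN N ==> 1 + real N <= hw j"
proof -
 assume "j \<notin> JN N"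
 then have "1 + int N <= \<bar>j\<bar>" by (auto simp: JN_def)
 then have a: "1 + real N <= \<bar>rl j\<bar>" by linarith
 also have "\<bar>rl j\<bar> <= \<bar>rl j\<bar>\<^sup>2" using a by (intro self_le_power) auto
 also have "\<dots> <= 1 + (rl j)\<^sup>2" by simp
 also have "\<dots> <= hw j" unfolding hw_def by (intro self_le_power) auto
 finally show "1 + real N <= hw j" .
qed

lemma diff_forward:
 assumes N: "2 <= N" "N <= N'" and g: "galerkin l (JN N) v" "galerkin l (JN N') v'"
 and i: "!!j. v 0 j = v' 0 j" "!!j. cmod (v' 0 j) = cmod (c j)" and t: "0 <= t" "t <= T"
 shows "cmod (v' t j - v t j) <= Eb T N"
proof -
 have N': "2 <= N'" using N by simp
 have sub: "JN N \<subseteq> JN N'" using N by (auto simp: JN_def)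
 have "(\<Sum>j\<in>JN N'. (cmod (v' t j - v t j))\<^sup>2) <= 200 * (Ab T / (1 + real N)) * t * exp (30 * t)"
 proof (rule galerkin_difference[OF finite_JN sub g l i(1)])
 show "n1 (JN N) (v s) <= 23" if "0 <= s" for s using bounds_forward(1)[OF N(1) g(1) _ that] i by simp
 show "n1 (JN N') (v' s) <= 23" if "0 <= s" for s using bounds_forward(1)[OF N' g(2) i(2) that] .
 fix s k assume s: "s : {0..t}" and k: "k : JN N' - JN N"
 have "hw k * cmod (v' s k) <= Ab s" using bounds_forward(2)[OF N' g(2) i(2)] s by simp
 also have "\<dots> <= Ab T" using s t by (intro Ab_mono) auto
 finally have "(1 + real N) * cmod (v' s k) <= Ab T"
 using hw_outside[of k N] k by (meson DiffD2 mult_right_mono norm_ge_zero order_trans)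
 then show "cmod (v' s k) <= Ab T / (1 + real N)" by (simp add: field_simps)
 qed (use t in auto)
 also have "\<dots> <= 200 * (Ab T / (1 + real N)) * T * exp (30 * T)"
 using t by (intro mult_mono mult_nonneg_nonneg) auto
 finally have b: "(\<Sum>j\<in>JN N'. (cmod (v' t j - v t j))\<^sup>2) <= 200 * (Ab T / (1 + real N)) * T * exp (30 * T)" .
 show ?thesis
 proof (cases "j : JN N'")
 case True
 have "(cmod (v' t j - v t j))\<^sup>2 <= (\<Sum>j\<in>JN N'. (cmod (v' t j - v t j))\<^sup>2)" using True by (intro member_le_sum) auto
 then show ?thesis using b unfolding Eb_def by (intro real_le_rsqrt) simp
 next
 case False
 then have "v' t j = 0" "v t j = 0" using g sub unfolding galerkin_def by blast+
 then show ?thesis unfolding Eb_def using t by simp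
 qed
qed

lemma diff_V:
 assumes N: "2 <= N" "N <= N'" and t: "\<bar>t\<bar> <= T"
 shows "cmod (V N' t j - V N t j) <= Eb T N"
proof -
 have N': "2 <= N'" using N by simp
 show ?thesis
 proof (cases "0 <= t")
 case True
 then show ?thesis using diff_forward[OF N gal gal] init'[OF N(1)] init'[OF N'] t by simp
 next
 case False
 have "cmod (cnj (V N' (- (- t)) j) - cnj (V N (- (- t)) j)) <= Eb T N"
 by (rule diff_forward[OF N reversed reversed]) (use init'[OF N(1)] init'[OF N'] t False in auto)
 then show ?thesis by (simp flip: complex_cnj_diff)
 qed
qed

text \<open>The distance of two truncations is interpolated with the decay of each. The square root
  of 1 / \<open>hw\<close> consists of two powers of 1 / (1 + j^2): one pays for two derivatives,
  the other for the sum over the modes.\<close>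

lemma weighted_diff_V:
 assumes N: "2 <= N" "N <= N'" and t: "\<bar>t\<bar> <= T" and X: "finite X"
 shows "(\<Sum>j\<in>X. (1 + (rl j)\<^sup>2) * cmod (V N' t j - V N t j)) <= Gb T N"
proof -
 have T: "0 <= T" using t by linarith
 have E0: "0 <= Eb T N" unfolding Eb_def using T by simp
 have pt: "(1 + (rl j)\<^sup>2) * cmod (V N' t j - V N t j) <= sqrt (2 * Ab T * Eb T N) * (1 / (1 + (rl j)\<^sup>2))" for j
 proof -
 define q where "q = 1 + (rl j)\<^sup>2"
 have q: "0 < q" by (simp add: q_def add_pos_nonneg)
 have hw: "hw j = (q\<^sup>2)\<^sup>2" by (simp add: hw_def q_def flip: power_mult)
 define d where "d = cmod (V N' t j - V N t j)"
 have d1: "d <= Eb T N" unfolding d_def by (rule diff_V[OF N t])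
 have "d <= cmod (V N' t j) + cmod (V N t j)" unfolding d_def by (rule norm_triangle_ineq4)
 also have "\<dots> <= Ab T / hw j + Ab T / hw j" using N by (intro add_mono hw_V t) auto
 finally have d2: "d <= 2 * Ab T / hw j" by simp
 have d0: "0 <= d" by (simp add: d_def)
 have "d\<^sup>2 <= Eb T N * (2 * Ab T / hw j)" unfolding power2_eq_square using d0 d1 d2 E0 by (intro mult_mono) auto
 then have "(q\<^sup>2 * d)\<^sup>2 <= 2 * Ab T * Eb T N" using q hw_pos[of j] unfolding power_mult_distrib hw[symmetric] by (simp add: field_simps)
 then have "q\<^sup>2 * d <= sqrt (2 * Ab T * Eb T N)" by (rule real_le_rsqrt)
 then have "q * d <= sqrt (2 * Ab T * Eb T N) * (1 / q)" using q by (simp add: field_simps power2_eq_square)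
 then show ?thesis by (simp add: q_def d_def)
 qed
 have "(\<Sum>j\<in>X. (1 + (rl j)\<^sup>2) * cmod (V N' t j - V N t j)) <= (\<Sum>j\<in>X. sqrt (2 * Ab T * Eb T N) * (1 / (1 + (rl j)\<^sup>2)))"
 by (intro sum_mono pt)
 also have "\<dots> <= sqrt (2 * Ab T * Eb T N) * 5"
 unfolding sum_distrib_left[symmetric] using E0 by (intro mult_left_mono sum_inverse_one_plus_sq_le X) auto
 finally show ?thesis by (simp add: Gb_def mult.commute)
qed

definition ph :: "real => real => int => complex" where "ph t x j = cis (rl j * x - (rl j)\<^sup>2 * t)"
text \<open>The multiplier \<open>m\<close> treats the function and its space derivatives at
  once.\<close>

definition P :: "(int => complex) => nat => real => real => complex" where
 "P m N t x = (\<Sum>j\<in>JN N. m j * V N t j * ph t x j)"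

lemma ph_norm [simp]: "cmod (ph t x j) = 1" by (simp add: ph_def)

lemma P_diff:
 assumes m: "!!j. cmod (m j) <= 1 + (rl j)\<^sup>2" and N: "2 <= N" "N <= N'" and t: "\<bar>t\<bar> <= T"
 shows "cmod (P m N' t x - P m N t x) <= Gb T N"
proof -
 have sub: "JN N \<subseteq> JN N'" using N by (auto simp: JN_def)
 have "P m N t x = (\<Sum>j\<in>JN N'. m j * V N t j * ph t x j)"
 unfolding P_def by (rule sum.mono_neutral_left) (use sub V_0 in auto)
 then have "cmod (P m N' t x - P m N t x) = cmod (\<Sum>j\<in>JN N'. m j * (V N' t j - V N t j) * ph t x j)"
 unfolding P_def by (simp add: algebra_simps sum_subtractf)
 also have "\<dots> <= (\<Sum>j\<in>JN N'. (1 + (rl j)\<^sup>2) * cmod (V N' t j - V N t j))"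
 by (rule sum_norm_le) (simp add: norm_mult mult_right_mono m)
 also have "\<dots> <= Gb T N" by (rule weighted_diff_V[OF N t finite_JN])
 finally show ?thesis .
qed

definition L :: "(int => complex) => real => real => complex" where "L m t x = lim (%N. P m N t x)"

lemma P_tendsto:
 assumes m: "!!j. cmod (m j) <= 1 + (rl j)\<^sup>2"
 shows "(%N. P m N t x) \<longlonglongrightarrow> L m t x"
proof -
 have "Cauchy (%N. P m N t x)"
 proof (rule metric_CauchyI)
 fix e :: real assume "0 < e"
 then have "\<forall>\<^sub>F N in sequentially. Gb \<bar>t\<bar> N < e" using Gb_lim by (rule order_tendstoD(2)[rotated])
 then obtain M where M: "!!N. M <= N ==> Gb \<bar>t\<bar> N < e" by (auto simp: eventually_at_top_linorder)
 define K where "K = max M 2"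
 have a: "dist (P m N' t x) (P m N t x) < e" if "K <= N" "N <= N'" for N N'
 unfolding dist_norm using P_diff[OF m, of N N' t "\<bar>t\<bar>" x] M[of N] that by (auto simp: K_def)
 have "dist (P m p t x) (P m q t x) < e" if "K <= p" "K <= q" for p q
 using a[of p q] a[of q p] that by (cases "p <= q") (auto simp: dist_commute)
 then show "\<exists>M. \<forall>p\<ge>M. \<forall>q\<ge>M. dist (P m p t x) (P m q t x) < e" by blast
 qed
 then show ?thesis unfolding L_def by (simp add: Cauchy_convergent_iff convergent_LIMSEQ_iff)
qed

lemma P_L_le:
 assumes m: "!!j. cmod (m j) <= 1 + (rl j)\<^sup>2" and N: "2 <= N" and t: "\<bar>t\<bar> <= T"
 shows "cmod (P m N t x - L m t x) <= Gb T N"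
proof -
 have "(%N'. cmod (P m N' t x - P m N t x)) \<longlonglongrightarrow> cmod (L m t x - P m N t x)"
 by (intro tendsto_intros P_tendsto m)
 moreover have "\<forall>\<^sub>F N' in sequentially. cmod (P m N' t x - P m N t x) <= Gb T N"
 using eventually_ge_at_top[of N] by eventually_elim (rule P_diff[OF m N _ t])
 ultimately have "cmod (L m t x - P m N t x) <= Gb T N" by (rule tendsto_upperbound) simp
 then show ?thesis by (simp add: norm_minus_commute)
qed

lemma V_continuous: "continuous_on X (%t. V N t j)"
proof (cases "j : JN N")
 case True
 then have "!!t. ((%t. V N t j) hvd - \<i> * l * qsum (JN N) (kF t) (V N t) (V N t) (V N t) (V N t) (V N t) j) (at t)"
 using gal[of N] by (simp add: galerkin_def)
 then have "continuous (at t) (%t. V N t j)" for t using has_vector_derivative_continuous by blast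
 then show ?thesis by (simp add: continuous_at_imp_continuous_on)
qed (simp add: V_0)

lemma P_continuous: "continuous_on X (%(t, x). P m N t x)"
 unfolding P_def ph_def case_prod_unfold cis_conv_exp
 by (intro continuous_intros continuous_on_compose2[OF V_continuous[of UNIV]]) auto

lemma L_continuous:
 assumes m: "!!j. cmod (m j) <= 1 + (rl j)\<^sup>2"
 shows "continuous_on UNIV (%(t, x). L m t x)"
proof -
 have "continuous_on ({-T<..<T} \<times> UNIV) (%(t, x). L m t x)" for T
 proof (rule uniform_limit_theorem[where f = "%N (t, x). P m N t x" and F = sequentially])
 show "\<forall>\<^sub>F N in sequentially. continuous_on ({-T<..<T} \<times> UNIV) (%(t, x). P m N t x)"
 by (intro always_eventually allI P_continuous)
 show "uniform_limit ({-T<..<T} \<times> UNIV) (%N (t, x). P m N t x) (%(t, x). L m t x) sequentially"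
 unfolding uniform_limit_iff
 proof (intro allI impI)
 fix e :: real assume "0 < e"
 then have "\<forall>\<^sub>F N in sequentially. Gb T N < e" using Gb_lim by (rule order_tendstoD(2)[rotated])
 then show "\<forall>\<^sub>F N in sequentially. \<forall>y\<in>{-T<..<T} \<times> UNIV. dist (case y of (t, x) => P m N t x) (case y of (t, x) => L m t x) < e"
 using eventually_ge_at_top[of 2]
 proof eventually_elim
 case (elim N)
 then show ?case by (auto simp: dist_norm intro!: le_less_trans[OF P_L_le[OF m elim(2), where T = T]])
 qed
 qed
 qed simp
 then have "continuous_on (\<Union>n. {- real n<..<real n} \<times> UNIV) (%(t, x). L m t x)"
 by (intro continuous_on_open_UN open_Times) auto
 moreover have "(\<Union>n. {- real n<..<real n} \<times> (UNIV :: real set)) = UNIV"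
 proof -
 have "\<exists>n. - real n < t & t < real n" for t :: real
 using reals_Archimedean2[of "\<bar>t\<bar>"] by (auto simp: abs_less_iff minus_less_iff)
 then show ?thesis by (auto simp: set_eq_iff)
 qed
 ultimately show ?thesis by simp
qed

lemma ph_dx: "((%x. ph t x j) hvd \<i> * of_int j * ph t x j) (at x)"
proof -
 have "((%z. exp (\<i> * (of_int j * z - of_real ((rl j)\<^sup>2 * t)))) has_field_derivative \<i> * of_int j * exp (\<i> * (of_int j * of_real x - of_real ((rl j)\<^sup>2 * t)))) (at (cpx x))"
 by (auto intro!: derivative_eq_intros)
 from has_vector_derivative_real_field[OF this, of UNIV] show ?thesis
 by (simp add: ph_def cis_conv_exp)
qed

lemma ph_dt: "((%t. ph t x j) hvd - \<i> * (of_int j)\<^sup>2 * ph t x j) (at t)"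
proof -
 have "((%z. exp (\<i> * (of_real (rl j * x) - (of_int j)\<^sup>2 * z))) has_field_derivative - \<i> * (of_int j)\<^sup>2 * exp (\<i> * (of_real (rl j * x) - (of_int j)\<^sup>2 * of_real t))) (at (cpx t))"
 by (auto intro!: derivative_eq_intros)
 from has_vector_derivative_real_field[OF this, of UNIV] show ?thesis
 by (simp add: ph_def cis_conv_exp)
qed

lemma P_dx: "(P m N t hvd P (%j. \<i> * of_int j * m j) N t x) (at x)"
proof -
 have "((%x. \<Sum>j\<in>JN N. m j * V N t j * ph t x j) hvd (\<Sum>j\<in>JN N. m j * V N t j * (\<i> * of_int j * ph t x j))) (at x)"
 by (intro has_vector_derivative_sum has_vector_derivative_mult_right ph_dx)
 then show ?thesis unfolding P_def[abs_def] by (simp add: mult_ac)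
qed

lemma L_dx:
 assumes m: "!!j. cmod (m j) <= 1 + (rl j)\<^sup>2" and m': "!!j. cmod (\<i> * of_int j * m j) <= 1 + (rl j)\<^sup>2"
 shows "(L m t hvd L (%j. \<i> * of_int j * m j) t x) (at x)"
 by (rule has_vector_derivative_uniform_limit[of UNIV "%N. P m N t" "%N. P (%j. \<i> * of_int j * m j) N t" 2 _ "Gb \<bar>t\<bar>"])
 (auto intro: P_dx P_tendsto m Gb_lim P_L_le[OF m'])

lemma P1_norm: "2 <= N ==> cmod (P (%_. 1) N t x) <= 23"
proof -
 assume N: "2 <= N"
 have "cmod (P (%_. 1) N t x) <= n1 (JN N) (V N t)" unfolding P_def n1_def by (rule sum_norm_le) (simp add: norm_mult)
 then show ?thesis using n1_V[OF N, of t] by simp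
qed

text \<open>The truncation discards only tuples whose output frequency leaves \<open>JN N\<close>.
  The moduli of their indices add up to at least \<open>N\<close>, so a factor 1 / N is gained at
  the cost of one derivative in one of the five slots, whose l^1 norm is at most five times
  \<open>Ab T\<close>.\<close>

lemma product_expansion:
 assumes N: "2 <= N" and t: "\<bar>t\<bar> <= T"
 shows "cmod ((\<Sum>j\<in>JN N. qsum (JN N) (kF t) (V N t) (V N t) (V N t) (V N t) (V N t) j * ph t x j)
 - cpx (cmod (P (%_. 1) N t x) ^ 4) * P (%_. 1) N t x) <= 25 * 23 ^ 4 * Ab T / real N"
proof -
 define U where "U k = V N t k * ph t x k" for k
 define J where "J = JN N"
 have finJ: "finite J" by (simp add: J_def)
 have PU: "P (%_. 1) N t x = sum U J" by (simp add: P_def U_def J_def)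
 define F where "F a b c d e = U a * U b * U c * cnj (U d) * cnj (U e)" for a b c d e
 have "cpx (cmod (sum U J) ^ 4) * sum U J = sum U J * sum U J * sum U J * (\<Sum>d\<in>J. cnj (U d)) * (\<Sum>e\<in>J. cnj (U e))"
 unfolding cmod_pow4_eq cnj_sum ..
 also have "\<dots> = (\<Sum>a\<in>J. \<Sum>b\<in>J. \<Sum>c\<in>J. \<Sum>d\<in>J. \<Sum>e\<in>J. F a b c d e)"
 unfolding F_def by (simp only: mult.assoc sum_distrib_left[symmetric] sum_distrib_right[symmetric])
 also have "\<dots> = (\<Sum>(a, b, c, d, e)\<in>J \<times> J \<times> J \<times> J \<times> J. F a b c d e)" by (rule sum5_nested[symmetric])
 finally have prod: "cpx (cmod (sum U J) ^ 4) * sum U J = (\<Sum>(a, b, c, d, e)\<in>J \<times> J \<times> J \<times> J \<times> J. F a b c d e)" .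
 have phase: "kF t (j\<^sup>2 + d\<^sup>2 + e\<^sup>2 - a\<^sup>2 - b\<^sup>2 - c\<^sup>2) * (V N t a * V N t b * V N t c * cnj (V N t d) * cnj (V N t e)) * ph t x j = F a b c d e"
 if "j = a + b + c - d - e" for a b c d e j
 proof -
 have "kF t (j\<^sup>2 + d\<^sup>2 + e\<^sup>2 - a\<^sup>2 - b\<^sup>2 - c\<^sup>2) * ph t x j = ph t x a * ph t x b * ph t x c * cnj (ph t x d) * cnj (ph t x e)"
 unfolding ph_def kF_def cis_cnj cis_mult that by (rule arg_cong[of _ _ cis]) (simp add: algebra_simps)
 then show ?thesis by (simp add: F_def U_def mult_ac)
 qed
 have "(\<Sum>j\<in>J. qsum J (kF t) (V N t) (V N t) (V N t) (V N t) (V N t) j * ph t x j) =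
 (\<Sum>y\<in>J \<times> J \<times> J \<times> J \<times> J. \<Sum>j\<in>J. (case y of (a, b, c, d, e) => if a + b + c = d + e + j
 then kF t (j\<^sup>2 + d\<^sup>2 + e\<^sup>2 - a\<^sup>2 - b\<^sup>2 - c\<^sup>2) * (V N t a * V N t b * V N t c * cnj (V N t d) * cnj (V N t e)) else 0) * ph t x j)"
 unfolding qsum_def sum_distrib_right by (rule sum.swap)
 also have "\<dots> = (\<Sum>(a, b, c, d, e)\<in>J \<times> J \<times> J \<times> J \<times> J. if a + b + c - d - e : J then F a b c d e else 0)"
 proof (rule sum.cong[OF refl], elim SigmaE, simp only: prod.case)
 fix a b c d e :: int
 have "(\<Sum>j\<in>J. (if a + b + c = d + e + j then kF t (j\<^sup>2 + d\<^sup>2 + e\<^sup>2 - a\<^sup>2 - b\<^sup>2 - c\<^sup>2) * (V N t a * V N t b * V N t c * cnj (V N t d) * cnj (V N t e)) else 0) * ph t x j)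
 = (\<Sum>j\<in>J. if j = a + b + c - d - e then F a b c d e else 0)"
 proof (rule sum.cong[OF refl])
 fix j assume "j : J"
 show "(if a + b + c = d + e + j then kF t (j\<^sup>2 + d\<^sup>2 + e\<^sup>2 - a\<^sup>2 - b\<^sup>2 - c\<^sup>2) * (V N t a * V N t b * V N t c * cnj (V N t d) * cnj (V N t e)) else 0) * ph t x j
 = (if j = a + b + c - d - e then F a b c d e else 0)"
 proof (cases "j = a + b + c - d - e")
 case True
 then have eq: "a + b + c = d + e + j" by simp
 show ?thesis unfolding if_P[OF eq] if_P[OF True] by (rule phase[OF True])
 next
 case False
 then have "a + b + c ~= d + e + j" by auto
 then show ?thesis using False by simp
 qed
 qed
 then show "(\<Sum>j\<in>J. (if a + b + c = d + e + j then kF t (j\<^sup>2 + d\<^sup>2 + e\<^sup>2 - a\<^sup>2 - b\<^sup>2 - c\<^sup>2) * (V N t a * V N t b * V N t c * cnj (V N t d) * cnj (V N t e)) else 0) * ph t x j)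
 = (if a + b + c - d - e : J then F a b c d e else 0)" using finJ by (simp add: sum.delta)
 qed
 finally have Qs: "(\<Sum>j\<in>J. qsum J (kF t) (V N t) (V N t) (V N t) (V N t) (V N t) j * ph t x j) =
 (\<Sum>(a, b, c, d, e)\<in>J \<times> J \<times> J \<times> J \<times> J. if a + b + c - d - e : J then F a b c d e else 0)" .
 define W where "W k = cmod (V N t k)" for k
 define Y where "Y k = \<bar>rl k\<bar> * W k" for k
 have FW: "cmod (F a b c d e) = W a * W b * W c * W d * W e" for a b c d e by (simp add: F_def U_def W_def norm_mult)
 have N0: "real N > 0" using N by simp
 have "cmod ((\<Sum>j\<in>J. qsum J (kF t) (V N t) (V N t) (V N t) (V N t) (V N t) j * ph t x j) - cpx (cmod (sum U J) ^ 4) * sum U J) <=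
 (\<Sum>(a, b, c, d, e)\<in>J \<times> J \<times> J \<times> J \<times> J. (Y a * W b * W c * W d * W e + W a * Y b * W c * W d * W e + W a * W b * Y c * W d * W e
 + W a * W b * W c * Y d * W e + W a * W b * W c * W d * Y e) / real N)"
 unfolding Qs prod sum_subtractf[symmetric]
 proof (rule sum_norm_le, elim SigmaE, simp only: prod.case)
 fix a b c d e :: int
 have W0: "0 <= W k" for k by (simp add: W_def)
 show "cmod ((if a + b + c - d - e : J then F a b c d e else 0) - F a b c d e) <= (Y a * W b * W c * W d * W e + W a * Y b * W c * W d * W e + W a * W b * Y c * W d * W e
 + W a * W b * W c * Y d * W e + W a * W b * W c * W d * Y e) / real N"
 proof (cases "a + b + c - d - e : J")
 case True
 then show ?thesis using W0 N0 by (simp add: Y_def)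
 next
 case False
 then have "int N < \<bar>a + b + c - d - e\<bar>" by (auto simp: J_def JN_def)
 then have "real N <= \<bar>rl a\<bar> + \<bar>rl b\<bar> + \<bar>rl c\<bar> + \<bar>rl d\<bar> + \<bar>rl e\<bar>" by linarith
 then have "real N * (W a * W b * W c * W d * W e) <= (\<bar>rl a\<bar> + \<bar>rl b\<bar> + \<bar>rl c\<bar> + \<bar>rl d\<bar> + \<bar>rl e\<bar>) * (W a * W b * W c * W d * W e)"
 using W0 by (intro mult_right_mono) auto
 then show ?thesis using False N0 by (simp add: FW Y_def field_simps)
 qed
 qed
 also have "\<dots> = 5 * (sum Y J * (sum W J) ^ 4) / real N"
 unfolding sum_divide_distrib[symmetric] case_prod_unfold sum.distrib
 by (simp only: sum5_product[unfolded case_prod_unfold]) (simp add: eval_nat_numeral)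
 also have "\<dots> <= 5 * ((Ab T * 5) * 23 ^ 4) / real N"
 proof (intro divide_right_mono mult_left_mono mult_mono power_mono)
 show "sum W J <= 23" using n1_V[OF N, of t] by (simp add: n1_def W_def J_def)
 have "sum Y J <= (\<Sum>k\<in>J. Ab T * (1 / (1 + (rl k)\<^sup>2)))"
 proof (rule sum_mono)
 fix k
 define q where "q = 1 + (rl k)\<^sup>2"
 have q: "1 <= q" by (simp add: q_def)
 have k: "\<bar>rl k\<bar> <= q" unfolding q_def using zero_le_power2[of "\<bar>rl k\<bar> - 1"] by (simp add: power2_eq_square algebra_simps)
 have "W k <= Ab T / q ^ 4" using hw_V[OF N t, of k] by (simp add: W_def hw_def q_def)
 then have "Y k <= q * (Ab T / q ^ 4)" unfolding Y_def using k q by (intro mult_mono) (auto simp: W_def)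
 also have "\<dots> = Ab T / q ^ 3" using q by (simp add: eval_nat_numeral)
 also have "\<dots> <= Ab T / q" using q by (intro divide_left_mono self_le_power mult_pos_pos) auto
 finally show "Y k <= Ab T * (1 / (1 + (rl k)\<^sup>2))" by (simp add: q_def)
 qed
 also have "\<dots> <= Ab T * 5"
 unfolding sum_distrib_left[symmetric] by (intro mult_left_mono sum_inverse_one_plus_sq_le finJ) simp
 finally show "sum Y J <= Ab T * 5" .
 qed (auto simp: W_def Y_def intro!: sum_nonneg)
 finally show ?thesis by (simp add: J_def PU mult_ac)
qed

lemma m_bounds:
 "cmod 1 <= 1 + (rl j)\<^sup>2" "cmod (\<i> * of_int j * 1) <= 1 + (rl j)\<^sup>2" "cmod (\<i> * of_int j * (\<i> * of_int j * 1)) <= 1 + (rl j)\<^sup>2"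
proof -
 have "\<bar>rl j\<bar> <= 1 + (rl j)\<^sup>2" using zero_le_power2[of "\<bar>rl j\<bar> - 1"] by (simp add: power2_eq_square algebra_simps)
 then show "cmod (\<i> * of_int j * 1) <= 1 + (rl j)\<^sup>2" by (simp add: norm_mult)
qed (simp_all add: norm_mult power2_eq_square)

definition u :: "real => real => complex" where "u = L (%_. 1)"
definition uxx :: "real => real => complex" where "uxx = L (%j. \<i> * of_int j * (\<i> * of_int j * 1))"
text \<open>Read off from the equation; that it is the time derivative of the limit is
  \<open>u_dt\<close>.\<close>

definition ut :: "real => real => complex" where
 "ut t x = \<i> * uxx t x - \<i> * l * (cpx (cmod (u t x) ^ 4) * u t x)"

lemma u_norm: "cmod (u t x) <= 23"
proof -
 have "(%N. cmod (P (%_. 1) N t x)) \<longlonglongrightarrow> cmod (u t x)" unfolding u_def by (intro tendsto_intros P_tendsto m_bounds)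
 moreover have "\<forall>\<^sub>F N in sequentially. cmod (P (%_. 1) N t x) <= 23" using eventually_ge_at_top[of 2] by eventually_elim (rule P1_norm)
 ultimately show ?thesis by (rule tendsto_upperbound) simp
qed

lemma P_dt:
 "((%t. P (%_. 1) N t x) hvd \<i> * P (%j. \<i> * of_int j * (\<i> * of_int j * 1)) N t x
 - \<i> * l * (\<Sum>j\<in>JN N. qsum (JN N) (kF t) (V N t) (V N t) (V N t) (V N t) (V N t) j * ph t x j)) (at t)"
proof -
 define Q where "Q = qsum (JN N) (kF t) (V N t) (V N t) (V N t) (V N t) (V N t)"
 have "((%t. \<Sum>j\<in>JN N. V N t j * ph t x j) hvd (\<Sum>j\<in>JN N. V N t j * (- \<i> * (of_int j)\<^sup>2 * ph t x j) + - \<i> * l * Q j * ph t x j)) (at t)"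
 by (intro has_vector_derivative_sum has_vector_derivative_mult ph_dt) (use gal[of N] in \<open>simp add: galerkin_def Q_def\<close>)
 also have "(\<Sum>j\<in>JN N. V N t j * (- \<i> * (of_int j)\<^sup>2 * ph t x j) + - \<i> * l * Q j * ph t x j) =
 \<i> * P (%j. \<i> * of_int j * (\<i> * of_int j * 1)) N t x - \<i> * l * (\<Sum>j\<in>JN N. Q j * ph t x j)"
 unfolding P_def sum_distrib_left sum_subtractf[symmetric]
 by (intro sum.cong refl) (simp add: power2_eq_square algebra_simps)
 finally show ?thesis by (simp add: P_def Q_def)
qed

lemma u_dt: "((%t. u t x) hvd ut t x) (at t)"
proof -
 define T where "T = \<bar>t\<bar> + 1"
 define e where "e N = Gb T N + \<bar>l\<bar> * (25 * 23 ^ 4 * Ab T / real N + 5 * 23 ^ 4 * Gb T N)" for N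
 show ?thesis
 proof (rule has_vector_derivative_uniform_limit[of "{-T<..<T}" "%N t. P (%_. 1) N t x" "%N t. \<i> * P (%j. \<i> * of_int j * (\<i> * of_int j * 1)) N t x
 - \<i> * l * (\<Sum>j\<in>JN N. qsum (JN N) (kF t) (V N t) (V N t) (V N t) (V N t) (V N t) j * ph t x j)" 2 _ e])
 fix N :: nat and t assume N: "2 <= N" and "t : {-T<..<T}"
 then have t: "\<bar>t\<bar> <= T" by auto
 define S where "S = (\<Sum>j\<in>JN N. qsum (JN N) (kF t) (V N t) (V N t) (V N t) (V N t) (V N t) j * ph t x j)"
 define p where "p = P (%_. 1) N t x"
 define pxx where "pxx = P (%j. \<i> * of_int j * (\<i> * of_int j * 1)) N t x"
 define cu where "cu z = cpx (cmod z ^ 4) * z" for z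
 have a: "cmod (pxx - uxx t x) <= Gb T N" unfolding pxx_def uxx_def by (rule P_L_le[OF m_bounds(3) N t])
 have b: "cmod (S - cu p) <= 25 * 23 ^ 4 * Ab T / real N" unfolding S_def cu_def p_def by (rule product_expansion[OF N t])
 have "cmod (cu p - cu (u t x)) <= 5 * 23 ^ 4 * cmod (p - u t x)" unfolding cu_def p_def by (rule quintic_lipschitz[OF P1_norm[OF N] u_norm])
 also have "\<dots> <= 5 * 23 ^ 4 * Gb T N" unfolding p_def u_def by (intro mult_left_mono P_L_le m_bounds N t) auto
 finally have cc: "cmod (cu p - cu (u t x)) <= 5 * 23 ^ 4 * Gb T N" .
 have "\<i> * pxx - \<i> * l * S - ut t x = \<i> * (pxx - uxx t x) - \<i> * (l * ((S - cu p) + (cu p - cu (u t x))))"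
 by (simp add: ut_def cu_def algebra_simps)
 then have "cmod (\<i> * pxx - \<i> * l * S - ut t x) <= cmod (pxx - uxx t x) + \<bar>l\<bar> * cmod ((S - cu p) + (cu p - cu (u t x)))"
 using norm_triangle_ineq4[of "\<i> * (pxx - uxx t x)" "\<i> * (l * ((S - cu p) + (cu p - cu (u t x))))"] by (simp add: norm_mult)
 also have "\<dots> <= Gb T N + \<bar>l\<bar> * (25 * 23 ^ 4 * Ab T / real N + 5 * 23 ^ 4 * Gb T N)"
 using a b cc by (intro add_mono mult_left_mono order_trans[OF norm_triangle_ineq]) auto
 finally show "cmod (\<i> * P (%j. \<i> * of_int j * (\<i> * of_int j * 1)) N t x - \<i> * l * (\<Sum>j\<in>JN N. qsum (JN N) (kF t) (V N t) (V N t) (V N t) (V N t) (V N t) j * ph t x j) - ut t x) <= e N"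
 by (simp add: e_def S_def pxx_def)
 next
 have "(%N. Gb T N + \<bar>l\<bar> * (25 * 23 ^ 4 * Ab T / real N + 5 * 23 ^ 4 * Gb T N)) \<longlonglongrightarrow> 0 + \<bar>l\<bar> * (0 + 5 * 23 ^ 4 * 0)"
 by (intro tendsto_intros Gb_lim tendsto_divide_0[OF tendsto_const] filterlim_at_top_imp_at_infinity filterlim_real_sequentially)
 then show "e \<longlonglongrightarrow> 0" by (simp add: e_def[abs_def])
 show "(%N. P (%_. 1) N t x) \<longlonglongrightarrow> u t x" for t unfolding u_def by (intro P_tendsto m_bounds)
 qed (auto simp: T_def intro: P_dt[simplified])
qed

theorem solution:
 "(\<exists>ut ux uxx :: real => real => complex.
 continuous_on UNIV (%(t, x). ut t x) & continuous_on UNIV (%(t, x). ux t x) & continuous_on UNIV (%(t, x). uxx t x) &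
 (\<forall>t x. ((%r. u r x) hvd ut t x) (at t) &
 (u t hvd ux t x) (at x) & (ux t hvd uxx t x) (at x) &
 \<i> * ut t x + uxx t x = cpx (l * cmod (u t x) ^ 4) * u t x))"
proof (rule exI[of _ ut], rule exI[of _ "L (%j. \<i> * of_int j * 1)"], rule exI[of _ uxx], intro conjI allI)
 have cu: "continuous_on UNIV (%(t, x). u t x)" unfolding u_def by (rule L_continuous[OF m_bounds(1)])
 show cxx: "continuous_on UNIV (%(t, x). uxx t x)" unfolding uxx_def by (rule L_continuous[OF m_bounds(3)])
 show "continuous_on UNIV (%(t, x). L (%j. \<i> * of_int j * 1) t x)" by (rule L_continuous[OF m_bounds(2)])
 show "continuous_on UNIV (%(t, x). ut t x)"
 using cu cxx unfolding ut_def case_prod_unfold by (intro continuous_intros) auto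
 fix t x
 show "((%r. u r x) hvd ut t x) (at t)" by (rule u_dt)
 show "(u t hvd L (%j. \<i> * of_int j * 1) t x) (at x)" unfolding u_def by (rule L_dx[OF m_bounds(1,2)])
 show "(L (%j. \<i> * of_int j * 1) t hvd uxx t x) (at x)" unfolding uxx_def by (rule L_dx[OF m_bounds(2,3)])
 show "\<i> * ut t x + uxx t x = cpx (l * cmod (u t x) ^ 4) * u t x"
 by (simp add: ut_def algebra_simps)
qed

lemma u_periodic: "u t (x + 2 * pi) = u t x"
proof -
 have "ph t (x + 2 * pi) j = ph t x j" for j
 proof -
 have "ph t (x + 2 * pi) j = ph t x j * cis (2 * pi * rl j)" unfolding ph_def cis_mult by (rule arg_cong[of _ _ cis]) (simp add: algebra_simps)
 then show ?thesis by simp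
 qed
 then show ?thesis by (simp add: u_def L_def P_def)
qed

lemma u_uniform: "2 <= N ==> cmod ((\<Sum>j\<in>JN N. V N t j * ph t x j) - u t x) <= Gb \<bar>t\<bar> N"
 using P_L_le[OF m_bounds(1), of N t "\<bar>t\<bar>" x] by (simp add: P_def u_def)

end

section \<open>The planar limit system\<close>

text \<open>Positivity of \<open>Q\<close> beyond both turning points records that \<open>gm\<close>
  and \<open>kap\<close> are simple zeros. The margin \<open>dlt\<close> leaves room for perturbed
  orbits to overshoot them.\<close>

locale planar_orbit =
 fixes gm kap dlt q0 q1 d1 :: real and Q Q' :: "real => real"
 assumes gmkap: "gm < kap" and dlt: "0 < dlt" and q0: "0 < q0" and d1: "0 <= d1"
 and Qd: "!!x. (Q hrd Q' x) (at x)" and Q'c: "continuous_on UNIV Q'"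
 and Qb: "!!x. x : {gm - dlt..kap + dlt} ==> q0 <= Q x & Q x <= q1 & \<bar>Q' x\<bar> <= d1"
begin

definition m :: real where "m = (gm + kap) / 2"
definition r :: real where "r = (kap - gm) / 2"
abbreviation "I \<equiv> {gm - dlt..kap + dlt}"
definition q :: "real => real" where "q x = sqrt (Q x)"
text \<open>Writing the orbit as x = m - r cos bet removes the square root singularity at the
  turning points: the angle moves with this continuous positive speed.\<close>

definition gh :: "real => real" where "gh bet = q (m - r * cos bet)"
definition P :: "real => real" where "P x = (x - gm) * (kap - x) * Q x"
definition dP :: "real => real" where "dP x = 2 * (m - x) * Q x + (x - gm) * (kap - x) * Q' x"

lemma r: "0 < r" using gmkap by (simp add: r_def)

lemma P_r: "(x - gm) * (kap - x) = r\<^sup>2 - (m - x)\<^sup>2"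
 by (simp add: r_def m_def power2_eq_square field_simps)

lemma in_I: "m - r * cos bet : I"
proof -
 have "r * \<bar>cos bet\<bar> <= r * 1" using r by (intro mult_left_mono) auto
 then have "\<bar>r * cos bet\<bar> <= r" using r by (simp add: abs_mult)
 then have "m - r * cos bet : {m - r..m + r}" by auto
 then show ?thesis using dlt by (simp add: m_def r_def field_simps)
qed

lemma in_gmkap: "gm <= m - r * cos bet" "m - r * cos bet <= kap"
proof -
 have "r * \<bar>cos bet\<bar> <= r * 1" using r by (intro mult_left_mono) auto
 then have "\<bar>r * cos bet\<bar> <= r" using r by (simp add: abs_mult)
 then have "m - r * cos bet : {m - r..m + r}" by auto
 then show "gm <= m - r * cos bet" "m - r * cos bet <= kap" by (simp_all add: m_def r_def field_simps)
qed

lemma q_bounds: "x : I ==> sqrt q0 <= q x" "x : I ==> q x <= sqrt q1" "x : I ==> 0 < q x" "x : I ==> (q x)\<^sup>2 = Q x"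
 using Qb[of x] q0 by (auto simp: q_def)

lemma sq0: "0 < sqrt q0" using q0 by simp

lemma q_deriv: "x : I ==> (q hrd Q' x / (2 * q x)) (at x)"
proof -
 assume x: "x : I"
 then have "0 < Q x" using Qb[of x] q0 by auto
 from DERIV_chain2[OF DERIV_real_sqrt[OF this] Qd] show ?thesis unfolding q_def by (simp add: field_simps)
qed

lemma q'_bound: "x : I ==> \<bar>Q' x / (2 * q x)\<bar> <= d1 / (2 * sqrt q0)"
 using Qb[of x] q_bounds(1)[of x] sq0 by (auto simp: abs_mult intro!: frac_le)

lemma q_lip: assumes "x : I" "y : I" shows "\<bar>q x - q y\<bar> <= d1 / (2 * sqrt q0) * \<bar>x - y\<bar>"
proof -
 have "norm (q x - q y) <= d1 / (2 * sqrt q0) * norm (x - y)"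
 by (rule field_differentiable_bound[of I q "%x. Q' x / (2 * q x)"])
 (use assms q_deriv q'_bound in \<open>auto intro: has_field_derivative_at_within\<close>)
 then show ?thesis by simp
qed

lemma gh_bounds: "sqrt q0 <= gh bet" "gh bet <= sqrt q1" "0 < gh bet"
 unfolding gh_def using q_bounds[OF in_I] by auto

lemma gh_cont: "isCont gh bet"
proof -
 have "isCont q (m - r * cos bet)" using q_deriv[OF in_I] by (rule DERIV_isCont)
 moreover have "isCont (%bet. m - r * cos bet) bet" by (intro continuous_intros)
 ultimately show ?thesis unfolding gh_def by (rule isCont_o2[rotated])
qed

text \<open>The time at which the unperturbed orbit, started at \<open>gm\<close>, reaches the angle
  \<open>bet\<close>; its inverse \<open>alp\<close> is the exact angle as a function of time, and
  pi is the angle of the other turning point.\<close>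

definition G :: "real => real" where
 "G = (SOME G. G 0 = 0 & (\<forall>bet. (G hrd 1 / gh bet) (at bet)))"

lemma G: "G 0 = 0" "(G hrd 1 / gh bet) (at bet)"
proof -
 have "\<exists>F. \<forall>x. - \<infinity> < ereal x --> ereal x < \<infinity> --> (F hvd 1 / gh x) (at x)"
 proof (rule einterval_antiderivative)
 show "isCont (%x. 1 / gh x) x" for x using gh_cont gh_bounds(3)[of x] by (intro continuous_intros) auto
 qed simp
 then obtain F where F: "!!x. (F hrd 1 / gh x) (at x)"
 by (auto simp: has_real_derivative_iff_has_vector_derivative)
 have "\<exists>G. G 0 = 0 & (\<forall>bet. (G hrd 1 / gh bet) (at bet))"
 by (rule exI[of _ "%x. F x - F 0"]) (auto intro!: derivative_eq_intros F)
 from someI_ex[OF this] show "G 0 = 0" "(G hrd 1 / gh bet) (at bet)" unfolding G_def[symmetric] by auto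
qed

lemma q1: "0 < sqrt q1" using gh_bounds[of 0] by linarith

lemma G_growth: assumes "a <= b" shows "(b - a) / sqrt q1 <= G b - G a"
proof -
 have "G a - a / sqrt q1 <= G b - b / sqrt q1"
 proof (rule DERIV_nonneg_imp_nondecreasing[OF assms, where f = "%x. G x - x / sqrt q1"])
 fix x
 have "1 / sqrt q1 <= 1 / gh x" using gh_bounds[of x] q1 by (intro divide_left_mono mult_pos_pos) auto
 moreover have "((%x. G x - x / sqrt q1) hrd 1 / gh x - 1 / sqrt q1) (at x)"
 by (intro DERIV_diff G(2) DERIV_cdivide DERIV_ident)
 ultimately show "\<exists>y. ((%x. G x - x / sqrt q1) hrd y) (at x) & 0 <= y" by force
 qed
 then show ?thesis by (simp add: diff_divide_distrib)
qed

lemma G_lower: "\<bar>b - a\<bar> <= sqrt q1 * \<bar>G b - G a\<bar>"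
proof -
 have g: "b - a <= sqrt q1 * \<bar>G b - G a\<bar>" if "a <= b" for a b
 proof -
 have "b - a <= sqrt q1 * (G b - G a)" using G_growth[OF that] q1 by (simp add: field_simps)
 also have "\<dots> <= sqrt q1 * \<bar>G b - G a\<bar>" using q1 by (intro mult_left_mono) auto
 finally show ?thesis .
 qed
 show ?thesis using g[of a b] g[of b a] by (cases "a <= b") (auto simp: abs_minus_commute)
qed

lemma G_inj: "G a = G b ==> a = b" using G_lower[of b a] by simp

lemma G_surj: "\<exists>bet. G bet = tau"
proof -
 define b where "b = sqrt q1 * \<bar>tau\<bar>"
 have b: "0 <= b" using q1 by (simp add: b_def)
 have "\<bar>tau\<bar> <= G b" "G (- b) <= - \<bar>tau\<bar>"
 using G_growth[of 0 b] G_growth[of "- b" 0] b q1 by (simp_all add: G(1)) (simp_all add: b_def)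
 then have "G (- b) <= tau" "tau <= G b" by linarith+
 then show ?thesis using IVT[of G "- b" tau b] b DERIV_isCont[OF G(2)] by auto
qed

definition alp :: "real => real" where "alp tau = (SOME bet. G bet = tau)"

lemma G_alp: "G (alp tau) = tau" unfolding alp_def using someI_ex[OF G_surj] .

lemma alp_eq: "G bet = tau ==> alp tau = bet" using G_inj G_alp by metis

lemma G_minus: "G (- bet) = - G bet"
proof -
 have "((%bet. G (- bet) + G bet) hrd 0) (at bet)" for bet
 proof -
 have "gh (- bet) = gh bet" by (simp add: gh_def)
 moreover have "((%bet. G (- bet) + G bet) hrd 1 / gh (- bet) * (- 1) + 1 / gh bet) (at bet)"
 by (intro DERIV_add DERIV_chain2[OF G(2)] G(2) DERIV_minus DERIV_ident)
 ultimately show ?thesis by simp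
 qed
 then have "G (- bet) + G bet = G (- 0) + G 0" using DERIV_isconst_all[of "%bet. G (- bet) + G bet" bet 0] by blast
 then show ?thesis by (simp add: G(1))
qed

definition T :: real where "T = G pi"
definition K :: "real => real" where "K tau = m - r * cos (alp tau)"

lemma T_pos: "0 < T"
proof -
 have "0 < pi / sqrt q1" using q1 by simp
 also have "\<dots> <= T" using G_growth[of 0 pi] by (simp add: G(1) T_def)
 finally show ?thesis .
qed

lemma G_period: "G (bet + 2 * pi) = G bet + 2 * T"
proof -
 have "((%bet. G (bet + 2 * pi) - G bet) hrd 0) (at bet)" for bet
 proof -
 have "gh (bet + 2 * pi) = gh bet" by (simp add: gh_def)
 moreover have "((%bet. G (bet + 2 * pi) - G bet) hrd 1 / gh (bet + 2 * pi) * (1 + 0) - 1 / gh bet) (at bet)"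
 by (intro DERIV_diff DERIV_chain2[OF G(2)] G(2) DERIV_add DERIV_ident DERIV_const)
 ultimately show ?thesis by simp
 qed
 then have "G (bet + 2 * pi) - G bet = G (- pi + 2 * pi) - G (- pi)" using DERIV_isconst_all[of "%bet. G (bet + 2 * pi) - G bet" bet "- pi"] by blast
 then show ?thesis by (simp add: G_minus T_def)
qed

lemma K_period: "K (tau + 2 * T) = K tau"
proof -
 have "alp (tau + 2 * T) = alp tau + 2 * pi" by (rule alp_eq) (simp add: G_period G_alp)
 then show ?thesis by (simp add: K_def)
qed

lemma K_0: "K 0 = gm"
proof -
 have "alp 0 = 0" by (rule alp_eq) (rule G)
 then show ?thesis by (simp add: K_def m_def r_def field_simps)
qed

lemma K_T: "K T = kap"
proof -
 have "alp T = pi" by (rule alp_eq) (simp add: T_def)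
 then show ?thesis by (simp add: K_def m_def r_def field_simps)
qed

lemma K_bounds: "gm <= K tau" "K tau <= kap" unfolding K_def by (rule in_gmkap)+

text \<open>Error budget for the stability theorem: \<open>p1\<close> bounds \<open>P\<close>,
  \<open>C1\<close> the error in the derivative of the rescaled velocity, \<open>C2\<close> that of
  the angular speed, \<open>C3\<close> that of the position at a given angle, and \<open>C4\<close>
  the total deviation of the speed from \<open>gh\<close>.\<close>

definition p1 :: real where "p1 = (r\<^sup>2 + (r + dlt)\<^sup>2) * q1"
definition C1 :: real where "C1 = 1 / sqrt q0 + d1 / (2 * sqrt q0) * (p1 + 3) / q0"
definition C2 :: real where "C2 = 2 / r\<^sup>2 * ((r + dlt) * C1 + (p1 + 2) / sqrt q0)"
definition C3 :: real where "C3 = 4 * (1 + 1 / (q0 * r)) + 4 / sqrt q0 + 1 / (q0 * r)"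
definition C4 :: real where "C4 = C2 + d1 / (2 * sqrt q0) * C3"
definition Cstab :: real where "Cstab = C3 + r * (sqrt q1 * (C4 / sqrt q0))"
text \<open>The entry with \<open>r\<close> keeps the perturbed point away from the centre of
  rotation. The last two put \<open>P\<close> below \<open>- eps0\<close> at the ends of the
  interval, which makes them barriers.\<close>

definition eps0 :: real where "eps0 = Min {1, dlt / 2, q0 * r\<^sup>2 / 2, - P (gm - dlt) / 2, - P (kap + dlt) / 2}"

lemma P_out: "P (gm - dlt) < 0" "P (kap + dlt) < 0"
proof -
 have "0 < Q (gm - dlt)" "0 < Q (kap + dlt)" using Qb[of "gm - dlt"] Qb[of "kap + dlt"] gmkap dlt q0 by auto
 then show "P (gm - dlt) < 0" "P (kap + dlt) < 0" unfolding P_def using gmkap dlt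
 by (auto intro!: mult_neg_pos simp: mult_less_0_iff)
qed

lemma eps0: "0 < eps0" "eps0 <= 1" "eps0 < dlt" "eps0 <= q0 * r\<^sup>2 / 2" "eps0 < - P (gm - dlt)" "eps0 < - P (kap + dlt)"
proof -
 have pos: "0 < q0 * r\<^sup>2" using q0 r by simp
 show "0 < eps0" unfolding eps0_def using pos dlt P_out by simp
 have le: "eps0 <= x" if "x : {1, dlt / 2, q0 * r\<^sup>2 / 2, - P (gm - dlt) / 2, - P (kap + dlt) / 2}" for x
 unfolding eps0_def using that by (intro Min_le) auto
 show "eps0 <= 1" "eps0 <= q0 * r\<^sup>2 / 2" by (rule le; simp)+
 have "eps0 <= dlt / 2" "eps0 <= - P (gm - dlt) / 2" "eps0 <= - P (kap + dlt) / 2" by (rule le; simp)+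
 then show "eps0 < dlt" "eps0 < - P (gm - dlt)" "eps0 < - P (kap + dlt)" using dlt P_out by linarith+
qed

lemma C_nonneg: "0 <= p1" "0 <= C1" "0 <= C2" "0 <= C3" "0 <= C4"
proof -
 have q1': "0 <= q1" using q1 by simp
 show p: "0 <= p1" using q1' by (simp add: p1_def)
 show 1: "0 <= C1" unfolding C1_def using sq0 q0 d1 p by (intro add_nonneg_nonneg divide_nonneg_pos mult_nonneg_nonneg) auto
 show 2: "0 <= C2" unfolding C2_def using sq0 r dlt p 1 by (intro mult_nonneg_nonneg add_nonneg_nonneg divide_nonneg_pos) auto
 show 3: "0 <= C3" unfolding C3_def using sq0 q0 r by (intro mult_nonneg_nonneg add_nonneg_nonneg divide_nonneg_pos) auto
 show "0 <= C4" unfolding C4_def using 2 3 sq0 d1 by (intro mult_nonneg_nonneg add_nonneg_nonneg divide_nonneg_pos) auto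
qed

text \<open>The point \<open>\<zeta> = (m - x) + \<i> y / q x\<close> rotates about the origin with angular speed \<open>q x\<close>; on the energy
 level \<open>y\<^sup>2 = P x\<close> its modulus is \<open>r\<close>.\<close>
theorem stability:
 fixes x y x' y' :: "real => real"
 assumes xd: "!!tau. tau : {0..S} ==> (x hrd x' tau) (at tau)"
 and yd: "!!tau. tau : {0..S} ==> (y hrd y' tau) (at tau)"
 and x'c: "continuous_on {0..S} x'" and y'c: "continuous_on {0..S} y'"
 and e1: "!!tau. tau : {0..S} ==> \<bar>x' tau - y tau\<bar> <= eps"
 and e2: "!!tau. tau : {0..S} ==> \<bar>y' tau - dP (x tau) / 2\<bar> <= eps"
 and e3: "!!tau. tau : {0..S} ==> \<bar>(y tau)\<^sup>2 - P (x tau)\<bar> <= eps"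
 and x0: "\<bar>x 0 - gm\<bar> <= eps" and y0: "\<bar>y 0\<bar> <= eps" and eps: "0 <= eps" "eps <= eps0" and tau: "tau : {0..S}"
 shows "\<bar>x tau - K tau\<bar> <= Cstab * (eps + eps * tau)"
proof -
 have S: "0 <= S" using tau by simp
 have xc: "isCont x tau" if "tau : {0..S}" for tau using xd[OF that] by (rule DERIV_isCont)
 have yc: "isCont y tau" if "tau : {0..S}" for tau using yd[OF that] by (rule DERIV_isCont)
 have PI: "- eps0 <= P (x tau)" if "tau : {0..S}" for tau
 using e3[OF that] eps zero_le_power2[of "y tau"] by linarith
 \<comment> \<open>Along the orbit \<open>P\<close> stays above \<open>- eps0\<close>, while at both
   ends of the interval it is lower; by continuity the orbit cannot cross them.\<close>
 have xI: "x tau : I" if tau: "tau : {0..S}" for tau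
 proof (rule ccontr)
 assume "x tau \<notin> I"
 then consider "x tau < gm - dlt" | "kap + dlt < x tau" by fastforce
 then show False
 proof cases
 case 1
 have "gm - dlt <= x 0" using x0 eps eps0(3) by linarith
 then obtain s where "0 <= s" "s <= tau" "x s = gm - dlt" using IVT2[of x tau "gm - dlt" 0] 1 tau xc by auto
 then show False using PI[of s] tau eps0(5) by auto
 next
 case 2
 have "x 0 <= kap + dlt" using x0 eps eps0(3) gmkap by linarith
 then obtain s where "0 <= s" "s <= tau" "x s = kap + dlt" using IVT[of x 0 "kap + dlt" tau] 2 tau xc by auto
 then show False using PI[of s] tau eps0(6) by auto
 qed
 qed
 define X where "X tau = m - x tau" for tau
 define Y where "Y tau = y tau / q (x tau)" for tau
 define X' where "X' tau = - x' tau" for tau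
 define qp where "qp tau = Q' (x tau) / (2 * q (x tau))" for tau
 define Y' where "Y' tau = (y' tau * q (x tau) - y tau * (qp tau * x' tau)) / (q (x tau) * q (x tau))" for tau
 have Xd: "(X hrd X' tau) (at tau)" if "tau : {0..S}" for tau
 unfolding X_def X'_def using xd[OF that] by (auto intro!: derivative_eq_intros)
 have Yd: "(Y hrd Y' tau) (at tau)" if "tau : {0..S}" for tau
 unfolding Y_def Y'_def qp_def
 using q_bounds(3)[OF xI[OF that]]
 by (intro DERIV_divide yd[OF that] DERIV_chain2[OF q_deriv[OF xI[OF that]] xd[OF that]]) auto
 have Xb: "\<bar>X tau\<bar> <= r + dlt" if "tau : {0..S}" for tau using xI[OF that] by (auto simp: X_def m_def r_def field_simps abs_le_iff)
 have Py: "\<bar>y tau\<bar> <= p1 + 2" if tau: "tau : {0..S}" for tau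
 proof -
 have "\<bar>r\<^sup>2 - (X tau)\<^sup>2\<bar> <= r\<^sup>2 + (r + dlt)\<^sup>2"
 proof -
 have "(X tau)\<^sup>2 <= (r + dlt)\<^sup>2" using Xb[OF tau] r dlt by (intro abs_le_square_iff[THEN iffD1]) auto
 then show ?thesis by (smt (verit) zero_le_power2)
 qed
 then have "\<bar>P (x tau)\<bar> <= p1" unfolding P_def p1_def P_r X_def[symmetric] abs_mult
 using Qb[OF xI[OF tau]] q0 by (intro mult_mono) auto
 then have "(y tau)\<^sup>2 <= p1 + 1" using e3[OF tau] eps eps0(2) by linarith
 also have "\<dots> <= (p1 + 2)\<^sup>2" using C_nonneg(1) by (simp add: power2_eq_square algebra_simps)
 finally show ?thesis using C_nonneg(1) by (simp add: power2_le_iff_abs_le)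
 qed
 define rho where "rho tau = cmod (Complex (X tau) (Y tau))" for tau
 have rho2: "(rho tau)\<^sup>2 = (X tau)\<^sup>2 + (Y tau)\<^sup>2" for tau by (simp add: rho_def cmod_power2)
 have rho0: "0 <= rho tau" for tau by (simp add: rho_def)
 \<comment> \<open>The approximate energy relation fixes the modulus at each time separately, so its
   error does not accumulate; only the angle can drift.\<close>
 have rhor: "\<bar>(rho tau)\<^sup>2 - r\<^sup>2\<bar> <= eps / q0" if tau: "tau : {0..S}" for tau
 proof -
 have Qp: "0 < Q (x tau)" using Qb[OF xI[OF tau]] q0 by auto
 have "(rho tau)\<^sup>2 - r\<^sup>2 = ((y tau)\<^sup>2 - P (x tau)) / Q (x tau)"
 unfolding rho2 Y_def power_divide q_bounds(4)[OF xI[OF tau]] P_def P_r X_def using Qp by (simp add: field_simps)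
 then have "\<bar>(rho tau)\<^sup>2 - r\<^sup>2\<bar> = \<bar>(y tau)\<^sup>2 - P (x tau)\<bar> / Q (x tau)" using Qp by simp
 also have "\<dots> <= eps / q0" using e3[OF tau] Qb[OF xI[OF tau]] q0 eps by (intro frac_le) auto
 finally show ?thesis .
 qed
 have half: "eps / q0 <= r\<^sup>2 / 2" using eps eps0(4) q0 by (simp add: field_simps)
 have rholow: "r\<^sup>2 / 2 <= (rho tau)\<^sup>2" "r / 2 <= rho tau" "rho tau <= 2 * r" "\<bar>rho tau - r\<bar> <= eps / (q0 * r)" if tau: "tau : {0..S}" for tau
 proof -
 show a: "r\<^sup>2 / 2 <= (rho tau)\<^sup>2" using rhor[OF tau] half by linarith
 have "(r / 2)\<^sup>2 <= (rho tau)\<^sup>2"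
 proof -
 have "(r / 2)\<^sup>2 = r\<^sup>2 / 4" by (simp add: power_divide)
 then show ?thesis using a zero_le_power2[of r] by linarith
 qed
 then show "r / 2 <= rho tau" using rho0 by (rule power2_le_imp_le)
 have "(rho tau)\<^sup>2 <= (2 * r)\<^sup>2"
 proof -
 have "(2 * r)\<^sup>2 = 4 * r\<^sup>2" by (simp add: power_mult_distrib)
 then show ?thesis using rhor[OF tau] half zero_le_power2[of r] by linarith
 qed
 then show "rho tau <= 2 * r" by (rule power2_le_imp_le) (use r in simp)
 have "\<bar>rho tau - r\<bar> * r <= \<bar>rho tau - r\<bar> * (rho tau + r)" using rho0 by (intro mult_left_mono) auto
 also have "\<dots> = \<bar>(rho tau)\<^sup>2 - r\<^sup>2\<bar>"
 proof -
 have "(rho tau)\<^sup>2 - r\<^sup>2 = (rho tau - r) * (rho tau + r)" by (simp add: power2_eq_square algebra_simps)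
 moreover have "0 <= rho tau + r" using rho0[of tau] r by simp
 ultimately show ?thesis by (simp only: abs_mult abs_of_nonneg)
 qed
 also have "\<dots> <= eps / q0" by (rule rhor[OF tau])
 finally show "\<bar>rho tau - r\<bar> <= eps / (q0 * r)" using r q0 by (simp add: field_simps)
 qed
 \<comment> \<open>The angular speed, that is, the imaginary part of the logarithmic derivative of
   the rotating point.\<close>
 define b where "b tau = (X tau * Y' tau - Y tau * X' tau) / (rho tau)\<^sup>2" for tau
 have b: "\<bar>b tau - q (x tau)\<bar> <= C2 * eps" if tau: "tau : {0..S}" for tau
 proof -
 define qq where "qq = q (x tau)"
 have qq: "0 < qq" "qq\<^sup>2 = Q (x tau)" "sqrt q0 <= qq" using q_bounds[OF xI[OF tau]] by (simp_all add: qq_def)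
 define E1 where "E1 = x' tau - y tau"
 define E2 where "E2 = y' tau - dP (x tau) / 2"
 define E3 where "E3 = (y tau)\<^sup>2 - P (x tau)"
 define EE where "EE = E2 / qq - qp tau * (E3 + y tau * E1) / qq\<^sup>2"
 have yY: "y tau = qq * Y tau" using qq by (simp add: Y_def qq_def)
 have X'eq: "X' tau = - qq * Y tau - E1" by (simp add: X'_def E1_def yY)
 have Q'q: "Q' (x tau) = 2 * qp tau * qq" using qq(1) by (simp add: qp_def qq_def)
 have y'eq: "y' tau = X tau * qq\<^sup>2 + (r\<^sup>2 - (X tau)\<^sup>2) * (qp tau * qq) + E2"
 unfolding E2_def dP_def P_r Q'q qq(2)[symmetric] X_def[symmetric] by (simp add: field_simps)
 have Peq: "P (x tau) = (r\<^sup>2 - (X tau)\<^sup>2) * qq\<^sup>2" unfolding P_def P_r X_def qq(2) ..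
 have yx: "y tau * x' tau = (r\<^sup>2 - (X tau)\<^sup>2) * qq\<^sup>2 + E3 + y tau * E1"
 unfolding E1_def E3_def Peq by (simp add: power2_eq_square algebra_simps)
 have Y'eq: "Y' tau = qq * X tau + EE"
 proof -
 have "Y' tau * qq\<^sup>2 = y' tau * qq - qp tau * (y tau * x' tau)"
 using qq(1) by (simp add: Y'_def qq_def[symmetric] power2_eq_square mult_ac)
 also have "\<dots> = qq\<^sup>2 * (qq * X tau + EE)"
 unfolding yx y'eq EE_def using qq(1) by (simp add: field_simps power2_eq_square)
 finally show ?thesis using qq(1) by simp
 qed
 have "\<bar>EE\<bar> <= eps / sqrt q0 + d1 / (2 * sqrt q0) * ((1 + (p1 + 2)) * eps) / q0"
 proof -
 have "\<bar>E2 / qq\<bar> <= eps / sqrt q0" using e2[OF tau] qq sq0 eps by (auto simp: E2_def abs_mult intro!: frac_le)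
 moreover have "\<bar>qp tau * (E3 + y tau * E1) / qq\<^sup>2\<bar> <= d1 / (2 * sqrt q0) * ((1 + (p1 + 2)) * eps) / q0"
 proof -
 have "\<bar>E3 + y tau * E1\<bar> <= eps + (p1 + 2) * eps"
 using e3[OF tau] e1[OF tau] Py[OF tau] unfolding E3_def[symmetric] E1_def[symmetric]
 by (intro order_trans[OF abs_triangle_ineq] add_mono) (auto simp: abs_mult intro!: mult_mono)
 then have "\<bar>qp tau\<bar> * \<bar>E3 + y tau * E1\<bar> <= d1 / (2 * sqrt q0) * ((1 + (p1 + 2)) * eps)"
 using q'_bound[OF xI[OF tau]] d1 sq0 by (intro mult_mono) (auto simp: qp_def algebra_simps)
 moreover have "q0 <= qq\<^sup>2" using Qb[OF xI[OF tau]] by (simp add: qq(2))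
 moreover have "0 <= d1 / (2 * sqrt q0) * ((1 + (p1 + 2)) * eps)"
 using d1 sq0 C_nonneg(1) eps by (intro mult_nonneg_nonneg divide_nonneg_pos) auto
 ultimately show ?thesis unfolding abs_divide abs_mult using q0 by (intro frac_le) auto
 qed
 ultimately show ?thesis unfolding EE_def by linarith
 qed
 also have "\<dots> = C1 * eps" by (simp add: C1_def algebra_simps add_divide_distrib)
 finally have EE: "\<bar>EE\<bar> <= C1 * eps" .
 have Yb: "\<bar>Y tau\<bar> <= (p1 + 2) / sqrt q0"
 using Py[OF tau] qq sq0 C_nonneg(1) unfolding Y_def qq_def[symmetric] abs_divide by (intro frac_le) auto
 have rhop: "0 < (rho tau)\<^sup>2" using rholow(1)[OF tau] r by (smt (verit) half_gt_zero zero_less_power)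
 have "X tau * Y' tau - Y tau * X' tau = qq * (rho tau)\<^sup>2 + (X tau * EE + Y tau * E1)"
 unfolding Y'eq X'eq rho2 by (simp add: power2_eq_square algebra_simps)
 then have "b tau - q (x tau) = (X tau * EE + Y tau * E1) / (rho tau)\<^sup>2"
 unfolding b_def qq_def[symmetric] using rhop by (simp add: field_simps)
 also have "\<bar>\<dots>\<bar> <= ((r + dlt) * (C1 * eps) + (p1 + 2) / sqrt q0 * eps) / (r\<^sup>2 / 2)"
 proof -
 have "\<bar>X tau * EE + Y tau * E1\<bar> <= (r + dlt) * (C1 * eps) + (p1 + 2) / sqrt q0 * eps"
 proof -
 have "\<bar>X tau\<bar> * \<bar>EE\<bar> <= (r + dlt) * (C1 * eps)" using Xb[OF tau] EE r dlt by (intro mult_mono) auto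
 moreover have "\<bar>Y tau\<bar> * \<bar>E1\<bar> <= (p1 + 2) / sqrt q0 * eps"
 using Yb e1[OF tau] order_trans[OF abs_ge_zero Yb] unfolding E1_def[symmetric] by (intro mult_mono) auto
 ultimately show ?thesis using abs_triangle_ineq[of "X tau * EE" "Y tau * E1"] unfolding abs_mult by linarith
 qed
 moreover have "0 <= (r + dlt) * (C1 * eps) + (p1 + 2) / sqrt q0 * eps"
 using r dlt sq0 C_nonneg eps by (intro add_nonneg_nonneg mult_nonneg_nonneg divide_nonneg_pos) auto
 ultimately show ?thesis unfolding abs_divide using rholow(1)[OF tau] r by (intro frac_le) auto
 qed
 also have "\<dots> = C2 * eps" by (simp add: C2_def algebra_simps add_divide_distrib)
 finally show ?thesis .
 qed
 define \<zeta> where "\<zeta> tau = Complex (X tau) (Y tau)" for tau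
 define \<zeta>' where "\<zeta>' tau = Complex (X' tau) (Y' tau)" for tau
 have \<zeta>0: "\<zeta> tau ~= 0" if "tau : {0..S}" for tau using rholow(2)[OF that] r by (auto simp: rho_def \<zeta>_def)
 have \<zeta>d: "(\<zeta> hvd \<zeta>' tau) (at tau within {0..S})" if "tau : {0..S}" for tau
 proof -
 have "((%tau. cpx (X tau) + \<i> * cpx (Y tau)) hvd cpx (X' tau) + \<i> * cpx (Y' tau)) (at tau)"
 using Xd[OF that] Yd[OF that]
 by (intro has_vector_derivative_add has_vector_derivative_mult_right has_vector_derivative_of_real)
 (simp_all add: has_real_derivative_iff_has_vector_derivative)
 then show ?thesis unfolding \<zeta>_def \<zeta>'_def Complex_eq by (rule has_vector_derivative_at_within)
 qed
 have contx: "continuous_on {0..S} x" "continuous_on {0..S} y" using xc yc by (auto intro: continuous_at_imp_continuous_on)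
 have contq: "continuous_on {0..S} (%tau. q (x tau))"
 proof -
 have "isCont (%tau. q (x tau)) tau" if "tau : {0..S}" for tau
 using isCont_o2[OF xc[OF that]] q_deriv[OF xI[OF that]] DERIV_isCont by blast
 then show ?thesis by (auto intro: continuous_at_imp_continuous_on)
 qed
 have contQ': "continuous_on {0..S} (%tau. Q' (x tau))" by (rule continuous_on_compose2[OF Q'c contx(1)]) auto
 have q_ne: "q (x tau) ~= 0" if "tau : {0..S}" for tau using q_bounds(3)[OF xI[OF that]] by simp
 have cont\<zeta>': "continuous_on {0..S} \<zeta>'"
 unfolding \<zeta>'_def X'_def Y'_def qp_def Complex_eq
 by (intro continuous_intros x'c y'c contx contq contQ') (use q_ne in auto)
 have cont\<zeta>: "continuous_on {0..S} \<zeta>"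
 using \<zeta>d by (meson continuous_on_eq_continuous_within has_vector_derivative_continuous)
 \<comment> \<open>Integrating the logarithmic derivative lifts the argument to a continuous angle
   over many revolutions, without branch cuts.\<close>
 define w where "w tau = \<zeta>' tau / \<zeta> tau" for tau
 have contw: "continuous_on {0..S} w" unfolding w_def using \<zeta>0 by (intro continuous_intros cont\<zeta> cont\<zeta>') auto
 define L where "L tau = integral {0..tau} w" for tau
 have Ld: "(L hvd w tau) (at tau within {0..S})" if "tau : {0..S}" for tau
 unfolding L_def by (rule integral_has_vector_derivative[OF contw that])
 have L0: "L 0 = 0" by (simp add: L_def)
 have \<zeta>L: "\<zeta> tau = \<zeta> 0 * exp (L tau)" if tau: "tau : {0..S}" for tau
 proof -
 have "((%tau. \<zeta> tau * exp (- L tau)) hvd 0) (at tau within {0..S})" if tau: "tau : {0..S}" for tau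
 proof -
 have "((%tau. exp (- L tau)) hvd - w tau * exp (- L tau)) (at tau within {0..S})"
 using field_vector_diff_chain_within[OF has_vector_derivative_minus[OF Ld[OF tau]], of exp "exp (- L tau)"]
 by (simp add: o_def DERIV_exp has_field_derivative_at_within)
 from has_vector_derivative_mult[OF \<zeta>d[OF tau] this]
 show ?thesis using \<zeta>0[OF tau] by (simp add: w_def)
 qed
 then obtain k where k: "!!tau. tau : {0..S} ==> \<zeta> tau * exp (- L tau) = k"
 using has_vector_derivative_zero_constant[of "{0..S}" "%tau. \<zeta> tau * exp (- L tau)"] by auto
 have "\<zeta> tau * exp (- L tau) = \<zeta> 0" using k[OF tau] k[of 0] S by (simp add: L0)
 then show ?thesis by (simp add: exp_minus field_simps)
 qed
 define tht where "tht tau = Im (L tau)" for tau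
 have thtd: "(tht hrd b tau) (at tau within {0..S})" if tau: "tau : {0..S}" for tau
 proof -
 have "Im (w tau) = b tau"
 by (simp add: w_def \<zeta>'_def \<zeta>_def b_def rho2 Im_divide)
 then show ?thesis unfolding tht_def has_real_derivative_iff_has_vector_derivative
 using bounded_linear.has_vector_derivative[OF bounded_linear_Im Ld[OF tau]] by simp
 qed
 have Xcos: "\<bar>X tau - r * cos (tht tau)\<bar> <= C3 * eps" if tau: "tau : {0..S}" for tau
 proof -
 have 0: "0 : {0..S}" using S by simp
 define R where "R = exp (Re (L tau))"
 have R: "0 < R" "R * rho 0 = rho tau"
 using arg_cong[OF \<zeta>L[OF tau], of cmod] by (simp_all add: R_def rho_def \<zeta>_def[symmetric] norm_mult mult.commute)
 have "X tau = Re (\<zeta> tau)" by (simp add: \<zeta>_def)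
 also have "\<dots> = R * (X 0 * cos (tht tau) - Y 0 * sin (tht tau))"
 unfolding \<zeta>L[OF tau] by (simp add: \<zeta>_def R_def tht_def Re_exp Im_exp algebra_simps)
 finally have Xeq: "X tau - r * cos (tht tau) = R * (X 0 - rho 0) * cos (tht tau) - R * Y 0 * sin (tht tau) + (rho tau - r) * cos (tht tau)"
 unfolding R(2)[symmetric] by (simp add: algebra_simps)
 have R4: "R <= 4"
 proof -
 have "R * (r / 2) <= R * rho 0" using R rholow(2)[OF 0] by (intro mult_left_mono) auto
 also have "\<dots> <= 2 * r" using R(2) rholow(3)[OF tau] by simp
 finally show ?thesis using r by simp
 qed
 have X0: "\<bar>X 0 - rho 0\<bar> <= (1 + 1 / (q0 * r)) * eps"
 proof -
 have "X 0 - r = gm - x 0" by (simp add: X_def m_def r_def field_simps)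
 then have "\<bar>X 0 - r\<bar> <= eps" using x0 by linarith
 then show ?thesis using rholow(4)[OF 0] by (simp add: algebra_simps)
 qed
 have Y0: "\<bar>Y 0\<bar> <= eps / sqrt q0"
 unfolding Y_def abs_divide using y0 q_bounds(1,3)[OF xI[OF 0]] sq0 by (intro frac_le) auto
 have c: "\<bar>a * cos s\<bar> <= \<bar>a\<bar>" "\<bar>a * sin s\<bar> <= \<bar>a\<bar>" for a s :: real
 by (simp_all add: abs_mult mult_left_le)
 have "\<bar>X tau - r * cos (tht tau)\<bar> <= \<bar>R * (X 0 - rho 0)\<bar> + \<bar>R * Y 0\<bar> + \<bar>rho tau - r\<bar>"
 unfolding Xeq using c(1)[of "R * (X 0 - rho 0)" "tht tau"] c(2)[of "R * Y 0" "tht tau"] c(1)[of "rho tau - r" "tht tau"] by linarith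
 also have "\<dots> <= 4 * ((1 + 1 / (q0 * r)) * eps) + 4 * (eps / sqrt q0) + eps / (q0 * r)"
 proof (intro add_mono rholow(4)[OF tau])
 show "\<bar>R * (X 0 - rho 0)\<bar> <= 4 * ((1 + 1 / (q0 * r)) * eps)" unfolding abs_mult using R R4 X0 by (intro mult_mono) auto
 show "\<bar>R * Y 0\<bar> <= 4 * (eps / sqrt q0)" unfolding abs_mult using R R4 Y0 by (intro mult_mono) auto
 qed
 also have "\<dots> = C3 * eps" by (simp add: C3_def algebra_simps)
 finally show ?thesis .
 qed
 have speed: "\<bar>b tau - gh (tht tau)\<bar> <= C4 * eps" if tau: "tau : {0..S}" for tau
 proof -
 have "\<bar>q (x tau) - gh (tht tau)\<bar> <= d1 / (2 * sqrt q0) * \<bar>x tau - (m - r * cos (tht tau))\<bar>"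
 unfolding gh_def by (rule q_lip[OF xI[OF tau] in_I])
 also have "\<dots> <= d1 / (2 * sqrt q0) * (C3 * eps)"
 using Xcos[OF tau] d1 sq0 by (intro mult_left_mono) (auto simp: X_def abs_le_iff)
 finally show ?thesis using b[OF tau] unfolding C4_def by (simp add: algebra_simps)
 qed
 \<comment> \<open>In the coordinate \<open>G\<close> the unperturbed angle advances at speed 1, so
   speed errors add up linearly. An estimate by Gronwall would instead be exponential in the
   rescaled time, which becomes large.\<close>
 have "\<bar>(G (tht tau) - tau) - (G (tht 0) - 0)\<bar> <= C4 * eps / sqrt q0 * \<bar>tau - 0\<bar>"
 proof -
 have "norm ((G (tht tau) - tau) - (G (tht 0) - 0)) <= C4 * eps / sqrt q0 * norm (tau - 0)"
 proof (rule field_differentiable_bound[of "{0..S}" "%tau. G (tht tau) - tau" "%tau. 1 / gh (tht tau) * b tau - 1"])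
 fix s assume s: "s : {0..S}"
 show "((%tau. G (tht tau) - tau) hrd 1 / gh (tht s) * b s - 1) (at s within {0..S})"
 by (intro DERIV_diff DERIV_chain2[OF G(2) thtd[OF s]] DERIV_ident)
 have "1 / gh (tht s) * b s - 1 = (b s - gh (tht s)) / gh (tht s)" using gh_bounds(3)[of "tht s"] by (simp add: field_simps)
 then show "norm (1 / gh (tht s) * b s - 1) <= C4 * eps / sqrt q0"
 using speed[OF s] gh_bounds[of "tht s"] sq0 C_nonneg(5) eps by (auto simp: abs_mult intro!: frac_le)
 qed (use tau S in auto)
 then show ?thesis by simp
 qed
 then have "\<bar>G (tht tau) - G (alp tau)\<bar> <= C4 * eps / sqrt q0 * tau" using tau by (simp add: tht_def L0 G(1) G_alp)
 then have "\<bar>tht tau - alp tau\<bar> <= sqrt q1 * (C4 * eps / sqrt q0 * tau)"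
 using G_lower[of "tht tau" "alp tau"] q1 by (meson mult_left_mono order_trans less_imp_le)
 then have "r * \<bar>cos (tht tau) - cos (alp tau)\<bar> <= r * (sqrt q1 * (C4 * eps / sqrt q0 * tau))"
 proof -
 have "norm (cos (tht tau) - cos (alp tau)) <= 1 * norm (tht tau - alp tau)"
 by (rule field_differentiable_bound[of UNIV cos "%x. - sin x"]) (auto intro!: derivative_eq_intros)
 then show ?thesis using \<open>\<bar>tht tau - alp tau\<bar> <= _\<close> r by (intro mult_left_mono) auto
 qed
 moreover have "x tau - K tau = - (X tau - r * cos (tht tau)) - r * (cos (tht tau) - cos (alp tau))"
 by (simp add: X_def K_def algebra_simps)
 moreover have "\<bar>r * (cos (tht tau) - cos (alp tau))\<bar> = r * \<bar>cos (tht tau) - cos (alp tau)\<bar>" using r by (simp add: abs_mult)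
 ultimately have "\<bar>x tau - K tau\<bar> <= C3 * eps + r * (sqrt q1 * (C4 * eps / sqrt q0 * tau))" using Xcos[OF tau] by linarith
 also have "\<dots> <= Cstab * (eps + eps * tau)"
 proof -
 have "0 <= C3 * (eps * tau)" "0 <= r * (sqrt q1 * (C4 / sqrt q0)) * eps" using C_nonneg eps tau r q1 sq0 by auto
 then show ?thesis unfolding Cstab_def by (simp add: algebra_simps add_divide_distrib)
 qed
 finally show ?thesis .
qed

end

section \<open>The sextic polynomial and its turning points\<close>

definition hh :: "real => real" where "hh gm = 5 * gm - 59 / 2 * gm\<^sup>2 + 3 * gm * (1 - gm) * sqrt ((7 + gm) * (1 - gm))"
definition VV :: "real => real => real" where "VV h x = h + 59 / 2 * x\<^sup>2 - 5 * x"
text \<open>The square of 12 Im X on the level set, where X is the coupling between the two pairs of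
  modes: the first term is 144 times the squared modulus of X, and \<open>VV\<close> is six times
  its real part.\<close>

definition PP :: "real => real => real" where "PP h x = 36 * x\<^sup>2 * (1 - x) ^ 3 * (7 + x) - 4 * (VV h x)\<^sup>2"
definition dPP :: "real => real => real" where
 "dPP h x = 36 * (2 * x * (1 - x) ^ 3 * (7 + x) - 3 * x\<^sup>2 * (1 - x)\<^sup>2 * (7 + x) + x\<^sup>2 * (1 - x) ^ 3) - 8 * VV h x * (59 * x - 5)"

lemma PP_deriv: "(PP h hrd dPP h x) (at x)"
 unfolding PP_def[abs_def] dPP_def VV_def
 by (auto intro!: derivative_eq_intros simp: algebra_simps eval_nat_numeral)

context
 fixes gm :: real
 assumes gm: "0 < gm" "gm < 1 / 10"
begin

definition sq :: "real => real" where "sq x = sqrt ((7 + x) * (1 - x))"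
definition UU :: "real => real" where "UU x = 3 * x * (1 - x) * sq x"
text \<open>\<open>PP\<close> is four times the difference of the squares of \<open>UU\<close> and
  \<open>VV\<close>. Up to the factor \<open>UU + VV\<close>, which is shown to be positive, its
  zeros are those of \<open>DD\<close>.\<close>

definition DD :: "real => real" where "DD x = UU x - VV (hh gm) x"
definition UU' :: "real => real" where "UU' x = 3 * (1 - 2 * x) * sq x - 3 * (x * (1 - x) * (3 + x) / sq x)"
definition DD' :: "real => real" where "DD' x = UU' x - (59 * x - 5)"

lemma sq_pos: "0 <= x ==> x < 1 ==> 0 < sq x" by (simp add: sq_def)

lemma sq_antimono: assumes "0 <= x" "x <= y" "y < 1" shows "sq y <= sq x"
proof -
 have "(7 + y) * (1 - y) <= (7 + x) * (1 - x)"
 proof -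
 have "(7 + x) * (1 - x) - (7 + y) * (1 - y) = (y - x) * (6 + x + y)" by (simp add: algebra_simps)
 moreover have "0 <= (y - x) * (6 + x + y)" using assms by (intro mult_nonneg_nonneg) auto
 ultimately show ?thesis by linarith
 qed
 then show ?thesis by (simp add: sq_def)
qed

lemma UU_deriv: assumes "0 <= x" "x < 1" shows "(UU hrd UU' x) (at x)"
proof -
 have p: "0 < (7 + x) * (1 - x)" using assms by simp
 have "((%x. (7 + x) * (1 - x)) hrd - (6 + 2 * x)) (at x)"
 by (auto intro!: derivative_eq_intros)
 from DERIV_chain2[OF DERIV_real_sqrt[OF p] this]
 have "(sq hrd inverse (sq x) / 2 * - (6 + 2 * x)) (at x)" unfolding sq_def .
 moreover have "inverse (sq x) / 2 * - (6 + 2 * x) = - (3 + x) / sq x" using sq_pos[OF assms] by (simp add: field_simps)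
 ultimately have s: "(sq hrd - (3 + x) / sq x) (at x)" by (simp only:)
 have "(UU hrd 3 * x * (1 - x) * (- (3 + x) / sq x) + (3 * x * (0 - 1) + 3 * 1 * (1 - x)) * sq x) (at x)"
 unfolding UU_def[abs_def] by (rule DERIV_mult'[OF _ s]) (auto intro!: derivative_eq_intros)
 moreover have "3 * x * (1 - x) * (- (3 + x) / sq x) + (3 * x * (0 - 1) + 3 * 1 * (1 - x)) * sq x = UU' x"
 unfolding UU'_def by (simp add: algebra_simps add_divide_distrib diff_divide_distrib)
 ultimately show ?thesis by (simp only:)
qed

lemma VV_deriv: "(VV h hrd 59 * x - 5) (at x)"
 unfolding VV_def[abs_def] by (auto intro!: derivative_eq_intros)

lemma DD_deriv: "0 <= x ==> x < 1 ==> (DD hrd DD' x) (at x)"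
 unfolding DD_def[abs_def] DD'_def by (intro DERIV_diff UU_deriv VV_deriv)

text \<open>Strict concavity of \<open>DD\<close> up to 2/5. It allows at most two zeros there and
  replaces a root count for the sextic.\<close>

lemma DD'_strict: assumes "0 <= x" "x < y" "y <= 2 / 5" shows "DD' y < DD' x"
proof -
 have s: "sq y <= sq x" "0 < sq x" "0 < sq y" using assms sq_antimono[of x y] sq_pos by auto
 have "(1 - 2 * y) * sq y <= (1 - 2 * x) * sq x" using assms s by (intro mult_mono) auto
 moreover have "x * (1 - x) * (3 + x) / sq x <= y * (1 - y) * (3 + y) / sq y"
 proof (rule frac_le)
 have xy: "x * (1 - x) <= y * (1 - y)"
 proof -
 have "y * (1 - y) - x * (1 - x) = (y - x) * (1 - x - y)" by (simp add: algebra_simps)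
 moreover have "0 <= (y - x) * (1 - x - y)" using assms by (intro mult_nonneg_nonneg) auto
 ultimately show ?thesis by linarith
 qed
 show "x * (1 - x) * (3 + x) <= y * (1 - y) * (3 + y)" by (rule mult_mono[OF xy]) (use assms in auto)
 show "0 <= y * (1 - y) * (3 + y)" using assms by simp
 qed (use s in auto)
 ultimately show ?thesis unfolding DD'_def UU'_def using assms by linarith
qed

text \<open>By concavity it is enough to test the slope at 1/10. \<open>DD\<close> still increases
  up to there, so starting from its zero at \<open>gm\<close> it is positive at 1/10, and the other
  turning point lies beyond 1/10.\<close>

lemma DD'_pos: assumes "0 <= x" "x <= 1 / 10" shows "0 < DD' x"
proof -
 have a: "5 / 2 <= sq (1 / 10)" unfolding sq_def by (rule real_le_rsqrt) (simp add: power2_eq_square)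
 define c :: real where "c = 1 / 10 * (1 - 1 / 10) * (3 + 1 / 10)"
 have "c / sq (1 / 10) <= c / (5 / 2)" using a by (intro divide_left_mono) (auto simp: c_def)
 moreover have "DD' (1 / 10) = 12 / 5 * sq (1 / 10) - 3 * (c / sq (1 / 10)) - 9 / 10" by (simp add: DD'_def UU'_def c_def)
 ultimately have "0 < DD' (1 / 10)" using a by (simp add: c_def)
 moreover have "x < 1 / 10 \<or> x = 1 / 10" using assms by linarith
 ultimately show ?thesis using DD'_strict[of x "1 / 10"] assms by (elim disjE) (simp, simp only:)
qed

lemma hh_pos: "0 < hh gm"
proof -
 have "hh gm = gm * (5 - 59 / 2 * gm) + 3 * gm * (1 - gm) * sqrt ((7 + gm) * (1 - gm))"
 by (simp add: hh_def power2_eq_square algebra_simps)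
 moreover have "0 < gm * (5 - 59 / 2 * gm)" using gm by (intro mult_pos_pos) auto
 moreover have "0 <= 3 * gm * (1 - gm) * sqrt ((7 + gm) * (1 - gm))" using gm by (intro mult_nonneg_nonneg) auto
 ultimately show ?thesis by linarith
qed

text \<open>The level \<open>hh gm\<close> is made for this: the amplitudes of the data are real and
  positive, so X starts real and positive, and \<open>gm\<close> is a turning point.\<close>

lemma DD_gm: "DD gm = 0" by (simp add: DD_def UU_def VV_def hh_def sq_def)

lemma DD_cont: "0 <= a ==> b < 1 ==> continuous_on {a..b} DD"
 by (rule DERIV_continuous_on[of _ _ DD'], rule has_field_derivative_at_within, rule DD_deriv) auto

lemma ex_kap: "\<exists>kap. 1 / 10 < kap & kap < 2 / 5 & DD kap = 0"
proof -
 have "DD gm < DD (1 / 10)"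
 using DERIV_pos_imp_increasing[of gm "1 / 10" DD] gm DD_deriv DD'_pos by force
 then have 1: "0 < DD (1 / 10)" by (simp add: DD_gm)
 \<comment> \<open>At 2/5 the polynomial part wins: \<open>UU\<close> is at most 2.16, while
   \<open>VV\<close> is 2.72 plus the positive level.\<close>
 have "sq (2 / 5) <= 3" unfolding sq_def by (rule real_le_lsqrt) (simp_all add: power2_eq_square)
 then have 2: "DD (2 / 5) < 0" using hh_pos by (simp add: DD_def UU_def VV_def power2_eq_square)
 obtain x where x: "1 / 10 <= x" "x <= 2 / 5" "DD x = 0"
 using IVT2'[of DD "2 / 5" 0 "1 / 10"] 1 2 DD_cont[of "1 / 10" "2 / 5"] by auto
 have "x ~= 1 / 10" "x ~= 2 / 5" using x(3) 1 2 by (metis less_irrefl)+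
 then show ?thesis using x by (intro exI[of _ x]) (metis less_le)
qed

text \<open>A strictly concave function that vanishes at \<open>gm\<close> and \<open>kap\<close> is
  positive in between, by the mean value theorem on both sides of a putative bad point. Its negative
  slope at \<open>kap\<close> makes that zero simple.\<close>

lemma DD_between:
 assumes kap: "1 / 10 < kap" "kap < 2 / 5" "DD kap = 0"
 shows "gm < x ==> x < kap ==> 0 < DD x" "DD' kap < 0"
proof -
 show "DD' kap < 0"
 proof (rule ccontr)
 assume "\<not> DD' kap < 0"
 then have pos: "0 < DD' x" if "0 <= x" "x < kap" for x using DD'_strict[of x kap] that kap by simp
 have "DD gm < DD kap"
 proof (rule DERIV_pos_imp_increasing_open[where f = DD])
 show "\<exists>y. (DD hrd y) (at x) & 0 < y" if "gm < x" "x < kap" for x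
 by (intro exI[of _ "DD' x"] conjI DD_deriv pos) (use that gm kap in auto)
 qed (use gm kap in \<open>auto intro: DD_cont\<close>)
 then show False by (simp add: DD_gm kap)
 qed
 assume x: "gm < x" "x < kap"
 show "0 < DD x"
 proof (rule ccontr)
 assume n: "\<not> 0 < DD x"
 have "\<exists>c>gm. c < x & DD x - DD gm = (x - gm) * DD' c"
 by (rule MVT2[where f = DD and f' = DD']) (use x gm kap in \<open>auto intro: DD_deriv\<close>)
 then obtain c1 where c1: "gm < c1" "c1 < x" "DD x - DD gm = (x - gm) * DD' c1" by blast
 have "\<exists>c>x. c < kap & DD kap - DD x = (kap - x) * DD' c"
 by (rule MVT2[where f = DD and f' = DD']) (use x gm kap in \<open>auto intro: DD_deriv\<close>)
 then obtain c2 where c2: "x < c2" "c2 < kap" "DD kap - DD x = (kap - x) * DD' c2" by blast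
 have "DD' c1 <= 0"
 proof (rule ccontr)
 assume "\<not> DD' c1 <= 0"
 then have "0 < (x - gm) * DD' c1" using x by (intro mult_pos_pos) auto
 then show False using c1(3) n DD_gm by simp
 qed
 moreover have "0 <= DD' c2"
 proof (rule ccontr)
 assume "\<not> 0 <= DD' c2"
 then have "(kap - x) * DD' c2 < 0" using x by (intro mult_pos_neg) auto
 then show False using c2(3) n kap by simp
 qed
 ultimately show False using DD'_strict[of c1 c2] c1 c2 gm kap by simp
 qed
qed

lemma UV_pos: assumes "0 < x" "x <= 2 / 5" shows "0 < UU x + VV (hh gm) x"
proof -
 have "0 < 59 / 2 * x - 5 + 3 * (1 - x) * sq x"
 proof (cases "x <= 1 / 10")
 case True
 have "5 / 2 <= sq (1 / 10)" unfolding sq_def by (rule real_le_rsqrt) (simp add: power2_eq_square)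
 also have "\<dots> <= sq x" using sq_antimono[of x "1 / 10"] assms True by simp
 finally have "(27 / 10) * (5 / 2) <= 3 * (1 - x) * sq x" using True by (intro mult_mono) auto
 then show ?thesis using assms by linarith
 next
 case False
 have "2 <= sq (2 / 5)" unfolding sq_def by (rule real_le_rsqrt) (simp add: power2_eq_square)
 also have "\<dots> <= sq x" using sq_antimono[of x "2 / 5"] assms by simp
 finally have "(9 / 5) * 2 <= 3 * (1 - x) * sq x" using assms by (intro mult_mono) auto
 then show ?thesis using False by linarith
 qed
 then have "0 < x * (59 / 2 * x - 5 + 3 * (1 - x) * sq x)" using assms by (intro mult_pos_pos) auto
 also have "x * (59 / 2 * x - 5 + 3 * (1 - x) * sq x) = UU x + VV (hh gm) x - hh gm"
 by (simp add: UU_def VV_def power2_eq_square algebra_simps)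
 finally show ?thesis using hh_pos by linarith
qed

lemma PP_factor: assumes "0 <= x" "x < 1" shows "PP (hh gm) x = 4 * DD x * (UU x + VV (hh gm) x)"
proof -
 have "(sq x)\<^sup>2 = (7 + x) * (1 - x)" using assms by (simp add: sq_def)
 then have "(UU x)\<^sup>2 = 9 * x\<^sup>2 * (1 - x)\<^sup>2 * ((7 + x) * (1 - x))" by (simp add: UU_def power_mult_distrib)
 then have U2: "4 * (UU x)\<^sup>2 = 36 * x\<^sup>2 * (1 - x) ^ 3 * (7 + x)" by (simp add: eval_nat_numeral mult_ac)
 show ?thesis unfolding PP_def U2[symmetric] DD_def by (simp add: power2_eq_square algebra_simps)
qed

text \<open>Dividing the sextic by its two roots leaves a quartic that is positive between them
  because \<open>PP\<close> is, positive at them by comparing derivatives, and hence positive on a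
  compact neighbourhood, where the bounds of the locale are attained.\<close>

theorem orbit_data:
 "\<exists>kap dlt q0 q1 d1 Q Q'. planar_orbit gm kap dlt q0 q1 d1 Q Q' & 1 / 10 < kap & kap < 2 / 5 &
 (\<forall>x. planar_orbit.P gm kap Q x = PP (hh gm) x & planar_orbit.dP gm kap Q Q' x = dPP (hh gm) x)"
proof -
 obtain kap where kap: "1 / 10 < kap" "kap < 2 / 5" "DD kap = 0" using ex_kap by blast
 define h where "h = hh gm"
 define p where "p = smult 36 ([:0, 0, 1:] * [:1, -1:] ^ 3 * [:7, 1:]) - smult 4 ([:h, -5, 59 / 2:] ^ 2)"
 have pP: "poly p x = PP h x" for x
 by (simp add: p_def PP_def VV_def power2_eq_square power3_eq_cube algebra_simps)
 have "poly p gm = 0" unfolding pP h_def using PP_factor[of gm] gm by (simp add: DD_gm)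
 then obtain a where a: "p = [:- gm, 1:] * a" unfolding poly_eq_0_iff_dvd by (elim dvdE)
 have "poly p kap = 0" unfolding pP h_def using PP_factor[of kap] kap by simp
 then have "poly a kap = 0" using gm kap by (simp add: a)
 then obtain b where b: "a = [:- kap, 1:] * b" unfolding poly_eq_0_iff_dvd by (elim dvdE)
 define Q where "Q = poly (- b)"
 define Q' where "Q' = poly (pderiv (- b))"
 have PQ: "PP h x = (x - gm) * (kap - x) * Q x" for x
 unfolding pP[symmetric] a b Q_def by (simp add: algebra_simps)
 have Qd: "(Q hrd Q' x) (at x)" for x unfolding Q_def Q'_def by (rule poly_DERIV)
 have Qc: "isCont Q x" for x using Qd by (rule DERIV_isCont)
 have PPd: "(PP h hrd ((x - gm) * (- 1) + 1 * (kap - x)) * Q x + (x - gm) * (kap - x) * Q' x) (at x)" for x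
 unfolding PQ[abs_def] by (auto intro!: derivative_eq_intros Qd simp: algebra_simps)
 have PPD: "dPP h x = 4 * DD' x * (UU x + VV h x)" if "0 < x" "x < 1" "DD x = 0" for x
 proof -
 have "((%x. 4 * DD x * (UU x + VV h x)) hrd 4 * DD x * (UU' x + (59 * x - 5)) + (4 * DD' x) * (UU x + VV h x)) (at x)"
 using that by (intro DERIV_mult' DERIV_cmult DD_deriv DERIV_add UU_deriv VV_deriv) auto
 then have "(PP h hrd 4 * DD' x * (UU x + VV h x)) (at x)"
 using that by (intro has_field_derivative_transform_within_open[of "%x. 4 * DD x * (UU x + VV h x)" _ x "{0<..<1}" "PP h"])
 (auto simp: PP_factor[unfolded h_def[symmetric]])
 then show ?thesis using PP_deriv DERIV_unique by blast
 qed
 have Qin: "0 < Q x" if "gm < x" "x < kap" for x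
 proof -
 have "0 < 4 * DD x * (UU x + VV h x)" using DD_between(1)[OF kap that] UV_pos[of x] that gm kap unfolding h_def by (intro mult_pos_pos) auto
 then have "0 < (x - gm) * (kap - x) * Q x" using PP_factor[of x] that gm kap unfolding h_def[symmetric] PQ by simp
 moreover have "0 < (x - gm) * (kap - x)" using that by simp
 ultimately show ?thesis by (rule zero_less_mult_pos)
 qed
 have Qgm: "0 < Q gm"
 proof -
 have "(kap - gm) * Q gm = dPP h gm" using DERIV_unique[OF PPd[of gm] PP_deriv] by simp
 also have "\<dots> = 4 * DD' gm * (UU gm + VV h gm)" using gm by (intro PPD) (auto simp: DD_gm)
 also have "\<dots> > 0" using DD'_pos[of gm] UV_pos[of gm] gm unfolding h_def by (intro mult_pos_pos) auto
 finally show ?thesis using gm kap by (simp add: zero_less_mult_iff)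
 qed
 have Qkap: "0 < Q kap"
 proof -
 have "- (kap - gm) * Q kap = dPP h kap" using DERIV_unique[OF PPd[of kap] PP_deriv] by simp
 also have "\<dots> = 4 * DD' kap * (UU kap + VV h kap)" using kap by (intro PPD) auto
 also have "\<dots> < 0" using DD_between(2)[OF kap] UV_pos[of kap] kap unfolding h_def by (intro mult_neg_pos[of "4 * _"]) auto
 finally have "0 < (kap - gm) * Q kap" by (simp add: algebra_simps)
 then show ?thesis using gm kap by (simp add: zero_less_mult_iff)
 qed
 have nbhd: "\<exists>d>0. \<forall>x. \<bar>x - y\<bar> < d --> 0 < Q x" if "0 < Q y" for y
 proof -
 have "\<forall>\<^sub>F x in at y. 0 < Q x" using order_tendstoD(1)[OF Qc[of y, unfolded isCont_def] that] .
 then obtain d where "d > 0" "!!x. x ~= y ==> dist x y < d ==> 0 < Q x" by (auto simp: eventually_at)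
 then show ?thesis using that by (intro exI[of _ d]) (metis dist_real_def)
 qed
 obtain da where da: "0 < da" "!!x. \<bar>x - gm\<bar> < da ==> 0 < Q x" using nbhd[OF Qgm] by blast
 obtain db where db: "0 < db" "!!x. \<bar>x - kap\<bar> < db ==> 0 < Q x" using nbhd[OF Qkap] by blast
 define dlt where "dlt = min da db / 2"
 have dlt: "0 < dlt" "dlt < da" "dlt < db" using da db by (auto simp: dlt_def)
 define I where "I = {gm - dlt..kap + dlt}"
 have I: "compact I" "I ~= {}" using dlt gm kap by (auto simp: I_def)
 have QI: "0 < Q x" if "x : I" for x
 proof -
 consider "x <= gm" | "gm < x" "x < kap" | "kap <= x" by linarith
 then show ?thesis using that da(2)[of x] db(2)[of x] Qin[of x] dlt unfolding I_def by cases auto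
 qed
 have cQ: "continuous_on I Q" using Qc by (simp add: continuous_at_imp_continuous_on)
 have cQ': "continuous_on X Q'" for X unfolding Q'_def by (intro continuous_intros)
 obtain y0 where y0: "y0 : I" "!!x. x : I ==> Q y0 <= Q x" using continuous_attains_inf[OF I cQ] by blast
 obtain y1 where y1: "y1 : I" "!!x. x : I ==> Q x <= Q y1" using continuous_attains_sup[OF I cQ] by blast
 obtain y2 where y2: "y2 : I" "!!x. x : I ==> \<bar>Q' x\<bar> <= \<bar>Q' y2\<bar>"
 using continuous_attains_sup[OF I, of "%x. \<bar>Q' x\<bar>"] cQ'[of I] by (auto intro: continuous_intros)
 have po: "planar_orbit gm kap dlt (Q y0) (Q y1) \<bar>Q' y2\<bar> Q Q'"
 by unfold_locales (use gm kap dlt QI[OF y0(1)] Qd cQ' y0 y1 y2 in \<open>auto simp: I_def\<close>)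
 have P: "planar_orbit.P gm kap Q x = PP h x" for x unfolding planar_orbit.P_def[OF po] PQ ..
 have "planar_orbit.dP gm kap Q Q' x = dPP h x" for x
 using DERIV_unique[OF PPd[of x] PP_deriv] unfolding planar_orbit.dP_def[OF po] planar_orbit.m_def[OF po]
 by (simp add: field_simps)
 then show ?thesis using po P kap unfolding h_def by blast
qed

end

section \<open>Normal form\<close>

text \<open>The increment \<open>h\<close> visits every slot, with \<open>p\<close> before it and
  \<open>q\<close> after it. For \<open>p = q\<close> this is the derivative of the quintic sum; for
  different arguments it is the exact finite difference.\<close>

definition X5 :: "int set => (int => complex) => (int => complex) => (int => complex) => (int => complex) => int => complex" where
 "X5 J kap p h q j = qsum J kap h q q q q j + qsum J kap p h q q q j + qsum J kap p p h q q j
 + qsum J kap p p p h q j + qsum J kap p p p p h j"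

text \<open>A time antiderivative of the oscillating part of \<open>kF\<close>, up to the factor i.
  Nonzero defects are integers, so there are no small divisors.\<close>

definition kP :: "real => int => complex" where "kP t x = (if x = 0 then 0 else cis (t * rl x) / of_int x)"

lemma kP_norm [simp]: "cmod (kP t x) <= 1"
proof (cases "x = 0")
 case False
 then have "1 <= \<bar>rl x\<bar>" by linarith
 then show ?thesis by (simp add: kP_def norm_divide divide_le_eq)
qed (simp add: kP_def)

lemma kP_has_vector_derivative: "((%t. kP t x) hvd \<i> * (kF t x - kR x)) (at t)"
proof (cases "x = 0")
 case True then show ?thesis by (simp add: kP_def kF_def kR_def)
next
 case False
 have "((%t. (1 / of_int x) * kF t x) hvd (1 / of_int x) * (\<i> * of_int x * kF t x)) (at t)"
 by (intro has_vector_derivative_mult_right kF_has_vector_derivative)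
 then show ?thesis using False by (simp add: kP_def kF_def kR_def)
qed

lemma qsum_X5_diff: "qsum J kap w w w w w j - qsum J kap v v v v v j = X5 J kap v (%i. w i - v i) w j"
 unfolding qsum_diff X5_def ..

lemma X5_real_scale: "X5 J kap p (%i. cpx c * h i) q j = cpx c * X5 J kap p h q j"
 using qsum_scale[of J kap c h 1 q 1 q 1 q 1 q j] qsum_scale[of J kap 1 p c h 1 q 1 q 1 q j]
 qsum_scale[of J kap 1 p 1 p c h 1 q 1 q j] qsum_scale[of J kap 1 p 1 p 1 p c h 1 q j] qsum_scale[of J kap 1 p 1 p 1 p 1 p c h j]
 by (simp add: X5_def distrib_left)

text \<open>20^4, four applications of \<open>wt_conv\<close>.\<close>

definition K0 :: real where "K0 = 160000"

lemma qs_bound: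
 assumes fin: "finite J" and k: "!!x. cmod (kap x) <= 1" and b: "0 <= b" and h: "0 <= bh"
 and p: "!!i. i : J ==> cmod (p i) <= b * wt i" and q: "!!i. i : J ==> cmod (q i) <= b * wt i"
 and r: "!!i. i : J ==> cmod (r i) <= b * wt i" and s: "!!i. i : J ==> cmod (s i) <= b * wt i"
 and d: "!!i. i : J ==> cmod (d i) <= bh * wt i"
 shows "cmod (qsum J kap d p q r s j) <= K0 * b ^ 4 * bh * wt j" "cmod (qsum J kap p d q r s j) <= K0 * b ^ 4 * bh * wt j"
 "cmod (qsum J kap p q d r s j) <= K0 * b ^ 4 * bh * wt j" "cmod (qsum J kap p q r d s j) <= K0 * b ^ 4 * bh * wt j"
 "cmod (qsum J kap p q r s d j) <= K0 * b ^ 4 * bh * wt j"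
 using qsum_wt_bound[of J kap d bh p b q b r b s b j, OF fin k d p q r s h b b b b] qsum_wt_bound[of J kap p b d bh q b r b s b j, OF fin k p d q r s b h b b b]
 qsum_wt_bound[of J kap p b q b d bh r b s b j, OF fin k p q d r s b b h b b] qsum_wt_bound[of J kap p b q b r b d bh s b j, OF fin k p q r d s b b b h b]
 qsum_wt_bound[of J kap p b q b r b s b d bh j, OF fin k p q r s d b b b b h]
 by (simp_all add: K0_def eval_nat_numeral mult_ac)

lemma norm_sum5: "cmod (a + b + c + d + e) <= cmod a + cmod b + cmod c + cmod d + cmod e"
 by (intro order_trans[OF norm_triangle_ineq] add_mono order_refl)

lemma X5_wt:
 assumes fin: "finite J" and k: "!!x. cmod (kap x) <= 1" and b: "0 <= b" and bh: "0 <= bh"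
 and p: "!!i. i : J ==> cmod (p i) <= b * wt i" and q: "!!i. i : J ==> cmod (q i) <= b * wt i"
 and h: "!!i. i : J ==> cmod (h i) <= bh * wt i"
 shows "cmod (X5 J kap p h q j) <= 5 * (K0 * b ^ 4 * bh) * wt j"
 unfolding X5_def
 using norm_sum5[of "qsum J kap h q q q q j" "qsum J kap p h q q q j" "qsum J kap p p h q q j" "qsum J kap p p p h q j" "qsum J kap p p p p h j"]
 qs_bound(1)[where kap = kap and p = q and q = q and r = q and s = q and d = h, OF fin k b bh q q q q h, where j = j]
 qs_bound(2)[where kap = kap and p = p and q = q and r = q and s = q and d = h, OF fin k b bh p q q q h, where j = j]
 qs_bound(3)[where kap = kap and p = p and q = p and r = q and s = q and d = h, OF fin k b bh p p q q h, where j = j]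
 qs_bound(4)[where kap = kap and p = p and q = p and r = p and s = q and d = h, OF fin k b bh p p p q h, where j = j]
 qs_bound(5)[where kap = kap and p = p and q = p and r = p and s = p and d = h, OF fin k b bh p p p p h, where j = j]
 by (simp add: algebra_simps)

lemma qsum_lip_wt:
 assumes fin: "finite J" and k: "!!x. cmod (kap x) <= 1" and b: "0 <= b" and d: "0 <= d1" "0 <= d2" "0 <= d3" "0 <= d4" "0 <= d5"
 and p: "!!i. i : J ==> cmod (p i) <= b * wt i" "!!i. i : J ==> cmod (q i) <= b * wt i" "!!i. i : J ==> cmod (r i) <= b * wt i"
 "!!i. i : J ==> cmod (s i) <= b * wt i" "!!i. i : J ==> cmod (t i) <= b * wt i"
 and p': "!!i. i : J ==> cmod (p' i) <= b * wt i" "!!i. i : J ==> cmod (q' i) <= b * wt i" "!!i. i : J ==> cmod (r' i) <= b * wt i"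
 "!!i. i : J ==> cmod (s' i) <= b * wt i" "!!i. i : J ==> cmod (t' i) <= b * wt i"
 and dp: "!!i. i : J ==> cmod (p i - p' i) <= d1 * wt i" "!!i. i : J ==> cmod (q i - q' i) <= d2 * wt i"
 "!!i. i : J ==> cmod (r i - r' i) <= d3 * wt i" "!!i. i : J ==> cmod (s i - s' i) <= d4 * wt i" "!!i. i : J ==> cmod (t i - t' i) <= d5 * wt i"
 shows "cmod (qsum J kap p q r s t j - qsum J kap p' q' r' s' t' j) <= K0 * b ^ 4 * (d1 + d2 + d3 + d4 + d5) * wt j"
proof -
 have "cmod (qsum J kap (%i. p i - p' i) q r s t j) <= K0 * b ^ 4 * d1 * wt j" by (rule qs_bound(1)) (use assms in auto)
 moreover have "cmod (qsum J kap p' (%i. q i - q' i) r s t j) <= K0 * b ^ 4 * d2 * wt j" by (rule qs_bound(2)) (use assms in auto)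
 moreover have "cmod (qsum J kap p' q' (%i. r i - r' i) s t j) <= K0 * b ^ 4 * d3 * wt j" by (rule qs_bound(3)) (use assms in auto)
 moreover have "cmod (qsum J kap p' q' r' (%i. s i - s' i) t j) <= K0 * b ^ 4 * d4 * wt j" by (rule qs_bound(4)) (use assms in auto)
 moreover have "cmod (qsum J kap p' q' r' s' (%i. t i - t' i) j) <= K0 * b ^ 4 * d5 * wt j" by (rule qs_bound(5)) (use assms in auto)
 ultimately show ?thesis unfolding qsum_diff
 using norm_sum5[of "qsum J kap (%i. p i - p' i) q r s t j" "qsum J kap p' (%i. q i - q' i) r s t j" "qsum J kap p' q' (%i. r i - r' i) s t j"
 "qsum J kap p' q' r' (%i. s i - s' i) t j" "qsum J kap p' q' r' s' (%i. t i - t' i) j"]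
 by (simp add: algebra_simps)
qed

lemma X5_diff_norm: "cmod (X5 J kap p h q j - X5 J kap p' h' q' j) <= cmod (qsum J kap h q q q q j - qsum J kap h' q' q' q' q' j) + cmod (qsum J kap p h q q q j - qsum J kap p' h' q' q' q' j) + cmod (qsum J kap p p h q q j - qsum J kap p' p' h' q' q' j)
 + cmod (qsum J kap p p p h q j - qsum J kap p' p' p' h' q' j) + cmod (qsum J kap p p p p h j - qsum J kap p' p' p' p' h' j)"
proof -
 have "X5 J kap p h q j - X5 J kap p' h' q' j = (qsum J kap h q q q q j - qsum J kap h' q' q' q' q' j) + (qsum J kap p h q q q j - qsum J kap p' h' q' q' q' j) + (qsum J kap p p h q q j - qsum J kap p' p' h' q' q' j)
 + (qsum J kap p p p h q j - qsum J kap p' p' p' h' q' j) + (qsum J kap p p p p h j - qsum J kap p' p' p' p' h' j)"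
 by (simp add: X5_def)
 then show ?thesis by (simp only: norm_sum5)
qed

lemma X5_lip_wt:
 assumes fin: "finite J" and k: "!!x. cmod (kap x) <= 1" and b: "0 <= b" and d: "0 <= dp" "0 <= dh" "0 <= dq"
 and p: "!!i. i : J ==> cmod (p i) <= b * wt i" "!!i. i : J ==> cmod (h i) <= b * wt i" "!!i. i : J ==> cmod (q i) <= b * wt i"
 and p': "!!i. i : J ==> cmod (p' i) <= b * wt i" "!!i. i : J ==> cmod (h' i) <= b * wt i" "!!i. i : J ==> cmod (q' i) <= b * wt i"
 and dd: "!!i. i : J ==> cmod (p i - p' i) <= dp * wt i" "!!i. i : J ==> cmod (h i - h' i) <= dh * wt i" "!!i. i : J ==> cmod (q i - q' i) <= dq * wt i"
 shows "cmod (X5 J kap p h q j - X5 J kap p' h' q' j) <= K0 * b ^ 4 * (5 * dh + 10 * dp + 10 * dq) * wt j"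
proof -
 note L = qsum_lip_wt[where kap = kap, OF fin k b]
 have "cmod (qsum J kap h q q q q j - qsum J kap h' q' q' q' q' j) <= K0 * b ^ 4 * (dh + dq + dq + dq + dq) * wt j" by (rule L) (use assms in auto)
 moreover have "cmod (qsum J kap p h q q q j - qsum J kap p' h' q' q' q' j) <= K0 * b ^ 4 * (dp + dh + dq + dq + dq) * wt j" by (rule L) (use assms in auto)
 moreover have "cmod (qsum J kap p p h q q j - qsum J kap p' p' h' q' q' j) <= K0 * b ^ 4 * (dp + dp + dh + dq + dq) * wt j" by (rule L) (use assms in auto)
 moreover have "cmod (qsum J kap p p p h q j - qsum J kap p' p' p' h' q' j) <= K0 * b ^ 4 * (dp + dp + dp + dh + dq) * wt j" by (rule L) (use assms in auto)
 moreover have "cmod (qsum J kap p p p p h j - qsum J kap p' p' p' p' h' j) <= K0 * b ^ 4 * (dp + dp + dp + dp + dh) * wt j" by (rule L) (use assms in auto)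
 ultimately show ?thesis using X5_diff_norm[of J kap p h q j p' h' q'] by (simp add: algebra_simps)
qed

lemma qsum_lip_n1:
 assumes fin: "finite J" and k: "!!x. cmod (kap x) <= 1"
 and b: "n1 J p <= b" "n1 J q <= b" "n1 J r <= b" "n1 J s <= b" "n1 J t <= b" "n1 J p' <= b" "n1 J q' <= b" "n1 J r' <= b" "n1 J s' <= b" "n1 J t' <= b"
 shows "n1 J (%j. qsum J kap p q r s t j - qsum J kap p' q' r' s' t' j) <=
 b ^ 4 * (n1 J (%i. p i - p' i) + n1 J (%i. q i - q' i) + n1 J (%i. r i - r' i) + n1 J (%i. s i - s' i) + n1 J (%i. t i - t' i))"
proof -
 have b0: "0 <= b" using b(1) n1_nonneg order_trans by blast
 have m: "x * y * z * u * d <= b ^ 4 * d" if "0 <= x" "0 <= y" "0 <= z" "0 <= u" "0 <= d" "x <= b" "y <= b" "z <= b" "u <= b" for x y z u d :: real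
 proof -
 have "x * y * z * u <= b * b * b * b" using that b0 by (intro mult_mono) auto
 then show ?thesis using that by (intro mult_right_mono) (auto simp: eval_nat_numeral mult_ac)
 qed
 note M = m[OF n1_nonneg n1_nonneg n1_nonneg n1_nonneg n1_nonneg]
 have 1: "n1 J (qsum J kap (%i. p i - p' i) q r s t) <= b ^ 4 * n1 J (%i. p i - p' i)"
 using qsum_n1[where kap = kap, OF fin k, of J "%i. p i - p' i" q r s t] M[OF b(2) b(3) b(4) b(5), of J "%i. p i - p' i"] by (simp add: mult_ac)
 have 2: "n1 J (qsum J kap p' (%i. q i - q' i) r s t) <= b ^ 4 * n1 J (%i. q i - q' i)"
 using qsum_n1[where kap = kap, OF fin k, of J p' "%i. q i - q' i" r s t] M[OF b(6) b(3) b(4) b(5), of J "%i. q i - q' i"] by (simp add: mult_ac)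
 have 3: "n1 J (qsum J kap p' q' (%i. r i - r' i) s t) <= b ^ 4 * n1 J (%i. r i - r' i)"
 using qsum_n1[where kap = kap, OF fin k, of J p' q' "%i. r i - r' i" s t] M[OF b(6) b(7) b(4) b(5), of J "%i. r i - r' i"] by (simp add: mult_ac)
 have 4: "n1 J (qsum J kap p' q' r' (%i. s i - s' i) t) <= b ^ 4 * n1 J (%i. s i - s' i)"
 using qsum_n1[where kap = kap, OF fin k, of J p' q' r' "%i. s i - s' i" t] M[OF b(6) b(7) b(8) b(5), of J "%i. s i - s' i"] by (simp add: mult_ac)
 have 5: "n1 J (qsum J kap p' q' r' s' (%i. t i - t' i)) <= b ^ 4 * n1 J (%i. t i - t' i)"
 using qsum_n1[where kap = kap, OF fin k, of J p' q' r' s' "%i. t i - t' i"] M[OF b(6) b(7) b(8) b(9), of J "%i. t i - t' i"] by (simp add: mult_ac)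
 have "n1 J (%j. qsum J kap p q r s t j - qsum J kap p' q' r' s' t' j) <= n1 J (qsum J kap (%i. p i - p' i) q r s t) + n1 J (qsum J kap p' (%i. q i - q' i) r s t)
 + n1 J (qsum J kap p' q' (%i. r i - r' i) s t) + n1 J (qsum J kap p' q' r' (%i. s i - s' i) t) + n1 J (qsum J kap p' q' r' s' (%i. t i - t' i))"
 unfolding n1_def sum.distrib[symmetric] qsum_diff by (intro sum_mono norm_sum5)
 then show ?thesis using 1 2 3 4 5 by (simp add: algebra_simps)
qed

lemma X5_lip_n1:
 assumes fin: "finite J" and k: "!!x. cmod (kap x) <= 1"
 and b: "n1 J p <= b" "n1 J h <= b" "n1 J q <= b" "n1 J p' <= b" "n1 J h' <= b" "n1 J q' <= b"
 shows "n1 J (%j. X5 J kap p h q j - X5 J kap p' h' q' j) <= b ^ 4 * (5 * n1 J (%i. h i - h' i) + 10 * n1 J (%i. p i - p' i) + 10 * n1 J (%i. q i - q' i))"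
proof -
 note L = qsum_lip_n1[where kap = kap, OF fin k]
 define D where "D f g = n1 J (%i. f i - g i)" for f g :: "int => complex"
 have "n1 J (%j. X5 J kap p h q j - X5 J kap p' h' q' j) <= D (qsum J kap h q q q q) (qsum J kap h' q' q' q' q') + D (qsum J kap p h q q q) (qsum J kap p' h' q' q' q')
 + D (qsum J kap p p h q q) (qsum J kap p' p' h' q' q') + D (qsum J kap p p p h q) (qsum J kap p' p' p' h' q') + D (qsum J kap p p p p h) (qsum J kap p' p' p' p' h')"
 unfolding n1_def D_def sum.distrib[symmetric]
 by (intro sum_mono X5_diff_norm)
 also have "\<dots> <= b ^ 4 * (D h h' + D q q' + D q q' + D q q' + D q q') + b ^ 4 * (D p p' + D h h' + D q q' + D q q' + D q q')
 + b ^ 4 * (D p p' + D p p' + D h h' + D q q' + D q q') + b ^ 4 * (D p p' + D p p' + D p p' + D h h' + D q q') + b ^ 4 * (D p p' + D p p' + D p p' + D p p' + D h h')"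
 unfolding D_def by (intro add_mono L b)
 finally show ?thesis by (simp add: D_def algebra_simps)
qed

lemma n1_wt_le:
 assumes "finite J" "0 <= b" "!!i. i : J ==> cmod (p i) <= b * wt i"
 shows "n1 J p <= 5 * b"
proof -
 have "n1 J p <= (\<Sum>i\<in>J. b * (1 / (1 + (rl i)\<^sup>2)))"
 unfolding n1_def using assms wt_le by (intro sum_mono) (meson mult_left_mono order_trans)
 also have "\<dots> <= b * 5" unfolding sum_distrib_left[symmetric]
 using assms by (intro mult_left_mono sum_inverse_one_plus_sq_le) auto
 finally show ?thesis by simp
qed

lemma h1_wt_le:
 assumes "finite J" "0 <= b" "!!i. i : J ==> cmod (p i) <= b * wt i"
 shows "(\<Sum>j\<in>J. (1 + (rl j)\<^sup>2) * (cmod (p j))\<^sup>2) <= 5 * b\<^sup>2"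
proof -
 have "(\<Sum>j\<in>J. (1 + (rl j)\<^sup>2) * (cmod (p j))\<^sup>2) <= (\<Sum>j\<in>J. b\<^sup>2 * (1 / (1 + (rl j)\<^sup>2)))"
 proof (rule sum_mono)
 fix j assume j: "j : J"
 define s where "s = 1 + (rl j)\<^sup>2"
 have s: "1 <= s" by (simp add: s_def)
 have "cmod (p j) <= b * (1 / s)" using assms(3)[OF j] wt_le[of j] assms(2) unfolding s_def by (meson mult_left_mono order_trans)
 then have "(cmod (p j))\<^sup>2 <= (b * (1 / s))\<^sup>2" by (intro power_mono) auto
 then have "s * (cmod (p j))\<^sup>2 <= s * (b * (1 / s))\<^sup>2" using s by (intro mult_left_mono) auto
 also have "\<dots> = b\<^sup>2 * (1 / s)" using s by (simp add: power2_eq_square)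
 finally show "(1 + (rl j)\<^sup>2) * (cmod (p j))\<^sup>2 <= b\<^sup>2 * (1 / (1 + (rl j)\<^sup>2))" by (simp add: s_def)
 qed
 also have "\<dots> <= b\<^sup>2 * 5" unfolding sum_distrib_left[symmetric] using assms by (intro mult_left_mono sum_inverse_one_plus_sq_le) auto
 finally show ?thesis by simp
qed

definition Fv :: "int set => real => (int => complex) => int => complex" where "Fv J t v = qsum J (kF t) v v v v v"
definition Pv :: "int set => real => (int => complex) => int => complex" where "Pv J t v = qsum J (kP t) v v v v v"
definition Wv :: "real => int set => real => (int => complex) => int => complex" where
 "Wv l J t v = (%j. v j + cpx l * Pv J t v j)"
text \<open>The two parts have two sources: the resonant sum is evaluated at the new variable
  instead of \<open>v\<close>, and \<open>v\<close> moves inside the correction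
  \<open>Pv\<close>.\<close>

definition EE :: "real => int set => real => (int => complex) => int => complex" where
 "EE l J t v j = \<i> * X5 J kR v (Pv J t v) (Wv l J t v) j + X5 J (kP t) v (%i. - \<i> * Fv J t v i) v j"

text \<open>The explicit time derivative of the correction cancels the nonresonant part of the
  nonlinearity; all that is left over carries a second factor \<open>l\<close>.\<close>

lemma Wv_has_vector_derivative:
 assumes g: "galerkin l J v" and j: "j : J"
 shows "((%s. Wv l J s (v s) j) has_vector_derivative
 - \<i> * l * qsum J kR (Wv l J t (v t)) (Wv l J t (v t)) (Wv l J t (v t)) (Wv l J t (v t)) (Wv l J t (v t)) j
 + cpx (l\<^sup>2) * EE l J t (v t) j) (at t)"
proof -
 define w where "w = Wv l J t (v t)"
 define h where "h = (%i. - \<i> * Fv J t (v t) i)"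
 have v: "((%s. v s i) hvd cpx l * h i) (at t)" if "i : J" for i
 using g that by (simp add: galerkin_def Fv_def h_def mult_ac)
 have P: "((%s. Pv J s (v s) j) has_vector_derivative
 qsum J (%x. \<i> * (kF t x - kR x)) (v t) (v t) (v t) (v t) (v t) j + X5 J (kP t) (v t) (%i. cpx l * h i) (v t) j) (at t)"
 unfolding Pv_def X5_def by (rule qsum_has_vector_derivative[OF kP_has_vector_derivative v v v v v])
 have k: "qsum J (%x. \<i> * (kF t x - kR x)) (v t) (v t) (v t) (v t) (v t) j = \<i> * (Fv J t (v t) j - qsum J kR (v t) (v t) (v t) (v t) (v t) j)"
 using qsum_scale_kernel[of J \<i> "%x. kF t x + (-1) * kR x" "v t" "v t" "v t" "v t" "v t" j]
 qsum_add_kernel[of J "kF t" "%x. (-1) * kR x" "v t" "v t" "v t" "v t" "v t" j]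
 qsum_scale_kernel[of J "-1" kR "v t" "v t" "v t" "v t" "v t" j] by (simp add: Fv_def)
 have R: "qsum J kR w w w w w j - qsum J kR (v t) (v t) (v t) (v t) (v t) j = cpx l * X5 J kR (v t) (Pv J t (v t)) w j"
 unfolding qsum_X5_diff X5_real_scale[symmetric] by (simp add: w_def Wv_def)
 have "((%s. Wv l J s (v s) j) hvd cpx l * h j + cpx l *
 (\<i> * (Fv J t (v t) j - qsum J kR (v t) (v t) (v t) (v t) (v t) j) + cpx l * X5 J (kP t) (v t) h (v t) j)) (at t)"
 unfolding Wv_def by (intro has_vector_derivative_add v[OF j] has_vector_derivative_mult_right P[unfolded k X5_real_scale])
 moreover have "cpx l * h j + cpx l *
 (\<i> * (Fv J t (v t) j - qsum J kR (v t) (v t) (v t) (v t) (v t) j) + cpx l * X5 J (kP t) (v t) h (v t) j)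
 = - \<i> * l * (qsum J kR w w w w w j - cpx l * X5 J kR (v t) (Pv J t (v t)) w j) + cpx l * cpx l * X5 J (kP t) (v t) h (v t) j"
 unfolding R[symmetric] by (simp add: h_def algebra_simps)
 moreover have "\<dots> = - \<i> * l * qsum J kR w w w w w j + cpx (l\<^sup>2) * EE l J t (v t) j"
 by (simp add: EE_def w_def h_def power2_eq_square algebra_simps)
 ultimately show ?thesis by (simp add: w_def)
qed

lemma qsum_continuous:
 fixes p q r s u :: "real => int => complex"
 assumes "!!x. continuous_on X (%t. kap t x)" "!!i. continuous_on X (%t. p t i)" "!!i. continuous_on X (%t. q t i)"
 "!!i. continuous_on X (%t. r t i)" "!!i. continuous_on X (%t. s t i)" "!!i. continuous_on X (%t. u t i)"
 shows "continuous_on X (%t. qsum J (kap t) (p t) (q t) (r t) (s t) (u t) j)"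
 unfolding qsum_def
proof (intro continuous_on_sum)
 fix x :: "int \<times> int \<times> int \<times> int \<times> int"
 obtain a b c d e where x: "x = (a, b, c, d, e)" by (cases x) auto
 show "continuous_on X (%t. case x of (a, b, c, d, e) => if a + b + c = d + e + j
 then kap t (j\<^sup>2 + d\<^sup>2 + e\<^sup>2 - a\<^sup>2 - b\<^sup>2 - c\<^sup>2) * (p t a * q t b * r t c * cnj (s t d) * cnj (u t e)) else 0)"
 proof (cases "a + b + c = d + e + j")
 case True then show ?thesis unfolding x by simp (intro continuous_intros assms)
 qed (simp add: x)
qed

lemma EE_continuous:
 assumes v: "!!i. continuous_on X (%t. v t i)"
 shows "continuous_on X (%t. EE l J t (v t) j)"
proof -
 have kF: "continuous_on X (%t. kF t x)" for x
 unfolding kF_def by (intro continuous_intros)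
 have kP: "continuous_on X (%t. kP t x)" for x unfolding kP_def by (cases "x = 0") (auto intro!: continuous_intros)
 have F: "continuous_on X (%t. Fv J t (v t) i)" and P: "continuous_on X (%t. Pv J t (v t) i)" for i
 unfolding Fv_def Pv_def by (intro qsum_continuous v kF kP)+
 have W: "continuous_on X (%t. Wv l J t (v t) i)" for i unfolding Wv_def by (intro continuous_intros v P)
 show ?thesis unfolding EE_def X5_def by (intro continuous_intros qsum_continuous v kP W P F)
qed

text \<open>On the modes divisible by 3 the remainder \<open>EE\<close>, evaluated at a vector supported on \<open>A4\<close>, has mean
 zero over time translations by \<open>2 \<pi> / 3\<close>, because \<open>i\<^sup>2\<close> is congruent to 1 modulo 3 on \<open>A4\<close>.\<close>

lemma X5_shift:
 "X5 J (%x. cis (tht * rl x) * kap x) p h q j = cis (tht * (rl j)\<^sup>2) *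
 X5 J kap (%i. cis (- tht * (rl i)\<^sup>2) * p i) (%i. cis (- tht * (rl i)\<^sup>2) * h i) (%i. cis (- tht * (rl i)\<^sup>2) * q i) j"
 unfolding X5_def qsum_shift distrib_left ..

lemma qsum_cis: "qsum J kap (%i. cis alp * p i) (%i. cis alp * q i) (%i. cis alp * r i) (%i. cis alp * s i) (%i. cis alp * t i) j
 = cis alp * qsum J kap p q r s t j"
 unfolding qsum_scale by (simp add: cis_cnj cis_mult)

lemma X5_cis: "X5 J kap (%i. cis alp * p i) (%i. cis alp * h i) (%i. cis alp * q i) j = cis alp * X5 J kap p h q j"
 by (simp add: X5_def qsum_cis distrib_left)

lemma EE_rotation:
 assumes a: "!!i. i \<notin> A4 ==> a i = 0" and j: "3 dvd j"
 shows "EE l J (t + 2 * pi / 3) a j = cis (- (2 * pi / 3)) * EE l J t a j"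
proof -
 define tht where "tht = 2 * pi / 3"
 have kF: "kF (t + tht) = (%x. cis (tht * rl x) * kF t x)" by (auto simp: kF_def cis_mult algebra_simps)
 have kP: "kP (t + tht) = (%x. cis (tht * rl x) * kP t x)" by (auto simp: kP_def cis_mult algebra_simps)
 have kR: "kR = (%x. cis (tht * rl x) * kR x)" by (auto simp: kR_def)
 have "cis (- tht * 4) = cis (- tht) * cnj (cis (2 * pi))" unfolding cis_cnj cis_mult by (simp add: tht_def)
 then have c4: "cis (- (tht * 4)) = cis (- tht)" by simp
 have M: "(%i. cis (- tht * (rl i)\<^sup>2) * a i) = (%i. cis (- tht) * a i)"
 proof
 fix i show "cis (- tht * (rl i)\<^sup>2) * a i = cis (- tht) * a i"
 using a[of i] c4 by (cases "i : A4") (auto simp: A4_def)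
 qed
 have inv: "cis (- tht * (rl i)\<^sup>2) * (cis (tht * (rl i)\<^sup>2) * z) = z" for i z
 by (simp add: mult.assoc[symmetric] cis_mult)
 have F: "Fv J (t + tht) a = (%i. cis (tht * (rl i)\<^sup>2) * (cis (- tht) * Fv J t a i))"
 and P: "Pv J (t + tht) a = (%i. cis (tht * (rl i)\<^sup>2) * (cis (- tht) * Pv J t a i))"
 by (rule ext, simp only: Fv_def Pv_def kF kP qsum_shift M qsum_cis)+
 have MP: "(%i. cis (- tht * (rl i)\<^sup>2) * Pv J (t + tht) a i) = (%i. cis (- tht) * Pv J t a i)" unfolding P inv ..
 have MF: "(%i. cis (- tht * (rl i)\<^sup>2) * (- \<i> * Fv J (t + tht) a i)) = (%i. cis (- tht) * (- \<i> * Fv J t a i))"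
 unfolding F using inv by (auto simp: mult_ac)
 have MW: "(%i. cis (- tht * (rl i)\<^sup>2) * Wv l J (t + tht) a i) = (%i. cis (- tht) * Wv l J t a i)"
 proof
 fix i
 have "cis (- tht * (rl i)\<^sup>2) * Wv l J (t + tht) a i
 = cis (- tht * (rl i)\<^sup>2) * a i + cpx l * (cis (- tht * (rl i)\<^sup>2) * Pv J (t + tht) a i)"
 by (simp add: Wv_def algebra_simps)
 also have "\<dots> = cis (- tht) * Wv l J t a i" unfolding fun_cong[OF M, of i] fun_cong[OF MP, of i] by (simp add: Wv_def algebra_simps)
 finally show "cis (- tht * (rl i)\<^sup>2) * Wv l J (t + tht) a i = cis (- tht) * Wv l J t a i" .
 qed
 obtain k where k: "j = 3 * k" using j by (auto elim: dvdE)
 have "tht * (rl j)\<^sup>2 = 2 * pi * rl (3 * k\<^sup>2)" by (simp add: tht_def k power2_eq_square)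
 then have cj: "cis (tht * (rl j)\<^sup>2) = 1" by (metis cis_multiple_2pi Ints_of_int)
 have "X5 J kR a (Pv J (t + tht) a) (Wv l J (t + tht) a) j = cis (- tht) * X5 J kR a (Pv J t a) (Wv l J t a) j"
 by (subst kR, unfold X5_shift M MP MW X5_cis cj) simp
 moreover have "X5 J (kP (t + tht)) a (%i. - \<i> * Fv J (t + tht) a i) a j = cis (- tht) * X5 J (kP t) a (%i. - \<i> * Fv J t a i) a j"
 unfolding kP X5_shift M MF X5_cis cj by simp
 ultimately show ?thesis unfolding EE_def tht_def[symmetric] by (simp only: distrib_left mult.left_commute)
qed

lemma vector_derivative_bound:
 fixes G :: "real => complex"
 assumes d: "!!s. s : {a..b} ==> (G hvd g s) (at s)" and M: "!!s. s : {a..b} ==> cmod (g s) <= M" and ab: "a <= b"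
 shows "cmod (G b - G a) <= M * (b - a)"
proof -
 have "norm (G b - G a) <= M * norm (b - a)"
 proof (rule differentiable_bound[of "{a..b}" G "%s h. h *\<^sub>R g s"])
 fix s assume s: "s : {a..b}"
 show "(G has_derivative (%h. h *\<^sub>R g s)) (at s within {a..b})"
 using d[OF s] unfolding has_vector_derivative_def by (rule has_derivative_at_withinI)
 show "onorm (%h. h *\<^sub>R g s) <= M"
 proof (rule onorm_le)
 fix h :: real show "norm (h *\<^sub>R g s) <= M * norm h" using mult_left_mono[OF M[OF s], of "\<bar>h\<bar>"] by (simp add: mult.commute)
 qed
 qed (use ab in auto)
 then show ?thesis using ab by simp
qed

text \<open>Three shifted copies of \<open>G\<close> have a small total derivative, and
  \<open>G\<close> differs from their average only by increments over times up to
  \<open>2 * h\<close>. The result is a boundary term plus the averaged forcing.\<close>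

lemma rotating_integral_bound:
 fixes G :: "real => complex"
 assumes d: "!!s. s : {0..S} ==> (G hvd g s) (at s)" and M: "!!s. s : {0..S} ==> cmod (g s) <= M" and G0: "G 0 = 0"
 and h: "0 < h" and dlt: "!!s. 0 <= s ==> s + 2 * h <= S ==> cmod (g s + g (s + h) + g (s + 2 * h)) <= dlt" "0 <= dlt" and t: "t : {0..S}"
 shows "cmod (G t) <= 2 * h * M + dlt * t"
proof -
 have M0: "0 <= M" using M[of t] t norm_ge_zero order_trans by blast
 have Gd: "cmod (G y - G x) <= M * (y - x)" if "0 <= x" "x <= y" "y <= S" for x y
 by (rule vector_derivative_bound[where g = g]) (use d M that in auto)
 show ?thesis
 proof (cases "t <= 2 * h")
 case True
 have "cmod (G t) <= M * t" using Gd[of 0 t] t G0 by simp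
 also have "\<dots> <= M * (2 * h)" using True M0 by (intro mult_left_mono) auto
 finally show ?thesis using dlt(2) t by (simp add: mult_ac add_increasing2)
 next
 case False
 define D where "D = (%s. G s + G (s + h) + G (s + 2 * h))"
 have sh: "((%s. G (s + c)) hvd g (s + c)) (at s)" if "s + c : {0..S}" for s c
 using vector_diff_chain_at[of "%s. s + c" 1 s G "g (s + c)"] d[OF that]
 has_vector_derivative_add[OF has_vector_derivative_id has_vector_derivative_const] by (auto simp: o_def)
 have "cmod (D (t - 2 * h) - D 0) <= dlt * (t - 2 * h - 0)"
 proof (rule vector_derivative_bound)
 fix s assume s: "s : {0..t - 2 * h}"
 show "(D hvd g s + g (s + h) + g (s + 2 * h)) (at s)"
 unfolding D_def using s t h by (intro has_vector_derivative_add d sh) auto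
 show "cmod (g s + g (s + h) + g (s + 2 * h)) <= dlt" using s t by (intro dlt) auto
 qed (use False in auto)
 also have "\<dots> <= dlt * t" using dlt(2) h by (intro mult_left_mono) auto
 finally have 1: "cmod (D (t - 2 * h) - D 0) <= dlt * t" .
 have "cmod (G t - G (t - 2 * h)) <= M * (2 * h)" "cmod (G t - G (t - h)) <= M * h" "cmod (G h) <= M * h" "cmod (G (2 * h)) <= M * (2 * h)"
 using Gd[of "t - 2 * h" t] Gd[of "t - h" t] Gd[of 0 h] Gd[of 0 "2 * h"] False h t G0 by auto
 moreover have "3 * G t = (D (t - 2 * h) - D 0) + (G t - G (t - 2 * h)) + (G t - G (t - h)) + G h + G (2 * h)"
 by (simp add: D_def G0 algebra_simps)
 then have "cmod (3 * G t) <= cmod (D (t - 2 * h) - D 0) + cmod (G t - G (t - 2 * h)) + cmod (G t - G (t - h)) + cmod (G h) + cmod (G (2 * h))"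
 by (simp only: norm_sum5)
 ultimately have "3 * cmod (G t) <= 6 * (h * M) + dlt * t" using 1 by (simp add: norm_mult algebra_simps)
 moreover have "0 <= dlt * t" using dlt(2) t by simp
 ultimately show ?thesis by linarith
 qed
qed

section \<open>Constants of the bootstrap\<close>

definition Cv :: real where "Cv = 3 / wt 2"
definition Cf :: real where "Cf = K0 * Cv ^ 5"
definition Cw :: real where "Cw = Cv + Cf"
definition CE :: real where "CE = 10 * (K0 * Cw ^ 4 * Cf)"
text \<open>Small enough for the critical cubic term in \<open>high_modes\<close>: there it is
  multiplied by 1280000 / 2300^2, which is below 1/4.\<close>

definition eta :: real where "eta = 1 / (2300 * Cw)"
text \<open>Fixed after \<open>CE\<close> and \<open>Cf\<close> and large against both: for small
  \<open>mu\<close> the bound on the squared H^1 norm contains \<open>B\<close> only linearly, while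
  the target is its square.\<close>

definition B :: real where "B = 200 * (CE + Cf + 1)"
definition D1 :: real where "D1 = 5 * (K0 * Cw ^ 4)"
definition CL :: real where "CL = K0 * Cw ^ 4 * (20 * D1 + 40)"
definition Cr :: real where "Cr = 8 * (CL * Cf) + 6 * CE"
definition Cg :: real where "Cg = (5 * Cw) ^ 4 * (100 * (5 * Cw) ^ 4 + 40)"
definition c1 :: real where "c1 = 2 * (3 * B + 2) * (6 * Cw) ^ 3 + 1"
definition c2 :: real where "c2 = 25 * (6 * Cw) ^ 4 * Cr + 3 * B * Cg"
text \<open>Exponential in \<open>B\<close> through \<open>c1\<close>; tolerable because it
  multiplies a higher power of \<open>mu\<close>.\<close>

definition Cn :: real where "Cn = (25 * Cf\<^sup>2 + c2\<^sup>2) * exp c1"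
definition Cy :: real where "Cy = 2 * Cn + 2 * Cr\<^sup>2"
text \<open>Chosen last, so that it may depend on all constants before it:
  \<open>Csm * mu <= 1\<close> implies every smallness condition on \<open>mu\<close>, one for each
  summand.\<close>

definition Csm :: real where "Csm = 4 * (2 * Cf + CE) / eta + 2 * B / (eta * wt 38) + 5 * Cf + 5 * Cr + 18 * Cy + Cf / eta + 1"

lemma Cv_ge: "3 <= Cv" using wt_le_1[of 2] wt_pos[of 2] by (simp add: Cv_def le_divide_eq)
lemma Cf_pos: "0 < Cf" using Cv_ge by (simp add: Cf_def K0_def)
lemma Cw_ge: "3 <= Cw" "Cv <= Cw" "Cf <= Cw" using Cv_ge Cf_pos by (auto simp: Cw_def)
lemma CE_pos: "0 < CE" using Cw_ge Cf_pos by (simp add: CE_def K0_def)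
lemma eta_pos: "0 < eta" "eta <= 1" using Cw_ge by (auto simp: eta_def)
lemma B_ge: "200 <= B" using CE_pos Cf_pos by (simp add: B_def)
lemma D1_pos: "0 < D1" using Cw_ge by (simp add: D1_def K0_def)
lemma CL_pos: "0 < CL" using Cw_ge D1_pos by (simp add: CL_def K0_def)
lemma Cr_pos: "0 < Cr" using CL_pos CE_pos Cf_pos by (auto simp: Cr_def intro!: add_pos_pos)
lemma Cg_pos: "0 < Cg" using Cw_ge by (auto simp: Cg_def intro!: mult_pos_pos add_pos_pos)
lemma c1_pos: "0 < c1" using Cw_ge B_ge by (auto simp: c1_def intro!: add_pos_pos mult_pos_pos)
lemma Cn_pos: "0 < Cn" using Cf_pos by (auto simp: Cn_def intro!: mult_pos_pos add_pos_nonneg)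
lemma Cy_pos: "0 < Cy" using Cn_pos by (simp add: Cy_def add_pos_nonneg)

lemma Csm_ge: "4 * (2 * Cf + CE) / eta <= Csm" "2 * B / (eta * wt 38) <= Csm" "5 * Cf <= Csm" "5 * Cr <= Csm" "18 * Cy <= Csm" "Cf / eta <= Csm" "1 <= Csm"
proof -
 have "0 < 4 * (2 * Cf + CE) / eta" "0 < 2 * B / (eta * wt 38)" "0 < Cf / eta"
 using Cf_pos CE_pos eta_pos B_ge wt_pos[of 38] by (auto intro!: divide_pos_pos mult_pos_pos add_pos_pos)
 then show "4 * (2 * Cf + CE) / eta <= Csm" "2 * B / (eta * wt 38) <= Csm" "5 * Cf <= Csm" "5 * Cr <= Csm" "18 * Cy <= Csm" "Cf / eta <= Csm" "1 <= Csm"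
 using Cf_pos Cr_pos Cy_pos unfolding Csm_def by linarith+
qed

lemma qsum_Cf:
 assumes "finite J" "!!x. cmod (kap x) <= 1" "!!i. i : J ==> cmod (v i) <= Cv * wt i"
 shows "cmod (qsum J kap v v v v v j) <= Cf * wt j"
 using qs_bound(1)[where kap = kap and p = v and q = v and r = v and s = v and d = v and b = Cv and bh = Cv and j = j, OF assms(1,2)] assms(3) Cv_ge
 by (simp add: Cf_def eval_nat_numeral mult_ac)

lemma Fv_wt: "finite J ==> (!!i. i : J ==> cmod (v i) <= Cv * wt i) ==> cmod (Fv J t v j) <= Cf * wt j"
 unfolding Fv_def by (rule qsum_Cf) auto
lemma Pv_wt: "finite J ==> (!!i. i : J ==> cmod (v i) <= Cv * wt i) ==> cmod (Pv J t v j) <= Cf * wt j"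
 unfolding Pv_def by (rule qsum_Cf) auto

lemma Cw_wt: "x <= Cv * wt i ==> x <= Cw * wt i" "x <= Cf * wt i ==> x <= Cw * wt i"
 using Cw_ge wt_nonneg[of i] by (meson mult_right_mono order_trans)+

lemma lPv_le: "\<bar>l\<bar> <= 1 ==> cmod (cpx l * z) <= cmod z"
 by (simp add: norm_mult mult_left_le_one_le)

lemma Wv_wt:
 assumes "finite J" "!!i. i : J ==> cmod (v i) <= Cv * wt i" "\<bar>l\<bar> <= 1" "i : J"
 shows "cmod (Wv l J t v i) <= Cw * wt i"
 using norm_triangle_ineq[of "v i" "cpx l * Pv J t v i"] lPv_le[OF assms(3), of "Pv J t v i"] Pv_wt[OF assms(1,2), of t i] assms(2)[OF assms(4)]
 by (simp add: Wv_def Cw_def distrib_right)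

lemma EE_wt:
 assumes fin: "finite J" and v: "!!i. i : J ==> cmod (v i) <= Cv * wt i" and l: "\<bar>l\<bar> <= 1"
 shows "cmod (EE l J t v j) <= CE * wt j"
proof -
 have C: "0 <= Cw" "0 <= Cf" using Cw_ge Cf_pos by auto
 have "cmod (X5 J kR v (Pv J t v) (Wv l J t v) j) <= 5 * (K0 * Cw ^ 4 * Cf) * wt j"
 by (rule X5_wt[OF fin kR_norm C]) (use v Wv_wt[OF fin v l] Pv_wt[OF fin v] Cw_wt in auto)
 moreover have "cmod (X5 J (kP t) v (%i. - \<i> * Fv J t v i) v j) <= 5 * (K0 * Cw ^ 4 * Cf) * wt j"
 by (rule X5_wt[OF fin kP_norm C]) (use v Fv_wt[OF fin v] Cw_wt in \<open>auto simp: norm_mult\<close>)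
 ultimately show ?thesis
 using norm_triangle_ineq[of "\<i> * X5 J kR v (Pv J t v) (Wv l J t v) j" "X5 J (kP t) v (%i. - \<i> * Fv J t v i) v j"]
 by (simp add: EE_def CE_def norm_mult algebra_simps)
qed

lemma EE_lip_wt:
 assumes fin: "finite J" and v: "!!i. i : J ==> cmod (v i) <= Cv * wt i" and a: "!!i. i : J ==> cmod (a i) <= Cv * wt i" and l: "\<bar>l\<bar> <= 1"
 and d: "!!i. i : J ==> cmod (v i - a i) <= d * wt i" "0 <= d"
 shows "cmod (EE l J t v j - EE l J t a j) <= CL * d * wt j"
proof -
 have C: "0 <= Cw" using Cw_ge by auto
 have dd: "0 <= D1 * d" "0 <= (1 + D1) * d" using D1_pos d(2) by auto
 have q: "cmod (qsum J kap v v v v v i - qsum J kap a a a a a i) <= D1 * d * wt i" if "!!x. cmod (kap x) <= 1" for kap i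
 proof -
 have "cmod (qsum J kap v v v v v i - qsum J kap a a a a a i) <= K0 * Cw ^ 4 * (d + d + d + d + d) * wt i"
 by (rule qsum_lip_wt[OF fin that C]) (use v a d Cw_wt in auto)
 then show ?thesis by (simp add: D1_def algebra_simps)
 qed
 have F: "cmod (Fv J t v i - Fv J t a i) <= D1 * d * wt i" and P: "cmod (Pv J t v i - Pv J t a i) <= D1 * d * wt i" for i
 unfolding Fv_def Pv_def by (rule q, simp)+
 have W: "cmod (Wv l J t v i - Wv l J t a i) <= (1 + D1) * d * wt i" if "i : J" for i
 proof -
 have "Wv l J t v i - Wv l J t a i = (v i - a i) + cpx l * (Pv J t v i - Pv J t a i)" by (simp add: Wv_def algebra_simps)
 then have "cmod (Wv l J t v i - Wv l J t a i) <= cmod (v i - a i) + cmod (Pv J t v i - Pv J t a i)"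
 using lPv_le[OF l, of "Pv J t v i - Pv J t a i"] norm_triangle_ineq[of "v i - a i" "cpx l * (Pv J t v i - Pv J t a i)"] by simp
 then show ?thesis using d(1)[OF that] P[of i] by (simp add: algebra_simps)
 qed
 have 1: "cmod (X5 J kR v (Pv J t v) (Wv l J t v) j - X5 J kR a (Pv J t a) (Wv l J t a) j) <= K0 * Cw ^ 4 * (5 * (D1 * d) + 10 * d + 10 * ((1 + D1) * d)) * wt j"
 by (rule X5_lip_wt[OF fin kR_norm C d(2) dd])
 (use v a d(1) P W Wv_wt[OF fin v l] Wv_wt[OF fin a l] Pv_wt[OF fin v] Pv_wt[OF fin a] Cw_wt in auto)
 have 2: "cmod (X5 J (kP t) v (%i. - \<i> * Fv J t v i) v j - X5 J (kP t) a (%i. - \<i> * Fv J t a i) a j) <= K0 * Cw ^ 4 * (5 * (D1 * d) + 10 * d + 10 * d) * wt j"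
 proof (rule X5_lip_wt[OF fin kP_norm C d(2) dd(1) d(2)])
 fix i
 have "- \<i> * Fv J t v i - - \<i> * Fv J t a i = - \<i> * (Fv J t v i - Fv J t a i)" by (simp add: algebra_simps)
 then show "cmod (- \<i> * Fv J t v i - - \<i> * Fv J t a i) <= D1 * d * wt i" using F[of i] by (simp only: norm_mult) simp
 qed (use v a d Fv_wt[OF fin v] Fv_wt[OF fin a] Cw_wt in \<open>auto simp: norm_mult\<close>)
 have "EE l J t v j - EE l J t a j = \<i> * (X5 J kR v (Pv J t v) (Wv l J t v) j - X5 J kR a (Pv J t a) (Wv l J t a) j)
 + (X5 J (kP t) v (%i. - \<i> * Fv J t v i) v j - X5 J (kP t) a (%i. - \<i> * Fv J t a i) a j)" by (simp add: EE_def algebra_simps)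
 then have "cmod (EE l J t v j - EE l J t a j) <= cmod (X5 J kR v (Pv J t v) (Wv l J t v) j - X5 J kR a (Pv J t a) (Wv l J t a) j)
 + cmod (X5 J (kP t) v (%i. - \<i> * Fv J t v i) v j - X5 J (kP t) a (%i. - \<i> * Fv J t a i) a j)"
 by (metis norm_triangle_ineq norm_mult norm_ii mult_1)
 then show ?thesis using 1 2 by (simp add: CL_def algebra_simps)
qed

lemma EE_lip_n1:
 assumes fin: "finite J" and v: "!!i. i : J ==> cmod (v i) <= Cv * wt i" and a: "!!i. i : J ==> cmod (a i) <= Cv * wt i" and l: "\<bar>l\<bar> <= 1"
 shows "n1 J (%j. EE l J t v j - EE l J t a j) <= Cg * n1 J (%i. v i - a i)"
proof -
 define b where "b = 5 * Cw"
 have Cgb: "Cg = b ^ 4 * (100 * b ^ 4 + 40)" by (simp only: Cg_def b_def)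
 define d where "d = n1 J (%i. v i - a i)"
 have C: "0 <= Cw" using Cw_ge by auto
 have nb: "n1 J p <= b" if "!!i. i : J ==> cmod (p i) <= Cw * wt i" for p unfolding b_def by (rule n1_wt_le[OF fin C that])
 have bs: "n1 J v <= b" "n1 J a <= b" "n1 J (Pv J t v) <= b" "n1 J (Pv J t a) <= b" "n1 J (Wv l J t v) <= b" "n1 J (Wv l J t a) <= b"
 "n1 J (%i. - \<i> * Fv J t v i) <= b" "n1 J (%i. - \<i> * Fv J t a i) <= b"
 using v a Wv_wt[OF fin v l] Wv_wt[OF fin a l] Pv_wt[OF fin v] Pv_wt[OF fin a] Fv_wt[OF fin v] Fv_wt[OF fin a] Cw_wt by (auto intro!: nb simp: norm_mult)
 have q: "n1 J (%j. qsum J kap v v v v v j - qsum J kap a a a a a j) <= 5 * b ^ 4 * d" if "!!x. cmod (kap x) <= 1" for kap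
 using qsum_lip_n1[where kap = kap, OF fin that bs(1) bs(1) bs(1) bs(1) bs(1) bs(2) bs(2) bs(2) bs(2) bs(2)] by (simp add: d_def)
 have P: "n1 J (%i. Pv J t v i - Pv J t a i) <= 5 * b ^ 4 * d" unfolding Pv_def by (rule q) simp
 have F: "n1 J (%i. - \<i> * Fv J t v i - - \<i> * Fv J t a i) <= 5 * b ^ 4 * d"
 proof -
 have "- \<i> * Fv J t v i - - \<i> * Fv J t a i = - \<i> * (Fv J t v i - Fv J t a i)" for i by (simp add: algebra_simps)
 then have "n1 J (%i. - \<i> * Fv J t v i - - \<i> * Fv J t a i) = n1 J (%i. Fv J t v i - Fv J t a i)" unfolding n1_def by (simp only: norm_mult) simp
 also have "\<dots> <= 5 * b ^ 4 * d" unfolding Fv_def by (rule q) simp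
 finally show ?thesis .
 qed
 have W: "n1 J (%i. Wv l J t v i - Wv l J t a i) <= d + 5 * b ^ 4 * d"
 proof -
 have "n1 J (%i. Wv l J t v i - Wv l J t a i) <= n1 J (%i. v i - a i) + n1 J (%i. Pv J t v i - Pv J t a i)"
 unfolding n1_def sum.distrib[symmetric]
 proof (rule sum_mono)
 fix i
 have "Wv l J t v i - Wv l J t a i = (v i - a i) + cpx l * (Pv J t v i - Pv J t a i)" by (simp add: Wv_def algebra_simps)
 then show "cmod (Wv l J t v i - Wv l J t a i) <= cmod (v i - a i) + cmod (Pv J t v i - Pv J t a i)"
 using lPv_le[OF l, of "Pv J t v i - Pv J t a i"] norm_triangle_ineq[of "v i - a i" "cpx l * (Pv J t v i - Pv J t a i)"] by simp
 qed
 then show ?thesis using P by (simp add: d_def)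
 qed
 have b4: "0 <= b ^ 4" by simp
 have 1: "n1 J (%j. X5 J kR v (Pv J t v) (Wv l J t v) j - X5 J kR a (Pv J t a) (Wv l J t a) j) <= b ^ 4 * (5 * (5 * b ^ 4 * d) + 10 * d + 10 * (d + 5 * b ^ 4 * d))"
 using P W by (intro order_trans[OF X5_lip_n1[OF fin kR_norm bs(1) bs(3) bs(5) bs(2) bs(4) bs(6)]] mult_left_mono b4) (simp add: d_def)
 have 2: "n1 J (%j. X5 J (kP t) v (%i. - \<i> * Fv J t v i) v j - X5 J (kP t) a (%i. - \<i> * Fv J t a i) a j) <= b ^ 4 * (5 * (5 * b ^ 4 * d) + 10 * d + 10 * d)"
 using F by (intro order_trans[OF X5_lip_n1[OF fin kP_norm bs(1) bs(7) bs(1) bs(2) bs(8) bs(2)]] mult_left_mono b4) (simp add: d_def)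
 have "n1 J (%j. EE l J t v j - EE l J t a j) <= n1 J (%j. X5 J kR v (Pv J t v) (Wv l J t v) j - X5 J kR a (Pv J t a) (Wv l J t a) j)
 + n1 J (%j. X5 J (kP t) v (%i. - \<i> * Fv J t v i) v j - X5 J (kP t) a (%i. - \<i> * Fv J t a i) a j)"
 unfolding n1_def sum.distrib[symmetric]
 proof (rule sum_mono)
 fix j
 have "EE l J t v j - EE l J t a j = \<i> * (X5 J kR v (Pv J t v) (Wv l J t v) j - X5 J kR a (Pv J t a) (Wv l J t a) j)
 + (X5 J (kP t) v (%i. - \<i> * Fv J t v i) v j - X5 J (kP t) a (%i. - \<i> * Fv J t a i) a j)" by (simp add: EE_def algebra_simps)
 then show "cmod (EE l J t v j - EE l J t a j) <= cmod (X5 J kR v (Pv J t v) (Wv l J t v) j - X5 J kR a (Pv J t a) (Wv l J t a) j)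
 + cmod (X5 J (kP t) v (%i. - \<i> * Fv J t v i) v j - X5 J (kP t) a (%i. - \<i> * Fv J t a i) a j)"
 by (metis norm_triangle_ineq norm_mult norm_ii mult_1)
 qed
 also have "\<dots> <= Cg * d" using add_mono[OF 1 2] unfolding Cgb by (simp add: algebra_simps)
 finally show ?thesis by (simp add: d_def)
qed

section \<open>Stability of the resonant modes\<close>

lemma wt_antimono: "\<bar>i\<bar> <= \<bar>j\<bar> ==> wt j <= wt i"
 unfolding wt_def by (intro frac_le add_left_mono) (auto simp: add_pos_nonneg abs_le_square_iff simp flip: of_int_abs of_int_power)

lemma Re_split: "Re (cnj a * (- \<i> * cpx l * b + cpx m * c)) = l * Im (cnj a * b) + m * Re (cnj a * c)"
 by (simp add: algebra_simps)

lemma of_bool_sum_le: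
 assumes fin: "finite J" and b: "!!j. j : J ==> \<bar>phi j\<bar> <= cmod (y j) * cmod (X j)"
 shows "\<bar>\<Sum>j\<in>J. of_bool (3 dvd j) * phi j\<bar> <= n2 J (%i. if 3 dvd i then y i else 0) * n1 J (X :: int => complex)"
 unfolding n1_def sum_distrib_left
proof (rule order_trans[OF sum_abs], rule sum_mono)
 fix j assume j: "j : J"
 show "\<bar>of_bool (3 dvd j) * phi j\<bar> <= n2 J (%i. if 3 dvd i then y i else 0) * cmod (X j)"
 proof (cases "3 dvd j")
 case True
 have "cmod (y j) <= n2 J (%i. if 3 dvd i then y i else 0)"
 using member_le_L2_set[OF fin j, of "%i. cmod (if 3 dvd i then y i else 0)"] True by (simp add: n2_def)
 then show ?thesis using order_trans[OF b[OF j] mult_right_mono[OF _ norm_ge_zero]] True by simp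
 qed simp
qed

lemma cis_120_sum: "1 + cis (- (2 * pi / 3)) + cis (- (2 * pi / 3)) * cis (- (2 * pi / 3)) = 0"
 by (simp add: complex_eq_iff cos_120 sin_120 power2_eq_square)

text \<open>\<open>H1\<close> and \<open>H2\<close> are the bootstrap hypotheses on [0, S]; the
  estimates below are conditional on them and lead to strict improvements of both. \<open>mu\<close>
  is the fourth root of the coupling, and \<open>S\<close> may reach mu^-6.\<close>

locale galerkin_dyn =
 fixes l mu S :: real and N :: nat and v :: "real => int => complex"
 assumes gal: "galerkin l (JN N) v" and N2: "2 <= N" and mu: "0 < mu" "Csm * mu <= 1" and l: "\<bar>l\<bar> = mu ^ 4"
 and mass: "(\<Sum>j\<in>JN N. (cmod (v 0 j))\<^sup>2) <= 5" and init: "!!j. j \<notin> A4 ==> v 0 j = 0"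
 and S: "0 <= S" "S * mu ^ 6 <= 1"
 and H1: "!!t j. t : {0..S} ==> j : JN N - A4 ==> cmod (v t j) <= eta * mu * wt j"
 and H2: "!!t. t : {0..S} ==> (\<Sum>j\<in>JN N - A4. (1 + (rl j)\<^sup>2) * (cmod (v t j))\<^sup>2) <= (B * mu\<^sup>2)\<^sup>2"
begin

abbreviation J :: "int set" where "J \<equiv> JN N"

lemma small: "x <= Csm ==> x * mu <= 1" using mu mult_right_mono[of x Csm mu] by linarith
lemma mu1: "mu <= 1" using small[OF Csm_ge(7)] by simp
lemma mu_pow: "m <= n ==> mu ^ n <= mu ^ m" using mu mu1 by (intro power_decreasing) auto
lemma mu_pow1: "0 < n ==> mu ^ n <= mu" using mu_pow[of 1 n] by simp
lemma l1: "\<bar>l\<bar> <= 1" using l mu_pow[of 0 4] by simp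
lemma l_sq: "l\<^sup>2 = mu ^ 8" using l by (metis power2_abs power_mult mult_2 numeral_Bit0)
lemma small1: "(2 * Cf + CE) * mu <= eta / 4" "B * mu < eta * wt 38" "Cf * mu <= eta"
proof -
 show "(2 * Cf + CE) * mu <= eta / 4" using small[OF Csm_ge(1)] eta_pos by (simp add: field_simps)
 have p: "0 < eta * wt 38" using eta_pos wt_pos by simp
 have "2 * B * mu <= eta * wt 38" using small[OF Csm_ge(2)] p by (simp add: divide_le_eq)
 then show "B * mu < eta * wt 38" using p by linarith
 show "Cf * mu <= eta" using small[OF Csm_ge(6)] eta_pos by (simp add: field_simps)
qed

lemma scaled_le: "0 <= x ==> 0 < n ==> x * mu <= c ==> x * mu ^ n <= c"
 using mult_left_mono[OF mu_pow1, of n x] by simp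

lemma t_le: assumes "t : {0..S}" shows "mu ^ 6 * t <= 1"
proof -
 have "mu ^ 6 * t <= mu ^ 6 * S" using assms mu by (intro mult_left_mono) auto
 then show ?thesis using S by (simp add: mult.commute)
qed

lemma A4_J: "A4 \<subseteq> J" using N2 by (auto simp: A4_def JN_def)

lemma v_0: "i \<notin> J ==> v t i = 0" using gal by (simp add: galerkin_def)

lemma v_deriv: "i : J ==> ((%s. v s i) hvd - \<i> * l * Fv J t (v t) i) (at t)"
 using gal by (simp add: galerkin_def Fv_def)

lemma v_cont: "continuous_on X (%t. v t i)"
proof (cases "i : J")
 case True
 then show ?thesis using v_deriv[OF True] by (meson continuous_at_imp_continuous_on has_vector_derivative_continuous)
qed (simp add: v_0)

lemma v_le: "cmod (v t j) <= 3"
proof (cases "j : J")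
 case True
 have "(cmod (v t j))\<^sup>2 <= (\<Sum>j\<in>J. (cmod (v t j))\<^sup>2)" using member_le_sum[OF True, of "%j. (cmod (v t j))\<^sup>2"] by simp
 also have "\<dots> <= 3\<^sup>2" using mass galerkin_mass[OF finite_JN gal, of t] by simp
 finally show ?thesis by (rule power2_le_imp_le) simp
qed (simp add: v_0)

lemma v_bound: assumes t: "t : {0..S}" and i: "i : J" shows "cmod (v t i) <= Cv * wt i"
proof (cases "i : A4")
 case True
 then have "wt 2 <= wt i" by (intro wt_antimono) (auto simp: A4_def)
 then have "3 <= Cv * wt i" using wt_pos[of 2] by (simp add: Cv_def field_simps)
 then show ?thesis using v_le[of t i] by linarith
next
 case False
 have "eta * mu <= 1 * 1" using eta_pos mu mu1 by (intro mult_mono) auto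
 then have "eta * mu * wt i <= Cv * wt i" using Cv_ge wt_nonneg by (intro mult_right_mono) auto
 then show ?thesis using H1[OF t, of i] i False by auto
qed

definition w :: "real => int => complex" where "w t = Wv l J t (v t)"
definition R :: "real => int => complex" where "R t = qsum J kR (w t) (w t) (w t) (w t) (w t)"
definition E :: "real => int => complex" where "E t = EE l J t (v t)"

lemma w_deriv: "j : J ==> ((%s. w s j) hvd - \<i> * l * R t j + cpx (l\<^sup>2) * E t j) (at t)"
 unfolding w_def R_def E_def by (rule Wv_has_vector_derivative[OF gal])

lemma w_bound: "t : {0..S} ==> i : J ==> cmod (w t i) <= Cw * wt i"
 unfolding w_def by (rule Wv_wt[OF finite_JN v_bound l1])
lemma E_bound: "t : {0..S} ==> cmod (E t j) <= CE * wt j"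
 unfolding E_def by (rule EE_wt[OF finite_JN v_bound l1])
lemma P_bound: "t : {0..S} ==> cmod (Pv J t (v t) j) <= Cf * wt j"
 by (rule Pv_wt[OF finite_JN v_bound])
lemma F_bound: "t : {0..S} ==> cmod (Fv J t (v t) j) <= Cf * wt j"
 by (rule Fv_wt[OF finite_JN v_bound])
lemma wv_diff: "t : {0..S} ==> cmod (w t j - v t j) <= Cf * mu ^ 4 * wt j"
 using P_bound[of t j] l mu by (simp add: w_def Wv_def norm_mult mult.assoc mult.left_commute[of Cf])
lemma w_init: "j \<notin> A4 ==> cmod (w 0 j) <= Cf * mu ^ 4 * wt j"
 using wv_diff[of 0 j] init S by simp

lemma n1_w: "t : {0..S} ==> n1 J (w t) <= 5 * Cw"
 using Cw_ge by (intro n1_wt_le w_bound) auto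

definition zo :: "real => int => complex" where "zo t i = (if i : A4 then 0 else v t i)"

lemma n1_zo: assumes t: "t : {0..S}" shows "n1 J (zo t) <= 3 * B * mu\<^sup>2"
proof -
 have "(\<Sum>j\<in>J. (1 + (rl j)\<^sup>2) * (cmod (zo t j))\<^sup>2) = (\<Sum>j\<in>J - A4. (1 + (rl j)\<^sup>2) * (cmod (v t j))\<^sup>2)"
 by (rule sum.mono_neutral_cong_right) (auto simp: zo_def)
 then have "(n1 J (zo t))\<^sup>2 <= 5 * (B * mu\<^sup>2)\<^sup>2" using n1_le_h1[OF finite_JN, of N "zo t"] H2[OF t] by linarith
 also have "\<dots> <= (3 * (B * mu\<^sup>2))\<^sup>2" by (simp only: power_mult_distrib) (simp add: mult_right_mono)
 finally have "(n1 J (zo t))\<^sup>2 <= (3 * (B * mu\<^sup>2))\<^sup>2" .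
 from power2_le_imp_le[OF this] show ?thesis using B_ge by simp
qed

text \<open>Trivial pairings leave the modulus alone, so the resonant sum acts at rate mu^4 (eta
  mu)^3. Over the time mu^-6 this returns a multiple of eta mu: critical in \<open>mu\<close> and
  closed by the smallness of \<open>eta\<close>. The remainder and the change of variable contribute
  order mu^2 or less.\<close>

lemma high_modes:
 assumes t: "t : {0..S}" and j: "j : J" "38 < \<bar>j\<bar>"
 shows "cmod (v t j) < eta * mu * wt j"
proof -
 define alp where "alp = 2 * eta * mu / Cw"
 have Ca: "Cw * alp = 2 * eta * mu" using Cw_ge by (simp add: alp_def)
 have em: "0 < eta * mu" "eta * mu <= 1" using eta_pos mu mu1 mult_mono[of eta 1 mu 1] by auto
 have alp: "0 <= alp" "alp <= 1" using em Cw_ge by (auto simp: alp_def mult.assoc)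
 have cm: "Cf * mu ^ 4 <= eta * mu"
 using mult_right_mono[OF scaled_le[of Cf 3 eta], of mu] small1(3) Cf_pos mu by (simp add: eval_nat_numeral mult.assoc)
 have off: "cmod (w s i) <= Cw * alp * wt i" if "s : {0..S}" "i : J" "i \<notin> A4" for s i
 proof -
 have "cmod (w s i) <= cmod (v s i) + cmod (w s i - v s i)" by (rule norm_triangle_sub)
 also have "\<dots> <= eta * mu * wt i + eta * mu * wt i"
 using H1[OF that(1), of i] that wv_diff[OF that(1), of i] mult_right_mono[OF cm wt_nonneg, of i] by (intro add_mono) auto
 finally show ?thesis by (simp add: Ca)
 qed
 define m where "m = (mu ^ 4 * (160000 * Cw ^ 5 * alp ^ 3) + mu ^ 8 * CE) * wt j"
 have m0: "0 <= m" unfolding m_def using Cw_ge CE_pos alp mu wt_nonneg by (intro mult_nonneg_nonneg add_nonneg_nonneg) auto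
 have "cmod (w t j) <= cmod (w 0 j) + m * t"
 proof (rule cmod_growth[OF w_deriv[OF j(1)] _ m0 t])
 fix s assume s: "s : {0..S}"
 have "\<bar>Im (cnj (w s j) * R s j)\<bar> <= cmod (w s j) * (160000 * Cw ^ 5 * alp ^ 3 * wt j)"
 unfolding R_def by (rule qsum_kR_high[OF finite_JN j(2) _ alp w_bound[OF s] off[OF s]]) (use Cw_ge in auto)
 then have "\<bar>l * Im (cnj (w s j) * R s j)\<bar> <= mu ^ 4 * (cmod (w s j) * (160000 * Cw ^ 5 * alp ^ 3 * wt j))"
 unfolding abs_mult l using mu by (intro mult_left_mono) auto
 moreover have "\<bar>Re (cnj (w s j) * E s j)\<bar> <= cmod (w s j) * (CE * wt j)"
 using abs_Re_le_cmod[of "cnj (w s j) * E s j"] mult_left_mono[OF E_bound[OF s, of j], of "cmod (w s j)"] by (simp add: norm_mult)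
 then have "\<bar>l\<^sup>2 * Re (cnj (w s j) * E s j)\<bar> <= mu ^ 8 * (cmod (w s j) * (CE * wt j))"
 unfolding abs_mult l_sq using mu by (auto intro!: mult_left_mono)
 ultimately show "Re (cnj (w s j) * (- \<i> * l * R s j + cpx (l\<^sup>2) * E s j)) <= m * cmod (w s j)"
 unfolding Re_split m_def by (simp add: algebra_simps abs_le_iff)
 qed
 moreover have "m * t <= (eta * mu / 4 + mu\<^sup>2 * CE) * wt j"
 proof -
 have CC: "Cw * alp = 2 * mu * eta" "Cw * eta = 1 / 2300" using Cw_ge by (auto simp: alp_def eta_def)
 have "160000 * Cw ^ 5 * alp ^ 3 = 160000 * (Cw * alp) ^ 3 * Cw\<^sup>2" by (simp add: eval_nat_numeral)
 also have "\<dots> = 1280000 * (Cw * eta)\<^sup>2 * (eta * mu ^ 3)" unfolding CC(1) by (simp add: eval_nat_numeral)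
 also have "\<dots> <= 1 / 4 * (eta * mu ^ 3)" unfolding CC(2) using eta_pos mu by (intro mult_right_mono) (auto simp: power2_eq_square)
 finally have "mu ^ 4 * (160000 * Cw ^ 5 * alp ^ 3) <= mu ^ 4 * (1 / 4 * (eta * mu ^ 3))" using mu by (intro mult_left_mono) auto
 then have "m * t <= (mu ^ 4 * (1 / 4 * (eta * mu ^ 3)) + mu ^ 8 * CE) * wt j * t"
 unfolding m_def using t wt_nonneg by (intro mult_right_mono) auto
 also have "\<dots> = (mu ^ 6 * t) * ((eta * mu / 4 + mu\<^sup>2 * CE) * wt j)" by (simp add: algebra_simps eval_nat_numeral)
 also have "\<dots> <= 1 * ((eta * mu / 4 + mu\<^sup>2 * CE) * wt j)"
 using t_le[OF t] eta_pos mu CE_pos wt_nonneg by (intro mult_right_mono mult_nonneg_nonneg add_nonneg_nonneg) auto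
 finally show ?thesis by simp
 qed
 moreover have "cmod (v t j) <= cmod (w t j) + Cf * mu ^ 4 * wt j"
 using norm_triangle_sub[of "v t j" "w t j"] wv_diff[OF t, of j] by (simp add: norm_minus_commute)
 moreover have "cmod (w 0 j) <= Cf * mu ^ 4 * wt j" using j by (intro w_init) (auto simp: A4_def)
 ultimately have "cmod (v t j) <= (2 * (Cf * mu ^ 4) + eta * mu / 4 + mu\<^sup>2 * CE) * wt j" by (simp add: algebra_simps)
 also have "\<dots> < eta * mu * wt j"
 proof (rule mult_strict_right_mono[OF _ wt_pos])
 have "Cf * mu ^ 4 <= Cf * mu\<^sup>2" using mu_pow[of 2 4] Cf_pos by simp
 then have "2 * (Cf * mu ^ 4) + eta * mu / 4 + mu\<^sup>2 * CE <= (2 * Cf + CE) * mu * mu + eta * mu / 4" by (simp add: algebra_simps power2_eq_square)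
 also have "\<dots> <= eta / 4 * mu + eta * mu / 4" using small1(1) mu by (intro add_right_mono mult_right_mono) auto
 also have "\<dots> < eta * mu" using em by simp
 finally show "2 * (Cf * mu ^ 4) + eta * mu / 4 + mu\<^sup>2 * CE < eta * mu" .
 qed
 finally show ?thesis .
qed

text \<open>Up to 38 the weight is bounded below by \<open>wt 38\<close>, so the H^1 bound of order
  mu^2 beats a pointwise bound of order mu.\<close>

lemma middle_modes:
 assumes t: "t : {0..S}" and j: "j : J - A4" "\<bar>j\<bar> <= 38"
 shows "cmod (v t j) < eta * mu * wt j"
proof -
 have "(1 + (rl j)\<^sup>2) * (cmod (v t j))\<^sup>2 <= (\<Sum>j\<in>J - A4. (1 + (rl j)\<^sup>2) * (cmod (v t j))\<^sup>2)"
 using member_le_sum[OF j(1), of "%j. (1 + (rl j)\<^sup>2) * (cmod (v t j))\<^sup>2"] by simp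
 also have "\<dots> <= (B * mu\<^sup>2)\<^sup>2" by (rule H2[OF t])
 finally have "(1 + (rl j)\<^sup>2) * (cmod (v t j))\<^sup>2 <= (B * mu\<^sup>2)\<^sup>2" .
 moreover have "1 * (cmod (v t j))\<^sup>2 <= (1 + (rl j)\<^sup>2) * (cmod (v t j))\<^sup>2" by (intro mult_right_mono) auto
 ultimately have "(cmod (v t j))\<^sup>2 <= (B * mu\<^sup>2)\<^sup>2" by linarith
 from power2_le_imp_le[OF this] have "cmod (v t j) <= B * mu\<^sup>2" using B_ge by simp
 also have "\<dots> = B * mu * mu" by (simp add: power2_eq_square)
 also have "\<dots> < eta * wt 38 * mu" using small1(2) mu by (intro mult_strict_right_mono) auto
 also have "\<dots> <= eta * mu * wt j" using wt_antimono[of j 38] j eta_pos mu by (simp add: mult_ac mult_left_mono)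
 finally show ?thesis .
qed

lemma v_increment:
 assumes "0 <= s" "s <= s'" "s' <= S" "i : J"
 shows "cmod (v s' i - v s i) <= Cf * mu ^ 4 * (s' - s) * wt i"
proof -
 have "cmod (v s' i - v s i) <= mu ^ 4 * (Cf * wt i) * (s' - s)"
 by (rule vector_derivative_bound[OF v_deriv[OF assms(4)]])
 (use assms F_bound l mu in \<open>auto simp: norm_mult intro!: mult_left_mono\<close>)
 then show ?thesis by (simp add: mult_ac)
qed

definition aa :: "real => int => complex" where "aa t i = (if i : A4 then v t i else 0)"
definition g :: "real => int => complex" where "g t = EE l J t (aa t)"

lemma aa_bound: "t : {0..S} ==> i : J ==> cmod (aa t i) <= Cv * wt i"
 using v_bound[of t i] Cv_ge wt_nonneg[of i] by (auto simp: aa_def)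

lemma g_bound: "t : {0..S} ==> cmod (g t j) <= CE * wt j"
 unfolding g_def by (rule EE_wt[OF finite_JN aa_bound l1])

text \<open>For a frozen argument the three values differ by powers of a cube root of unity and
  cancel, by \<open>EE_rotation\<close>. During two shifts the true argument moves only by order
  mu^4.\<close>

lemma g_rotation:
 assumes j: "3 dvd j" and s: "0 <= s" "s + 2 * (2 * pi / 3) <= S"
 shows "cmod (g s j + g (s + 2 * pi / 3) j + g (s + 2 * (2 * pi / 3)) j) <= 8 * (CL * Cf) * mu ^ 4 * wt j"
proof -
 define h where "h = 2 * pi / 3"
 have h: "0 < h" "3 * h <= 8" using pi_less_4 by (auto simp: h_def)
 have "s + 2 * h <= S" using s(2) unfolding h_def .
 then have sh: "s + h <= S" "s + 2 * h <= S" using h by linarith+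
 define omg where "omg = cis (- (2 * pi / 3))"
 have rot: "EE l J (x + h) (aa s) j = omg * EE l J x (aa s) j" for x
 unfolding h_def omg_def by (rule EE_rotation[OF _ j]) (simp add: aa_def)
 have r1: "EE l J (s + h) (aa s) j = omg * g s j" using rot[of s] by (simp add: g_def)
 have r2: "EE l J (s + 2 * h) (aa s) j = omg * omg * g s j" using rot[of "s + h"] r1 by (simp add: algebra_simps)
 have d: "cmod (EE l J (s + c) (aa (s + c)) j - EE l J (s + c) (aa s) j) <= CL * (Cf * mu ^ 4 * c) * wt j"
 if "0 <= c" "s + c <= S" for c
 proof (rule EE_lip_wt[OF finite_JN _ _ l1])
 show "cmod (aa (s + c) i - aa s i) <= Cf * mu ^ 4 * c * wt i" if "i : J" for i
 using v_increment[of s "s + c" i] s \<open>0 <= c\<close> \<open>s + c <= S\<close> that Cf_pos mu wt_nonneg[of i] by (auto simp: aa_def)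
 qed (use aa_bound that s Cf_pos mu in auto)
 have "g s j + g (s + h) j + g (s + 2 * h) j = (1 + omg + omg * omg) * g s j
 + (EE l J (s + h) (aa (s + h)) j - EE l J (s + h) (aa s) j) + (EE l J (s + 2 * h) (aa (s + 2 * h)) j - EE l J (s + 2 * h) (aa s) j)"
 unfolding r1 r2 by (simp add: g_def algebra_simps)
 also have "(1 + omg + omg * omg) = 0" unfolding omg_def by (rule cis_120_sum)
 finally have "cmod (g s j + g (s + h) j + g (s + 2 * h) j) <= cmod (EE l J (s + h) (aa (s + h)) j - EE l J (s + h) (aa s) j)
 + cmod (EE l J (s + 2 * h) (aa (s + 2 * h)) j - EE l J (s + 2 * h) (aa s) j)" by (simp add: norm_triangle_ineq)
 also have "\<dots> <= CL * (Cf * mu ^ 4 * h) * wt j + CL * (Cf * mu ^ 4 * (2 * h)) * wt j"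
 by (intro add_mono d) (use sh h in auto)
 also have "\<dots> = (3 * h) * (CL * Cf * mu ^ 4 * wt j)" by (simp add: algebra_simps)
 also have "\<dots> <= 8 * (CL * Cf * mu ^ 4 * wt j)" using h CL_pos Cf_pos mu wt_nonneg by (intro mult_right_mono mult_nonneg_nonneg) auto
 finally show ?thesis by (simp add: h_def mult_ac)
qed

text \<open>The accumulated forcing that the resonant modes exert on a multiple of 3. Without
  averaging it would be bounded by order mu^2 only; the order mu^6 is what the estimate of the zero
  mode can afford.\<close>

lemma correction_exists:
 assumes j: "3 dvd j"
 shows "\<exists>G. G 0 = 0 & (\<forall>t\<in>{0..S}. (G hvd cpx (l\<^sup>2) * g t j) (at t) & cmod (G t) <= Cr * mu ^ 6 * wt j)"
proof -
 have "continuous_on {-1..S + 1} (%t. aa t i)" for i using v_cont by (cases "i : A4") (auto simp: aa_def)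
 then have "continuous_on {-1..S + 1} (%t. g t j)" unfolding g_def by (rule EE_continuous)
 from antiderivative_continuous[OF this] obtain G where
 G: "!!t. t : {-1..S + 1} ==> (G hvd g t j) (at t within {-1..S + 1})" by blast
 have G': "(G hvd g t j) (at t)" if "t : {0..S}" for t
 proof -
 have "t : interior {-1..S + 1}" using that by (simp add: interior_atLeastAtMost_real)
 then show ?thesis using G[of t] that at_within_interior[of t "{-1..S + 1}"] by auto
 qed
 define H where "H = (%t. G t - G 0)"
 have Hd: "(H hvd g t j) (at t)" if "t : {0..S}" for t
 unfolding H_def using has_vector_derivative_diff[OF G'[OF that] has_vector_derivative_const] by simp
 have "cmod (cpx (l\<^sup>2) * H t) <= Cr * mu ^ 6 * wt j" if t: "t : {0..S}" for t
 proof -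
 have "cmod (H t) <= 2 * (2 * pi / 3) * (CE * wt j) + 8 * (CL * Cf) * mu ^ 4 * wt j * t"
 by (rule rotating_integral_bound[OF Hd g_bound _ _ _ _ t])
 (use g_rotation[OF j] CL_pos Cf_pos mu wt_nonneg[of j] in \<open>auto simp: H_def\<close>)
 also have "2 * (2 * pi / 3) * (CE * wt j) <= 6 * (CE * wt j)" using pi_less_4 CE_pos wt_nonneg by (intro mult_right_mono) auto
 finally have "mu ^ 8 * cmod (H t) <= mu ^ 8 * (6 * (CE * wt j) + 8 * (CL * Cf) * mu ^ 4 * wt j * t)" using mu by simp
 also have "\<dots> = 6 * CE * wt j * mu ^ 8 + 8 * (CL * Cf) * wt j * mu ^ 6 * (mu ^ 6 * t)" by (simp add: algebra_simps eval_nat_numeral)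
 also have "\<dots> <= 6 * CE * wt j * mu ^ 6 + 8 * (CL * Cf) * wt j * mu ^ 6 * 1"
 using mu_pow[of 6 8] t_le[OF t] CE_pos CL_pos Cf_pos wt_nonneg[of j] mu by (intro add_mono mult_left_mono) auto
 also have "\<dots> = Cr * mu ^ 6 * wt j" by (simp add: Cr_def algebra_simps)
 finally show ?thesis using mu by (simp add: norm_mult norm_power l_sq)
 qed
 then show ?thesis using Hd by (intro exI[of _ "%t. cpx (l\<^sup>2) * H t"]) (auto simp: H_def intro!: has_vector_derivative_mult_right)
qed

end

context galerkin_dyn begin

lemma n1_difference_bound:
 assumes t: "t : {0..S}"
 shows "n1 J (%j. E t j - g t j) <= Cg * (3 * B * mu\<^sup>2)"
proof -
 have "n1 J (%j. E t j - g t j) <= Cg * n1 J (%i. v t i - aa t i)"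
 unfolding E_def g_def by (rule EE_lip_n1[OF finite_JN v_bound[OF t] aa_bound[OF t] l1])
 also have "(%i. v t i - aa t i) = zo t" by (auto simp: aa_def zo_def)
 also have "Cg * n1 J (zo t) <= Cg * (3 * B * mu\<^sup>2)" using n1_zo[OF t] Cg_pos by (intro mult_left_mono) auto
 finally show ?thesis .
qed

text \<open>Once the accumulated forcing is subtracted, the mass of \<open>y\<close> on multiples of
  3 changes by three effects: the cubic resonant transfer, the passage from \<open>w\<close> to
  \<open>y\<close> in the resonant sum, and the difference between \<open>E\<close> and
  \<open>g\<close>. The last two are of order mu^10 times the l^2 norm.\<close>

lemma zero_mode:
 assumes t: "t : {0..S}"
 shows "(cmod (w t 0))\<^sup>2 <= Cy * mu ^ 8"
proof -
 obtain G where G: "!!j. 3 dvd j ==> G j 0 = 0 & (\<forall>t\<in>{0..S}. (G j hvd cpx (l\<^sup>2) * g t j) (at t) & cmod (G j t) <= Cr * mu ^ 6 * wt j)"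
 using correction_exists by metis
 define r where "r s j = (if 3 dvd j then G j s else 0)" for s j
 define y where "y s j = w s j - r s j" for s j
 define Y where "Y s = (%j. if 3 dvd j then y s j else 0)" for s
 define D where "D s j = E s j - of_bool (3 dvd j) * g s j" for s j
 define Ry where "Ry s = qsum J kR (y s) (y s) (y s) (y s) (y s)" for s
 define Nn where "Nn s = (\<Sum>j\<in>J. of_bool (3 dvd j) * (cmod (y s j))\<^sup>2)" for s
 define Nn' where "Nn' s = (\<Sum>j\<in>J. of_bool (3 dvd j) * (2 * Re (cnj (y s j) * (- \<i> * l * R s j + cpx (l\<^sup>2) * D s j))))" for s
 have Cr6: "0 <= Cr * mu ^ 6" "5 * (Cr * mu ^ 6) <= mu\<^sup>2"
 proof -
 have "5 * Cr * mu ^ 4 <= 1" using small[OF Csm_ge(4)] Cr_pos by (intro scaled_le) auto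
 from mult_right_mono[OF this, of "mu\<^sup>2"] show "5 * (Cr * mu ^ 6) <= mu\<^sup>2" by (simp add: mult.assoc flip: power_add)
 qed (use Cr_pos mu in auto)
 have Cf4: "5 * (Cf * mu ^ 4) <= mu\<^sup>2"
 proof -
 have "5 * Cf * mu\<^sup>2 <= 1" using small[OF Csm_ge(3)] Cf_pos by (intro scaled_le) auto
 from mult_right_mono[OF this, of "mu\<^sup>2"] show ?thesis by (simp add: mult.assoc flip: power_add)
 qed
 have rb: "cmod (r s j) <= Cr * mu ^ 6 * wt j" if "s : {0..S}" for s j
 using G[of j] that Cr6(1) wt_nonneg[of j] by (auto simp: r_def)
 have n1r: "n1 J (r s) <= 5 * (Cr * mu ^ 6)" if "s : {0..S}" for s by (rule n1_wt_le[OF finite_JN Cr6(1) rb[OF that]])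
 have n1w: "n1 J (w s) <= 6 * Cw" and n1y: "n1 J (y s) <= 6 * Cw" if s: "s : {0..S}" for s
 proof -
 have "n1 J (y s) <= n1 J (w s) + n1 J (r s)"
 unfolding n1_def y_def sum.distrib[symmetric] by (intro sum_mono norm_triangle_ineq4)
 moreover have "mu\<^sup>2 <= 1" using mu_pow[of 0 2] by simp
 ultimately show "n1 J (y s) <= 6 * Cw" using n1_w[OF s] n1r[OF s] Cr6(2) Cw_ge(1) by linarith
 show "n1 J (w s) <= 6 * Cw" using n1_w[OF s] Cw_ge(1) by linarith
 qed
 have n1Y: "n1 J (Y s) <= (3 * B + 2) * mu\<^sup>2" if s: "s : {0..S}" for s
 proof -
 have "n1 J (Y s) <= n1 J (zo s) + n1 J (%j. w s j - v s j) + n1 J (r s)"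
 unfolding n1_def sum.distrib[symmetric]
 proof (rule sum_mono)
 fix j show "cmod (Y s j) <= cmod (zo s j) + cmod (w s j - v s j) + cmod (r s j)"
 proof (cases "3 dvd j")
 case True
 \<comment> \<open>No multiple of 3 lies in \<open>A4\<close>, so \<open>v\<close> is one of the
   small modes here.\<close>
 then have "zo s j = v s j" by (auto simp: zo_def A4_def)
 then have "y s j = zo s j + (w s j - v s j) - r s j" by (simp add: y_def)
 then show ?thesis using True norm_triangle_ineq4[of "zo s j + (w s j - v s j)" "r s j"] norm_triangle_ineq[of "zo s j" "w s j - v s j"]
 by (simp add: Y_def)
 qed (simp add: Y_def)
 qed
 moreover have "n1 J (%j. w s j - v s j) <= 5 * (Cf * mu ^ 4)"
 using Cf_pos mu by (intro n1_wt_le wv_diff[OF s]) auto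
 ultimately show ?thesis using n1_zo[OF s] n1r[OF s] Cr6(2) Cf4 by (simp add: algebra_simps)
 qed
 have NY: "Nn s = (n2 J (Y s))\<^sup>2" for s unfolding Nn_def n2_sq Y_def by (rule sum.cong) auto
 have deriv: "(Nn hrd Nn' s) (at s)" if s: "s : {0..S}" for s
 unfolding Nn_def Nn'_def
 proof (rule DERIV_sum)
 fix j assume j: "j : J"
 show "((%s. of_bool (3 dvd j) * (cmod (y s j))\<^sup>2) has_real_derivative
 of_bool (3 dvd j) * (2 * Re (cnj (y s j) * (- \<i> * l * R s j + cpx (l\<^sup>2) * D s j)))) (at s)"
 proof (cases "3 dvd j")
 case True
 have "((%s. w s j - G j s) hvd (- \<i> * l * R s j + cpx (l\<^sup>2) * E s j) - cpx (l\<^sup>2) * g s j) (at s)"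
 using G[OF True] s by (intro has_vector_derivative_diff w_deriv[OF j]) auto
 then have "((%s. y s j) hvd (- \<i> * l * R s j + cpx (l\<^sup>2) * D s j)) (at s)"
 using True by (simp add: y_def r_def D_def algebra_simps)
 from has_real_derivative_cmod_sq[OF this] show ?thesis using True by simp
 qed simp
 qed
 define n where "n s = n2 J (Y s)" for s
 have n0: "0 <= n s" for s by (simp add: n_def)
 have le: "Nn' s <= c1 * mu ^ 6 * Nn s + c2\<^sup>2 * mu ^ 14" if s: "s : {0..S}" for s
 proof -
 have tm: "of_bool (3 dvd j) * (2 * Re (cnj (y s j) * (- \<i> * l * R s j + cpx (l\<^sup>2) * D s j)))
 = 2 * l * (of_bool (3 dvd j) * Im (cnj (y s j) * Ry s j)) + 2 * l * (of_bool (3 dvd j) * Im (cnj (y s j) * (R s j - Ry s j)))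
 + 2 * l\<^sup>2 * (of_bool (3 dvd j) * Re (cnj (y s j) * D s j))" for j
 unfolding Re_split by (simp add: right_diff_distrib distrib_left mult_ac)
 define S1 where "S1 = (\<Sum>j\<in>J. of_bool (3 dvd j) * Im (cnj (y s j) * Ry s j))"
 define S2 where "S2 = (\<Sum>j\<in>J. of_bool (3 dvd j) * Im (cnj (y s j) * (R s j - Ry s j)))"
 define S3 where "S3 = (\<Sum>j\<in>J. of_bool (3 dvd j) * Re (cnj (y s j) * D s j))"
 have NN: "Nn' s = 2 * l * S1 + 2 * l * S2 + 2 * l\<^sup>2 * S3"
 unfolding Nn'_def tm S1_def S2_def S3_def by (simp only: sum.distrib sum_distrib_left)
 have b1: "\<bar>S1\<bar> <= (n s)\<^sup>2 * ((3 * B + 2) * mu\<^sup>2) * (6 * Cw) ^ 3"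
 proof -
 have "\<bar>S1\<bar> <= (n2 J (Y s))\<^sup>2 * n1 J (Y s) * (n1 J (y s)) ^ 3"
 unfolding S1_def Ry_def Y_def by (rule qsum_kR_multiples_of_3[OF finite_JN])
 also have "\<dots> <= (n2 J (Y s))\<^sup>2 * ((3 * B + 2) * mu\<^sup>2) * (6 * Cw) ^ 3"
 by (intro mult_mono mult_left_mono n1Y s power_mono n1y) (use B_ge in auto)
 finally show ?thesis unfolding n_def .
 qed
 have b2: "\<bar>S2\<bar> <= n s * (25 * (6 * Cw) ^ 4 * Cr * mu ^ 6)"
 proof -
 have "\<bar>S2\<bar> <= n s * n1 J (%j. R s j - Ry s j)" unfolding S2_def n_def Y_def
 by (rule of_bool_sum_le[OF finite_JN]) (metis abs_Im_le_cmod norm_mult complex_mod_cnj)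
 moreover have "n1 J (%j. R s j - Ry s j) <= (6 * Cw) ^ 4 * (5 * (5 * (Cr * mu ^ 6)))"
 proof -
 have "n1 J (%j. R s j - Ry s j) <= (6 * Cw) ^ 4 * (n1 J (%i. w s i - y s i) + n1 J (%i. w s i - y s i) + n1 J (%i. w s i - y s i) + n1 J (%i. w s i - y s i) + n1 J (%i. w s i - y s i))"
 unfolding R_def Ry_def by (rule qsum_lip_n1[OF finite_JN kR_norm]) (use n1w[OF s] n1y[OF s] in auto)
 also have "(%i. w s i - y s i) = r s" by (auto simp: y_def)
 also have "(6 * Cw) ^ 4 * (n1 J (r s) + n1 J (r s) + n1 J (r s) + n1 J (r s) + n1 J (r s)) <= (6 * Cw) ^ 4 * (5 * (5 * (Cr * mu ^ 6)))"
 using n1r[OF s] by (intro mult_left_mono) auto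
 finally show ?thesis .
 qed
 from mult_left_mono[OF this n0[of s]] have "n s * n1 J (%j. R s j - Ry s j) <= n s * (25 * (6 * Cw) ^ 4 * Cr * mu ^ 6)" by (simp add: mult_ac)
 ultimately show ?thesis by linarith
 qed
 have b3: "\<bar>S3\<bar> <= n s * (Cg * (3 * B * mu\<^sup>2))"
 proof -
 have "S3 = (\<Sum>j\<in>J. of_bool (3 dvd j) * Re (cnj (y s j) * (E s j - g s j)))" unfolding S3_def D_def by (rule sum.cong) auto
 also have "\<bar>\<dots>\<bar> <= n s * n1 J (%j. E s j - g s j)" unfolding n_def Y_def
 by (rule of_bool_sum_le[OF finite_JN]) (metis abs_Re_le_cmod norm_mult complex_mod_cnj)
 also have "\<dots> <= n s * (Cg * (3 * B * mu\<^sup>2))" by (intro mult_left_mono n1_difference_bound s n0)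
 finally show ?thesis .
 qed
 have lS: "2 * l * x <= 2 * (mu ^ 4 * X)" if "\<bar>x\<bar> <= X" for x X :: real
 proof -
 have "2 * l * x <= \<bar>2 * l * x\<bar>" by simp
 also have "\<dots> = 2 * (mu ^ 4 * \<bar>x\<bar>)" by (simp add: abs_mult l)
 also have "\<dots> <= 2 * (mu ^ 4 * X)" using that mu by (intro mult_left_mono) auto
 finally show ?thesis .
 qed
 have l2S: "2 * l\<^sup>2 * x <= 2 * (mu ^ 8 * X)" if "\<bar>x\<bar> <= X" for x X :: real
 proof -
 have "2 * (mu ^ 8 * x) <= 2 * (mu ^ 8 * X)" using that mu by (intro mult_left_mono) auto
 then show ?thesis by (simp add: l_sq)
 qed
 have "Nn' s <= 2 * (mu ^ 4 * ((n s)\<^sup>2 * ((3 * B + 2) * mu\<^sup>2) * (6 * Cw) ^ 3)) + 2 * (mu ^ 4 * (n s * (25 * (6 * Cw) ^ 4 * Cr * mu ^ 6)))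
 + 2 * (mu ^ 8 * (n s * (Cg * (3 * B * mu\<^sup>2))))"
 using lS[OF b1] lS[OF b2] l2S[OF b3] NN by linarith
 also have "\<dots> = (c1 - 1) * mu ^ 6 * (n s)\<^sup>2 + 2 * (n s * mu ^ 3) * (c2 * mu ^ 7)"
 by (simp add: c1_def c2_def distrib_left distrib_right eval_nat_numeral mult_ac)
 \<comment> \<open>Splitting mu^10 as mu^3 * mu^7 produces mu^6 times the mass, which Gronwall
   tolerates over mu^-6, and mu^14, which integrates to mu^8.\<close>
 also have "2 * (n s * mu ^ 3) * (c2 * mu ^ 7) <= (n s * mu ^ 3)\<^sup>2 + (c2 * mu ^ 7)\<^sup>2" by (rule sum_squares_bound)
 finally show ?thesis unfolding NY n_def[symmetric] by (simp add: power_mult_distrib algebra_simps flip: power_mult)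
 qed
 have init: "Nn 0 <= 25 * Cf\<^sup>2 * mu ^ 8"
 proof -
 have "n2 J (Y 0) <= n1 J (Y 0)" by (rule n2_le_n1)
 also have "\<dots> <= 5 * (Cf * mu ^ 4)"
 proof (rule n1_wt_le)
 fix j show "cmod (Y 0 j) <= Cf * mu ^ 4 * wt j"
 proof (cases "3 dvd j")
 case True
 then have "j \<notin> A4" by (auto simp: A4_def)
 then show ?thesis using w_init[of j] G[OF True] True by (simp add: Y_def y_def r_def)
 qed (use Cf_pos mu wt_nonneg in \<open>auto simp: Y_def\<close>)
 qed (use Cf_pos mu in auto)
 finally have "(n2 J (Y 0))\<^sup>2 <= (5 * (Cf * mu ^ 4))\<^sup>2" by (intro power_mono) auto
 then show ?thesis unfolding NY by (simp add: power_mult_distrib flip: power_mult)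
 qed
 have "Nn t <= (Nn 0 + c2\<^sup>2 * mu ^ 14 * t) * exp (c1 * mu ^ 6 * t)"
 by (rule gronwall[OF deriv le _ _ t]) (use c1_pos mu in auto)
 also have "\<dots> <= (25 * Cf\<^sup>2 * mu ^ 8 + c2\<^sup>2 * mu ^ 8) * exp c1"
 proof (rule mult_mono)
 have "c2\<^sup>2 * mu ^ 14 * t = c2\<^sup>2 * mu ^ 8 * (mu ^ 6 * t)" by (simp add: mult_ac flip: power_add)
 also have "\<dots> <= c2\<^sup>2 * mu ^ 8 * 1" using t_le[OF t] mu by (intro mult_left_mono) auto
 finally show "Nn 0 + c2\<^sup>2 * mu ^ 14 * t <= 25 * Cf\<^sup>2 * mu ^ 8 + c2\<^sup>2 * mu ^ 8" using init by simp
 have "c1 * (mu ^ 6 * t) <= c1 * 1" using t_le[OF t] c1_pos by (intro mult_left_mono) auto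
 then show "exp (c1 * mu ^ 6 * t) <= exp c1" by (simp add: mult.assoc)
 qed (use mu in auto)
 finally have Nt: "Nn t <= Cn * mu ^ 8" by (simp add: Cn_def algebra_simps)
 have "(cmod (y t 0))\<^sup>2 <= Nn t"
 using member_le_sum[of 0 J "%j. of_bool (3 dvd j) * (cmod (y t j))\<^sup>2"] by (simp add: Nn_def JN_def)
 then have 1: "(cmod (y t 0))\<^sup>2 <= Cn * mu ^ 8" using Nt by linarith
 have "cmod (r t 0) <= Cr * mu ^ 6 * 1" using rb[OF t, of 0] wt_le_1[of 0] mult_left_mono[OF wt_le_1[of 0] Cr6(1)] by linarith
 also have "\<dots> <= Cr * mu ^ 4" using mu_pow[of 4 6] Cr_pos by simp
 finally have "(cmod (r t 0))\<^sup>2 <= (Cr * mu ^ 4)\<^sup>2" by (intro power_mono) auto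
 then have 2: "(cmod (r t 0))\<^sup>2 <= Cr\<^sup>2 * mu ^ 8" by (simp add: power_mult_distrib flip: power_mult)
 have "cmod (w t 0) <= cmod (y t 0) + cmod (r t 0)" using norm_triangle_ineq[of "y t 0" "r t 0"] by (simp add: y_def)
 then have "(cmod (w t 0))\<^sup>2 <= (cmod (y t 0) + cmod (r t 0))\<^sup>2" by (intro power_mono) auto
 also have "\<dots> <= 2 * (cmod (y t 0))\<^sup>2 + 2 * (cmod (r t 0))\<^sup>2"
 using sum_squares_bound[of "cmod (y t 0)" "cmod (r t 0)"] by (simp add: power2_sum)
 also have "\<dots> <= 2 * (Cn * mu ^ 8) + 2 * (Cr\<^sup>2 * mu ^ 8)" using 1 2 by simp
 finally show ?thesis by (simp add: Cy_def algebra_simps)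
qed

lemma fw_abs_le: "\<bar>rl (fw j)\<bar> <= 4 * (1 + (rl j)\<^sup>2)"
proof -
 have "0 <= j mod 2" "j mod 2 <= 1" by auto
 then have "- 4 <= fw j" "fw j <= j\<^sup>2" unfolding fw_def using zero_le_power2[of j] by linarith+
 then have "rl (- 4) <= rl (fw j)" "rl (fw j) <= rl (j\<^sup>2)" by (simp_all only: of_int_le_iff)
 then have f: "- 4 <= rl (fw j)" "rl (fw j) <= (rl j)\<^sup>2" by simp_all
 have g: "\<bar>x\<bar> <= 4 * (1 + y)" if "- 4 <= x" "x <= y" "0 <= y" for x y :: real
 proof (rule abs_leI)
 show "x <= 4 * (1 + y)" using that by (simp add: distrib_left)
 show "- x <= 4 * (1 + y)" using that by (simp add: distrib_left)
 qed
 show ?thesis by (rule g[OF f zero_le_power2])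
qed

text \<open>The resonant part conserves the mass weighted by \<open>fw\<close>. The remainder
  changes it at rate mu^8 times the off-resonant l^1 norm, since the decay of \<open>E\<close>
  absorbs the factor 1 + j^2; that is mu^10, hence mu^4 over the time span.\<close>

lemma w_off_h1:
 assumes t: "t : {0..S}"
 shows "(\<Sum>j\<in>J - A4. (1 + (rl j)\<^sup>2) * (cmod (w t j))\<^sup>2) < ((40 * Cf\<^sup>2 + 16 * CE * (3 * B + 1)) + 9 * Cy * mu ^ 4) * mu ^ 4 + mu ^ 4"
proof -
 define Lf where "Lf s = (\<Sum>j\<in>J. rl (fw j) * (cmod (w s j))\<^sup>2)" for s
 define Lf' where "Lf' s = (\<Sum>j\<in>J. rl (fw j) * (2 * Re (cnj (w s j) * (- \<i> * l * R s j + cpx (l\<^sup>2) * E s j))))" for s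
 have d: "(Lf hrd Lf' s) (at s)" for s
 unfolding Lf_def Lf'_def by (intro DERIV_sum DERIV_cmult has_real_derivative_cmod_sq w_deriv)
 have L'b: "Lf' s <= 8 * CE * (3 * B + 1) * mu ^ 10" if s: "s : {0..S}" for s
 proof -
 have c: "(\<Sum>j\<in>J. rl (fw j) * Im (cnj (w s j) * R s j)) = 0"
 unfolding R_def by (rule qsum_kR_conserved) (rule res_fw)
 have "Lf' s = 2 * l * (\<Sum>j\<in>J. rl (fw j) * Im (cnj (w s j) * R s j)) + 2 * l\<^sup>2 * (\<Sum>j\<in>J. rl (fw j) * Re (cnj (w s j) * E s j))"
 unfolding Lf'_def Re_split sum_distrib_left sum.distrib[symmetric] by (intro sum.cong refl) (simp add: algebra_simps)
 then have e: "Lf' s = 2 * mu ^ 8 * (\<Sum>j\<in>J. rl (fw j) * Re (cnj (w s j) * E s j))" unfolding c l_sq by simp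
 have "(\<Sum>j\<in>J. rl (fw j) * Re (cnj (w s j) * E s j)) <= (\<Sum>j\<in>J. 4 * CE * (cmod (zo s j) + Cf * mu ^ 4 * wt j))"
 proof (rule sum_mono)
 fix j assume j: "j : J"
 show "rl (fw j) * Re (cnj (w s j) * E s j) <= 4 * CE * (cmod (zo s j) + Cf * mu ^ 4 * wt j)"
 proof (cases "j : A4")
 case True then show ?thesis using CE_pos Cf_pos mu wt_nonneg by simp
 next
 case False
 have "cmod (w s j) <= cmod (zo s j) + Cf * mu ^ 4 * wt j"
 using norm_triangle_sub[of "w s j" "v s j"] wv_diff[OF s, of j] False by (simp add: zo_def)
 moreover have "(1 + (rl j)\<^sup>2) * wt j <= 1"
 using wt_le[of j] by (simp add: le_divide_eq add_pos_nonneg mult.commute)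
 moreover have "rl (fw j) * Re (cnj (w s j) * E s j) <= 4 * (1 + (rl j)\<^sup>2) * (cmod (w s j) * (CE * wt j))"
 proof -
 have "rl (fw j) * Re (cnj (w s j) * E s j) <= \<bar>rl (fw j) * Re (cnj (w s j) * E s j)\<bar>" by simp
 also have "\<dots> <= 4 * (1 + (rl j)\<^sup>2) * (cmod (w s j) * (CE * wt j))"
 unfolding abs_mult
 proof (rule mult_mono[OF fw_abs_le])
 have "\<bar>Re (cnj (w s j) * E s j)\<bar> <= cmod (w s j) * cmod (E s j)" by (metis abs_Re_le_cmod norm_mult complex_mod_cnj)
 also have "\<dots> <= cmod (w s j) * (CE * wt j)" by (intro mult_left_mono E_bound s) auto
 finally show "\<bar>Re (cnj (w s j) * E s j)\<bar> <= cmod (w s j) * (CE * wt j)" .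
 qed auto
 finally show ?thesis .
 qed
 ultimately have "rl (fw j) * Re (cnj (w s j) * E s j) <= 4 * ((1 + (rl j)\<^sup>2) * wt j) * (cmod (w s j) * CE)" by (simp add: mult_ac)
 also have "\<dots> <= 4 * 1 * (cmod (w s j) * CE)"
 using \<open>(1 + (rl j)\<^sup>2) * wt j <= 1\<close> CE_pos by (intro mult_right_mono mult_left_mono) auto
 also have "\<dots> <= 4 * 1 * ((cmod (zo s j) + Cf * mu ^ 4 * wt j) * CE)"
 using \<open>cmod (w s j) <= _\<close> CE_pos by (intro mult_left_mono mult_right_mono) auto
 finally show ?thesis by (simp add: mult_ac)
 qed
 qed
 also have "\<dots> = 4 * CE * (n1 J (zo s) + (\<Sum>j\<in>J. Cf * mu ^ 4 * wt j))" by (simp add: n1_def sum.distrib flip: sum_distrib_left)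
 also have "(\<Sum>j\<in>J. Cf * mu ^ 4 * wt j) <= mu\<^sup>2"
 proof -
 have "n1 J (%j. cpx (Cf * mu ^ 4 * wt j)) <= 5 * (Cf * mu ^ 4)"
 using Cf_pos mu wt_nonneg by (intro n1_wt_le) (auto simp: norm_mult norm_power)
 moreover have "n1 J (%j. cpx (Cf * mu ^ 4 * wt j)) = (\<Sum>j\<in>J. Cf * mu ^ 4 * wt j)"
 unfolding n1_def using Cf_pos mu wt_nonneg by (intro sum.cong) (auto simp: norm_mult norm_power)
 moreover have "5 * Cf * mu\<^sup>2 <= 1" using small[OF Csm_ge(3)] Cf_pos by (intro scaled_le) auto
 from mult_right_mono[OF this, of "mu\<^sup>2"] have "5 * (Cf * mu ^ 4) <= mu\<^sup>2" by (simp add: mult.assoc flip: power_add)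
 ultimately show ?thesis by linarith
 qed
 also have "4 * CE * (n1 J (zo s) + mu\<^sup>2) <= 4 * CE * (3 * B * mu\<^sup>2 + mu\<^sup>2)"
 using n1_zo[OF s] CE_pos by (intro mult_left_mono add_right_mono) auto
 finally have "(\<Sum>j\<in>J. rl (fw j) * Re (cnj (w s j) * E s j)) <= 4 * CE * (3 * B * mu\<^sup>2 + mu\<^sup>2)" using CE_pos by (simp add: add_left_mono mult_left_mono)
 then have "Lf' s <= 2 * mu ^ 8 * (4 * CE * (3 * B * mu\<^sup>2 + mu\<^sup>2))" unfolding e using mu by (intro mult_left_mono) auto
 also have "\<dots> = 8 * CE * (3 * B + 1) * mu ^ 10" by (simp add: algebra_simps flip: power_add)
 finally show ?thesis .
 qed
 have L0: "Lf 0 <= 20 * Cf\<^sup>2 * mu ^ 8"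
 proof -
 have "Lf 0 <= (\<Sum>j\<in>J. 4 * ((1 + (rl j)\<^sup>2) * (cmod (cpx (Cf * mu ^ 4 * wt j)))\<^sup>2))"
 unfolding Lf_def
 proof (rule sum_mono)
 fix j
 show "rl (fw j) * (cmod (w 0 j))\<^sup>2 <= 4 * ((1 + (rl j)\<^sup>2) * (cmod (cpx (Cf * mu ^ 4 * wt j)))\<^sup>2)"
 proof (cases "j : A4")
 case False
 have "rl (fw j) * (cmod (w 0 j))\<^sup>2 <= 4 * (1 + (rl j)\<^sup>2) * (Cf * mu ^ 4 * wt j)\<^sup>2"
 using fw_abs_le[of j] w_init[OF False] by (intro mult_mono power_mono) auto
 then show ?thesis by (simp only: norm_of_real power2_abs mult.assoc)
 qed simp
 qed
 also have "\<dots> = 4 * (\<Sum>j\<in>J. (1 + (rl j)\<^sup>2) * (cmod (cpx (Cf * mu ^ 4 * wt j)))\<^sup>2)" by (simp add: sum_distrib_left)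
 also have "\<dots> <= 4 * (5 * (Cf * mu ^ 4)\<^sup>2)"
 using Cf_pos mu wt_nonneg by (intro mult_left_mono h1_wt_le) (auto simp: norm_mult norm_power)
 finally show ?thesis by (simp add: power_mult_distrib flip: power_mult)
 qed
 have "Lf t <= (Lf 0 + (8 * CE * (3 * B + 1) * mu ^ 10) * t) * exp (0 * t)"
 by (rule gronwall[OF d _ _ _ t]) (use L'b CE_pos B_ge mu in auto)
 also have "\<dots> = Lf 0 + 8 * CE * (3 * B + 1) * mu ^ 4 * (mu ^ 6 * t)" by (simp add: mult_ac flip: power_add)
 also have "\<dots> <= 20 * Cf\<^sup>2 * mu ^ 8 + 8 * CE * (3 * B + 1) * mu ^ 4 * 1"
 using L0 t_le[OF t] CE_pos B_ge mu by (intro add_mono mult_left_mono) auto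
 also have "\<dots> <= 20 * Cf\<^sup>2 * mu ^ 4 + 8 * CE * (3 * B + 1) * mu ^ 4" using mu_pow[of 4 8] by (simp add: mult_left_mono)
 finally have Lt: "2 * Lf t <= (40 * Cf\<^sup>2 + 16 * CE * (3 * B + 1)) * mu ^ 4" by (simp add: algebra_simps)
 \<comment> \<open>At the zero mode \<open>fw\<close> is -4; adding nine times its mass restores 1 =
   2 * (-4) + 9.\<close>
 have "(\<Sum>j\<in>J - A4. (1 + (rl j)\<^sup>2) * (cmod (w t j))\<^sup>2) <= (\<Sum>j\<in>J - A4. 2 * (rl (fw j) * (cmod (w t j))\<^sup>2) + (if j = 0 then 9 * (cmod (w t 0))\<^sup>2 else 0))"
 proof (rule sum_mono)
 fix j assume j: "j : J - A4"
 show "(1 + (rl j)\<^sup>2) * (cmod (w t j))\<^sup>2 <= 2 * (rl (fw j) * (cmod (w t j))\<^sup>2) + (if j = 0 then 9 * (cmod (w t 0))\<^sup>2 else 0)"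
 proof (cases "j = 0")
 case False
 then have "1 + j\<^sup>2 <= 2 * fw j" using A4_or[of j] j by (intro fw_ge) auto
 then have "rl (1 + j\<^sup>2) <= rl (2 * fw j)" by (simp only: of_int_le_iff)
 then have "(1 + (rl j)\<^sup>2) * (cmod (w t j))\<^sup>2 <= (2 * rl (fw j)) * (cmod (w t j))\<^sup>2" by (intro mult_right_mono) auto
 then show ?thesis using False by simp
 qed simp
 qed
 also have "\<dots> = 2 * (\<Sum>j\<in>J - A4. rl (fw j) * (cmod (w t j))\<^sup>2) + (\<Sum>j\<in>J - A4. if j = 0 then 9 * (cmod (w t 0))\<^sup>2 else 0)"
 by (simp only: sum.distrib sum_distrib_left)
 also have "(\<Sum>j\<in>J - A4. if j = 0 then 9 * (cmod (w t 0))\<^sup>2 else 0) = 9 * (cmod (w t 0))\<^sup>2"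
 by (subst sum.delta) (auto simp: A4_def JN_def)
 also have "(\<Sum>j\<in>J - A4. rl (fw j) * (cmod (w t j))\<^sup>2) = Lf t"
 unfolding Lf_def by (rule sum.mono_neutral_left) auto
 also have "2 * Lf t + 9 * (cmod (w t 0))\<^sup>2 <= (40 * Cf\<^sup>2 + 16 * CE * (3 * B + 1)) * mu ^ 4 + 9 * (Cy * mu ^ 8)"
 using Lt zero_mode[OF t] by simp
 also have "\<dots> < ((40 * Cf\<^sup>2 + 16 * CE * (3 * B + 1)) + 9 * Cy * mu ^ 4) * mu ^ 4 + mu ^ 4"
 using mu by (simp add: algebra_simps flip: power_add)
 finally show ?thesis .
qed

text \<open>The change of variable costs order mu^4. The improvement is strict because
  \<open>B\<close> enters linearly through \<open>CE * B\<close> while its square is available, and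
  the zero mode is absorbed by the smallness of \<open>mu\<close>.\<close>

lemma v_off_h1:
 assumes t: "t : {0..S}"
 shows "(\<Sum>j\<in>J - A4. (1 + (rl j)\<^sup>2) * (cmod (v t j))\<^sup>2) < (B * mu\<^sup>2)\<^sup>2"
proof -
 have "(\<Sum>j\<in>J - A4. (1 + (rl j)\<^sup>2) * (cmod (v t j))\<^sup>2)
 <= (\<Sum>j\<in>J - A4. 2 * ((1 + (rl j)\<^sup>2) * (cmod (w t j))\<^sup>2) + 2 * ((1 + (rl j)\<^sup>2) * (cmod (w t j - v t j))\<^sup>2))"
 proof (rule sum_mono)
 fix j
 have "cmod (v t j) <= cmod (w t j) + cmod (w t j - v t j)" using norm_triangle_sub[of "v t j" "w t j"] by (simp add: norm_minus_commute)
 then have "(cmod (v t j))\<^sup>2 <= (cmod (w t j) + cmod (w t j - v t j))\<^sup>2" by (intro power_mono) auto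
 also have "\<dots> <= 2 * (cmod (w t j))\<^sup>2 + 2 * (cmod (w t j - v t j))\<^sup>2"
 using sum_squares_bound[of "cmod (w t j)" "cmod (w t j - v t j)"] by (simp add: power2_sum)
 finally have "(1 + (rl j)\<^sup>2) * (cmod (v t j))\<^sup>2 <= (1 + (rl j)\<^sup>2) * (2 * (cmod (w t j))\<^sup>2 + 2 * (cmod (w t j - v t j))\<^sup>2)"
 by (intro mult_left_mono) auto
 then show "(1 + (rl j)\<^sup>2) * (cmod (v t j))\<^sup>2 <= 2 * ((1 + (rl j)\<^sup>2) * (cmod (w t j))\<^sup>2) + 2 * ((1 + (rl j)\<^sup>2) * (cmod (w t j - v t j))\<^sup>2)"
 by (simp add: algebra_simps)
 qed
 also have "\<dots> = 2 * (\<Sum>j\<in>J - A4. (1 + (rl j)\<^sup>2) * (cmod (w t j))\<^sup>2) + 2 * (\<Sum>j\<in>J - A4. (1 + (rl j)\<^sup>2) * (cmod (w t j - v t j))\<^sup>2)"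
 by (simp only: sum.distrib sum_distrib_left)
 finally have 1: "(\<Sum>j\<in>J - A4. (1 + (rl j)\<^sup>2) * (cmod (v t j))\<^sup>2) <= 2 * (\<Sum>j\<in>J - A4. (1 + (rl j)\<^sup>2) * (cmod (w t j))\<^sup>2)
 + 2 * (\<Sum>j\<in>J - A4. (1 + (rl j)\<^sup>2) * (cmod (w t j - v t j))\<^sup>2)" .
 have 2: "(\<Sum>j\<in>J - A4. (1 + (rl j)\<^sup>2) * (cmod (w t j - v t j))\<^sup>2) <= 5 * (Cf * mu ^ 4)\<^sup>2"
 using Cf_pos mu wv_diff[OF t] by (intro h1_wt_le) auto
 have 3: "5 * (Cf * mu ^ 4)\<^sup>2 <= 5 * Cf\<^sup>2 * mu ^ 4"
 using mu_pow[of 4 8] by (simp add: power_mult_distrib mult_left_mono flip: power_mult)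
 have "(\<Sum>j\<in>J - A4. (1 + (rl j)\<^sup>2) * (cmod (v t j))\<^sup>2)
 < 2 * (((40 * Cf\<^sup>2 + 16 * CE * (3 * B + 1)) + 9 * Cy * mu ^ 4) * mu ^ 4 + mu ^ 4) + 2 * (5 * Cf\<^sup>2 * mu ^ 4)"
 proof -
 have "x < 2 * W + 2 * c" if "x <= 2 * y + 2 * z" "y < W" "z <= c" for x y z c W :: real using that by linarith
 then show ?thesis using 1 w_off_h1[OF t] order_trans[OF 2 3] by blast
 qed
 also have "\<dots> = (90 * Cf\<^sup>2 + 96 * (CE * B) + 32 * CE + 18 * Cy * mu ^ 4 + 2) * mu ^ 4" by (simp add: algebra_simps)
 also have "\<dots> <= B\<^sup>2 * mu ^ 4"
 proof (rule mult_right_mono)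
 have "18 * Cy * mu ^ 4 <= 1" using small[OF Csm_ge(5)] Cy_pos by (intro scaled_le) auto
 moreover have "B\<^sup>2 = 200 * (CE * B) + 200 * (Cf * B) + 200 * B" by (simp add: B_def power2_eq_square algebra_simps)
 moreover have "Cf * (200 * Cf) <= Cf * B" using Cf_pos CE_pos by (intro mult_left_mono) (auto simp: B_def)
 then have "200 * Cf\<^sup>2 <= Cf * B" by (simp add: power2_eq_square)
 moreover have "200 * CE + 200 <= B" using Cf_pos by (simp add: B_def)
 moreover have "0 <= CE * B" "0 <= Cf\<^sup>2" using CE_pos B_ge by auto
 ultimately show "90 * Cf\<^sup>2 + 96 * (CE * B) + 32 * CE + 18 * Cy * mu ^ 4 + 2 <= B\<^sup>2" using CE_pos by linarith
 qed (use mu in auto)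
 finally show ?thesis by (simp add: power_mult_distrib flip: power_mult)
qed

end

text \<open>The bounds are indexed by an option type, \<open>None\<close> for the H^1 sum and
  \<open>Some j\<close> for single modes. On every [0, t] the weak bounds instantiate the locale,
  whose conclusions are the strict ones.\<close>

theorem galerkin_bootstrap:
 assumes gal: "galerkin l (JN N) v" and N2: "2 <= N" and mu: "0 < mu" "Csm * mu <= 1" and l: "\<bar>l\<bar> = mu ^ 4"
 and mass: "(\<Sum>j\<in>JN N. (cmod (v 0 j))\<^sup>2) <= 5" and init: "!!j. j \<notin> A4 ==> v 0 j = 0"
 and S: "0 <= S" "S * mu ^ 6 <= 1"
 shows "galerkin_dyn l mu S N v"
proof -
 define phi where "phi k t = (case k of None => \<Sum>j\<in>JN N - A4. (1 + (rl j)\<^sup>2) * (cmod (v t j))\<^sup>2 | Some j => cmod (v t j))" for k t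
 define b where "b k = (case k of None => (B * mu\<^sup>2)\<^sup>2 | Some j => eta * mu * wt j)" for k
 define I where "I = insert None (Some ` (JN N - A4))"
 have vc: "continuous_on {0..S} (%t. v t j)" if "j : JN N" for j
 using gal that unfolding galerkin_def by (meson continuous_at_imp_continuous_on has_vector_derivative_continuous)
 have step: "phi k t < b k" if t: "t : {0..S}" and h: "!!s k. s : {0..t} ==> k : I ==> phi k s <= b k" and k: "k : I" for t k
 proof -
 have "t * mu ^ 6 <= S * mu ^ 6" using t mu by (intro mult_right_mono) auto
 then have tm: "t * mu ^ 6 <= 1" "0 <= t" using S t by auto
 have hN: "(\<Sum>j\<in>JN N - A4. (1 + (rl j)\<^sup>2) * (cmod (v s j))\<^sup>2) <= (B * mu\<^sup>2)\<^sup>2" if "s : {0..t}" for s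
 using h[of s None] that by (simp add: phi_def b_def I_def)
 have hS: "cmod (v s j) <= eta * mu * wt j" if "s : {0..t}" "j : JN N - A4" for s j
 using h[of s "Some j"] that by (simp add: phi_def b_def I_def)
 interpret D: galerkin_dyn l mu t N v
 by (rule galerkin_dyn.intro[OF gal N2 mu l mass init tm(2,1) hS hN])
 show ?thesis
 proof (cases k)
 case None then show ?thesis using D.v_off_h1[of t] t by (simp add: phi_def b_def)
 next
 case (Some j)
 then have "j : JN N - A4" using k by (auto simp: I_def)
 then show ?thesis using D.high_modes[of t j] D.middle_modes[of t j] t Some by (cases "38 < \<bar>j\<bar>") (auto simp: phi_def b_def)
 qed
 qed
 have main: "phi k t < b k" if "t : {0..S}" "k : I" for k t
 proof (rule continuity_bootstrap[where I = I and S = S and phi = phi and b = b, OF _ _ _ step that])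
 show "finite I" by (simp add: I_def)
 show "continuous_on {0..S} (phi i)" if "i : I" for i
 using that vc by (cases i) (auto simp: phi_def[abs_def] I_def intro!: continuous_intros)
 show "phi i 0 <= b i" if "i : I" for i
 using that init mu eta_pos wt_nonneg by (cases i) (auto simp: phi_def b_def I_def)
 qed auto
 have hN: "(\<Sum>j\<in>JN N - A4. (1 + (rl j)\<^sup>2) * (cmod (v s j))\<^sup>2) <= (B * mu\<^sup>2)\<^sup>2" if "s : {0..S}" for s
 using main[of s None] that by (simp add: phi_def b_def I_def)
 have hS: "cmod (v s j) <= eta * mu * wt j" if "s : {0..S}" "j : JN N - A4" for s j
 using main[of s "Some j"] that by (simp add: phi_def b_def I_def)
 show ?thesis by (rule galerkin_dyn.intro[OF gal N2 mu l mass init S hS hN])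
qed

section \<open>The four resonant modes\<close>

lemmas has_vector_derivative_Re = bounded_linear.has_vector_derivative[OF bounded_linear_Re]
lemmas has_vector_derivative_Im = bounded_linear.has_vector_derivative[OF bounded_linear_Im]

lemma sum_A4: "sum f A4 = f (-2) + f (-1) + f 1 + (f 2 :: 'a::comm_monoid_add)" by (simp add: A4_def add_ac)

lemma qsum_A4_expand:
 "qsum A4 kR z z z z z j = (\<Sum>a\<in>A4. \<Sum>b\<in>A4. \<Sum>c\<in>A4. \<Sum>d\<in>A4. \<Sum>e\<in>A4. if a + b + c = d + e + j
 then kR (j\<^sup>2 + d\<^sup>2 + e\<^sup>2 - a\<^sup>2 - b\<^sup>2 - c\<^sup>2) * (z a * z b * z c * cnj (z d) * cnj (z e)) else 0)"
 unfolding qsum_def by (simp only: sum.cartesian_product)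

text \<open>Within \<open>A4\<close> the only nontrivial resonance is 1 + 1 - 2 = -1 - 1 + 2. All
  other contributions are pairings and amount to a real multiple of the mode.\<close>

lemma four_mode_sum:
 fixes I :: "int => real"
 assumes I: "!!j. cpx (I j) = z j * cnj (z j)"
 defines "M \<equiv> I 1 + I (-2) + I (-1) + I 2" and "S \<equiv> (I 1)\<^sup>2 + (I (-2))\<^sup>2 + (I (-1))\<^sup>2 + (I 2)\<^sup>2"
 shows "qsum A4 kR z z z z z 1 = z 1 * cpx ((6 * M\<^sup>2 - 3 * S) - 6 * M * I 1 + 4 * (I 1)\<^sup>2) + 6 * (cnj (z 1) * cnj (z (-2)) * ((z (-1))\<^sup>2 * z 2))"
 "qsum A4 kR z z z z z (-2) = z (-2) * cpx ((6 * M\<^sup>2 - 3 * S) - 6 * M * I (-2) + 4 * (I (-2))\<^sup>2) + 3 * ((cnj (z 1))\<^sup>2 * ((z (-1))\<^sup>2 * z 2))"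
 "qsum A4 kR z z z z z (-1) = z (-1) * cpx ((6 * M\<^sup>2 - 3 * S) - 6 * M * I (-1) + 4 * (I (-1))\<^sup>2) + 6 * (cnj (z (-1)) * cnj (z 2) * ((z 1)\<^sup>2 * z (-2)))"
 "qsum A4 kR z z z z z 2 = z 2 * cpx ((6 * M\<^sup>2 - 3 * S) - 6 * M * I 2 + 4 * (I 2)\<^sup>2) + 3 * ((cnj (z (-1)))\<^sup>2 * ((z 1)\<^sup>2 * z (-2)))"
 unfolding qsum_A4_expand sum_A4 M_def S_def
 by (simp add: kR_def, simp add: I algebra_simps power2_eq_square)+

text \<open>Stated for an abstract pair whose first mode counts twice, with \<open>b\<close> the
  monomial of the opposite pair, so that it applies to (1, -2) and to (-1, 2). The real phase speeds
  drop out of the moduli.\<close>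

lemma resonant_pair:
 fixes z1 z2 :: "real => complex"
 assumes d1: "(z1 hvd - \<i> * cpx l * (z1 t * cpx omg1 + 6 * (cnj (z1 t) * cnj (z2 t) * b)) + dlt1) (at t)"
 and d2: "(z2 hvd - \<i> * cpx l * (z2 t * cpx omg2 + 3 * ((cnj (z1 t))\<^sup>2 * b)) + dlt2) (at t)"
 and I: "cpx I1 = z1 t * cnj (z1 t)" "cpx I2 = z2 t * cnj (z2 t)"
 shows "((%s. (z1 s)\<^sup>2 * z2 s) hvd - \<i> * cpx l * ((z1 t)\<^sup>2 * z2 t * cpx (2 * omg1 + omg2)
 + b * cpx (12 * I1 * I2 + 3 * I1\<^sup>2)) + (2 * z1 t * z2 t * dlt1 + (z1 t)\<^sup>2 * dlt2)) (at t)"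
 "((%s. (cmod (z1 s))\<^sup>2) hrd - 12 * l * Im ((z1 t)\<^sup>2 * z2 t * cnj b) + 2 * Re (cnj (z1 t) * dlt1)) (at t)"
 "((%s. (cmod (z2 s))\<^sup>2) hrd - 6 * l * Im ((z1 t)\<^sup>2 * z2 t * cnj b) + 2 * Re (cnj (z2 t) * dlt2)) (at t)"
proof -
 have "((%s. z1 s * z1 s * z2 s) hvd - \<i> * cpx l * (z1 t * z1 t * z2 t * cpx (2 * omg1 + omg2)
 + b * cpx (12 * I1 * I2 + 3 * I1\<^sup>2)) + (2 * z1 t * z2 t * dlt1 + z1 t * z1 t * dlt2)) (at t)"
 by (rule has_vector_derivative_eq_rhs[OF has_vector_derivative_mult[OF has_vector_derivative_mult[OF d1 d1] d2]])
 (simp add: I algebra_simps power2_eq_square)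
 then show "((%s. (z1 s)\<^sup>2 * z2 s) hvd - \<i> * cpx l * ((z1 t)\<^sup>2 * z2 t * cpx (2 * omg1 + omg2)
 + b * cpx (12 * I1 * I2 + 3 * I1\<^sup>2)) + (2 * z1 t * z2 t * dlt1 + (z1 t)\<^sup>2 * dlt2)) (at t)"
 by (simp only: power2_eq_square)
 have r6: "Re (- \<i> * cpx l * (cpx r + 6 * cnj x) + y) = - 6 * l * Im x + Re y"
 and r3: "Re (- \<i> * cpx l * (cpx r + 3 * cnj x) + y) = - 3 * l * Im x + Re y" for r x y
 by (simp_all add: algebra_simps)
 have g6: "2 * (- 6 * l * x + y) = - 12 * l * x + 2 * y" and g3: "2 * (- 3 * l * x + y) = - 6 * l * x + 2 * y" for x y :: real by simp_all
 have e1: "cnj (z1 t) * (- \<i> * cpx l * (z1 t * cpx omg1 + 6 * (cnj (z1 t) * cnj (z2 t) * b)) + dlt1)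
 = - \<i> * cpx l * (cpx (I1 * omg1) + 6 * cnj ((z1 t)\<^sup>2 * z2 t * cnj b)) + cnj (z1 t) * dlt1"
 by (simp add: I algebra_simps power2_eq_square)
 show "((%s. (cmod (z1 s))\<^sup>2) hrd - 12 * l * Im ((z1 t)\<^sup>2 * z2 t * cnj b) + 2 * Re (cnj (z1 t) * dlt1)) (at t)"
 by (rule DERIV_cong[OF has_real_derivative_cmod_sq[OF d1]]) (simp only: e1 r6 g6)
 have e2: "cnj (z2 t) * (- \<i> * cpx l * (z2 t * cpx omg2 + 3 * ((cnj (z1 t))\<^sup>2 * b)) + dlt2)
 = - \<i> * cpx l * (cpx (I2 * omg2) + 3 * cnj ((z1 t)\<^sup>2 * z2 t * cnj b)) + cnj (z2 t) * dlt2"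
 by (simp add: I algebra_simps power2_eq_square)
 show "((%s. (cmod (z2 s))\<^sup>2) hrd - 6 * l * Im ((z1 t)\<^sup>2 * z2 t * cnj b) + 2 * Re (cnj (z2 t) * dlt2)) (at t)"
 by (rule DERIV_cong[OF has_real_derivative_cmod_sq[OF d2]]) (simp only: e2 r3 g3)
qed

definition Ca :: real where "Ca = 10 * (3 * B + 1)\<^sup>2 * (5 * Cw) ^ 3 + CE"
lemma Ca_pos: "0 < Ca" using CE_pos B_ge Cw_ge by (auto simp: Ca_def intro!: add_nonneg_pos)

text \<open>The sextic resonant form of the four modes minus six times the cube of their mass, hence
  an invariant of the four-mode system. Here \<open>a\<close>, \<open>b\<close>, \<open>c\<close>,
  \<open>d\<close> stand for the squared moduli at 1, -2, -1, 2 and \<open>X\<close> for the real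
  part of the coupling.\<close>

definition Th :: "real => real => real => real => real => real" where
 "Th X a b c d = 18 * X - 9 * (a + b + c + d) * (a\<^sup>2 + b\<^sup>2 + c\<^sup>2 + d\<^sup>2) + 4 * (a ^ 3 + b ^ 3 + c ^ 3 + d ^ 3)"

context galerkin_dyn begin

definition RA :: "real => int => complex" where "RA t = qsum A4 kR (w t) (w t) (w t) (w t) (w t)"
definition dl :: "real => int => complex" where "dl t j = - \<i> * l * (R t j - RA t j) + cpx (l\<^sup>2) * E t j"

lemma mode_deriv: "j : A4 ==> ((%s. w s j) hvd - \<i> * cpx l * RA t j + dl t j) (at t)"
 using w_deriv[of j t] A4_J by (auto simp: dl_def algebra_simps)

text \<open>By \<open>qsum_kR_A4\<close> the off-resonant modes act quadratically, each factor of
  order mu^2, on top of the coupling mu^4. This matches the order mu^8 of the remainder.\<close>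

lemma dl_bound:
 assumes t: "t : {0..S}" and j: "j : A4"
 shows "cmod (dl t j) <= Ca * mu ^ 8"
proof -
 define z where "z i = (if i : A4 then 0 else w t i)" for i
 define a where "a i = (if i : A4 then w t i else 0)" for i
 have "n1 J z <= n1 J (zo t) + n1 J (%i. w t i - v t i)"
 unfolding n1_def sum.distrib[symmetric]
 by (rule sum_mono) (use norm_triangle_sub in \<open>auto simp: z_def zo_def\<close>)
 also have "n1 J (%i. w t i - v t i) <= 5 * (Cf * mu ^ 4)" using Cf_pos mu by (intro n1_wt_le wv_diff[OF t]) auto
 also have "5 * (Cf * mu ^ 4) <= mu\<^sup>2"
 proof -
 have "5 * Cf * mu\<^sup>2 <= 1" using small[OF Csm_ge(3)] Cf_pos by (intro scaled_le) auto
 from mult_right_mono[OF this, of "mu\<^sup>2"] show ?thesis by (simp add: mult.assoc flip: power_add)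
 qed
 finally have nz: "n1 J z <= (3 * B + 1) * mu\<^sup>2" using n1_zo[OF t] by (simp add: algebra_simps)
 have "qsum J kR a a a a a j = qsum A4 kR a a a a a j"
 by (rule qsum_support) (auto simp: A4_J[simplified] a_def)
 also have "\<dots> = RA t j" unfolding qsum_A4_expand RA_def by (intro sum.cong refl) (simp add: a_def)
 finally have "cmod (R t j - RA t j) <= 10 * (n1 J z)\<^sup>2 * (n1 J (w t)) ^ 3"
 using qsum_kR_A4[OF finite_JN j, of N "w t"] by (simp add: R_def a_def[abs_def] z_def[abs_def])
 also have "\<dots> <= 10 * ((3 * B + 1) * mu\<^sup>2)\<^sup>2 * (5 * Cw) ^ 3"
 using nz n1_w[OF t] by (intro mult_mono power_mono mult_left_mono) auto
 finally have "mu ^ 4 * cmod (R t j - RA t j) <= mu ^ 4 * (10 * ((3 * B + 1) * mu\<^sup>2)\<^sup>2 * (5 * Cw) ^ 3)" using mu by (intro mult_left_mono) auto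
 also have "\<dots> = 10 * (3 * B + 1)\<^sup>2 * (5 * Cw) ^ 3 * mu ^ 8" by (simp add: power_mult_distrib mult_ac flip: power_mult power_add)
 finally have 1: "cmod (- \<i> * l * (R t j - RA t j)) <= 10 * (3 * B + 1)\<^sup>2 * (5 * Cw) ^ 3 * mu ^ 8" by (simp add: norm_mult l)
 have "cmod (E t j) <= CE" using E_bound[OF t, of j] mult_left_mono[OF wt_le_1[of j], of CE] CE_pos by linarith
 then have "mu ^ 8 * cmod (E t j) <= mu ^ 8 * CE" using mu by (intro mult_left_mono) auto
 moreover have "cmod (cpx (l\<^sup>2) * E t j) = mu ^ 8 * cmod (E t j)" unfolding l_sq using mu by (simp add: norm_mult norm_power)
 ultimately have 2: "cmod (cpx (l\<^sup>2) * E t j) <= CE * mu ^ 8" by (simp add: mult.commute)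
 show ?thesis unfolding dl_def using norm_triangle_mono[OF 1 2] by (simp add: Ca_def algebra_simps)
qed

lemma w_le: "t : {0..S} ==> cmod (w t j) <= 4"
proof -
 assume t: "t : {0..S}"
 have "5 * Cf * mu ^ 4 <= 1" using small[OF Csm_ge(3)] Cf_pos by (intro scaled_le) auto
 then have "Cf * mu ^ 4 <= 1" using Cf_pos mu by simp
 then have "Cf * mu ^ 4 * wt j <= 1 * 1" using wt_le_1 wt_nonneg by (intro mult_mono) auto
 then show ?thesis using wv_diff[OF t, of j] v_le[of t j] norm_triangle_sub[of "w t j" "v t j"] by linarith
qed

definition Iw :: "real => int => real" where "Iw t j = (cmod (w t j))\<^sup>2"
definition om :: "real => int => real" where
 "om t j = (6 * (Iw t 1 + Iw t (-2) + Iw t (-1) + Iw t 2)\<^sup>2 - 3 * ((Iw t 1)\<^sup>2 + (Iw t (-2))\<^sup>2 + (Iw t (-1))\<^sup>2 + (Iw t 2)\<^sup>2))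
 - 6 * (Iw t 1 + Iw t (-2) + Iw t (-1) + Iw t 2) * Iw t j + 4 * (Iw t j)\<^sup>2"
definition AA :: "real => complex" where "AA t = (w t 1)\<^sup>2 * w t (-2)"
definition BB :: "real => complex" where "BB t = (w t (-1))\<^sup>2 * w t 2"
text \<open>The coupling between the two pairs: its imaginary part drives all four moduli, and
  together with them it forms a closed system up to errors.\<close>

definition XX :: "real => complex" where "XX t = AA t * cnj (BB t)"
definition eA :: "real => complex" where "eA t = 2 * w t 1 * w t (-2) * dl t 1 + (w t 1)\<^sup>2 * dl t (-2)"
definition eB :: "real => complex" where "eB t = 2 * w t (-1) * w t 2 * dl t (-1) + (w t (-1))\<^sup>2 * dl t 2"
definition eX :: "real => complex" where "eX t = eA t * cnj (BB t) + AA t * cnj (eB t)"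
definition ee :: "real => int => real" where "ee t j = 2 * Re (cnj (w t j) * dl t j)"
definition Om :: "real => real" where "Om t = (2 * om t 1 + om t (-2)) - (2 * om t (-1) + om t 2)"
definition Rr :: "real => real" where
 "Rr t = (Iw t (-1))\<^sup>2 * Iw t 2 * (12 * Iw t 1 * Iw t (-2) + 3 * (Iw t 1)\<^sup>2) - (Iw t 1)\<^sup>2 * Iw t (-2) * (12 * Iw t (-1) * Iw t 2 + 3 * (Iw t (-1))\<^sup>2)"
definition X' :: "real => complex" where
 "X' t = - \<i> * cpx l * (XX t * cpx (Om t) + cpx (Rr t)) + eX t"

lemma Iw_c: "cpx (Iw t j) = w t j * cnj (w t j)" unfolding Iw_def by (rule complex_norm_square)

lemma RA_eq:
 "RA t 1 = w t 1 * cpx (om t 1) + 6 * (cnj (w t 1) * cnj (w t (-2)) * BB t)"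
 "RA t (-2) = w t (-2) * cpx (om t (-2)) + 3 * ((cnj (w t 1))\<^sup>2 * BB t)"
 "RA t (-1) = w t (-1) * cpx (om t (-1)) + 6 * (cnj (w t (-1)) * cnj (w t 2) * AA t)"
 "RA t 2 = w t 2 * cpx (om t 2) + 3 * ((cnj (w t (-1)))\<^sup>2 * AA t)"
 unfolding RA_def om_def AA_def BB_def using four_mode_sum[of "Iw t" "w t", OF Iw_c] by simp_all

lemma pairs_deriv:
 "(AA hvd - \<i> * cpx l * (AA t * cpx (2 * om t 1 + om t (-2))
 + BB t * cpx (12 * Iw t 1 * Iw t (-2) + 3 * (Iw t 1)\<^sup>2)) + eA t) (at t)"
 "(BB hvd - \<i> * cpx l * (BB t * cpx (2 * om t (-1) + om t 2)
 + AA t * cpx (12 * Iw t (-1) * Iw t 2 + 3 * (Iw t (-1))\<^sup>2)) + eB t) (at t)"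
 "((%s. Iw s 1) hrd - 12 * l * Im (XX t) + ee t 1) (at t)"
 "((%s. Iw s (-2)) hrd - 6 * l * Im (XX t) + ee t (-2)) (at t)"
 "((%s. Iw s (-1)) hrd 12 * l * Im (XX t) + ee t (-1)) (at t)"
 "((%s. Iw s 2) hrd 6 * l * Im (XX t) + ee t 2) (at t)"
proof -
 have mem: "1 : A4" "-2 : A4" "-1 : A4" "2 : A4" by (auto simp: A4_def)
 note p = resonant_pair[OF mode_deriv[OF mem(1), of t, unfolded RA_eq] mode_deriv[OF mem(2), of t, unfolded RA_eq] Iw_c Iw_c]
 note q = resonant_pair[OF mode_deriv[OF mem(3), of t, unfolded RA_eq] mode_deriv[OF mem(4), of t, unfolded RA_eq] Iw_c Iw_c]
 show "(AA hvd - \<i> * cpx l * (AA t * cpx (2 * om t 1 + om t (-2))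
 + BB t * cpx (12 * Iw t 1 * Iw t (-2) + 3 * (Iw t 1)\<^sup>2)) + eA t) (at t)"
 using p(1) unfolding AA_def[abs_def] eA_def .
 show "(BB hvd - \<i> * cpx l * (BB t * cpx (2 * om t (-1) + om t 2)
 + AA t * cpx (12 * Iw t (-1) * Iw t 2 + 3 * (Iw t (-1))\<^sup>2)) + eB t) (at t)"
 using q(1) unfolding BB_def[abs_def] eB_def .
 have sw: "Im ((w t (-1))\<^sup>2 * w t 2 * cnj (AA t)) = - Im (XX t)"
 unfolding XX_def BB_def[symmetric] by (simp add: algebra_simps)
 show "((%s. Iw s 1) hrd - 12 * l * Im (XX t) + ee t 1) (at t)"
 using p(2) unfolding Iw_def ee_def XX_def AA_def .
 show "((%s. Iw s (-2)) hrd - 6 * l * Im (XX t) + ee t (-2)) (at t)"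
 using p(3) unfolding Iw_def ee_def XX_def AA_def .
 show "((%s. Iw s (-1)) hrd 12 * l * Im (XX t) + ee t (-1)) (at t)"
 using q(2) unfolding sw Iw_def ee_def by simp
 show "((%s. Iw s 2) hrd 6 * l * Im (XX t) + ee t 2) (at t)"
 using q(3) unfolding sw Iw_def ee_def by simp
qed

lemma XX_deriv: "(XX hvd X' t) (at t)"
proof -
 have n: "cpx ((Iw t 1)\<^sup>2 * Iw t (-2)) = AA t * cnj (AA t)" "cpx ((Iw t (-1))\<^sup>2 * Iw t 2) = BB t * cnj (BB t)"
 by (simp_all add: Iw_c AA_def BB_def power2_eq_square mult_ac)
 have R: "cpx (Rr t) = BB t * cnj (BB t) * cpx (12 * Iw t 1 * Iw t (-2) + 3 * (Iw t 1)\<^sup>2)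
 - AA t * cnj (AA t) * cpx (12 * Iw t (-1) * Iw t 2 + 3 * (Iw t (-1))\<^sup>2)"
 unfolding Rr_def of_real_diff of_real_mult[of "(Iw t (-1))\<^sup>2 * Iw t 2"] of_real_mult[of "(Iw t 1)\<^sup>2 * Iw t (-2)"] n ..
 have "((%s. AA s * cnj (BB s)) hvd X' t) (at t)"
 by (rule has_vector_derivative_eq_rhs[OF has_vector_derivative_mult[OF pairs_deriv(1) has_vector_derivative_cnj[OF pairs_deriv(2)]]])
 (simp add: X'_def R eX_def XX_def Om_def ring_distribs mult_ac)
 then show ?thesis by (simp only: XX_def[abs_def])
qed

lemma ee_bound: "t : {0..S} ==> j : A4 ==> \<bar>ee t j\<bar> <= 8 * (Ca * mu ^ 8)"
proof -
 assume t: "t : {0..S}" and j: "j : A4"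
 have "\<bar>Re (cnj (w t j) * dl t j)\<bar> <= cmod (w t j) * cmod (dl t j)" by (metis abs_Re_le_cmod norm_mult complex_mod_cnj)
 also have "\<dots> <= 4 * (Ca * mu ^ 8)" by (intro mult_mono w_le dl_bound t j) auto
 finally show ?thesis by (simp add: ee_def)
qed

lemma AA_BB_le: assumes t: "t : {0..S}" shows "cmod (AA t) <= 64" "cmod (BB t) <= 64"
proof -
 have "cmod (w t i) * cmod (w t i) * cmod (w t j) <= 4 * 4 * 4" for i j by (intro mult_mono w_le t) auto
 then show "cmod (AA t) <= 64" "cmod (BB t) <= 64" by (auto simp: AA_def BB_def norm_mult power2_eq_square)
qed

lemma eX_bound: assumes t: "t : {0..S}" shows "cmod (eX t) <= 6144 * (Ca * mu ^ 8)"
proof -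
 have p: "cmod (2 * w t i * w t k * dl t i + (w t i)\<^sup>2 * dl t k) <= 48 * (Ca * mu ^ 8)" if "i : A4" "k : A4" for i k
 proof -
 have "cmod (w t i) * cmod (w t k) * cmod (dl t i) <= 4 * 4 * (Ca * mu ^ 8)" "cmod (w t i) * cmod (w t i) * cmod (dl t k) <= 4 * 4 * (Ca * mu ^ 8)"
 by (intro mult_mono w_le dl_bound t that; simp)+
 then show ?thesis using norm_triangle_ineq[of "2 * w t i * w t k * dl t i" "(w t i)\<^sup>2 * dl t k"] by (simp add: norm_mult power2_eq_square)
 qed
 have "cmod (eA t) <= 48 * (Ca * mu ^ 8)" "cmod (eB t) <= 48 * (Ca * mu ^ 8)" unfolding eA_def eB_def by (rule p; simp add: A4_def)+
 then have "cmod (eA t) * cmod (BB t) <= 48 * (Ca * mu ^ 8) * 64" "cmod (AA t) * cmod (eB t) <= 64 * (48 * (Ca * mu ^ 8))"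
 using AA_BB_le[OF t] Ca_pos mu by (intro mult_mono; simp)+
 then show ?thesis using norm_triangle_ineq[of "eA t * cnj (BB t)" "AA t * cnj (eB t)"] by (simp add: eX_def norm_mult)
qed

text \<open>Errors of order mu^8 integrate to order mu^2 over the time span.\<close>

lemma drift:
 assumes d: "!!s. s : {0..S} ==> (Q hrd q s) (at s)" and b: "!!s. s : {0..S} ==> \<bar>q s\<bar> <= C * mu ^ 8" and t: "t : {0..S}"
 shows "\<bar>Q t - Q 0\<bar> <= C * mu\<^sup>2"
proof -
 have C: "0 <= C * mu ^ 8" using b[OF t] by linarith
 have "Q t <= (Q 0 + C * mu ^ 8 * t) * exp (0 * t)"
 by (rule gronwall[OF d _ _ C t]) (use b in \<open>auto simp: abs_le_iff\<close>)
 moreover have "- Q t <= (- Q 0 + C * mu ^ 8 * t) * exp (0 * t)"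
 by (rule gronwall[where N = "%t. - Q t", OF DERIV_minus[OF d] _ _ C t]) (use b in \<open>auto simp: abs_le_iff\<close>)
 moreover have "C * mu ^ 8 * t = C * mu ^ 8 / mu ^ 6 * (mu ^ 6 * t)" using mu by simp
 moreover have "C * mu ^ 8 / mu ^ 6 * (mu ^ 6 * t) <= C * mu ^ 8 / mu ^ 6 * 1" using t_le[OF t] C mu by (intro mult_left_mono) auto
 moreover have "C * mu ^ 8 / mu ^ 6 = C * mu\<^sup>2" using mu by (simp add: field_simps flip: power_add)
 ultimately show ?thesis by (simp add: abs_le_iff)
qed

lemma Iw_le: "t : {0..S} ==> \<bar>Iw t j\<bar> <= 16" using power_mono[OF w_le[of t j], of 2] by (simp add: Iw_def)

text \<open>The exchange moves mass within a pair in the ratio 2 : 1 and between the pairs with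
  opposite signs, which gives three linear invariants; the fourth is \<open>Th\<close>. Along the
  flow the main terms cancel identically and only \<open>ee\<close> and \<open>eX\<close>
  remain.\<close>

lemma conserved_drift:
 assumes t: "t : {0..S}"
 shows "\<bar>(Iw t 1 + Iw t (-1)) - (Iw 0 1 + Iw 0 (-1))\<bar> <= 24 * Ca * mu\<^sup>2"
 "\<bar>(Iw t 1 - 2 * Iw t (-2)) - (Iw 0 1 - 2 * Iw 0 (-2))\<bar> <= 24 * Ca * mu\<^sup>2"
 "\<bar>(Iw t 1 + 2 * Iw t 2) - (Iw 0 1 + 2 * Iw 0 2)\<bar> <= 24 * Ca * mu\<^sup>2"
 "\<bar>Th (Re (XX t)) (Iw t 1) (Iw t (-2)) (Iw t (-1)) (Iw t 2) - Th (Re (XX 0)) (Iw 0 1) (Iw 0 (-2)) (Iw 0 (-1)) (Iw 0 2)\<bar> <= 1100000 * Ca * mu\<^sup>2"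
proof -
 have mem: "1 : A4" "-2 : A4" "-1 : A4" "2 : A4" by (auto simp: A4_def)
 note eb = ee_bound[OF _ mem(1)] ee_bound[OF _ mem(2)] ee_bound[OF _ mem(3)] ee_bound[OF _ mem(4)]
 note pd = pairs_deriv(3-6)
 show "\<bar>(Iw t 1 + Iw t (-1)) - (Iw 0 1 + Iw 0 (-1))\<bar> <= 24 * Ca * mu\<^sup>2"
 proof (rule drift[OF _ _ t])
 fix s assume s: "s : {0..S}"
 show "((%s. Iw s 1 + Iw s (-1)) hrd ee s 1 + ee s (-1)) (at s)"
 using DERIV_add[OF pd(1)[of s] pd(3)[of s]] by simp
 show "\<bar>ee s 1 + ee s (-1)\<bar> <= 24 * Ca * mu ^ 8" using eb[OF s] by (simp add: abs_le_iff)
 qed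
 show "\<bar>(Iw t 1 - 2 * Iw t (-2)) - (Iw 0 1 - 2 * Iw 0 (-2))\<bar> <= 24 * Ca * mu\<^sup>2"
 proof (rule drift[OF _ _ t])
 fix s assume s: "s : {0..S}"
 show "((%s. Iw s 1 - 2 * Iw s (-2)) hrd ee s 1 - 2 * ee s (-2)) (at s)"
 using DERIV_diff[OF pd(1)[of s] DERIV_cmult[OF pd(2)[of s], of 2]] by (simp add: algebra_simps)
 show "\<bar>ee s 1 - 2 * ee s (-2)\<bar> <= 24 * Ca * mu ^ 8" using eb[OF s] by (simp add: abs_le_iff)
 qed
 show "\<bar>(Iw t 1 + 2 * Iw t 2) - (Iw 0 1 + 2 * Iw 0 2)\<bar> <= 24 * Ca * mu\<^sup>2"
 proof (rule drift[OF _ _ t])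
 fix s assume s: "s : {0..S}"
 show "((%s. Iw s 1 + 2 * Iw s 2) hrd ee s 1 + 2 * ee s 2) (at s)"
 using DERIV_add[OF pd(1)[of s] DERIV_cmult[OF pd(4)[of s], of 2]] by (simp add: algebra_simps)
 show "\<bar>ee s 1 + 2 * ee s 2\<bar> <= 24 * Ca * mu ^ 8" using eb[OF s] by (simp add: abs_le_iff)
 qed
 show "\<bar>Th (Re (XX t)) (Iw t 1) (Iw t (-2)) (Iw t (-1)) (Iw t 2) - Th (Re (XX 0)) (Iw 0 1) (Iw 0 (-2)) (Iw 0 (-1)) (Iw 0 2)\<bar> <= 1100000 * Ca * mu\<^sup>2"
 proof (rule drift[OF _ _ t])
 fix s assume s: "s : {0..S}"
 have dX: "((%s. Re (XX s)) hrd l * Om s * Im (XX s) + Re (eX s)) (at s)"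
 using has_vector_derivative_Re[OF XX_deriv[of s]] by (simp add: has_real_derivative_iff_has_vector_derivative X'_def algebra_simps)
 define q where "q = 18 * Re (eX s) - 9 * ((ee s 1 + ee s (-2) + ee s (-1) + ee s 2) * ((Iw s 1)\<^sup>2 + (Iw s (-2))\<^sup>2 + (Iw s (-1))\<^sup>2 + (Iw s 2)\<^sup>2)
 + (Iw s 1 + Iw s (-2) + Iw s (-1) + Iw s 2) * (2 * (Iw s 1 * ee s 1 + Iw s (-2) * ee s (-2) + Iw s (-1) * ee s (-1) + Iw s 2 * ee s 2)))
 + 12 * ((Iw s 1)\<^sup>2 * ee s 1 + (Iw s (-2))\<^sup>2 * ee s (-2) + (Iw s (-1))\<^sup>2 * ee s (-1) + (Iw s 2)\<^sup>2 * ee s 2)"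
 show "((%s. Th (Re (XX s)) (Iw s 1) (Iw s (-2)) (Iw s (-1)) (Iw s 2)) hrd q) (at s)"
 unfolding Th_def q_def
 by (rule derivative_eq_intros dX pd refl)+ (simp add: Om_def om_def power2_eq_square algebra_simps)
 define e where "e = 8 * (Ca * mu ^ 8)"
 have e0: "0 <= e" using Ca_pos mu by (simp add: e_def)
 have E: "\<bar>ee s 1\<bar> <= e" "\<bar>ee s (-2)\<bar> <= e" "\<bar>ee s (-1)\<bar> <= e" "\<bar>ee s 2\<bar> <= e" using eb[OF s] unfolding e_def .
 have I: "\<bar>Iw s j\<bar> <= 16" "(Iw s j)\<^sup>2 <= 256" for j using Iw_le[OF s, of j] power_mono[OF Iw_le[OF s, of j], of 2] by auto
 have 1: "\<bar>Re (eX s)\<bar> <= 768 * e" using eX_bound[OF s] abs_Re_le_cmod[of "eX s"] by (simp add: e_def)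
 have 2: "\<bar>(ee s 1 + ee s (-2) + ee s (-1) + ee s 2) * ((Iw s 1)\<^sup>2 + (Iw s (-2))\<^sup>2 + (Iw s (-1))\<^sup>2 + (Iw s 2)\<^sup>2)\<bar> <= (4 * e) * 1024"
 unfolding abs_mult
 proof (rule mult_mono)
 show "\<bar>ee s 1 + ee s (-2) + ee s (-1) + ee s 2\<bar> <= 4 * e" using E by linarith
 show "\<bar>(Iw s 1)\<^sup>2 + (Iw s (-2))\<^sup>2 + (Iw s (-1))\<^sup>2 + (Iw s 2)\<^sup>2\<bar> <= 1024" using I(2)[of 1] I(2)[of "-2"] I(2)[of "-1"] I(2)[of 2] by simp
 qed (use e0 in auto)
 have ab4: "\<bar>2 * (a + b + c + d)\<bar> <= 2 * (\<bar>a\<bar> + \<bar>b\<bar> + \<bar>c\<bar> + \<bar>d\<bar>)" for a b c d :: real by simp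
 have ab3: "\<bar>18 * a - 9 * (b + c) + 12 * d\<bar> <= 18 * \<bar>a\<bar> + 9 * \<bar>b\<bar> + 9 * \<bar>c\<bar> + 12 * \<bar>d\<bar>" for a b c d :: real by simp
 have pr: "\<bar>Iw s j * x\<bar> <= 16 * e" "\<bar>(Iw s j)\<^sup>2 * x\<bar> <= 256 * e" if "\<bar>x\<bar> <= e" for j x
 using that I[of j] unfolding abs_mult by (intro mult_mono; simp)+
 have 3: "\<bar>(Iw s 1 + Iw s (-2) + Iw s (-1) + Iw s 2) * (2 * (Iw s 1 * ee s 1 + Iw s (-2) * ee s (-2) + Iw s (-1) * ee s (-1) + Iw s 2 * ee s 2))\<bar> <= 64 * (128 * e)"
 unfolding abs_mult[of "Iw s 1 + Iw s (-2) + Iw s (-1) + Iw s 2"]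
 proof (rule mult_mono)
 show "\<bar>Iw s 1 + Iw s (-2) + Iw s (-1) + Iw s 2\<bar> <= 64" using I(1)[of 1] I(1)[of "-2"] I(1)[of "-1"] I(1)[of 2] by linarith
 show "\<bar>2 * (Iw s 1 * ee s 1 + Iw s (-2) * ee s (-2) + Iw s (-1) * ee s (-1) + Iw s 2 * ee s 2)\<bar> <= 128 * e"
 using pr(1)[OF E(1), of 1] pr(1)[OF E(2), of "-2"] pr(1)[OF E(3), of "-1"] pr(1)[OF E(4), of 2] by (intro ab4[THEN order_trans]) simp_all
 qed auto
 have 4: "\<bar>(Iw s 1)\<^sup>2 * ee s 1 + (Iw s (-2))\<^sup>2 * ee s (-2) + (Iw s (-1))\<^sup>2 * ee s (-1) + (Iw s 2)\<^sup>2 * ee s 2\<bar> <= 1024 * e"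
 using pr(2)[OF E(1), of 1] pr(2)[OF E(2), of "-2"] pr(2)[OF E(3), of "-1"] pr(2)[OF E(4), of 2] by linarith
 have "18 * x + 9 * y + 9 * z + 12 * w <= 137000 * e" if "x <= 768 * e" "y <= (4 * e) * 1024" "z <= 64 * (128 * e)" "w <= 1024 * e" for x y z w
 using that e0 by simp
 from order_trans[OF ab3 this[OF 1 2 3 4]] have "\<bar>q\<bar> <= 137000 * e" unfolding q_def .
 then show "\<bar>q\<bar> <= 1100000 * Ca * mu ^ 8" by (simp add: e_def)
 qed
qed

end

text \<open>Uniform closeness of two families, with an error controlled by \<open>d\<close>: it is a congruence for polynomial
 expressions, which hides the constants in the passage from the four resonant modes to the planar system.\<close>

locale closeness =
 fixes D :: "'p set" and d :: "'p => real"
 assumes d_nonneg: "!!p. p : D ==> 0 <= d p"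
begin

definition close :: "('p => 'a::real_normed_field) => ('p => 'a) => bool" where
 "close f g \<longleftrightarrow> (\<exists>C\<ge>0. \<forall>p\<in>D. norm (f p) <= C & norm (g p) <= C & norm (f p - g p) <= C * d p)"

lemma closeI:
 assumes "!!p. p : D ==> norm (f p) <= A" "!!p. p : D ==> norm (g p) <= A'" "!!p. p : D ==> norm (f p - g p) <= C * d p"
 shows "close f g"
 unfolding close_def
proof (intro exI[of _ "max 0 (max A (max A' C))"] conjI ballI)
 fix p assume p: "p : D"
 show "norm (f p) <= max 0 (max A (max A' C))" "norm (g p) <= max 0 (max A (max A' C))" using assms(1,2)[OF p] by auto
 have "C * d p <= max 0 (max A (max A' C)) * d p" using d_nonneg[OF p] by (intro mult_right_mono) auto
 then show "norm (f p - g p) <= max 0 (max A (max A' C)) * d p" using assms(3)[OF p] by linarith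
qed simp

lemma closeE:
 assumes "close f g"
 obtains C where "0 <= C" "!!p. p : D ==> norm (f p) <= C" "!!p. p : D ==> norm (g p) <= C" "!!p. p : D ==> norm (f p - g p) <= C * d p"
 using assms unfolding close_def by blast

lemma close_const: "close (%_. c) (%_. c)" by (rule closeI[where C = 0]) auto

lemma close_eq: "close f g ==> (!!p. f p = f' p) ==> (!!p. g p = g' p) ==> close f' g'"
 by (simp add: close_def)

lemma close_add: assumes "close f f'" "close g g'" shows "close (%p. f p + g p) (%p. f' p + g' p)"
proof -
 obtain C where C: "0 <= C" "!!p. p : D ==> norm (f p) <= C" "!!p. p : D ==> norm (f' p) <= C" "!!p. p : D ==> norm (f p - f' p) <= C * d p"
 using assms(1) by (rule closeE) blast
 obtain E where E: "0 <= E" "!!p. p : D ==> norm (g p) <= E" "!!p. p : D ==> norm (g' p) <= E" "!!p. p : D ==> norm (g p - g' p) <= E * d p"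
 using assms(2) by (rule closeE) blast
 show ?thesis
 proof (rule closeI)
 fix p assume p: "p : D"
 show "norm (f p + g p) <= C + E" by (rule norm_triangle_mono[OF C(2)[OF p] E(2)[OF p]])
 show "norm (f' p + g' p) <= C + E" by (rule norm_triangle_mono[OF C(3)[OF p] E(3)[OF p]])
 show "norm (f p + g p - (f' p + g' p)) <= (C + E) * d p"
 using norm_triangle_mono[OF C(4)[OF p] E(4)[OF p]] by (simp add: algebra_simps)
 qed
qed

lemma close_mult: assumes "close f f'" "close g g'" shows "close (%p. f p * g p) (%p. f' p * g' p)"
proof -
 obtain C where C: "0 <= C" "!!p. p : D ==> norm (f p) <= C" "!!p. p : D ==> norm (f' p) <= C" "!!p. p : D ==> norm (f p - f' p) <= C * d p"
 using assms(1) by (rule closeE) blast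
 obtain E where E: "0 <= E" "!!p. p : D ==> norm (g p) <= E" "!!p. p : D ==> norm (g' p) <= E" "!!p. p : D ==> norm (g p - g' p) <= E * d p"
 using assms(2) by (rule closeE) blast
 show ?thesis
 proof (rule closeI)
 fix p assume p: "p : D"
 show "norm (f p * g p) <= C * E" unfolding norm_mult using C(1,2) E(1,2) p by (intro mult_mono) auto
 show "norm (f' p * g' p) <= C * E" unfolding norm_mult using C(1,3) E(1,3) p by (intro mult_mono) auto
 have "norm (f p * (g p - g' p)) <= C * (E * d p)" unfolding norm_mult using C(1,2) E(4) p by (intro mult_mono) auto
 moreover have "norm ((f p - f' p) * g' p) <= C * d p * E" unfolding norm_mult using C(1,4) E(1,3) p d_nonneg[OF p] by (intro mult_mono) auto
 moreover have "f p * g p - f' p * g' p = f p * (g p - g' p) + (f p - f' p) * g' p" by (simp add: algebra_simps)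
 ultimately show "norm (f p * g p - f' p * g' p) <= (2 * C * E) * d p"
 using norm_triangle_ineq[of "f p * (g p - g' p)" "(f p - f' p) * g' p"] by (simp add: algebra_simps)
 qed
qed

lemma close_diff: assumes "close f f'" "close g g'" shows "close (%p. f p - g p) (%p. f' p - g' p)"
 by (rule close_eq[OF close_add[OF assms(1) close_mult[OF close_const[of "-1"] assms(2)]]]) auto

lemma close_power: assumes "close f f'" shows "close (%p. f p ^ n) (%p. f' p ^ n)"
 by (induction n) (auto intro: close_const close_mult assms)

lemma close_divide: assumes "close f f'" shows "close (%p. f p / c) (%p. f' p / c)"
 by (rule close_eq[OF close_mult[OF assms close_const[of "inverse c"]]]) (auto simp: divide_inverse)

lemma close_cnj: assumes "close f f'" shows "close (%p. cnj (f p)) (%p. cnj (f' p))"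
 using assms by (simp add: close_def flip: complex_cnj_diff)

lemma close_Re: assumes "close f f'" shows "close (%p. Re (f p)) (%p. Re (f' p))"
proof -
 obtain C where C: "0 <= C" "!!p. p : D ==> cmod (f p) <= C" "!!p. p : D ==> cmod (f' p) <= C" "!!p. p : D ==> cmod (f p - f' p) <= C * d p"
 using assms by (rule closeE) blast
 show ?thesis
 by (rule closeI[where A = C and A' = C and C = C])
 (use C abs_Re_le_cmod order_trans in \<open>fastforce simp flip: minus_complex.simps(1)\<close>)+
qed

lemma close_of_drift:
 assumes c: "close f0 (%_. c)" and d: "!!p. p : D ==> norm (f p - f0 p) <= C * d p" and A: "!!p. p : D ==> norm (f p) <= A"
 shows "close f (%_. c)"
proof -
 obtain E where E: "0 <= E" "!!p. p : D ==> norm (f0 p - c) <= E * d p" using c by (rule closeE) blast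
 show ?thesis
 proof (rule closeI[OF A])
 fix p assume p: "p : D"
 show "norm (f p - c) <= (C + E) * d p"
 using norm_triangle_ineq[of "f p - f0 p" "f0 p - c"] d[OF p] E(2)[OF p] by (simp add: algebra_simps)
 qed auto
qed

lemmas close_intros = close_add close_mult close_diff close_power close_divide close_const

end

section \<open>Uniform comparison of all runs with the planar system\<close>

definition cc :: "real => int => real" where
 "cc gm j = (if j = 1 then sqrt gm else if j = -2 then sqrt ((7 + gm) / 2) else if j = -1 then sqrt (1 - gm)
 else if j = 2 then sqrt ((1 - gm) / 2) else 0)"

text \<open>All parameters and the time form one point, so a constant valid on a set of runs is
  uniform in the sign, in \<open>mu\<close>, in the truncation and in time.\<close>

type_synonym run = "real \<times> real \<times> real \<times> nat \<times> (real => int => complex) \<times> real"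

definition adm :: "real => run set" where
 "adm gm = {(l, mu, S, N, v, t). galerkin_dyn l mu S N v & t : {0..S} & (\<forall>j. v 0 j = cpx (cc gm j))}"

definition pw :: "int => run => complex" where "pw j = (%(l, mu, S, N, v, t). galerkin_dyn.w l N v t j)"
definition pw0 :: "int => run => complex" where "pw0 j = (%(l, mu, S, N, v, t). galerkin_dyn.w l N v 0 j)"
definition pd :: "run => real" where "pd = (%(l, mu, S, N, v, t). mu\<^sup>2)"
definition pI :: "int => run => real" where "pI j p = (cmod (pw j p))\<^sup>2"
definition pI0 :: "int => run => real" where "pI0 j p = (cmod (pw0 j p))\<^sup>2"
definition pX :: "run => complex" where "pX p = (pw 1 p)\<^sup>2 * pw (-2) p * cnj ((pw (-1) p)\<^sup>2 * pw 2 p)"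
definition pX0 :: "run => complex" where "pX0 p = (pw0 1 p)\<^sup>2 * pw0 (-2) p * cnj ((pw0 (-1) p)\<^sup>2 * pw0 2 p)"

text \<open>For y equal to 12 Im X up to sign, \<open>Yq\<close> is y^2 and \<open>Yd\<close> is the
  main part of y' in rescaled time, both as polynomials in the squared moduli and Re X.
  \<open>Rx\<close> solves the invariant \<open>Th\<close> for Re X.\<close>

definition Yq :: "real => real => real => real => real => real" where
 "Yq a b c e X = 144 * (a\<^sup>2 * b * (c\<^sup>2 * e) - X\<^sup>2)"
definition Yd :: "real => real => real => real => real => real" where
 "Yd a b c e X = 12 * ((4 * (2 * a\<^sup>2 + b\<^sup>2 - 2 * c\<^sup>2 - e\<^sup>2) - 6 * (a + b + c + e) * (2 * a + b - 2 * c - e)) * X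
 + (c\<^sup>2 * e * (12 * a * b + 3 * a\<^sup>2) - a\<^sup>2 * b * (12 * c * e + 3 * c\<^sup>2)))"
definition Rx :: "real => real => real => real => real => real" where
 "Rx a b c e tht = (tht + 9 * (a + b + c + e) * (a\<^sup>2 + b\<^sup>2 + c\<^sup>2 + e\<^sup>2) - 4 * (a ^ 3 + b ^ 3 + c ^ 3 + e ^ 3)) / 18"

lemma Rx_Th: "Rx a b c e (Th X a b c e) = X" by (simp add: Rx_def Th_def)
lemma Rx_orbit: "Rx x ((7 + x) / 2) (1 - x) ((1 - x) / 2) (3 * h - 863 / 2) = VV h x / 6"
 by (simp add: Rx_def VV_def power2_eq_square power3_eq_cube field_simps)
lemma Yq_orbit: "Yq x ((7 + x) / 2) (1 - x) ((1 - x) / 2) (VV h x / 6) = PP h x"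
 by (simp add: Yq_def PP_def power2_eq_square power3_eq_cube field_simps)
lemma Yd_orbit: "Yd x ((7 + x) / 2) (1 - x) ((1 - x) / 2) (VV h x / 6) = dPP h x / 2"
 by (simp add: Yd_def dPP_def power2_eq_square power3_eq_cube field_simps)

context galerkin_dyn begin

lemma w_cont': "continuous_on X (%t. w t i)"
 unfolding w_def Wv_def Pv_def
proof (intro continuous_intros v_cont qsum_continuous)
 show "continuous_on X (%t. kP t x)" for x unfolding kP_def by (cases "x = 0") (auto intro!: continuous_intros)
qed

lemma dl_cont: "continuous_on X (%t. dl t j)"
 unfolding dl_def R_def RA_def E_def by (intro continuous_intros qsum_continuous EE_continuous w_cont' v_cont)

lemma fast_cont: "continuous_on X (%t. Im (XX t))" "continuous_on X (%t. ee t j)" "continuous_on X (%t. Im (X' t))"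
 unfolding X'_def XX_def ee_def AA_def BB_def eX_def eA_def eB_def Om_def Rr_def om_def Iw_def
 by (intro continuous_intros w_cont' dl_cont)+

lemma Om_Rr: "12 * (Om t * X + Rr t) = Yd (Iw t 1) (Iw t (-2)) (Iw t (-1)) (Iw t 2) X"
 unfolding Yd_def Om_def om_def Rr_def by (simp add: algebra_simps)

lemma Im_XX_sq: "144 * (Im (XX t))\<^sup>2 = Yq (Iw t 1) (Iw t (-2)) (Iw t (-1)) (Iw t 2) (Re (XX t))"
proof -
 have "(cmod (XX t))\<^sup>2 = (Iw t 1)\<^sup>2 * Iw t (-2) * ((Iw t (-1))\<^sup>2 * Iw t 2)"
 by (simp add: XX_def AA_def BB_def norm_mult norm_power Iw_def power_mult_distrib mult_ac flip: power_mult)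
 then show ?thesis by (simp add: Yq_def cmod_power2)
qed

lemma p_simps:
 "pw j (l, mu, S, N, v, t) = w t j" "pw0 j (l, mu, S, N, v, t) = w 0 j" "pd (l, mu, S, N, v, t) = mu\<^sup>2"
 "pI j (l, mu, S, N, v, t) = Iw t j" "pI0 j (l, mu, S, N, v, t) = Iw 0 j" "pX (l, mu, S, N, v, t) = XX t" "pX0 (l, mu, S, N, v, t) = XX 0"
 by (simp_all add: pw_def pw0_def pd_def pI_def pI0_def pX_def pX0_def Iw_def XX_def AA_def BB_def)

end

context
 fixes gm :: real
 assumes gm: "0 < gm" "gm < 1 / 10"
begin

interpretation C: closeness "adm gm" pd by unfold_locales (auto simp: adm_def pd_def)

lemma admE:
 assumes "p : adm gm"
 obtains l mu S N v t where "p = (l, mu, S, N, v, t)" "galerkin_dyn l mu S N v" "t : {0..S}" "!!j. v 0 j = cpx (cc gm j)"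
 using assms by (auto simp: adm_def)

lemma close_w0: "C.close (pw0 j) (%_. cpx (cc gm j))"
proof (rule C.closeI)
 fix p assume "p : adm gm"
 then obtain l mu S N v t where p: "p = (l, mu, S, N, v, t)" and D: "galerkin_dyn l mu S N v" and t: "t : {0..S}"
 and i: "!!j. v 0 j = cpx (cc gm j)" by (rule admE) blast
 interpret D: galerkin_dyn l mu S N v by (rule D)
 have 0: "0 : {0..S}" using t by auto
 show "cmod (pw0 j p) <= 4" unfolding p D.p_simps by (rule D.w_le[OF 0])
 have "cmod (D.w 0 j - v 0 j) <= Cf * mu ^ 4 * wt j" by (rule D.wv_diff[OF 0])
 also have "\<dots> <= Cf * mu ^ 4 * 1" using wt_le_1 Cf_pos D.mu by (intro mult_left_mono) auto
 also have "\<dots> <= Cf * mu\<^sup>2" using D.mu_pow[of 2 4] Cf_pos by simp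
 finally show "cmod (pw0 j p - cpx (cc gm j)) <= Cf * pd p" unfolding p D.p_simps i .
qed auto

lemma Re_mult_cnj: "Re (z * cnj z) = (cmod z)\<^sup>2" unfolding cmod_power2 by (simp add: power2_eq_square)

lemma close_I0: "C.close (pI0 j) (%_. (cc gm j)\<^sup>2)"
 by (rule C.close_eq[OF C.close_Re[OF C.close_mult[OF close_w0[of j] C.close_cnj[OF close_w0[of j]]]]])
 (simp_all only: Re_mult_cnj pI0_def norm_of_real power2_abs)

lemma close_X0: "C.close pX0 (%_. cpx ((cc gm 1)\<^sup>2 * cc gm (-2) * ((cc gm (-1))\<^sup>2 * cc gm 2)))"
proof -
 have "C.close (%p. (pw0 1 p)\<^sup>2 * pw0 (-2) p * cnj ((pw0 (-1) p)\<^sup>2 * pw0 2 p))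
 (%_. (cpx (cc gm 1))\<^sup>2 * cpx (cc gm (-2)) * cnj ((cpx (cc gm (-1)))\<^sup>2 * cpx (cc gm 2)))"
 by (intro C.close_mult C.close_power C.close_cnj close_w0)
 then show ?thesis by (rule C.close_eq) (auto simp: pX0_def)
qed

lemma cc_sq: "(cc gm 1)\<^sup>2 = gm" "(cc gm (-2))\<^sup>2 = (7 + gm) / 2" "(cc gm (-1))\<^sup>2 = 1 - gm" "(cc gm 2)\<^sup>2 = (1 - gm) / 2"
 using gm by (simp_all add: cc_def)

text \<open>Identifies the starting value of Re X with \<open>VV / 6\<close> at \<open>gm\<close>;
  this requirement is the origin of the formula for \<open>hh\<close>.\<close>

lemma cc_prod: "(cc gm 1)\<^sup>2 * cc gm (-2) * ((cc gm (-1))\<^sup>2 * cc gm 2) = VV (hh gm) gm / 6"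
proof -
 have "cc gm (-2) * cc gm 2 = sqrt ((7 + gm) * (1 - gm)) / 2"
 by (simp add: cc_def real_sqrt_mult[symmetric] real_sqrt_divide)
 moreover have "(cc gm 1)\<^sup>2 * cc gm (-2) * ((cc gm (-1))\<^sup>2 * cc gm 2) = (cc gm 1)\<^sup>2 * (cc gm (-1))\<^sup>2 * (cc gm (-2) * cc gm 2)"
 by (simp only: mult_ac)
 ultimately have "(cc gm 1)\<^sup>2 * cc gm (-2) * ((cc gm (-1))\<^sup>2 * cc gm 2) = gm * (1 - gm) * (sqrt ((7 + gm) * (1 - gm)) / 2)"
 by (simp only: cc_sq)
 then show ?thesis by (simp add: VV_def hh_def)
qed

lemma close_Th0: "C.close (%p. Th (Re (pX0 p)) (pI0 1 p) (pI0 (-2) p) (pI0 (-1) p) (pI0 2 p)) (%_. 3 * hh gm - 863 / 2)"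
proof -
 have "C.close (%p. Th (Re (pX0 p)) (pI0 1 p) (pI0 (-2) p) (pI0 (-1) p) (pI0 2 p))
 (%_. Th (Re (cpx ((cc gm 1)\<^sup>2 * cc gm (-2) * ((cc gm (-1))\<^sup>2 * cc gm 2)))) ((cc gm 1)\<^sup>2) ((cc gm (-2))\<^sup>2) ((cc gm (-1))\<^sup>2) ((cc gm 2)\<^sup>2))"
 unfolding Th_def by (intro C.close_add C.close_diff C.close_mult C.close_power C.close_const C.close_Re close_I0 close_X0)
 moreover have "Th (Re (cpx ((cc gm 1)\<^sup>2 * cc gm (-2) * ((cc gm (-1))\<^sup>2 * cc gm 2)))) ((cc gm 1)\<^sup>2) ((cc gm (-2))\<^sup>2) ((cc gm (-1))\<^sup>2) ((cc gm 2)\<^sup>2)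
 = Th (VV (hh gm) gm / 6) gm ((7 + gm) / 2) (1 - gm) ((1 - gm) / 2)"
 by (subst cc_prod) (simp only: Re_complex_of_real cc_sq)
 moreover have "Th (VV (hh gm) gm / 6) gm ((7 + gm) / 2) (1 - gm) ((1 - gm) / 2) = 3 * hh gm - 863 / 2"
 by (simp add: Th_def VV_def field_simps power2_eq_square power3_eq_cube)
 ultimately show ?thesis by simp
qed

lemma adm_drift:
 assumes "p : adm gm"
 shows "\<bar>(pI 1 p + pI (-1) p) - (pI0 1 p + pI0 (-1) p)\<bar> <= 24 * Ca * pd p"
 "\<bar>(pI 1 p - 2 * pI (-2) p) - (pI0 1 p - 2 * pI0 (-2) p)\<bar> <= 24 * Ca * pd p"
 "\<bar>(pI 1 p + 2 * pI 2 p) - (pI0 1 p + 2 * pI0 2 p)\<bar> <= 24 * Ca * pd p"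
 "\<bar>Th (Re (pX p)) (pI 1 p) (pI (-2) p) (pI (-1) p) (pI 2 p) - Th (Re (pX0 p)) (pI0 1 p) (pI0 (-2) p) (pI0 (-1) p) (pI0 2 p)\<bar> <= 1100000 * Ca * pd p"
 "\<bar>pI j p\<bar> <= 16" "\<bar>Re (pX p)\<bar> <= 4096"
proof -
 obtain l mu S N v t where p: "p = (l, mu, S, N, v, t)" and D: "galerkin_dyn l mu S N v" and t: "t : {0..S}"
 using assms by (rule admE) blast
 interpret D: galerkin_dyn l mu S N v by (rule D)
 show "\<bar>(pI 1 p + pI (-1) p) - (pI0 1 p + pI0 (-1) p)\<bar> <= 24 * Ca * pd p"
 "\<bar>(pI 1 p - 2 * pI (-2) p) - (pI0 1 p - 2 * pI0 (-2) p)\<bar> <= 24 * Ca * pd p"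
 "\<bar>(pI 1 p + 2 * pI 2 p) - (pI0 1 p + 2 * pI0 2 p)\<bar> <= 24 * Ca * pd p"
 "\<bar>Th (Re (pX p)) (pI 1 p) (pI (-2) p) (pI (-1) p) (pI 2 p) - Th (Re (pX0 p)) (pI0 1 p) (pI0 (-2) p) (pI0 (-1) p) (pI0 2 p)\<bar> <= 1100000 * Ca * pd p"
 "\<bar>pI j p\<bar> <= 16"
 unfolding p D.p_simps by (rule D.conserved_drift[OF t] D.Iw_le[OF t])+
 have "cmod (D.AA t) * cmod (D.BB t) <= 64 * 64" by (intro mult_mono D.AA_BB_le[OF t]) auto
 then show "\<bar>Re (pX p)\<bar> <= 4096" unfolding p D.p_simps using abs_Re_le_cmod[of "D.XX t"] by (simp add: D.XX_def norm_mult)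
qed

lemma close_x: "C.close (pI j) (pI j)" by (rule C.closeI[where A = 16 and A' = 16 and C = 0]) (use adm_drift(5) in auto)

text \<open>The three linear invariants express the other moduli through that of mode 1; their
  initial values are 1, -7 and 1.\<close>

lemma close_modes:
 "C.close (pI (-2)) (%p. (7 + pI 1 p) / 2)" "C.close (pI (-1)) (%p. 1 - pI 1 p)" "C.close (pI 2) (%p. (1 - pI 1 p) / 2)"
proof -
 have I: "\<bar>pI j p\<bar> <= 16" if "p : adm gm" for p j using adm_drift(5)[OF that] .
 have 0: "C.close (%p. pI0 1 p + pI0 (-1) p) (%_. (cc gm 1)\<^sup>2 + (cc gm (-1))\<^sup>2)"
 "C.close (%p. pI0 1 p - 2 * pI0 (-2) p) (%_. (cc gm 1)\<^sup>2 - 2 * (cc gm (-2))\<^sup>2)"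
 "C.close (%p. pI0 1 p + 2 * pI0 2 p) (%_. (cc gm 1)\<^sup>2 + 2 * (cc gm 2)\<^sup>2)"
 by (intro C.close_add C.close_diff C.close_mult C.close_const close_I0)+
 have k: "(cc gm 1)\<^sup>2 + (cc gm (-1))\<^sup>2 = 1" "(cc gm 1)\<^sup>2 - 2 * (cc gm (-2))\<^sup>2 = - 7" "(cc gm 1)\<^sup>2 + 2 * (cc gm 2)\<^sup>2 = 1"
 unfolding cc_sq by (simp_all add: field_simps)
 have 1: "C.close (%p. pI 1 p + pI (-1) p) (%_. 1)"
 by (rule C.close_of_drift[OF 0(1)[unfolded k], where C = "24 * Ca" and A = 32])
 (use adm_drift(1) I[of _ 1] I[of _ "-1"] in \<open>fastforce simp: abs_le_iff\<close>)+
 have 2: "C.close (%p. pI 1 p - 2 * pI (-2) p) (%_. - 7)"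
 by (rule C.close_of_drift[OF 0(2)[unfolded k], where C = "24 * Ca" and A = 48])
 (use adm_drift(2) I[of _ 1] I[of _ "-2"] in \<open>fastforce simp: abs_le_iff\<close>)+
 have 3: "C.close (%p. pI 1 p + 2 * pI 2 p) (%_. 1)"
 by (rule C.close_of_drift[OF 0(3)[unfolded k], where C = "24 * Ca" and A = 48])
 (use adm_drift(3) I[of _ 1] I[of _ 2] in \<open>fastforce simp: abs_le_iff\<close>)+
 show "C.close (pI (-1)) (%p. 1 - pI 1 p)" by (rule C.close_eq[OF C.close_diff[OF 1 close_x[of 1]]]) auto
 show "C.close (pI (-2)) (%p. (7 + pI 1 p) / 2)" by (rule C.close_eq[OF C.close_divide[OF C.close_diff[OF close_x[of 1] 2], of 2]]) auto
 show "C.close (pI 2) (%p. (1 - pI 1 p) / 2)" by (rule C.close_eq[OF C.close_divide[OF C.close_diff[OF 3 close_x[of 1]], of 2]]) auto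
qed

lemma close_Th: "C.close (%p. Th (Re (pX p)) (pI 1 p) (pI (-2) p) (pI (-1) p) (pI 2 p)) (%_. 3 * hh gm - 863 / 2)"
proof (rule C.close_of_drift[OF close_Th0])
 fix p assume p: "p : adm gm"
 show "norm (Th (Re (pX p)) (pI 1 p) (pI (-2) p) (pI (-1) p) (pI 2 p) - Th (Re (pX0 p)) (pI0 1 p) (pI0 (-2) p) (pI0 (-1) p) (pI0 2 p)) <= 1100000 * Ca * pd p"
 using adm_drift(4)[OF p] by simp
 have I: "\<bar>pI j p\<bar> <= 16" "\<bar>(pI j p)\<^sup>2\<bar> <= 256" "\<bar>(pI j p) ^ 3\<bar> <= 4096" for j
 using adm_drift(5)[OF p, of j] power_mono[OF adm_drift(5)[OF p, of j], of 2] power_mono[OF adm_drift(5)[OF p, of j], of 3] by (auto simp: power_abs)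
 have "\<bar>(pI 1 p + pI (-2) p + pI (-1) p + pI 2 p) * ((pI 1 p)\<^sup>2 + (pI (-2) p)\<^sup>2 + (pI (-1) p)\<^sup>2 + (pI 2 p)\<^sup>2)\<bar> <= 64 * 1024"
 unfolding abs_mult
 proof (rule mult_mono)
 show "\<bar>pI 1 p + pI (-2) p + pI (-1) p + pI 2 p\<bar> <= 64" using I(1)[of 1] I(1)[of "-2"] I(1)[of "-1"] I(1)[of 2] by linarith
 show "\<bar>(pI 1 p)\<^sup>2 + (pI (-2) p)\<^sup>2 + (pI (-1) p)\<^sup>2 + (pI 2 p)\<^sup>2\<bar> <= 1024" using I(2)[of 1] I(2)[of "-2"] I(2)[of "-1"] I(2)[of 2] by linarith
 qed auto
 note MS = this
 show "norm (Th (Re (pX p)) (pI 1 p) (pI (-2) p) (pI (-1) p) (pI 2 p)) <= 1000000"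
 proof -
 have "\<bar>18 * a - 9 * b + 4 * (x + y + z + w)\<bar> <= 1000000" if "\<bar>a\<bar> <= 4096" "\<bar>b\<bar> <= 64 * 1024" "\<bar>x\<bar> <= 4096" "\<bar>y\<bar> <= 4096" "\<bar>z\<bar> <= 4096" "\<bar>w\<bar> <= 4096"
 for a b x y z w :: real using that by (simp add: abs_le_iff)
 from this[OF adm_drift(6)[OF p] MS I(3) I(3) I(3) I(3)] show ?thesis unfolding Th_def real_norm_def mult.assoc[of 9] .
 qed
qed

lemma close_scale: "C.close f g ==> C.close (%p. c * f p) (%p. c * g p)" by (rule C.close_mult[OF C.close_const])

lemma close_sum4:
 "C.close (%p. (pI 1 p) ^ n + (pI (-2) p) ^ n + (pI (-1) p) ^ n + (pI 2 p) ^ n)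
 (%p. (pI 1 p) ^ n + ((7 + pI 1 p) / 2) ^ n + (1 - pI 1 p) ^ n + ((1 - pI 1 p) / 2) ^ n)"
 by (rule C.close_add[OF C.close_add[OF C.close_add[OF C.close_power[OF close_x[of 1]] C.close_power[OF close_modes(1)]] C.close_power[OF close_modes(2)]]
 C.close_power[OF close_modes(3)]])

text \<open>Re X is not obtained by integrating its equation but from the invariant
  \<open>Th\<close>, so its error stays of order mu^2 throughout.\<close>

lemma close_ReX: "C.close (%p. Re (pX p)) (%p. VV (hh gm) (pI 1 p) / 6)"
proof -
 have "C.close (%p. Rx (pI 1 p) (pI (-2) p) (pI (-1) p) (pI 2 p) (Th (Re (pX p)) (pI 1 p) (pI (-2) p) (pI (-1) p) (pI 2 p)))
 (%p. Rx (pI 1 p) ((7 + pI 1 p) / 2) (1 - pI 1 p) ((1 - pI 1 p) / 2) (3 * hh gm - 863 / 2))"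
 unfolding Rx_def
 by (rule C.close_divide[OF C.close_diff[OF C.close_add[OF close_Th C.close_mult[OF close_scale[OF close_sum4[of 1, unfolded power_one_right]] close_sum4]] close_scale[OF close_sum4]]])
 then show ?thesis by (simp only: Rx_Th Rx_orbit)
qed

lemma close_Yq: "C.close (%p. Yq (pI 1 p) (pI (-2) p) (pI (-1) p) (pI 2 p) (Re (pX p))) (%p. PP (hh gm) (pI 1 p))"
 unfolding Yq_orbit[symmetric] unfolding Yq_def
 by (rule close_scale[OF C.close_diff[OF C.close_mult[OF C.close_mult[OF C.close_power[OF close_x[of 1]] close_modes(1)]
 C.close_mult[OF C.close_power[OF close_modes(2)] close_modes(3)]] C.close_power[OF close_ReX]]])

lemma close_Yd: "C.close (%p. Yd (pI 1 p) (pI (-2) p) (pI (-1) p) (pI 2 p) (Re (pX p))) (%p. dPP (hh gm) (pI 1 p) / 2)"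
proof -
 note c = close_scale
 note m = close_modes close_x[of 1] close_ReX
 have M: "C.close (%p. pI 1 p + pI (-2) p + pI (-1) p + pI 2 p) (%p. pI 1 p + (7 + pI 1 p) / 2 + (1 - pI 1 p) + (1 - pI 1 p) / 2)"
 by (rule close_sum4[of 1, unfolded power_one_right])
 have L: "C.close (%p. 2 * pI 1 p + pI (-2) p - 2 * pI (-1) p - pI 2 p) (%p. 2 * pI 1 p + (7 + pI 1 p) / 2 - 2 * (1 - pI 1 p) - (1 - pI 1 p) / 2)"
 by (rule C.close_diff[OF C.close_diff[OF C.close_add[OF c[OF m(4)] m(1)] c[OF m(2)]] m(3)])
 have Q: "C.close (%p. 2 * (pI 1 p)\<^sup>2 + (pI (-2) p)\<^sup>2 - 2 * (pI (-1) p)\<^sup>2 - (pI 2 p)\<^sup>2)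
 (%p. 2 * (pI 1 p)\<^sup>2 + ((7 + pI 1 p) / 2)\<^sup>2 - 2 * (1 - pI 1 p)\<^sup>2 - ((1 - pI 1 p) / 2)\<^sup>2)"
 by (rule C.close_diff[OF C.close_diff[OF C.close_add[OF c[OF C.close_power[OF m(4)]] C.close_power[OF m(1)]] c[OF C.close_power[OF m(2)]]] C.close_power[OF m(3)]])
 have U: "C.close (%p. (pI (-1) p)\<^sup>2 * pI 2 p * (12 * pI 1 p * pI (-2) p + 3 * (pI 1 p)\<^sup>2))
 (%p. (1 - pI 1 p)\<^sup>2 * ((1 - pI 1 p) / 2) * (12 * pI 1 p * ((7 + pI 1 p) / 2) + 3 * (pI 1 p)\<^sup>2))"
 by (rule C.close_mult[OF C.close_mult[OF C.close_power[OF m(2)] m(3)] C.close_add[OF C.close_mult[OF c[OF m(4)] m(1)] c[OF C.close_power[OF m(4)]]]])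
 have V: "C.close (%p. (pI 1 p)\<^sup>2 * pI (-2) p * (12 * pI (-1) p * pI 2 p + 3 * (pI (-1) p)\<^sup>2))
 (%p. (pI 1 p)\<^sup>2 * ((7 + pI 1 p) / 2) * (12 * (1 - pI 1 p) * ((1 - pI 1 p) / 2) + 3 * (1 - pI 1 p)\<^sup>2))"
 by (rule C.close_mult[OF C.close_mult[OF C.close_power[OF m(4)] m(1)] C.close_add[OF C.close_mult[OF c[OF m(2)] m(3)] c[OF C.close_power[OF m(2)]]]])
 show ?thesis unfolding Yd_orbit[symmetric] unfolding Yd_def
 by (rule c[OF C.close_add[OF C.close_mult[OF C.close_diff[OF c[OF Q] C.close_mult[OF c[OF M] L]] m(5)] C.close_diff[OF U V]]])
qed

text \<open>In the time tau = mu^4 t the squared modulus of mode 1 and 12 Im X, up to sign, follow a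
  planar orbit with errors of order mu^2. Stability turns this into mu^2 + mu^2 tau, that is mu^2 +
  mu^6 t.\<close>

theorem modes_follow_orbit:
 assumes po: "planar_orbit gm kap dlt q0 q1 d1 Q Q'"
 and P: "!!x. planar_orbit.P gm kap Q x = PP (hh gm) x" and dP: "!!x. planar_orbit.dP gm kap Q Q' x = dPP (hh gm) x"
 defines "K \<equiv> planar_orbit.K gm kap Q"
 shows "\<exists>C mu1. 0 < mu1 & (\<forall>l mu S N v t. galerkin_dyn l mu S N v --> (\<forall>j. v 0 j = cpx (cc gm j)) --> mu <= mu1 --> t : {0..S} -->
 \<bar>(cmod (v t 1))\<^sup>2 - K (mu ^ 4 * t)\<bar> <= C * (mu\<^sup>2 + mu ^ 6 * t) &
 \<bar>(cmod (v t (-2)))\<^sup>2 - (7 + K (mu ^ 4 * t)) / 2\<bar> <= C * (mu\<^sup>2 + mu ^ 6 * t) &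
 \<bar>(cmod (v t (-1)))\<^sup>2 - (1 - K (mu ^ 4 * t))\<bar> <= C * (mu\<^sup>2 + mu ^ 6 * t) &
 \<bar>(cmod (v t 2))\<^sup>2 - (1 - K (mu ^ 4 * t)) / 2\<bar> <= C * (mu\<^sup>2 + mu ^ 6 * t))"
proof -
 interpret po: planar_orbit gm kap dlt q0 q1 d1 Q Q' by (rule po)
 obtain A1 where A1: "0 <= A1" "!!p. p : adm gm ==> \<bar>Yq (pI 1 p) (pI (-2) p) (pI (-1) p) (pI 2 p) (Re (pX p)) - PP (hh gm) (pI 1 p)\<bar> <= A1 * pd p"
 using close_Yq by (rule C.closeE) (auto simp: real_norm_def)
 obtain A2 where A2: "0 <= A2" "!!p. p : adm gm ==> \<bar>Yd (pI 1 p) (pI (-2) p) (pI (-1) p) (pI 2 p) (Re (pX p)) - dPP (hh gm) (pI 1 p) / 2\<bar> <= A2 * pd p"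
 using close_Yd by (rule C.closeE) (auto simp: real_norm_def)
 obtain A3 where A3: "0 <= A3" "!!p. p : adm gm ==> \<bar>pI0 1 p - (cc gm 1)\<^sup>2\<bar> <= A3 * pd p"
 using close_I0[of 1] by (rule C.closeE) (auto simp: real_norm_def)
 obtain A4 where A4: "0 <= A4" "!!p. p : adm gm ==> cmod (pX0 p - cpx ((cc gm 1)\<^sup>2 * cc gm (-2) * ((cc gm (-1))\<^sup>2 * cc gm 2))) <= A4 * pd p"
 using close_X0 by (rule C.closeE) auto
 obtain A5 where A5: "0 <= A5" "!!p. p : adm gm ==> \<bar>pI (-2) p - (7 + pI 1 p) / 2\<bar> <= A5 * pd p"
 using close_modes(1) by (rule C.closeE) (auto simp: real_norm_def)
 obtain A6 where A6: "0 <= A6" "!!p. p : adm gm ==> \<bar>pI (-1) p - (1 - pI 1 p)\<bar> <= A6 * pd p"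
 using close_modes(2) by (rule C.closeE) (auto simp: real_norm_def)
 obtain A7 where A7: "0 <= A7" "!!p. p : adm gm ==> \<bar>pI 2 p - (1 - pI 1 p) / 2\<bar> <= A7 * pd p"
 using close_modes(3) by (rule C.closeE) (auto simp: real_norm_def)
 define As where "As = A1 + A2 + A3 + 12 * A4 + 100000 * Ca"
 have As: "0 <= As" "A1 <= As" "A2 + 100000 * Ca <= As" "A3 <= As" "12 * A4 <= As" "8 * Ca <= As"
 using A1(1) A2(1) A3(1) A4(1) Ca_pos by (auto simp: As_def)
 \<comment> \<open>Keeps the perturbation below the threshold \<open>eps0\<close> of the stability
   theorem.\<close>
 define mu1 where "mu1 = min 1 (po.eps0 / (As + 1))"
 define Cs where "Cs = max 0 po.Cstab * As"
 have Cs: "0 <= Cs" using As by (simp add: Cs_def)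
 define CC where "CC = Cs + A5 + A6 + A7 + 7 * Cf"
 have CC: "Cs + 7 * Cf <= CC" "Cs + A5 + 7 * Cf <= CC" "Cs + A6 + 7 * Cf <= CC" "Cs + A7 + 7 * Cf <= CC"
 using A5(1) A6(1) A7(1) by (auto simp: CC_def)
 have "0 < mu1" using po.eps0(1) As(1) by (simp add: mu1_def)
 moreover have "\<bar>(cmod (v t 1))\<^sup>2 - K (mu ^ 4 * t)\<bar> <= CC * (mu\<^sup>2 + mu ^ 6 * t) &
 \<bar>(cmod (v t (-2)))\<^sup>2 - (7 + K (mu ^ 4 * t)) / 2\<bar> <= CC * (mu\<^sup>2 + mu ^ 6 * t) &
 \<bar>(cmod (v t (-1)))\<^sup>2 - (1 - K (mu ^ 4 * t))\<bar> <= CC * (mu\<^sup>2 + mu ^ 6 * t) &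
 \<bar>(cmod (v t 2))\<^sup>2 - (1 - K (mu ^ 4 * t)) / 2\<bar> <= CC * (mu\<^sup>2 + mu ^ 6 * t)"
 if D: "galerkin_dyn l mu S N v" and i: "\<forall>j. v 0 j = cpx (cc gm j)" and mu1: "mu <= mu1" and t: "t : {0..S}"
 for l mu S N v t
 proof -
 interpret D: galerkin_dyn l mu S N v by (rule D)
 have mem: "(l, mu, S, N, v, s) : adm gm" if "s : {0..S}" for s using D i that by (simp add: adm_def)
 define n where "n = mu ^ 4"
 have n: "0 < n" "n <= mu\<^sup>2" "mu ^ 8 = n * n" using D.mu D.mu_pow[of 2 4] by (auto simp: n_def simp flip: power_add)
 \<comment> \<open>The sign of the nonlinearity. It is absorbed into \<open>y\<close>; only its
   square enters the planar system, so \<open>K\<close> is the same for both signs.\<close>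
 define sg where "sg = l / n"
 have "l * l = n * n" using abs_mult_self_eq[of l] unfolding D.l n_def by simp
 then have sg: "l = sg * n" "sg * sg = 1" using n(1) by (simp_all add: sg_def)
 define e where "e = As * mu\<^sup>2"
 have e0: "0 <= e" using As by (simp add: e_def)
 have e1: "e <= po.eps0"
 proof -
 have "e <= (As + 1) * mu" unfolding e_def using D.mu_pow1[of 2] As D.mu by (intro mult_mono) auto
 also have "\<dots> <= (As + 1) * (po.eps0 / (As + 1))" using mu1 As unfolding mu1_def by (intro mult_left_mono) auto
 finally show ?thesis using As by simp
 qed
 have ts: "tau / n : {0..S}" if "tau : {0..n * S}" for tau using that n by (auto simp: divide_le_eq mult.commute)
 have ch: "((%tau. tau / n) hrd 1 / n) (at tau)" for tau using n by (auto intro!: derivative_eq_intros)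
 have sm: "c * mu ^ 8 / n <= c * mu\<^sup>2" if "0 <= c" for c using n that by (simp add: mult_left_mono)
 have "\<bar>D.Iw (n * t / n) 1 - po.K (n * t)\<bar> <= po.Cstab * (e + e * (n * t))"
 proof (rule po.stability[where S = "n * S" and x = "%tau. D.Iw (tau / n) 1" and y = "%tau. - 12 * sg * Im (D.XX (tau / n))"
 and x' = "%tau. (- 12 * l * Im (D.XX (tau / n)) + D.ee (tau / n) 1) * (1 / n)" and y' = "%tau. - 12 * sg * (Im (D.X' (tau / n)) * (1 / n))"])
 fix tau assume tau: "tau : {0..n * S}"
 note s = ts[OF tau]
 show "((%tau. D.Iw (tau / n) 1) hrd (- 12 * l * Im (D.XX (tau / n)) + D.ee (tau / n) 1) * (1 / n)) (at tau)"
 by (rule DERIV_chain2[OF D.pairs_deriv(3) ch])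
 have "((%s. Im (D.XX s)) hrd Im (D.X' (tau / n))) (at (tau / n))"
 using has_vector_derivative_Im[OF D.XX_deriv] by (simp add: has_real_derivative_iff_has_vector_derivative)
 from DERIV_cmult[OF DERIV_chain2[OF this ch]]
 show "((%tau. - 12 * sg * Im (D.XX (tau / n))) hrd - 12 * sg * (Im (D.X' (tau / n)) * (1 / n))) (at tau)" .
 have "(- 12 * l * Im (D.XX (tau / n)) + D.ee (tau / n) 1) * (1 / n) - - 12 * sg * Im (D.XX (tau / n)) = D.ee (tau / n) 1 / n"
 using n(1) unfolding sg(1) by (simp add: field_simps)
 moreover have "\<bar>D.ee (tau / n) 1 / n\<bar> <= 8 * Ca * mu ^ 8 / n"
 using D.ee_bound[OF s, of 1] n(1) by (simp add: A4_def abs_divide divide_right_mono)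
 ultimately show "\<bar>(- 12 * l * Im (D.XX (tau / n)) + D.ee (tau / n) 1) * (1 / n) - - 12 * sg * Im (D.XX (tau / n))\<bar> <= e"
 using sm[of "8 * Ca"] Ca_pos mult_right_mono[OF As(6), of "mu\<^sup>2"] unfolding e_def by simp
 have X': "- 12 * sg * (Im (D.X' (tau / n)) * (1 / n)) = 12 * (D.Om (tau / n) * Re (D.XX (tau / n)) + D.Rr (tau / n)) - 12 * sg * (Im (D.eX (tau / n)) / n)"
 proof -
 have X'_Im: "Im (D.X' (tau / n)) = - (sg * n) * (D.Om (tau / n) * Re (D.XX (tau / n)) + D.Rr (tau / n)) + Im (D.eX (tau / n))"
 unfolding D.X'_def sg(1)[symmetric] by (simp add: algebra_simps)
 have "- 12 * sg * (Im (D.X' (tau / n)) * (1 / n)) = 12 * (sg * sg) * (D.Om (tau / n) * Re (D.XX (tau / n)) + D.Rr (tau / n)) - 12 * sg * (Im (D.eX (tau / n)) / n)"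
 unfolding X'_Im using n(1) by (simp add: field_simps)
 then show ?thesis unfolding sg(2) by simp
 qed
 have "\<bar>sg\<bar> = 1" using sg(2) by (simp add: abs_square_eq_1 power2_eq_square[symmetric])
 then have "\<bar>12 * sg * (Im (D.eX (tau / n)) / n)\<bar> = 12 * (\<bar>Im (D.eX (tau / n))\<bar> / n)" using n(1) by (simp add: abs_mult)
 also have "\<dots> <= 12 * (6144 * (Ca * mu ^ 8) / n)"
 using D.eX_bound[OF s] abs_Im_le_cmod[of "D.eX (tau / n)"] n(1) by (intro mult_left_mono divide_right_mono) auto
 also have "\<dots> = (73728 * Ca) * mu ^ 8 / n" by simp
 also have "\<dots> <= (73728 * Ca) * mu\<^sup>2" using Ca_pos by (intro sm) auto
 also have "\<dots> <= 100000 * Ca * mu\<^sup>2" using Ca_pos by (intro mult_right_mono) auto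
 finally have "\<bar>12 * sg * (Im (D.eX (tau / n)) / n)\<bar> <= 100000 * Ca * mu\<^sup>2" .
 moreover have "\<bar>12 * (D.Om (tau / n) * Re (D.XX (tau / n)) + D.Rr (tau / n)) - dPP (hh gm) (D.Iw (tau / n) 1) / 2\<bar> <= A2 * mu\<^sup>2"
 using A2(2)[OF mem[OF s]] unfolding D.p_simps D.Om_Rr .
 moreover have "A2 * mu\<^sup>2 + 100000 * Ca * mu\<^sup>2 <= e" using mult_right_mono[OF As(3), of "mu\<^sup>2"] by (simp add: e_def algebra_simps)
 ultimately show "\<bar>- 12 * sg * (Im (D.X' (tau / n)) * (1 / n)) - po.dP (D.Iw (tau / n) 1) / 2\<bar> <= e"
 unfolding X' dP by linarith
 have "(- 12 * sg * Im (D.XX (tau / n)))\<^sup>2 = (sg * sg) * (144 * (Im (D.XX (tau / n)))\<^sup>2)" by (simp add: power2_eq_square)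
 then have y2: "(- 12 * sg * Im (D.XX (tau / n)))\<^sup>2 = Yq (D.Iw (tau / n) 1) (D.Iw (tau / n) (-2)) (D.Iw (tau / n) (-1)) (D.Iw (tau / n) 2) (Re (D.XX (tau / n)))"
 unfolding sg(2) D.Im_XX_sq by simp
 show "\<bar>(- 12 * sg * Im (D.XX (tau / n)))\<^sup>2 - po.P (D.Iw (tau / n) 1)\<bar> <= e"
 using A1(2)[OF mem[OF s]] mult_right_mono[OF As(2), of "mu\<^sup>2"] unfolding y2 P D.p_simps e_def by simp
 next
 show "continuous_on {0..n * S} (%tau. (- 12 * l * Im (D.XX (tau / n)) + D.ee (tau / n) 1) * (1 / n))"
 using n(1) by (intro continuous_intros continuous_on_compose2[OF D.fast_cont(1)[of UNIV]] continuous_on_compose2[OF D.fast_cont(2)[of UNIV]]) auto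
 show "continuous_on {0..n * S} (%tau. - 12 * sg * (Im (D.X' (tau / n)) * (1 / n)))"
 using n(1) by (intro continuous_intros continuous_on_compose2[OF D.fast_cont(3)[of UNIV]]) auto
 have 0: "0 : {0..S}" using D.S by auto
 show "\<bar>D.Iw (0 / n) 1 - gm\<bar> <= e"
 using A3(2)[OF mem[OF 0]] mult_right_mono[OF As(4), of "mu\<^sup>2"] unfolding D.p_simps cc_sq e_def by simp
 have "\<bar>Im (D.XX 0)\<bar> <= A4 * mu\<^sup>2"
 using A4(2)[OF mem[OF 0]] abs_Im_le_cmod[of "D.XX 0 - cpx ((cc gm 1)\<^sup>2 * cc gm (-2) * ((cc gm (-1))\<^sup>2 * cc gm 2))"]
 unfolding D.p_simps by (simp del: of_real_mult of_real_power)
 moreover have "\<bar>- 12 * sg * Im (D.XX (0 / n))\<bar> = 12 * \<bar>Im (D.XX 0)\<bar>"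
 using sg(2) by (simp add: abs_mult abs_square_eq_1 power2_eq_square[symmetric])
 ultimately show "\<bar>- 12 * sg * Im (D.XX (0 / n))\<bar> <= e"
 using mult_right_mono[OF As(5), of "mu\<^sup>2"] unfolding e_def by simp
 qed (use e0 e1 t n in auto)
 also have "\<dots> <= max 0 po.Cstab * (e + e * (n * t))" using e0 n t by (intro mult_right_mono) auto
 also have "\<dots> = Cs * (mu\<^sup>2 + mu ^ 6 * t)" by (simp add: Cs_def e_def n_def algebra_simps flip: power_add)
 finally have x: "\<bar>D.Iw t 1 - K (n * t)\<bar> <= Cs * (mu\<^sup>2 + mu ^ 6 * t)" using n(1) by (simp add: K_def)
 define q where "q = mu\<^sup>2 + mu ^ 6 * t"
 have q: "mu\<^sup>2 <= q" "0 <= q" using D.mu t by (auto simp: q_def)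
 have vw: "\<bar>(cmod (v t j))\<^sup>2 - D.Iw t j\<bar> <= 7 * Cf * q" for j
 proof -
 have "Cf * mu ^ 4 * wt j <= Cf * mu\<^sup>2 * 1" using wt_le_1 wt_nonneg Cf_pos D.mu n(2) by (intro mult_mono) (auto simp: n_def)
 then have "cmod (D.w t j - v t j) <= Cf * q" using D.wv_diff[OF t, of j] mult_left_mono[OF q(1), of Cf] Cf_pos by linarith
 moreover have "\<bar>cmod (v t j) - cmod (D.w t j)\<bar> <= cmod (D.w t j - v t j)" using norm_triangle_ineq3[of "v t j" "D.w t j"] by (simp add: norm_minus_commute)
 moreover have "\<bar>cmod (v t j) + cmod (D.w t j)\<bar> <= 7" using D.v_le[of t j] D.w_le[OF t, of j] by simp
 ultimately have "\<bar>cmod (v t j) - cmod (D.w t j)\<bar> * \<bar>cmod (v t j) + cmod (D.w t j)\<bar> <= Cf * q * 7" by (intro mult_mono) auto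
 moreover have "(cmod (v t j))\<^sup>2 - D.Iw t j = (cmod (v t j) - cmod (D.w t j)) * (cmod (v t j) + cmod (D.w t j))"
 by (simp add: D.Iw_def power2_eq_square algebra_simps)
 ultimately show ?thesis unfolding abs_mult[symmetric] by (simp add: mult_ac)
 qed
 have Aq: "A * mu\<^sup>2 <= A * q" if "0 <= A" for A using q that by (intro mult_left_mono) auto
 have fin: "X <= Cs * q + A * q + 7 * Cf * q ==> Cs + A + 7 * Cf <= CC ==> X <= CC * q" for X A
 using mult_right_mono[of "Cs + A + 7 * Cf" CC q] q by (simp add: algebra_simps)
 note m = A5(2)[OF mem[OF t], unfolded D.p_simps] A6(2)[OF mem[OF t], unfolded D.p_simps] A7(2)[OF mem[OF t], unfolded D.p_simps]
 have x': "\<bar>D.Iw t 1 - K (mu ^ 4 * t)\<bar> <= Cs * q" using x unfolding n_def q_def .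
 have b1: "\<bar>(cmod (v t 1))\<^sup>2 - K (mu ^ 4 * t)\<bar> <= Cs * q + 0 * q + 7 * Cf * q" using x' vw[of 1] by (simp add: abs_le_iff)
 have b2: "\<bar>(cmod (v t (-2)))\<^sup>2 - (7 + K (mu ^ 4 * t)) / 2\<bar> <= Cs * q + A5 * q + 7 * Cf * q"
 using x' vw[of "-2"] m(1) Aq[OF A5(1)] Cs q by (simp add: abs_le_iff field_simps)
 have b3: "\<bar>(cmod (v t (-1)))\<^sup>2 - (1 - K (mu ^ 4 * t))\<bar> <= Cs * q + A6 * q + 7 * Cf * q"
 using x' vw[of "-1"] m(2) Aq[OF A6(1)] by (simp add: abs_le_iff)
 have b4: "\<bar>(cmod (v t 2))\<^sup>2 - (1 - K (mu ^ 4 * t)) / 2\<bar> <= Cs * q + A7 * q + 7 * Cf * q"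
 using x' vw[of 2] m(3) Aq[OF A7(1)] Cs q by (simp add: abs_le_iff field_simps)
 have CC1: "Cs + 0 + 7 * Cf <= CC" using CC(1) by simp
 show ?thesis unfolding q_def[symmetric] by (intro conjI fin[OF b1 CC1] fin[OF b2 CC(2)] fin[OF b3 CC(3)] fin[OF b4 CC(4)])
 qed
 ultimately show ?thesis by blast
qed

end

section \<open>Fourier coefficients of the remainder\<close>

lemma exp_eq_cis: "exp (\<i> * of_int j * cpx x) = cis (rl j * x)"
 by (simp add: cis_conv_exp mult_ac)

lemma cis_affine_derivative:
 "((%t. cis (a + b * t)) hvd \<i> * cpx b * cis (a + b * t)) (at t)"
proof -
 have "((%z. exp (\<i> * (cpx a + cpx b * z))) has_field_derivative
 \<i> * cpx b * exp (\<i> * (cpx a + cpx b * cpx t))) (at (cpx t))"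
 by (auto intro!: derivative_eq_intros)
 from has_vector_derivative_real_field[OF this] show ?thesis by (simp add: cis_conv_exp)
qed

lemma integral_cis:
 fixes m :: int
 shows "((%x. cis (rl m * x)) has_integral (if m = 0 then 2 * pi else 0)) {0..2 * pi}"
proof (cases "m = 0")
 case True
 then show ?thesis using has_integral_const_real[of "1 :: complex" 0 "2 * pi"] by (simp add: scaleR_conv_of_real)
next
 case False
 have d: "((%x. cis (rl m * x) / (\<i> * of_int m)) hvd cis (rl m * x)) (at x within X)" for x X
 using has_vector_derivative_at_within[OF has_vector_derivative_mult_right[OF cis_affine_derivative[of 0 "rl m" x], of "1 / (\<i> * of_int m)"]] False
 by simp
 have "((%x. cis (rl m * x)) has_integral
 cis (rl m * (2 * pi)) / (\<i> * of_int m) - cis (rl m * 0) / (\<i> * of_int m)) {0..2 * pi}"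
 by (rule fundamental_theorem_of_calculus) (auto intro: d)
 moreover have "cis (rl m * (2 * pi)) = 1" using cis_multiple_2pi[of "rl m"] by (simp add: mult_ac)
 ultimately show ?thesis using False by simp
qed

text \<open>An exponential beats every power; the explicit constant comes from ln z <= z - 1 at a
  rescaled point. The exponent \<open>s + 1\<close> instead of \<open>s\<close> leaves a factor 1 /
  (1 + m^2) for the sum over frequencies.\<close>

lemma int_exp_decay_bound:
 fixes s b y :: real
 assumes b: "0 < b" and y: "0 <= y"
 shows "(1 + y\<^sup>2) powr (s + 1) * exp (- 2 * b * y) <= exp (2 * b - 2 * (\<bar>s + 1\<bar> + 1) - 2 * (\<bar>s + 1\<bar> + 1) * ln (b / (\<bar>s + 1\<bar> + 1)))"
proof -
 define p where "p = \<bar>s + 1\<bar> + 1"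
 define z where "z = 1 + y"
 have p: "1 <= p" "s + 1 <= p" by (auto simp: p_def)
 have z: "1 <= z" using y by (simp add: z_def)
 have "(1 + y\<^sup>2) powr (s + 1) <= (1 + y\<^sup>2) powr p" using p by (intro powr_mono) auto
 also have "\<dots> <= (z\<^sup>2) powr p" using p y by (intro powr_mono2) (auto simp: z_def power2_eq_square algebra_simps)
 also have "\<dots> = exp (2 * p * ln z)" using z by (simp add: powr_def ln_realpow)
 also have "\<dots> <= exp (2 * p * (b / p * z - 1 - ln (b / p)))"
 proof -
 have "ln (b / p * z) <= b / p * z - 1" using b p z by (intro ln_le_minus_one mult_pos_pos divide_pos_pos) auto
 moreover have "ln (b / p * z) = ln (b / p) + ln z" using b p z by (intro ln_mult_pos divide_pos_pos) auto
 ultimately have "ln z <= b / p * z - 1 - ln (b / p)" by linarith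
 then show ?thesis unfolding exp_le_cancel_iff using p by (intro mult_left_mono) auto
 qed
 also have "2 * p * (b / p * z - 1 - ln (b / p)) = 2 * b - 2 * p - 2 * p * ln (b / p) + 2 * b * y" using p by (simp add: z_def field_simps)
 finally have "(1 + y\<^sup>2) powr (s + 1) * exp (- 2 * b * y) <= exp (2 * b - 2 * p - 2 * p * ln (b / p) + 2 * b * y) * exp (- 2 * b * y)"
 by (intro mult_right_mono) auto
 also have "\<dots> = exp (2 * b - 2 * p - 2 * p * ln (b / p))" by (simp add: exp_add[symmetric])
 finally show ?thesis by (simp only: p_def)
qed

text \<open>Depends on the resonant set only through its centre and spacing: exponential decay in j
  at rate 1 becomes decay at rate 1 / |k| in the frequency m = c + k j, at the price of a constant
  factor.\<close>

definition Csob :: "real => int => int => real" where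
 "Csob s c k = sqrt (5 * ((exp (\<bar>rl c\<bar> / \<bar>rl k\<bar>))\<^sup>2 * exp (2 * (1 / \<bar>rl k\<bar>) - 2 * (\<bar>s + 1\<bar> + 1)
 - 2 * (\<bar>s + 1\<bar> + 1) * ln ((1 / \<bar>rl k\<bar>) / (\<bar>s + 1\<bar> + 1)))))"

lemma Csob_nonneg: "0 <= Csob s c k" by (simp add: Csob_def)

text \<open>\<open>f\<close> is known only as a uniform limit of trigonometric polynomials, which is
  enough to pass to the limit in each Fourier coefficient. Frequencies off the progression c + k j
  contribute nothing; on it the coefficient is \<open>d' j\<close>.\<close>

lemma sobolev_limit:
 fixes f :: "real => complex" and d :: "nat => int => complex" and c k :: int
 assumes k: "k ~= 0"
 and lim: "!!N x. N0 <= N ==> cmod ((\<Sum>j\<in>JN N. d N j * cis (rl (c + k * j) * x)) - f x) <= eps N" and eps: "eps \<longlonglongrightarrow> 0"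
 and dl: "!!j. (%N. d N j) \<longlonglongrightarrow> d' j" and b: "!!j. cmod (d' j) <= A * wt j" and A: "0 <= A"
 shows "f : sobolev_space s" "sobolev_norm s f <= A * Csob s c k"
proof -
 define P where "P N x = (\<Sum>j\<in>JN N. d N j * cis (rl (c + k * j) * x))" for N x
 have Pc: "continuous_on X (P N)" for N X unfolding P_def by (intro continuous_intros)
 have lim': "norm (P N x - f x) <= eps N" if "N0 <= N" for N x using lim[OF that] unfolding P_def .
 have "uniform_limit UNIV P f sequentially"
 proof (rule uniform_limitI)
 fix e :: real assume "0 < e"
 then have "\<forall>\<^sub>F N in sequentially. eps N < e" by (rule order_tendstoD(2)[OF eps])
 from eventually_conj[OF eventually_ge_at_top[of N0] this]
 show "\<forall>\<^sub>F N in sequentially. \<forall>x\<in>UNIV. dist (P N x) (f x) < e"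
 proof (rule eventually_mono)
 fix N assume h: "N0 <= N & eps N < e"
 show "\<forall>x\<in>UNIV. dist (P N x) (f x) < e"
 proof
 fix x show "dist (P N x) (f x) < e" unfolding dist_norm using lim'[of N x] h by linarith
 qed
 qed
 qed
 then have fc: "continuous_on UNIV f" by (rule uniform_limit_theorem[rotated]) (auto intro!: always_eventually Pc)
 have fcX: "continuous_on X f" for X using fc continuous_on_subset by blast
 have Pl: "(%N. P N x) \<longlonglongrightarrow> f x" for x
 proof -
 have "\<forall>\<^sub>F N in sequentially. norm (P N x - f x) <= eps N" using eventually_ge_at_top[of N0] by (rule eventually_mono) (rule lim')
 then have "(%N. P N x - f x) \<longlonglongrightarrow> 0" using eps by (rule Lim_null_comparison)
 then show ?thesis by (simp add: LIM_zero_iff)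
 qed
 have per: "circle_periodic f"
 unfolding circle_periodic_def
 proof
 fix x
 have h: "cis (rl m * (x + 2 * pi)) = cis (rl m * x)" for m :: int
 proof -
 have "cis (rl m * (x + 2 * pi)) = cis (rl m * x) * cis (2 * pi * rl m)" by (simp add: cis_mult algebra_simps)
 then show ?thesis by (simp add: cis_multiple_2pi)
 qed
 have "P N (x + 2 * pi) = P N x" for N unfolding P_def h ..
 then show "f (x + 2 * pi) = f x" using Pl[of "x + 2 * pi"] Pl[of x] LIMSEQ_unique by simp
 qed
 have int: "f absolutely_integrable_on {0..2 * pi}" by (rule absolutely_integrable_continuous_real[OF fcX])
 have fcP: "fourier_coeff (P N) m = (\<Sum>j\<in>JN N. if c + k * j = m then d N j else 0)" for N m
 proof -
 have t: "cis (rl (c + k * j) * x) * exp (- (\<i> * of_int m * cpx x)) = cis (rl (c + k * j - m) * x)" for j x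
 unfolding cis_conv_exp exp_add[symmetric] by (simp add: algebra_simps)
 have I: "((%x. \<Sum>j\<in>JN N. d N j * cis (rl (c + k * j - m) * x)) has_integral (\<Sum>j\<in>JN N. d N j * (if c + k * j - m = 0 then 2 * pi else 0))) {0..2 * pi}"
 by (intro has_integral_sum has_integral_mult_right integral_cis finite_JN)
 have g: "(%x. \<Sum>j\<in>JN N. d N j * cis (rl (c + k * j - m) * x)) = (%x. P N x * exp (- (\<i> * of_int m * cpx x)))"
 proof
 fix x show "(\<Sum>j\<in>JN N. d N j * cis (rl (c + k * j - m) * x)) = P N x * exp (- (\<i> * of_int m * cpx x))"
 unfolding P_def sum_distrib_right by (rule sum.cong) (simp_all only: t[symmetric] mult.assoc)
 qed
 have "integral {0..2 * pi} (%x. P N x * exp (- (\<i> * of_int m * cpx x))) = (\<Sum>j\<in>JN N. d N j * (if c + k * j - m = 0 then 2 * pi else 0))"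
 by (rule integral_unique) (use I in \<open>simp only: g\<close>)
 also have "\<dots> = 2 * pi * (\<Sum>j\<in>JN N. if c + k * j = m then d N j else 0)" unfolding sum_distrib_left by (rule sum.cong) auto
 finally show ?thesis by (simp add: fourier_coeff_def)
 qed
 have conv: "(%N. fourier_coeff (P N) m) \<longlonglongrightarrow> fourier_coeff f m" for m
 proof -
 have nb: "norm (fourier_coeff (P N) m - fourier_coeff f m) <= eps N" if N: "N0 <= N" for N
 proof -
 let ?e = "%x. exp (- (\<i> * of_int m * cpx x))"
 have ec: "continuous_on {0..2 * pi} ?e" by (intro continuous_intros)
 have "integral {0..2 * pi} (%x. P N x * ?e x) - integral {0..2 * pi} (%x. f x * ?e x) = integral {0..2 * pi} (%x. P N x * ?e x - f x * ?e x)"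
 by (rule integral_diff[symmetric]) (intro integrable_continuous_real continuous_intros Pc fcX)+
 moreover have "norm (integral {0..2 * pi} (%x. P N x * ?e x - f x * ?e x)) <= eps N * (2 * pi - 0)"
 proof (rule integral_bound)
 show "continuous_on {0..2 * pi} (%x. P N x * ?e x - f x * ?e x)" by (intro continuous_intros Pc fcX)
 fix x
 have "norm (P N x * ?e x - f x * ?e x) = norm (P N x - f x) * norm (?e x)" by (simp only: norm_mult[symmetric] left_diff_distrib)
 also have "norm (?e x) = 1"
 proof -
 have "?e x = cis (- (rl m * x))" by (simp add: cis_conv_exp mult_ac)
 then show ?thesis by simp
 qed
 finally show "norm (P N x * ?e x - f x * ?e x) <= eps N" using lim[OF N] by (simp add: P_def)
 qed auto
 ultimately have "norm (integral {0..2 * pi} (%x. P N x * ?e x) - integral {0..2 * pi} (%x. f x * ?e x)) <= eps N * (2 * pi)" by simp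
 moreover have "fourier_coeff (P N) m - fourier_coeff f m = cpx (1 / (2 * pi)) * (integral {0..2 * pi} (%x. P N x * ?e x) - integral {0..2 * pi} (%x. f x * ?e x))"
 by (simp add: fourier_coeff_def right_diff_distrib)
 moreover have "norm (cpx (1 / (2 * pi)) * w) <= eps N" if "norm w <= eps N * (2 * pi)" for w
 using that by (simp add: norm_mult norm_divide field_simps)
 ultimately show ?thesis by simp
 qed
 have "\<forall>\<^sub>F N in sequentially. norm (fourier_coeff (P N) m - fourier_coeff f m) <= eps N"
 using eventually_ge_at_top[of N0] by (rule eventually_mono) (rule nb)
 then have "(%N. fourier_coeff (P N) m - fourier_coeff f m) \<longlonglongrightarrow> 0" using eps by (rule Lim_null_comparison)
 then show ?thesis by (simp add: LIM_zero_iff)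
 qed
 define E where "E = exp (\<bar>rl c\<bar> / \<bar>rl k\<bar>)"
 define bet where "bet = 1 / \<bar>rl k\<bar>"
 have bet: "0 < bet" using k by (simp add: bet_def)
 have fb: "cmod (fourier_coeff f m) <= A * E * exp (- bet * \<bar>rl m\<bar>)" for m
 proof (cases "\<exists>j. c + k * j = m")
 case True
 then obtain j where j: "c + k * j = m" by blast
 have "\<forall>\<^sub>F N in sequentially. fourier_coeff (P N) m = d N j"
 using eventually_ge_at_top[of "nat \<bar>j\<bar>"]
 proof eventually_elim
 case (elim N)
 have "(\<Sum>i\<in>JN N. if c + k * i = m then d N i else 0) = (\<Sum>i\<in>JN N. if i = j then d N j else 0)"
 using j k by (intro sum.cong) auto
 also have "\<dots> = d N j"
 proof -
 have "j : JN N" using elim by (simp add: JN_def nat_le_iff abs_le_iff)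
 then show ?thesis by simp
 qed
 finally show ?case unfolding fcP .
 qed
 then have "(%N. d N j) \<longlonglongrightarrow> fourier_coeff f m" using conv[of m] by (rule Lim_transform_eventually[rotated])
 then have "fourier_coeff f m = d' j" using dl LIMSEQ_unique by blast
 then have "cmod (fourier_coeff f m) <= A * wt j" using b by simp
 moreover have "wt j <= exp (- \<bar>rl j\<bar>)" unfolding wt_def by (simp add: divide_le_eq mult_le_cancel_left1 add_pos_nonneg)
 moreover have "exp (- \<bar>rl j\<bar>) <= E * exp (- bet * \<bar>rl m\<bar>)"
 proof -
 have "\<bar>rl m\<bar> <= \<bar>rl c\<bar> + \<bar>rl k\<bar> * \<bar>rl j\<bar>"
 unfolding j[symmetric] by (simp add: abs_mult[symmetric])
 then have "bet * \<bar>rl m\<bar> <= bet * (\<bar>rl c\<bar> + \<bar>rl k\<bar> * \<bar>rl j\<bar>)" using bet by (intro mult_left_mono) auto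
 also have "\<dots> = \<bar>rl c\<bar> / \<bar>rl k\<bar> + \<bar>rl j\<bar>" using k by (simp add: bet_def field_simps)
 finally show ?thesis unfolding E_def exp_add[symmetric] by simp
 qed
 ultimately have "wt j <= E * exp (- bet * \<bar>rl m\<bar>)" by linarith
 from mult_left_mono[OF this A] show ?thesis using \<open>cmod (fourier_coeff f m) <= A * wt j\<close> by (simp only: mult.assoc)
 next
 case False
 then have "fourier_coeff (P N) m = 0" for N unfolding fcP by (intro sum.neutral) auto
 then have "fourier_coeff f m = 0" using conv[of m] by (simp add: LIMSEQ_const_iff)
 then show ?thesis using A by (simp add: E_def)
 qed
 define Q where "Q = exp (2 * bet - 2 * (\<bar>s + 1\<bar> + 1) - 2 * (\<bar>s + 1\<bar> + 1) * ln (bet / (\<bar>s + 1\<bar> + 1)))"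
 define T where "T m = (1 + (rl m)\<^sup>2) powr s * (cmod (fourier_coeff f m))\<^sup>2" for m
 have T0: "0 <= T m" for m by (simp add: T_def)
 have Tb: "T m <= A\<^sup>2 * (E\<^sup>2 * Q) * (1 / (1 + (rl m)\<^sup>2))" for m
 proof -
 define y where "y = \<bar>rl m\<bar>"
 define r where "r = 1 + (rl m)\<^sup>2"
 have r: "1 <= r" by (simp add: r_def)
 have "T m <= r powr s * (A * E * exp (- bet * y))\<^sup>2"
 unfolding T_def y_def r_def by (intro mult_left_mono power_mono fb) auto
 also have "\<dots> = A\<^sup>2 * E\<^sup>2 * (r powr (s + 1) * exp (- 2 * bet * y)) * (1 / r)"
 proof -
 have e: "r powr (s + 1) = r powr s * r" using r by (simp add: powr_add)
 have "- 2 * bet * y = - bet * y + - bet * y" by simp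
 then have x: "exp (- 2 * bet * y) = exp (- bet * y) * exp (- bet * y)" by (simp only: exp_add)
 show ?thesis unfolding e x using r by (simp add: power2_eq_square)
 qed
 also have "\<dots> <= A\<^sup>2 * E\<^sup>2 * Q * (1 / r)"
 using int_exp_decay_bound[OF bet, of y s] r unfolding Q_def by (intro mult_right_mono mult_left_mono) (auto simp: y_def r_def)
 finally show ?thesis by (simp add: r_def mult.assoc)
 qed
 have Ts: "sum T F <= A\<^sup>2 * (E\<^sup>2 * Q) * 5" if "finite F" for F
 proof -
 have "sum T F <= (\<Sum>m\<in>F. A\<^sup>2 * (E\<^sup>2 * Q) * (1 / (1 + (rl m)\<^sup>2)))" by (intro sum_mono Tb)
 also have "\<dots> <= A\<^sup>2 * (E\<^sup>2 * Q) * 5" unfolding sum_distrib_left[symmetric]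
 using sum_inverse_one_plus_sq_le[OF that] by (intro mult_left_mono) (auto simp: Q_def)
 finally show ?thesis .
 qed
 have sm: "T summable_on UNIV"
 using T0 by (intro nonneg_bdd_above_summable_on bdd_aboveI2[where M = "A\<^sup>2 * (E\<^sup>2 * Q) * 5"] Ts) auto
 show "f : sobolev_space s" unfolding sobolev_space_def using per int sm by (simp add: T_def[abs_def])
 have "infsum T UNIV <= A\<^sup>2 * (E\<^sup>2 * Q) * 5" using sm by (rule infsum_le_finite_sums) (use Ts in auto)
 then have "sqrt (infsum T UNIV) <= sqrt (A\<^sup>2 * (5 * (E\<^sup>2 * Q)))" by (simp add: mult_ac)
 also have "\<dots> = A * Csob s c k" using A by (simp add: real_sqrt_mult Csob_def E_def Q_def bet_def)
 finally show "sobolev_norm s f <= A * Csob s c k" by (simp add: sobolev_norm_def T_def[abs_def])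
qed

lemma sobolev_zero: "(%x. 0) : sobolev_space s" "sobolev_norm s (%x. 0) = 0"
 by (simp_all add: sobolev_space_def sobolev_norm_def circle_periodic_def fourier_coeff_def)

section \<open>Galilean boosts and the main theorem\<close>

text \<open>A boost moves the space argument in time, so the chain rule needs joint
  differentiability. Partial derivatives of which one is jointly continuous suffice for it.\<close>

lemma joint_derivative:
 fixes U Ux Ut :: "real => real => complex"
 assumes dt: "!!t x. ((%r. U r x) hvd Ut t x) (at t)" and dx: "!!t x. (U t hvd Ux t x) (at x)"
 and c: "continuous_on UNIV (%(t, x). Ux t x)"
 shows "((%(t, x). U t x) has_derivative (%(a, b). a *\<^sub>R Ut t x + b *\<^sub>R Ux t x)) (at (t, x))"
proof -
 have "continuous (at (t, x)) (%(t, x). Ux t x)" using c by (simp add: continuous_on_eq_continuous_at)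
 then have "continuous (at (t, x)) (%z. blinfun_scaleR_left ((%(t, x). Ux t x) z))"
 by (rule bounded_linear.continuous[OF bounded_linear_blinfun_scaleR_left])
 then have "continuous (at (t, x) within UNIV \<times> UNIV) (%(t, x). blinfun_scaleR_left (Ux t x))" by (simp add: case_prod_unfold)
 then have "((%(t, x). U t x) has_derivative (%(a, b). a *\<^sub>R Ut t x + blinfun_apply (blinfun_scaleR_left (Ux t x)) b)) (at (t, x) within UNIV \<times> UNIV)"
 using dt[of x t] dx
 by (intro has_derivative_partialsI[where f = U and fx = "%a. a *\<^sub>R Ut t x" and fy = "%t x. blinfun_scaleR_left (Ux t x)" and x = t and y = x and X = UNIV and Y = UNIV])
 (auto simp: has_vector_derivative_def)
 then show ?thesis by simp
qed

text \<open>The boost by \<open>c\<close> shifts frequencies and the scaling by \<open>k\<close>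
  stretches them, so mode j becomes c + k j. Time scales by k^2, which accounts for the relation
  between the couplings.\<close>

lemma galilei:
 fixes U :: "real => real => complex" and c k :: int
 assumes per: "!!t x. U t (x + 2 * pi) = U t x"
 and sol: "\<exists>ut ux uxx :: real => real => complex.
 continuous_on UNIV (%(t, x). ut t x) & continuous_on UNIV (%(t, x). ux t x) & continuous_on UNIV (%(t, x). uxx t x) &
 (\<forall>t x. ((%r. U r x) hvd ut t x) (at t) &
 (U t hvd ux t x) (at x) & (ux t hvd uxx t x) (at x) &
 \<i> * ut t x + uxx t x = cpx (l * cmod (U t x) ^ 4) * U t x)"
 and l: "(rl k)\<^sup>2 * l = \<sigma> * \<nu>"
 shows "quintic_NLS_solution \<sigma> \<nu> (%t x. cis (rl c * x - (rl c)\<^sup>2 * t) * U ((rl k)\<^sup>2 * t) (rl k * (x - 2 * rl c * t)))"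
proof -
 define C where "C = rl c"
 define k' where "k' = rl k"
 from sol obtain Ut Ux Uxx where cont: "continuous_on UNIV (%(t, x). Ut t x)" "continuous_on UNIV (%(t, x). Ux t x)" "continuous_on UNIV (%(t, x). Uxx t x)"
 and dt: "!!t x. ((%r. U r x) hvd Ut t x) (at t)" and dx: "!!t x. (U t hvd Ux t x) (at x)"
 and dxx: "!!t x. (Ux t hvd Uxx t x) (at x)"
 and eq: "!!t x. \<i> * Ut t x + Uxx t x = cpx (l * cmod (U t x) ^ 4) * U t x" by blast
 note J = joint_derivative[OF dt dx cont(2)]
 have cU: "continuous_on UNIV (%(t, x). U t x)"
 using has_derivative_continuous[OF J] by (auto intro!: continuous_at_imp_continuous_on)
 define ph where "ph t x = cis (C * x - C\<^sup>2 * t)" for t x :: real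
 define X where "X t x = k' * (x - 2 * C * t)" for t x :: real
 define u where "u t x = ph t x * U (k'\<^sup>2 * t) (X t x)" for t x
 define ut where "ut t x = - \<i> * C\<^sup>2 * ph t x * U (k'\<^sup>2 * t) (X t x) + ph t x * (k'\<^sup>2 *\<^sub>R Ut (k'\<^sup>2 * t) (X t x) + (- 2 * C * k') *\<^sub>R Ux (k'\<^sup>2 * t) (X t x))" for t x
 define ux where "ux t x = \<i> * C * ph t x * U (k'\<^sup>2 * t) (X t x) + ph t x * (k' *\<^sub>R Ux (k'\<^sup>2 * t) (X t x))" for t x
 define uxx where "uxx t x = \<i> * C * (\<i> * C * ph t x * U (k'\<^sup>2 * t) (X t x) + ph t x * (k' *\<^sub>R Ux (k'\<^sup>2 * t) (X t x)))
 + (\<i> * C * ph t x * (k' *\<^sub>R Ux (k'\<^sup>2 * t) (X t x)) + ph t x * (k' *\<^sub>R (k' *\<^sub>R Uxx (k'\<^sup>2 * t) (X t x))))" for t x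
 have cc: "continuous_on UNIV (%z. F (k'\<^sup>2 * fst z) (X (fst z) (snd z)))" if "continuous_on UNIV (%(t, x). F t x)" for F :: "real => real => complex"
 proof -
 have "continuous_on UNIV (%z. (k'\<^sup>2 * fst z, X (fst z) (snd z)))" unfolding X_def by (intro continuous_intros)
 from continuous_on_compose2[OF that this] show ?thesis by simp
 qed
 have cp: "continuous_on UNIV (%z. ph (fst z) (snd z))" unfolding ph_def by (intro continuous_intros)
 have c3: "continuous_on UNIV (%(t, x). ut t x)" "continuous_on UNIV (%(t, x). ux t x)" "continuous_on UNIV (%(t, x). uxx t x)"
 unfolding ut_def ux_def uxx_def case_prod_unfold by (intro continuous_intros cp cc cU cont)+
 have dA: "((%r. u r x) hvd ut t x) (at t)" for t x
 proof -
 have "((%s. (k'\<^sup>2 * s, X s x)) has_derivative (%h. (k'\<^sup>2 * h, - 2 * C * k' * h))) (at t)"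
 unfolding X_def by (auto intro!: derivative_eq_intros simp: algebra_simps)
 from has_derivative_compose[OF this J]
 have 1: "((%s. U (k'\<^sup>2 * s) (X s x)) hvd (k'\<^sup>2 *\<^sub>R Ut (k'\<^sup>2 * t) (X t x) + (- 2 * C * k') *\<^sub>R Ux (k'\<^sup>2 * t) (X t x))) (at t)"
 unfolding has_vector_derivative_def by (simp add: scaleR_add_right scaleR_right_diff_distrib mult_ac)
 have 2: "((%s. ph s x) hvd - \<i> * C\<^sup>2 * ph t x) (at t)"
 using cis_affine_derivative[of "C * x" "- (C\<^sup>2)" t] by (simp add: ph_def)
 show ?thesis unfolding u_def ut_def by (rule has_vector_derivative_eq_rhs[OF has_vector_derivative_mult[OF 2 1]]) simp
 qed
 have dc: "((%y. F (k'\<^sup>2 * t) (X t y)) hvd k' *\<^sub>R F' (k'\<^sup>2 * t) (X t x)) (at x)"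
 if "!!t x. (F t hvd F' t x) (at x)" for F F' :: "real => real => complex" and t x
 proof -
 have "((%y. X t y) hvd k') (at x)" unfolding X_def
 by (auto intro!: derivative_eq_intros simp flip: has_real_derivative_iff_has_vector_derivative)
 from vector_diff_chain_at[OF this that] show ?thesis by (simp add: o_def)
 qed
 have dp: "((%y. ph t y) hvd \<i> * C * ph t x) (at x)" for t x
 using cis_affine_derivative[of "- (C\<^sup>2 * t)" C x] by (simp add: ph_def algebra_simps)
 have dB: "(u t hvd ux t x) (at x)" for t x
 unfolding u_def ux_def by (rule has_vector_derivative_eq_rhs[OF has_vector_derivative_mult[OF dp dc[OF dx]]]) simp
 have dC: "(ux t hvd uxx t x) (at x)" for t x
 proof -
 have a: "((%y. ph t y * U (k'\<^sup>2 * t) (X t y)) hvd \<i> * C * ph t x * U (k'\<^sup>2 * t) (X t x) + ph t x * (k' *\<^sub>R Ux (k'\<^sup>2 * t) (X t x))) (at x)"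
 by (rule has_vector_derivative_eq_rhs[OF has_vector_derivative_mult[OF dp dc[OF dx]]]) simp
 have b: "((%y. ph t y * (k' *\<^sub>R Ux (k'\<^sup>2 * t) (X t y))) hvd \<i> * C * ph t x * (k' *\<^sub>R Ux (k'\<^sup>2 * t) (X t x)) + ph t x * (k' *\<^sub>R (k' *\<^sub>R Uxx (k'\<^sup>2 * t) (X t x)))) (at x)"
 by (rule has_vector_derivative_eq_rhs[OF has_vector_derivative_mult[OF dp bounded_linear.has_vector_derivative[OF bounded_linear_scaleR_right dc[OF dxx]]]]) simp
 have "((%y. \<i> * C * (ph t y * U (k'\<^sup>2 * t) (X t y)) + ph t y * (k' *\<^sub>R Ux (k'\<^sup>2 * t) (X t y))) hvd uxx t x) (at x)"
 unfolding uxx_def by (intro has_vector_derivative_add has_vector_derivative_mult_right a b)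
 then show ?thesis by (simp only: ux_def[abs_def] mult.assoc)
 qed
 have eqn: "\<i> * ut t x + uxx t x = cpx (\<sigma> * \<nu> * cmod (u t x) ^ 4) * u t x" for t x
 proof -
 have "\<i> * ut t x + uxx t x = k'\<^sup>2 * ph t x * (\<i> * Ut (k'\<^sup>2 * t) (X t x) + Uxx (k'\<^sup>2 * t) (X t x))"
 by (simp add: ut_def uxx_def scaleR_conv_of_real algebra_simps power2_eq_square)
 also have "\<dots> = k'\<^sup>2 * ph t x * (cpx (l * cmod (U (k'\<^sup>2 * t) (X t x)) ^ 4) * U (k'\<^sup>2 * t) (X t x))" unfolding eq ..
 also have "cmod (U (k'\<^sup>2 * t) (X t x)) = cmod (u t x)" by (simp add: u_def ph_def norm_mult)
 also have "k'\<^sup>2 * ph t x * (cpx (l * cmod (u t x) ^ 4) * U (k'\<^sup>2 * t) (X t x)) = cpx (k'\<^sup>2 * l) * cpx (cmod (u t x) ^ 4) * u t x"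
 unfolding u_def by simp
 also have "k'\<^sup>2 * l = \<sigma> * \<nu>" using l by (simp add: k'_def)
 finally show ?thesis by simp
 qed
 have pe: "circle_periodic (u t)" for t
 unfolding circle_periodic_def
 proof
 fix x
 have perN: "U s (y + 2 * pi * real n) = U s y" for s y and n :: nat
 proof (induction n)
 case (Suc n)
 have "U s (y + 2 * pi * real (Suc n)) = U s ((y + 2 * pi * real n) + 2 * pi)" by (simp add: algebra_simps)
 then show ?case using per Suc by simp
 qed simp
 have perZ: "U s (y + 2 * pi * rl m) = U s y" for s y and m :: int
 proof (cases "0 <= m")
 case True then show ?thesis using perN[of s y "nat m"] by simp
 next
 case False then show ?thesis using perN[of s "y + 2 * pi * rl m" "nat (- m)"] by simp
 qed
 have "ph t (x + 2 * pi) = ph t x * cis (2 * pi * C)" by (simp add: ph_def cis_mult algebra_simps)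
 moreover have "cis (2 * pi * C) = 1" by (simp add: C_def)
 moreover have "X t (x + 2 * pi) = X t x + 2 * pi * rl k" by (simp add: X_def k'_def algebra_simps)
 ultimately show "u t (x + 2 * pi) = u t x" by (simp add: u_def perZ)
 qed
 have "quintic_NLS_solution \<sigma> \<nu> u"
 unfolding quintic_NLS_solution_def
 by (rule conjI, rule allI, rule pe, rule exI[of _ ut], rule exI[of _ ux], rule exI[of _ uxx]) (intro conjI allI c3 dA dB dC eqn)
 then show ?thesis by (simp add: u_def[abs_def] ph_def X_def C_def k'_def)
qed

section \<open>Assembling the solution\<close>

definition kj :: "int => real => real" where
 "kj j kap = (if j = 1 then kap else if j = -2 then (7 + kap) / 2 else if j = -1 then 1 - kap else (1 - kap) / 2)"

text \<open>Lets a mode be given a prescribed modulus while its phase is kept; the value 1 at 0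
  makes it unimodular in all cases.\<close>

definition phase_of :: "complex => complex" where "phase_of z = (if z = 0 then 1 else z / cpx (cmod z))"

lemma phase_of_norm [simp]: "cmod (phase_of z) = 1" by (simp add: phase_of_def norm_divide)

lemma phase_of_diff: "cmod (z - cpx r * phase_of z) = \<bar>cmod z - r\<bar>"
proof -
 have "z = cpx (cmod z) * phase_of z" by (simp add: phase_of_def)
 then have "z - cpx r * phase_of z = cpx (cmod z - r) * phase_of z" by (metis left_diff_distrib of_real_diff)
 then show ?thesis by (simp add: norm_mult del: of_real_diff)
qed

text \<open>The lower bound \<open>g\<close> on the target keeps it away from the singularity of the
  square root at 0.\<close>

lemma sqrt_diff_le:
 assumes g: "0 < g" "g <= K" and a: "0 <= a" and e: "\<bar>a\<^sup>2 - K\<bar> <= e"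
 shows "\<bar>a - sqrt K\<bar> <= e / sqrt g"
proof -
 have "\<bar>a - sqrt K\<bar> * sqrt g <= \<bar>a - sqrt K\<bar> * (a + sqrt K)" using g a by (intro mult_left_mono) (auto intro: add_increasing)
 also have "\<dots> = \<bar>(a - sqrt K) * (a + sqrt K)\<bar>" using g a by (simp add: abs_mult)
 also have "(a - sqrt K) * (a + sqrt K) = a\<^sup>2 - K" using g by (simp add: algebra_simps power2_eq_square)
 finally show ?thesis using e g by (simp add: le_divide_eq)
qed

text \<open>The bootstrap holds for every truncation on the full interval up to mu^-6 with the same
  constants, so both kinds of bounds pass to the limit mode by mode, while the Galerkin sums
  converge uniformly in space.\<close>

lemma run_exists:
 fixes K :: "real => real"
 assumes gm: "0 < gm" "gm < 1 / 10"
 and modes: "!!l mu S N v t j. galerkin_dyn l mu S N v ==> (\<forall>j. v 0 j = cpx (cc gm j)) ==> mu <= mum ==> t : {0..S} ==> j : A4 ==>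
 \<bar>(cmod (v t j))\<^sup>2 - kj j (K (mu ^ 4 * t))\<bar> <= C * (mu\<^sup>2 + mu ^ 6 * t)"
 and mu: "0 < mu" "Csm * mu <= 1" "mu <= mum" "mu ^ 4 <= 1 / 100000" and l: "\<bar>l\<bar> = mu ^ 4"
 obtains U V vl eps where "!!t x. U t (x + 2 * pi) = U t x"
 and "\<exists>ut ux uxx :: real => real => complex.
 continuous_on UNIV (%(t, x). ut t x) & continuous_on UNIV (%(t, x). ux t x) & continuous_on UNIV (%(t, x). uxx t x) &
 (\<forall>t x. ((%r. U r x) hvd ut t x) (at t) &
 (U t hvd ux t x) (at x) & (ux t hvd uxx t x) (at x) &
 \<i> * ut t x + uxx t x = cpx (l * cmod (U t x) ^ 4) * U t x)"
 and "!!N t x. 2 <= N ==> cmod ((\<Sum>j\<in>JN N. V N t j * cis (rl j * x - (rl j)\<^sup>2 * t)) - U t x) <= eps t N"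
 and "!!t. eps t \<longlonglongrightarrow> 0" and "!!t j. (%N. V N t j) \<longlonglongrightarrow> vl t j"
 and "!!t j. 0 <= t ==> t * mu ^ 6 <= 1 ==> j \<notin> A4 ==> cmod (vl t j) <= eta * mu * wt j"
 and "!!t j. 0 <= t ==> t * mu ^ 6 <= 1 ==> j : A4 ==> \<bar>(cmod (vl t j))\<^sup>2 - kj j (K (mu ^ 4 * t))\<bar> <= C * (mu\<^sup>2 + mu ^ 6 * t)"
proof -
 define c where "c j = cpx (cc gm j)" for j
 have "\<exists>v. galerkin l (JN N) v & (\<forall>j\<in>JN N. v 0 j = c j)" for N by (rule galerkin_exists[OF finite_JN])
 then obtain V where V: "!!N. galerkin l (JN N) (V N)" "!!N j. j : JN N ==> V N 0 j = c j" by metis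
 have c0: "c j = 0" if "j \<notin> A4" for j using that by (auto simp: c_def cc_def A4_def)
 have s4: "(\<Sum>j\<in>JN 2. f j) = f (-2) + f (-1) + f 1 + f 2" if "!!j. j \<notin> A4 ==> f j = 0" for f :: "int => real"
 proof -
 have "sum f (JN 2) = sum f A4" using that by (intro sum.mono_neutral_right) (auto simp: A4_def JN_def)
 then show ?thesis by (simp only: sum_A4)
 qed
 have csq: "(cmod (c j))\<^sup>2 = (cc gm j)\<^sup>2" for j by (simp add: c_def)
 have mass: "(\<Sum>j\<in>JN 2. (cmod (c j))\<^sup>2) = 5" by (subst s4) (use c0 in \<open>auto simp: csq cc_sq[OF gm] field_simps\<close>)
 have kin: "(\<Sum>j\<in>JN 2. (rl j)\<^sup>2 * (cmod (c j))\<^sup>2) = 17" by (subst s4) (use c0 in \<open>auto simp: csq cc_sq[OF gm] field_simps\<close>)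
 have supp: "c j = 0" if "2 < \<bar>j\<bar>" for j using that by (intro c0) (auto simp: A4_def)
 interpret G: galerkin_family l c V
 by unfold_locales (use l mu(4) mass kin V supp in auto)
 have "convergent (%N. V N t j)" for t j
 proof -
 have "Cauchy (%N. V N t j)"
 proof (rule metric_CauchyI)
 fix e :: real assume "0 < e"
 then have "\<forall>\<^sub>F N in sequentially. G.Eb \<bar>t\<bar> N < e / 2" by (intro order_tendstoD(2)[OF G.Eb_lim]) auto
 with eventually_ge_at_top[of 2] have "\<forall>\<^sub>F N in sequentially. 2 <= N & G.Eb \<bar>t\<bar> N < e / 2" by eventually_elim auto
 then obtain M where M: "2 <= M" "G.Eb \<bar>t\<bar> M < e / 2" by (auto simp: eventually_sequentially)
 have d: "cmod (V n t j - V M t j) < e / 2" if "M <= n" for n using G.diff_V[OF M(1) that, of t "\<bar>t\<bar>" j] M(2) by simp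
 show "\<exists>M. \<forall>m\<ge>M. \<forall>n\<ge>M. dist (V m t j) (V n t j) < e"
 proof (intro exI[of _ M] allI impI)
 fix m n assume "M <= m" "M <= n"
 then show "dist (V m t j) (V n t j) < e"
 using dist_triangle_half_l[of "V m t j" "V M t j" e "V n t j"] d[of m] d[of n] by (simp add: dist_norm)
 qed
 qed
 then show ?thesis by (simp add: Cauchy_convergent_iff)
 qed
 then obtain vl where vl: "!!t j. (%N. V N t j) \<longlonglongrightarrow> vl t j" unfolding convergent_def by metis
 have V0: "V N 0 j = c j" if "2 <= N" for N j using G.init'[OF that] .
 have dyn: "galerkin_dyn l mu (1 / mu ^ 6) N (V N)" if N: "2 <= N" for N
 proof (rule galerkin_bootstrap[OF V(1) N mu(1,2) l])
 have "(\<Sum>j\<in>JN N. (cmod (V N 0 j))\<^sup>2) = (\<Sum>j\<in>JN 2. (cmod (c j))\<^sup>2)"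
 unfolding V0[OF N] by (rule G.sum_init[OF N]) simp
 then show "(\<Sum>j\<in>JN N. (cmod (V N 0 j))\<^sup>2) <= 5" using mass by simp
 show "V N 0 j = 0" if "j \<notin> A4" for j using V0[OF N] c0[OF that] by simp
 qed (use mu in auto)
 have tS: "t : {0..1 / mu ^ 6}" if "0 <= t" "t * mu ^ 6 <= 1" for t using that mu(1) by (simp add: le_divide_eq)
 show ?thesis
 proof (rule that[of G.u V "%t. G.Gb \<bar>t\<bar>" vl])
 show "G.u t (x + 2 * pi) = G.u t x" for t x by (rule G.u_periodic)
 show "\<exists>ut ux uxx :: real => real => complex.
 continuous_on UNIV (%(t, x). ut t x) & continuous_on UNIV (%(t, x). ux t x) & continuous_on UNIV (%(t, x). uxx t x) &
 (\<forall>t x. ((%r. G.u r x) hvd ut t x) (at t) &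
 (G.u t hvd ux t x) (at x) & (ux t hvd uxx t x) (at x) &
 \<i> * ut t x + uxx t x = cpx (l * cmod (G.u t x) ^ 4) * G.u t x)" by (rule G.solution)
 show "cmod ((\<Sum>j\<in>JN N. V N t j * cis (rl j * x - (rl j)\<^sup>2 * t)) - G.u t x) <= G.Gb \<bar>t\<bar> N" if "2 <= N" for N t x
 using G.u_uniform[OF that, of t x] by (simp add: G.ph_def)
 show "(%N. G.Gb \<bar>t\<bar> N) \<longlonglongrightarrow> 0" for t by (rule G.Gb_lim)
 show "(%N. V N t j) \<longlonglongrightarrow> vl t j" for t j by (rule vl)
 fix t j assume t: "0 <= t" "t * mu ^ 6 <= 1"
 show "cmod (vl t j) <= eta * mu * wt j" if j: "j \<notin> A4"
 proof (rule tendsto_upperbound[OF tendsto_norm[OF vl]])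
 show "\<forall>\<^sub>F N in sequentially. cmod (V N t j) <= eta * mu * wt j"
 using eventually_ge_at_top[of "max 2 (nat \<bar>j\<bar>)"]
 proof eventually_elim
 case (elim N)
 have "j : JN N - A4" using elim j by (simp add: JN_def nat_le_iff abs_le_iff)
 then show ?case using elim by (intro galerkin_dyn.H1[OF dyn tS[OF t]]) auto
 qed
 qed simp
 show "\<bar>(cmod (vl t j))\<^sup>2 - kj j (K (mu ^ 4 * t))\<bar> <= C * (mu\<^sup>2 + mu ^ 6 * t)" if j: "j : A4"
 proof (rule tendsto_upperbound)
 show "(%N. \<bar>(cmod (V N t j))\<^sup>2 - kj j (K (mu ^ 4 * t))\<bar>) \<longlonglongrightarrow> \<bar>(cmod (vl t j))\<^sup>2 - kj j (K (mu ^ 4 * t))\<bar>"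
 by (intro tendsto_intros vl)
 show "\<forall>\<^sub>F N in sequentially. \<bar>(cmod (V N t j))\<^sup>2 - kj j (K (mu ^ 4 * t))\<bar> <= C * (mu\<^sup>2 + mu ^ 6 * t)"
 using eventually_ge_at_top[of 2]
 proof eventually_elim
 case (elim N)
 show ?case by (rule modes[OF dyn[OF elim] _ mu(3) tS[OF t] j]) (use V0[OF elim] in \<open>simp add: c_def\<close>)
 qed
 qed simp
 qed
qed

theorem theorem1p4:
  fixes \<gamma> :: real
  assumes "0 < \<gamma>" and "\<gamma> < 1 / 10"
  shows "\<exists>(T::real) (K::real \<Rightarrow> real) (\<nu>0::real).
    T > 0 \<and>
    (\<forall>\<tau>. K (\<tau> + 2 * T) = K \<tau>) \<and> (\<forall>\<tau>. 0 < K \<tau> \<and> K \<tau> < 1) \<and>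
    K 0 = \<gamma> \<and> K T \<ge> 1 / 10 \<and>
    \<nu>0 > 0 \<and>
    (\<forall>(\<sigma>::real) A a2 a1 b2 b1. \<sigma> \<in> {1, -1} \<longrightarrow> resonant_set A a2 a1 b2 b1 \<longrightarrow>
      (\<exists>C :: real \<Rightarrow> real. \<forall>\<nu>::real. 0 < \<nu> \<and> \<nu> < \<nu>0 \<longrightarrow>
        (\<exists>(u :: real \<Rightarrow> real \<Rightarrow> complex) (uj :: int \<Rightarrow> real \<Rightarrow> complex)
           (q1 :: real \<Rightarrow> real \<Rightarrow> complex) (q2 :: real \<Rightarrow> real \<Rightarrow> complex).
          quintic_NLS_solution \<sigma> \<nu> u \<and>
          (\<forall>t. 0 \<le> t \<and> t \<le> \<nu> powr (- 3 / 2) \<longrightarrow>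
            (\<forall>x. u t x = (\<Sum>j\<in>A. uj j t * exp (\<i> * of_int j * complex_of_real x))
                   + complex_of_real (\<nu> powr (1 / 4)) * q1 t x
                   + complex_of_real (\<nu> powr (3 / 2) * t) * q2 t x) \<and>
            (cmod (uj a1 t))\<^sup>2 = K (\<nu> * t) \<and>
            2 * (cmod (uj a2 t))\<^sup>2 = 7 + K (\<nu> * t) \<and>
            (cmod (uj b1 t))\<^sup>2 = 1 - K (\<nu> * t) \<and>
            2 * (cmod (uj b2 t))\<^sup>2 = 1 - K (\<nu> * t)) \<and>
          (\<forall>s. (\<forall>t\<ge>0. q1 t \<in> sobolev_space s \<and> sobolev_norm s (q1 t) \<le> C s) \<and>
               (\<forall>t. 0 \<le> t \<and> t \<le> \<nu> powr (- 3 / 2) \<longrightarrow>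
                  q2 t \<in> sobolev_space s \<and> sobolev_norm s (q2 t) \<le> C s)))))"
proof -
 note \<gamma> = assms
 obtain kap dlt q0' q1' d1 Q Q' where po: "planar_orbit \<gamma> kap dlt q0' q1' d1 Q Q'" and kap: "1 / 10 < kap" "kap < 2 / 5"
 and PP: "!!x. planar_orbit.P \<gamma> kap Q x = PP (hh \<gamma>) x" "!!x. planar_orbit.dP \<gamma> kap Q Q' x = dPP (hh \<gamma>) x"
 using orbit_data[OF \<gamma>] by blast
 interpret po: planar_orbit \<gamma> kap dlt q0' q1' d1 Q Q' by (rule po)
 define K where "K = po.K"
 have Kb: "\<gamma> <= K \<tau>" "K \<tau> < 2 / 5" for \<tau> using po.K_bounds[of \<tau>] kap by (auto simp: K_def)
 obtain C1 mu1 where mu1: "0 < mu1" and M: "\<forall>l mu S N v t. galerkin_dyn l mu S N v --> (\<forall>j. v 0 j = cpx (cc \<gamma> j)) --> mu <= mu1 --> t : {0..S} -->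
 \<bar>(cmod (v t 1))\<^sup>2 - po.K (mu ^ 4 * t)\<bar> <= C1 * (mu\<^sup>2 + mu ^ 6 * t) &
 \<bar>(cmod (v t (-2)))\<^sup>2 - (7 + po.K (mu ^ 4 * t)) / 2\<bar> <= C1 * (mu\<^sup>2 + mu ^ 6 * t) &
 \<bar>(cmod (v t (-1)))\<^sup>2 - (1 - po.K (mu ^ 4 * t))\<bar> <= C1 * (mu\<^sup>2 + mu ^ 6 * t) &
 \<bar>(cmod (v t 2))\<^sup>2 - (1 - po.K (mu ^ 4 * t)) / 2\<bar> <= C1 * (mu\<^sup>2 + mu ^ 6 * t)"
 using modes_follow_orbit[OF \<gamma> po PP] by blast
 have modes: "\<bar>(cmod (v t j))\<^sup>2 - kj j (K (mu ^ 4 * t))\<bar> <= max 0 C1 * (mu\<^sup>2 + mu ^ 6 * t)"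
 if D: "galerkin_dyn l mu S N v" "\<forall>j. v 0 j = cpx (cc \<gamma> j)" "mu <= mu1" "t : {0..S}" and j: "j : A4" for l mu S N v t j
 proof -
 have "\<bar>(cmod (v t j))\<^sup>2 - kj j (K (mu ^ 4 * t))\<bar> <= C1 * (mu\<^sup>2 + mu ^ 6 * t)"
 proof -
 have m4: "\<bar>(cmod (v t 1))\<^sup>2 - po.K (mu ^ 4 * t)\<bar> <= C1 * (mu\<^sup>2 + mu ^ 6 * t) &
 \<bar>(cmod (v t (-2)))\<^sup>2 - (7 + po.K (mu ^ 4 * t)) / 2\<bar> <= C1 * (mu\<^sup>2 + mu ^ 6 * t) &
 \<bar>(cmod (v t (-1)))\<^sup>2 - (1 - po.K (mu ^ 4 * t))\<bar> <= C1 * (mu\<^sup>2 + mu ^ 6 * t) &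
 \<bar>(cmod (v t 2))\<^sup>2 - (1 - po.K (mu ^ 4 * t)) / 2\<bar> <= C1 * (mu\<^sup>2 + mu ^ 6 * t)" using M D by blast
 consider "j = 1" | "j = -2" | "j = -1" | "j = 2" using j by (auto simp: A4_def)
 then show ?thesis using m4 by cases (simp_all add: kj_def K_def)
 qed
 also have "\<dots> <= max 0 C1 * (mu\<^sup>2 + mu ^ 6 * t)"
 using D(4) galerkin_dyn.mu(1)[OF D(1)] by (intro mult_right_mono) auto
 finally show ?thesis .
 qed
 define C0 where "C0 = max 0 C1"
 define m where "m = min (1 / Csm) mu1"
 have Csm1: "1 <= Csm" by (rule Csm_ge(7))
 have m: "0 < m" using mu1 Csm1 by (simp add: m_def)
 \<comment> \<open>The first entry serves the bootstrap and the comparison with the orbit, the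
   second the energy bound behind global existence. Both are fixed before a resonant set is
   chosen.\<close>
 define \<nu>0 where "\<nu>0 = min (m ^ 4) (1 / 100000)"
 \<comment> \<open>\<open>eta\<close> covers the modes off \<open>A4\<close>. The other summand
   turns the error of a squared modulus into one of the mode, relative to the smallest weight on
   \<open>A4\<close>.\<close>
 define CA where "CA = eta + C0 / sqrt \<gamma> / wt 2"
 have CA: "0 <= C0 / sqrt \<gamma> / wt 2" "0 <= CA" "eta <= CA" "C0 / sqrt \<gamma> / wt 2 <= CA"
 using eta_pos \<gamma> wt_pos[of 2] by (auto simp: CA_def C0_def)
 have main: "\<exists>(u :: real => real => complex) (uj :: int => real => complex) (q1 :: real => real => complex) (q2 :: real => real => complex).
 quintic_NLS_solution \<sigma> \<nu> u &
 (\<forall>t. 0 <= t & t <= \<nu> powr (- 3 / 2) -->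
 (\<forall>x. u t x = (\<Sum>j\<in>A. uj j t * exp (\<i> * of_int j * cpx x))
 + cpx (\<nu> powr (1 / 4)) * q1 t x
 + cpx (\<nu> powr (3 / 2) * t) * q2 t x) &
 (cmod (uj a1 t))\<^sup>2 = K (\<nu> * t) &
 2 * (cmod (uj a2 t))\<^sup>2 = 7 + K (\<nu> * t) &
 (cmod (uj b1 t))\<^sup>2 = 1 - K (\<nu> * t) &
 2 * (cmod (uj b2 t))\<^sup>2 = 1 - K (\<nu> * t)) &
 (\<forall>s. (\<forall>t\<ge>0. q1 t : sobolev_space s & sobolev_norm s (q1 t) <= CA * Csob s c k) &
 (\<forall>t. 0 <= t & t <= \<nu> powr (- 3 / 2) -->
 q2 t : sobolev_space s & sobolev_norm s (q2 t) <= CA * Csob s c k))"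
 if \<sigma>: "\<sigma> : {1, -1}" and k: "k ~= 0" and A: "A = {n, n + 3 * k, n + 4 * k, n + k}"
 and ab: "a2 = n" "a1 = n + 3 * k" "b2 = n + 4 * k" "b1 = n + k" and c: "c = n + 2 * k" and \<nu>: "0 < \<nu>" "\<nu> < \<nu>0"
 for \<sigma> \<nu> :: real and A and a2 a1 b2 b1 n k c :: int
 proof -
 define k2 where "k2 = (rl k)\<^sup>2"
 have k2: "1 <= k2"
 proof -
 have "1 <= k\<^sup>2" using k by (simp add: int_one_le_iff_zero_less)
 then show ?thesis unfolding k2_def by (metis of_int_1_le_iff of_int_power)
 qed
 define rho where "rho = \<nu> powr (1 / 4)"
 have rho: "0 < rho" "rho ^ 4 = \<nu>" "rho ^ 6 = \<nu> powr (3 / 2)" "1 / rho ^ 6 = \<nu> powr (- 3 / 2)"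
 proof -
 show "0 < rho" using \<nu> by (simp add: rho_def)
 have p: "rho ^ i = \<nu> powr (1 / 4 * real i)" for i using \<nu> by (simp add: rho_def powr_powr flip: powr_realpow)
 show "rho ^ 4 = \<nu>" "rho ^ 6 = \<nu> powr (3 / 2)" using \<nu> by (simp_all add: p)
 then show "1 / rho ^ 6 = \<nu> powr (- 3 / 2)" by (simp add: powr_minus_divide)
 qed
 \<comment> \<open>The rescaled problem has coupling \<nu> / k^2 and runs for k^2 times as long. Its
   fourth root is \<open>rho * tht\<close> with \<open>tht\<close> at most 1, and
   \<open>tht ^ 6 * k2\<close> is at most 1 as well, so one threshold works for every
   \<open>k\<close>.\<close>
 define tht where "tht = k2 powr (- 1 / 4)"
 have tht: "0 < tht" "tht <= 1" "tht ^ 4 = 1 / k2" "tht ^ 6 * k2 <= 1"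
 proof -
 show "0 < tht" using k2 by (simp add: tht_def)
 have p: "tht ^ i = k2 powr (- 1 / 4 * real i)" for i using k2 by (simp add: tht_def powr_powr flip: powr_realpow)
 show 1: "tht <= 1" using powr_mono[of "- 1 / 4" 0 k2] k2 by (simp add: tht_def)
 show 4: "tht ^ 4 = 1 / k2" using k2 by (simp add: p powr_minus_divide)
 have "tht ^ 6 * k2 = tht\<^sup>2 * (tht ^ 4 * k2)" by (simp add: mult.assoc flip: power_add)
 also have "\<dots> = tht\<^sup>2" using 4 k2 by simp
 also have "\<dots> <= 1" using 1 \<open>0 < tht\<close> by (intro power_le_one) auto
 finally show "tht ^ 6 * k2 <= 1" .
 qed
 define mu where "mu = rho * tht"
 have mu0: "0 < mu" "mu <= rho" using rho(1) tht(1,2) by (auto simp: mu_def mult_left_le)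
 have mu4: "mu ^ 4 = \<nu> / k2" by (simp add: mu_def power_mult_distrib rho tht)
 have mu6: "mu ^ 6 * (k2 * t) <= rho ^ 6 * t" if "0 <= t" for t
 proof -
 have "mu ^ 6 * (k2 * t) = rho ^ 6 * t * (tht ^ 6 * k2)" by (simp add: mu_def power_mult_distrib mult_ac)
 also have "\<dots> <= rho ^ 6 * t * 1" using tht(4) rho(1) that by (intro mult_left_mono) auto
 finally show ?thesis by simp
 qed
 have "rho ^ 4 < m ^ 4" using \<nu> rho(2) by (simp add: \<nu>0_def)
 then have "rho < m" using m by (intro power_less_imp_less_base[of rho 4 m]) auto
 then have mum: "mu <= m" using mu0 by linarith
 have mua: "Csm * mu <= 1" "mu <= mu1" using mum Csm1 by (auto simp: m_def le_divide_eq mult.commute)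
 have mu1': "mu <= 1"
 proof -
 have "1 * mu <= Csm * mu" using Csm1 mu0 by (intro mult_right_mono) auto
 then show ?thesis using mua by linarith
 qed
 have mub: "mu ^ 4 <= 1 / 100000"
 proof -
 have "\<nu> / k2 <= \<nu>" using k2 \<nu> by (simp add: divide_le_eq mult_le_cancel_left1)
 moreover have "\<nu> < 1 / 100000" using \<nu> by (simp add: \<nu>0_def)
 ultimately show ?thesis unfolding mu4 by linarith
 qed
 define l where "l = \<sigma> * (\<nu> / k2)"
 have l: "\<bar>l\<bar> = mu ^ 4" using \<sigma> \<nu> k2 by (auto simp: l_def mu4 abs_mult)
 obtain U V vl eps where per: "!!t x. U t (x + 2 * pi) = U t x"
 and sol: "\<exists>ut ux uxx :: real => real => complex.
 continuous_on UNIV (%(t, x). ut t x) & continuous_on UNIV (%(t, x). ux t x) & continuous_on UNIV (%(t, x). uxx t x) &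
 (\<forall>t x. ((%r. U r x) hvd ut t x) (at t) &
 (U t hvd ux t x) (at x) & (ux t hvd uxx t x) (at x) &
 \<i> * ut t x + uxx t x = cpx (l * cmod (U t x) ^ 4) * U t x)"
 and unif: "!!N t x. 2 <= N ==> cmod ((\<Sum>j\<in>JN N. V N t j * cis (rl j * x - (rl j)\<^sup>2 * t)) - U t x) <= eps t N"
 and eps: "!!t. eps t \<longlonglongrightarrow> 0" and vl: "!!t j. (%N. V N t j) \<longlonglongrightarrow> vl t j"
 and off: "!!t j. 0 <= t ==> t * mu ^ 6 <= 1 ==> j \<notin> A4 ==> cmod (vl t j) <= eta * mu * wt j"
 and on: "!!t j. 0 <= t ==> t * mu ^ 6 <= 1 ==> j : A4 ==> \<bar>(cmod (vl t j))\<^sup>2 - kj j (K (mu ^ 4 * t))\<bar> <= C0 * (mu\<^sup>2 + mu ^ 6 * t)"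
 proof (rule run_exists[where K = K and C = C0 and mum = mu1 and mu = mu and l = l, OF \<gamma>])
 show "\<bar>(cmod (v t j))\<^sup>2 - kj j (K (mu' ^ 4 * t))\<bar> <= C0 * (mu'\<^sup>2 + mu' ^ 6 * t)"
 if "galerkin_dyn l mu' S N v" "\<forall>j. v 0 j = cpx (cc \<gamma> j)" "mu' <= mu1" "t : {0..S}" "j : A4" for l mu' S N v t j
 unfolding C0_def by (rule modes[OF that])
 qed ((rule mu0(1) mua(1) mua(2) mub l)+, ((rule that; assumption) | blast intro: that))
 define u where "u t x = cis (rl c * x - (rl c)\<^sup>2 * t) * U ((rl k)\<^sup>2 * t) (rl k * (x - 2 * rl c * t))" for t x
 have nls: "quintic_NLS_solution \<sigma> \<nu> u"
 unfolding u_def[abs_def] by (rule galilei[OF per sol]) (use k2 in \<open>simp add: l_def k2_def[symmetric]\<close>)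
 define fr where "fr j = c + k * j" for j
 have A_fr: "A = fr ` A4" by (auto simp: A A4_def fr_def c)
 have fr_inj: "inj fr" using k by (auto simp: fr_def inj_def)
 \<comment> \<open>Prescribed modulus with the phase of the computed mode: the four identities for
   the moduli become exact and the discrepancy is moved into the remainder.\<close>
 define z where "z j t = cpx (sqrt (kj j (K (\<nu> * t)))) * phase_of (vl (k2 * t) j)" for j t
 define om where "om j t = cis (- ((rl (fr j))\<^sup>2 * t))" for j t
 define uj where "uj m t = z (inv fr m) t * om (inv fr m) t" for m t
 have uj_fr: "uj (fr j) t = z j t * om j t" for j t by (simp add: uj_def inv_f_f[OF fr_inj])
 have kj_ge: "\<gamma> <= kj j (K \<tau>)" if "j : A4" for j \<tau> using Kb[of \<tau>] \<gamma> that by (auto simp: A4_def kj_def)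
 have uj_sq: "(cmod (uj (fr j) t))\<^sup>2 = kj j (K (\<nu> * t))" if "j : A4" for j t
 using kj_ge[OF that, of "\<nu> * t"] \<gamma> unfolding uj_fr by (simp add: z_def om_def norm_mult)
 \<comment> \<open>Both remainders are the same function, namely the error divided by the sum of
   their two prefactors.\<close>
 define R where "R t = rho + rho ^ 6 * t" for t
 define e where "e t x = u t x - (\<Sum>j\<in>A. uj j t * exp (\<i> * of_int j * cpx x))" for t x
 \<comment> \<open>The bound on the first remainder is demanded for all nonnegative times, so it is
   set to zero beyond the time span.\<close>
 define q where "q t = (if t <= \<nu> powr (- 3 / 2) then (%x. e t x / cpx (R t)) else (%x. 0))" for t
 have split: "u t x = (\<Sum>j\<in>A. uj j t * exp (\<i> * of_int j * cpx x)) + cpx (\<nu> powr (1 / 4)) * q t x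
 + cpx (\<nu> powr (3 / 2) * t) * q t x" if t: "0 <= t" "t <= \<nu> powr (- 3 / 2)" for t x
 proof -
 have "0 < R t" using rho(1) t by (simp add: R_def add_pos_nonneg)
 then have "e t x = cpx (R t) * q t x" using t by (simp add: q_def)
 then have "e t x = cpx rho * q t x + cpx (rho ^ 6 * t) * q t x" by (simp add: R_def distrib_right)
 moreover have "u t x = (\<Sum>j\<in>A. uj j t * exp (\<i> * of_int j * cpx x)) + e t x" by (simp add: e_def)
 ultimately show ?thesis unfolding rho_def[symmetric] rho(3)[symmetric] by (simp only: add.assoc)
 qed
 have qs: "q t : sobolev_space s & sobolev_norm s (q t) <= CA * Csob s c k" if t0: "0 <= t" for t s
 proof (cases "t <= \<nu> powr (- 3 / 2)")
 case False
 then show ?thesis using sobolev_zero[of s] CA Csob_nonneg[of s c k] by (simp add: q_def)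
 next
 case True
 have R: "0 < R t" using rho(1) t0 by (simp add: R_def add_pos_nonneg)
 define t' where "t' = k2 * t"
 have t': "0 <= t'" "t' * mu ^ 6 <= 1"
 proof -
 show "0 <= t'" using k2 t0 by (simp add: t'_def)
 have "rho ^ 6 * t <= rho ^ 6 * (1 / rho ^ 6)" unfolding rho(4) using True rho(1) by (intro mult_left_mono) auto
 then show "t' * mu ^ 6 <= 1" using mu6[OF t0] rho(1) by (simp add: t'_def mult.commute)
 qed
 have nt: "mu ^ 4 * t' = \<nu> * t" using k2 by (simp add: mu4 t'_def)
 have muR: "mu <= R t" "mu\<^sup>2 + mu ^ 6 * t' <= R t"
 proof -
 show 1: "mu <= R t" using mu0 rho(1) t0 by (simp add: R_def add_increasing2)
 have "mu\<^sup>2 <= mu" using mu0 mu1' by (simp add: power2_eq_square mult_left_le)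
 then show "mu\<^sup>2 + mu ^ 6 * t' <= R t" using mu6[OF t0] mu0(2) by (simp add: R_def t'_def)
 qed
 define d where "d N j = (V N t' j - (if j : A4 then z j t else 0)) * om j t / cpx (R t)" for N j
 define d' where "d' j = (vl t' j - (if j : A4 then z j t else 0)) * om j t / cpx (R t)" for j
 have omc: "om j t * cis (rl (c + k * j) * x) = cis (rl c * x - (rl c)\<^sup>2 * t)
 * cis (rl j * (rl k * (x - 2 * rl c * t)) - (rl j)\<^sup>2 * t')" for j x
 by (simp add: om_def fr_def cis_mult t'_def k2_def power2_eq_square algebra_simps)
 have H1: "cmod ((\<Sum>j\<in>JN N. d N j * cis (rl (c + k * j) * x)) - e t x / cpx (R t)) <= eps t' N / R t" if N: "2 <= N" for N x
 proof -
 have A4N: "A4 \<subseteq> JN N" using N by (auto simp: A4_def JN_def)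
 define y where "y = rl k * (x - 2 * rl c * t)"
 define p where "p = cis (rl c * x - (rl c)\<^sup>2 * t)"
 have sA: "(\<Sum>j\<in>A. uj j t * exp (\<i> * of_int j * cpx x)) = (\<Sum>j\<in>JN N. (if j : A4 then z j t else 0) * om j t * cis (rl (c + k * j) * x))"
 proof -
 have "(\<Sum>j\<in>A. uj j t * exp (\<i> * of_int j * cpx x)) = (\<Sum>j\<in>A4. uj (fr j) t * exp (\<i> * of_int (fr j) * cpx x))"
 unfolding A_fr by (subst sum.reindex[OF inj_on_subset[OF fr_inj]]) (auto simp: o_def)
 also have "\<dots> = (\<Sum>j\<in>A4. (if j : A4 then z j t else 0) * om j t * cis (rl (c + k * j) * x))"
 unfolding uj_fr exp_eq_cis by (rule sum.cong) (auto simp: fr_def)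
 also have "\<dots> = (\<Sum>j\<in>JN N. (if j : A4 then z j t else 0) * om j t * cis (rl (c + k * j) * x))"
 by (rule sum.mono_neutral_left[OF finite_JN A4N]) auto
 finally show ?thesis .
 qed
 have sV: "p * (\<Sum>j\<in>JN N. V N t' j * cis (rl j * y - (rl j)\<^sup>2 * t')) = (\<Sum>j\<in>JN N. V N t' j * om j t * cis (rl (c + k * j) * x))"
 unfolding sum_distrib_left mult.assoc omc y_def p_def by (rule sum.cong) (auto simp: mult_ac)
 have "(\<Sum>j\<in>JN N. d N j * cis (rl (c + k * j) * x)) = ((\<Sum>j\<in>JN N. V N t' j * om j t * cis (rl (c + k * j) * x))
 - (\<Sum>j\<in>JN N. (if j : A4 then z j t else 0) * om j t * cis (rl (c + k * j) * x))) / cpx (R t)"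
 unfolding sum_subtractf[symmetric] sum_divide_distrib by (rule sum.cong) (auto simp: d_def left_diff_distrib)
 also have "\<dots> = (p * (\<Sum>j\<in>JN N. V N t' j * cis (rl j * y - (rl j)\<^sup>2 * t')) - (\<Sum>j\<in>A. uj j t * exp (\<i> * of_int j * cpx x))) / cpx (R t)"
 unfolding sV sA ..
 finally have "(\<Sum>j\<in>JN N. d N j * cis (rl (c + k * j) * x)) - e t x / cpx (R t)
 = p * ((\<Sum>j\<in>JN N. V N t' j * cis (rl j * y - (rl j)\<^sup>2 * t')) - U t' y) / cpx (R t)"
 by (simp add: e_def u_def p_def y_def t'_def k2_def diff_divide_distrib right_diff_distrib)
 then have "cmod ((\<Sum>j\<in>JN N. d N j * cis (rl (c + k * j) * x)) - e t x / cpx (R t))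
 = cmod ((\<Sum>j\<in>JN N. V N t' j * cis (rl j * y - (rl j)\<^sup>2 * t')) - U t' y) / R t"
 using R by (simp add: norm_divide norm_mult p_def)
 also have "\<dots> <= eps t' N / R t" using unif[OF N, of t' y] R by (simp add: divide_right_mono)
 finally show "cmod ((\<Sum>j\<in>JN N. d N j * cis (rl (c + k * j) * x)) - e t x / cpx (R t)) <= eps t' N / R t" .
 qed
 have H2: "(%N. eps t' N / R t) \<longlonglongrightarrow> 0" using tendsto_divide[OF eps[of t'] tendsto_const[of "R t"]] R by simp
 have H3: "(%N. d N j) \<longlonglongrightarrow> d' j" for j unfolding d_def d'_def using R by (intro tendsto_intros vl) auto
 have H4: "cmod (d' j) <= CA * wt j" for j
 proof -
 have "cmod (vl t' j - (if j : A4 then z j t else 0)) <= CA * wt j * R t"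
 proof (cases "j : A4")
 case False
 have "eta * mu * wt j <= CA * R t * wt j" using CA(2,3) muR(1) mu0 wt_nonneg eta_pos by (intro mult_right_mono mult_mono) auto
 then show ?thesis using off[OF t' False] False by (simp add: mult_ac)
 next
 case True
 have "wt 2 <= wt j" using True by (intro wt_antimono) (auto simp: A4_def)
 have "cmod (vl t' j - z j t) = \<bar>cmod (vl t' j) - sqrt (kj j (K (\<nu> * t)))\<bar>"
 unfolding z_def t'_def by (rule phase_of_diff)
 also have "\<dots> <= C0 * (mu\<^sup>2 + mu ^ 6 * t') / sqrt \<gamma>"
 using on[OF t' True] unfolding nt by (intro sqrt_diff_le[OF \<gamma>(1) kj_ge[OF True]]) auto
 also have "\<dots> <= C0 * R t / sqrt \<gamma>" using muR(2) \<gamma> by (intro divide_right_mono mult_left_mono) (auto simp: C0_def)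
 also have "\<dots> = C0 / sqrt \<gamma> / wt 2 * R t * wt 2" using wt_pos[of 2] by simp
 also have "\<dots> <= CA * R t * wt j" using CA R \<open>wt 2 <= wt j\<close> wt_pos[of 2] by (intro mult_mono) auto
 finally show ?thesis using True by (simp add: mult_ac)
 qed
 then show ?thesis using R by (simp add: d'_def norm_divide norm_mult om_def divide_le_eq)
 qed
 show ?thesis using sobolev_limit[OF k H1 H2 H3 H4 CA(2), where s = s] True by (simp add: q_def)
 qed
 \<comment> \<open>Centring at n + 2 k with spacing k sends the four labels to 1, -2, -1 and
   2.\<close>
 have lab: "a1 = fr 1" "a2 = fr (-2)" "b1 = fr (-1)" "b2 = fr 2" by (auto simp: ab c fr_def)
 have mem: "1 : A4" "-2 : A4" "-1 : A4" "2 : A4" by (auto simp: A4_def)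
 have P1: "\<forall>t. 0 <= t & t <= \<nu> powr (- 3 / 2) -->
 (\<forall>x. u t x = (\<Sum>j\<in>A. uj j t * exp (\<i> * of_int j * cpx x))
 + cpx (\<nu> powr (1 / 4)) * q t x
 + cpx (\<nu> powr (3 / 2) * t) * q t x) &
 (cmod (uj a1 t))\<^sup>2 = K (\<nu> * t) &
 2 * (cmod (uj a2 t))\<^sup>2 = 7 + K (\<nu> * t) &
 (cmod (uj b1 t))\<^sup>2 = 1 - K (\<nu> * t) &
 2 * (cmod (uj b2 t))\<^sup>2 = 1 - K (\<nu> * t)"
 proof (intro allI impI)
 fix t assume t: "0 <= t & t <= \<nu> powr (- 3 / 2)"
 have u: "\<forall>x. u t x = (\<Sum>j\<in>A. uj j t * exp (\<i> * of_int j * cpx x))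
 + cpx (\<nu> powr (1 / 4)) * q t x
 + cpx (\<nu> powr (3 / 2) * t) * q t x" using split t by blast
 have "(cmod (uj a1 t))\<^sup>2 = K (\<nu> * t) & 2 * (cmod (uj a2 t))\<^sup>2 = 7 + K (\<nu> * t) &
 (cmod (uj b1 t))\<^sup>2 = 1 - K (\<nu> * t) & 2 * (cmod (uj b2 t))\<^sup>2 = 1 - K (\<nu> * t)"
 unfolding lab using uj_sq[OF mem(1), of t] uj_sq[OF mem(2), of t] uj_sq[OF mem(3), of t] uj_sq[OF mem(4), of t] by (simp add: kj_def)
 with u show "(\<forall>x. u t x = (\<Sum>j\<in>A. uj j t * exp (\<i> * of_int j * cpx x))
 + cpx (\<nu> powr (1 / 4)) * q t x
 + cpx (\<nu> powr (3 / 2) * t) * q t x) &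
 (cmod (uj a1 t))\<^sup>2 = K (\<nu> * t) &
 2 * (cmod (uj a2 t))\<^sup>2 = 7 + K (\<nu> * t) &
 (cmod (uj b1 t))\<^sup>2 = 1 - K (\<nu> * t) &
 2 * (cmod (uj b2 t))\<^sup>2 = 1 - K (\<nu> * t)" by (rule conjI)
 qed
 have P2: "\<forall>s. (\<forall>t\<ge>0. q t : sobolev_space s & sobolev_norm s (q t) <= CA * Csob s c k) &
 (\<forall>t. 0 <= t & t <= \<nu> powr (- 3 / 2) --> q t : sobolev_space s & sobolev_norm s (q t) <= CA * Csob s c k)"
 using qs by blast
 show ?thesis
 by (rule exI[of _ u], rule exI[of _ uj], rule exI[of _ q], rule exI[of _ q], rule conjI[OF nls conjI[OF P1 P2]])
 qed
 have fin: "\<exists>C :: real => real. \<forall>\<nu>::real. 0 < \<nu> & \<nu> < \<nu>0 -->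
 (\<exists>(u :: real => real => complex) (uj :: int => real => complex)
 (q1 :: real => real => complex) (q2 :: real => real => complex).
 quintic_NLS_solution \<sigma> \<nu> u &
 (\<forall>t. 0 <= t & t <= \<nu> powr (- 3 / 2) -->
 (\<forall>x. u t x = (\<Sum>j\<in>A. uj j t * exp (\<i> * of_int j * cpx x))
 + cpx (\<nu> powr (1 / 4)) * q1 t x
 + cpx (\<nu> powr (3 / 2) * t) * q2 t x) &
 (cmod (uj a1 t))\<^sup>2 = K (\<nu> * t) &
 2 * (cmod (uj a2 t))\<^sup>2 = 7 + K (\<nu> * t) &
 (cmod (uj b1 t))\<^sup>2 = 1 - K (\<nu> * t) &
 2 * (cmod (uj b2 t))\<^sup>2 = 1 - K (\<nu> * t)) &
 (\<forall>s. (\<forall>t\<ge>0. q1 t : sobolev_space s & sobolev_norm s (q1 t) <= C s) &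
 (\<forall>t. 0 <= t & t <= \<nu> powr (- 3 / 2) -->
 q2 t : sobolev_space s & sobolev_norm s (q2 t) <= C s)))"
 if \<sigma>: "\<sigma> : {1, -1}" and r: "resonant_set A a2 a1 b2 b1" for \<sigma> :: real and A a2 a1 b2 b1
 proof -
 obtain n k where nk: "k ~= 0" "A = {n, n + 3 * k, n + 4 * k, n + k}" "a2 = n" "a1 = n + 3 * k" "b2 = n + 4 * k" "b1 = n + k"
 using r unfolding resonant_set_def by blast
 show ?thesis
 by (rule exI[of _ "%s. CA * Csob s (n + 2 * k) k"], intro allI impI, erule conjE, rule main[OF \<sigma> nk refl])
 qed
 show ?thesis
 proof (rule exI[of _ po.T], rule exI[of _ K], rule exI[of _ \<nu>0], intro conjI)
 show "0 < po.T" by (rule po.T_pos)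
 show "\<forall>\<tau>. K (\<tau> + 2 * po.T) = K \<tau>" by (simp add: K_def po.K_period)
 show "\<forall>\<tau>. 0 < K \<tau> & K \<tau> < 1"
 proof
 fix \<tau> show "0 < K \<tau> & K \<tau> < 1" using Kb[of \<tau>] \<gamma> by auto
 qed
 show "K 0 = \<gamma>" by (simp add: K_def po.K_0)
 show "1 / 10 <= K po.T" using kap by (simp add: K_def po.K_T)
 show "0 < \<nu>0" using m by (simp add: \<nu>0_def)
 qed (intro allI impI fin)
qed

end
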